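(* Assume that $\psi(k)\ll k^{-(1+\delta)}$ for some $\delta>0$ (i.e. $\sup_{k\ge 1} k^{1+\delta}\psi(k)<\infty$). Let $K(t)$ be a mean zero Gaussian process on $[0,1]$ with covariance function $\Gamma(s,t)$ (with sample paths in $D[0,1]$). Then, as $N\to\infty$, $$\sqrt{N}\,D_N(S_k)\overset{d}{\longrightarrow}\sup_{0\le s<t\le 1}|K(t)-K(s)|,\qquad \sqrt{N}\,D_N^{(p)}(S_k)\overset{d}{\longrightarrow}\|K\|_{L^p([0,1])}\quad(1\le p\le\infty),$$ and the limit distributions are nondegenerate.
   Context: $X_1,X_2,\dots$ are independent, identically distributed real-valued random variables, $S_k=\sum_{j=1}^k X_j$, $\{\cdot\}$ denotes fractional part, and $\psi(k)=\sup_{t\in[0,1]}|\mathbb{P}(\{S_k\}\le t)-t|$. Let $F_N(t)=\frac1N\sum_{k=1}^N I_{[0,t)}(\{S_k\})$, $0\le t\le 1$. The discrepancy is $D_N(S_k)=\sup_{0\le s<t\le 1}|(F_N(t)-t)-(F_N(s)-s)|$, and the $L^p$-discrepancy $D_N^{(p)}(S_k)$, $1\le p\le\infty$, is the $L^p([0,1])$-norm of $F_N(t)-t$. $\mathcal{F}$ is the set of all $1$-periodic functions $f:\mathbb{R}\to\mathbb{R}$ of bounded variation on $[0,1]$ with $\int_0^1 f(x)\,\mathrm{d}x=0$. For $f,g\in\mathcal{F}$, $$C(f,g)=\mathbb{E} f(U)g(U)+\sum_{k=1}^{\infty}\mathbb{E} f(U)g(U+S_k)+\sum_{k=1}^{\infty}\mathbb{E}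 g(U)f(U+S_k),$$ where $U$ is uniformly distributed on $[0,1)$ and independent of $X_1,X_2,\dots$ (under the assumption on $\psi$ these series converge absolutely). For an interval $J\subseteq[0,1)$ of length $\lambda(J)$, $f_J(x)=I_J(\{x\})-\lambda(J)$ is its centered indicator extended with period $1$, and $\Gamma(s,t)=C(f_{[0,s)},f_{[0,t)})$ for $s,t\in[0,1]$; $\Gamma$ is symmetric, positive semidefinite and continuous on $[0,1]^2$. $D[0,1]$ is the Skorohod space of functions on $[0,1]$ with one-sided limits. *)

theory Defs
  imports "HOL-Probability.Probability"
begin

text \<open>
  The sequence is indexed from 1, as in the source: \<open>X 0\<close> is never used.
\<close>

definition partial_sum :: "(nat \<Rightarrow> 'a \<Rightarrow> real) \<Rightarrow> nat \<Rightarrow> 'a \<Rightarrow> real" where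
  "partial_sum X k \<omega> = (\<Sum>j=1..k. X j \<omega>)"

definition iid_seq :: "'a measure \<Rightarrow> (nat \<Rightarrow> 'a \<Rightarrow> real) \<Rightarrow> bool" where
  "iid_seq M X \<longleftrightarrow> prob_space.indep_vars M (\<lambda>_. borel) X {1..} \<and>
     (\<forall>j\<ge>1. distr M borel (X j) = distr M borel (X 1))"

definition psi :: "'a measure \<Rightarrow> (nat \<Rightarrow> 'a \<Rightarrow> real) \<Rightarrow> nat \<Rightarrow> real" where
  "psi M X k =
     (SUP t\<in>{0..1}. \<bar>measure M {\<omega> \<in> space M. frac (partial_sum X k \<omega>) \<le> t} - t\<bar>)"

definition emp :: "(nat \<Rightarrow> 'a \<Rightarrow> real) \<Rightarrow> nat \<Rightarrow> 'a \<Rightarrow> real \<Rightarrow> real" where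
  "emp X N \<omega> t = 1 / real N * (\<Sum>k=1..N. indicator {0..<t} (frac (partial_sum X k \<omega>)))"

definition sup_increment :: "(real \<Rightarrow> real) \<Rightarrow> real" where
  "sup_increment f = (SUP (s, t)\<in>{(s, t). 0 \<le> s \<and> s < t \<and> t \<le> 1}. \<bar>f t - f s\<bar>)"

definition Lp_norm :: "ennreal \<Rightarrow> (real \<Rightarrow> real) \<Rightarrow> real" where
  "Lp_norm p f =
     (if p = \<infinity> then enn2real (esssup (lebesgue_on {0..1}) (\<lambda>t. ennreal \<bar>f t\<bar>))
      else (LINT t|lebesgue_on {0..1}. \<bar>f t\<bar> powr enn2real p) powr (1 / enn2real p))"

definition discrepancy :: "(nat \<Rightarrow> 'a \<Rightarrow> real) \<Rightarrow> nat \<Rightarrow> 'a \<Rightarrow> real" where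
  "discrepancy X N \<omega> = sup_increment (\<lambda>t. emp X N \<omega> t - t)"

definition Lp_discrepancy ::
    "ennreal \<Rightarrow> (nat \<Rightarrow> 'a \<Rightarrow> real) \<Rightarrow> nat \<Rightarrow> 'a \<Rightarrow> real" where
  "Lp_discrepancy p X N \<omega> = Lp_norm p (\<lambda>t. emp X N \<omega> t - t)"

text \<open>
  The uniform variable independent of the \<open>X j\<close> is realised as the first coordinate of a
  product space, since \<open>M\<close> itself need not carry such a variable.
\<close>

definition unif_expectation :: "'a measure \<Rightarrow> (real \<Rightarrow> 'a \<Rightarrow> real) \<Rightarrow> real" where
  "unif_expectation M h = (LINT z|(uniform_measure lborel {0..<1} \<Otimes>\<^sub>M M). h (fst z) (snd z))"

definition cov_form ::
    "'a measure \<Rightarrow> (nat \<Rightarrow> 'a \<Rightarrow> real) \<Rightarrow> (real \<Rightarrow> real) \<Rightarrow> (real \<Rightarrow> real) \<Rightarrow> real" where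
  "cov_form M X f g =
     unif_expectation M (\<lambda>u \<omega>. f u * g u)
     + (\<Sum>i. unif_expectation M (\<lambda>u \<omega>. f u * g (u + partial_sum X (Suc i) \<omega>)))
     + (\<Sum>i. unif_expectation M (\<lambda>u \<omega>. g u * f (u + partial_sum X (Suc i) \<omega>)))"

definition centered_ind :: "real set \<Rightarrow> real \<Rightarrow> real" where
  "centered_ind J x = indicator J (frac x) - measure lborel J"

definition Gamma_cov :: "'a measure \<Rightarrow> (nat \<Rightarrow> 'a \<Rightarrow> real) \<Rightarrow> real \<Rightarrow> real \<Rightarrow> real" where
  "Gamma_cov M X s t = cov_form M X (centered_ind {0..<s}) (centered_ind {0..<t})"

text \<open>
  One-sided limits alone do not suffice for the Skorohod space: the value of a path at a single
  random point could then be changed without affecting any finite-dimensional distribution.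
  Both normalisations are allowed, right-continuous paths (the usual convention) and
  left-continuous ones (the one satisfied by \<^const>\<open>emp\<close>).
\<close>

definition skorohod_D :: "(real \<Rightarrow> real) set" where
  "skorohod_D = {f.
     (\<forall>t\<in>{0..<1}. \<exists>l. (f \<longlongrightarrow> l) (at_right t)) \<and>
     (\<forall>t\<in>{0<..1}. \<exists>l. (f \<longlongrightarrow> l) (at_left t)) \<and>
     ((\<forall>t\<in>{0..<1}. continuous (at_right t) f) \<or> (\<forall>t\<in>{0<..1}. continuous (at_left t) f))}"

text \<open>Degenerate normal distributions, that is point masses, count as Gaussian.\<close>

definition gaussian_distr :: "real measure \<Rightarrow> bool" where
  "gaussian_distr \<mu> \<longleftrightarrow> (\<exists>m. \<mu> = return borel m) \<or>
     (\<exists>m \<sigma>. \<sigma> > 0 \<and> \<mu> = density lborel (\<lambda>x. ennreal (normal_density m \<sigma> x)))"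

definition gaussian_process :: "'b measure \<Rightarrow> 'i set \<Rightarrow> ('i \<Rightarrow> 'b \<Rightarrow> real) \<Rightarrow> bool" where
  "gaussian_process P T K \<longleftrightarrow> prob_space P \<and> (\<forall>t\<in>T. K t \<in> borel_measurable P) \<and>
     (\<forall>F c. finite F \<longrightarrow> F \<subseteq> T \<longrightarrow>
        gaussian_distr (distr P borel (\<lambda>\<omega>. \<Sum>t\<in>F. c t * K t \<omega>)))"

definition covariance :: "'b measure \<Rightarrow> ('b \<Rightarrow> real) \<Rightarrow> ('b \<Rightarrow> real) \<Rightarrow> real" where
  "covariance P Y Z = (LINT \<omega>|P. (Y \<omega> - (LINT \<eta>|P. Y \<eta>)) * (Z \<omega> - (LINT \<eta>|P. Z \<eta>)))"

definition conv_in_distr ::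
    "'a measure \<Rightarrow> (nat \<Rightarrow> 'a \<Rightarrow> real) \<Rightarrow> 'b measure \<Rightarrow> ('b \<Rightarrow> real) \<Rightarrow> bool" where
  "conv_in_distr M Y P Z \<longleftrightarrow>
     (\<forall>n. Y n \<in> borel_measurable M) \<and> Z \<in> borel_measurable P \<and>
     weak_conv_m (\<lambda>n. distr M borel (Y n)) (distr P borel Z)"

definition nondegenerate :: "real measure \<Rightarrow> bool" where
  "nondegenerate \<mu> \<longleftrightarrow> (\<nexists>c. \<mu> = return borel c)"

end

theory Submission
  imports Defs "HOL-Real_Asymp.Real_Asymp"
begin

text \<open>
  Why the theorem is true.  Write \<open>G\<close> for the empirical process
  \<open>G N \<omega> t = sqrt N * (emp X N \<omega> t - t)\<close>, which is the normalised sum of the centered indicators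
  of \<open>[0, t)\<close> along the walk on the circle.  Both discrepancies, multiplied by \<open>sqrt N\<close>, are
  functionals of \<open>G\<close>: the largest increment and the \<open>L\<^sup>p\<close> norm.  Both functionals are Lipschitz
  for the supremum distance, so it suffices to prove that \<open>G\<close> converges to \<open>K\<close> in finite-dimensional
  distributions and that all the paths involved are uniformly close to their discretizations on a
  dyadic grid.

  The basic estimate is Koksma's inequality (\<open>koksma\<close>): for a periodic function \<open>h\<close> of
  variation \<open>V\<close>, the mean of \<open>h (x + S k)\<close> differs from the mean of \<open>h\<close> over the circle by at
  most \<open>3 * V * \<psi> k\<close>, whatever the starting point \<open>x\<close> (\<open>T_equidistributes\<close>).  The walk thus
  forgets its position at the summable rate \<open>\<psi>\<close>.  Moreover, a functional of product form
  of a stretch of the walk is again a function of bounded variation of the starting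
  point (\<open>circ_bv_W\<close>), so that the same inequality decouples blocks of steps separated by gaps.

  \<^item> Blocks and gaps give the central limit theorem \<open>clt_char\<close> for sums of one function along the
    walk, with the variance \<open>asymp_var\<close>, the quadratic form of \<open>cov_form\<close>.  Applied to linear
    combinations of indicators it is the convergence of the finite-dimensional distributions
    (\<open>fdd_char\<close>, \<open>cramer_wold\<close>).

  \<^item> Blocks and gaps also give exponential tails for the increments of \<open>G\<close> (\<open>increment_tail\<close>),
    and dyadic chaining turns these into \<open>tightness\<close>: up to an event of small probability, \<open>G\<close> is
    uniformly close to its values on a fixed dyadic grid.  The process \<open>K\<close> inherits this through its
    finite-dimensional distributions, because a Skorohod path is determined by its values on a
    countable dense set.  The two approximations yield \<open>functional_convergence\<close>.

  \<^item> For nondegeneracy, suppose that the limit functional were almost surely constant.  It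
    dominates the integral of \<open>\<bar>K\<bar>\<close>, which would therefore be bounded, and so would be the normal
    variable \<open>\<integral> 2 * pi * sin (2 * pi * t) * K t dt\<close>.  Hence its variance would vanish.  But the
    corresponding combination of centered indicators is the function \<open>cos (2 * pi * x)\<close>, and
    characters of the circle are eigenfunctions of the walk, with eigenvalue \<open>z\<close> say, so that the
    variance equals \<open>1 / 2 + Re (z / (1 - z))\<close>.  This is positive because \<open>\<psi> k \<rightarrow> 0\<close> forces
    \<open>\<bar>z\<bar> < 1\<close> (\<open>asymp_var_cos_pos\<close>).
\<close>

section \<open>Functions of bounded variation on the circle and Koksma's inequality\<close>

definition unif :: "real measure" where
  "unif = uniform_measure lborel {0..<1}"

lemma prob_space_unif: "prob_space unif"
  unfolding unif_def by (rule prob_space_uniform_measure) auto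

lemma sets_unif [simp, measurable_cong]: "sets unif = sets borel"
  and space_unif [simp]: "space unif = UNIV"
  by (simp_all add: unif_def)

lemma AE_unif: "AE u in unif. u \<in> {0..<1}"
  unfolding unif_def by (rule AE_uniform_measureI) auto

lemma unif_eq_density: "unif = density lborel (indicator {0..<1})"
proof -
  have "emeasure lborel {0..<1::real} = 1" by simp
  then show ?thesis
    unfolding unif_def uniform_measure_def by (simp add: divide_ennreal_def)
qed

lemma emeasure_lborel_Ico_finite: "emeasure lborel {a..<b::real} < top"
  by (cases "a \<le> b") auto

text \<open>Integrals over the circle are reduced to Lebesgue integrals over an interval, where translation
  invariance is available.\<close>

lemma integral_unif:
  fixes h :: "real \<Rightarrow> 'b::{banach, second_countable_topology}"
  assumes [measurable]: "h \<in> borel_measurable borel"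
  shows "(LINT u|unif. h u) = (LINT u|lborel. indicator {0..<1} u *\<^sub>R h u)"
proof -
  have "unif = density lborel (\<lambda>u. ennreal (indicator {0..<1} u))"
    by (simp add: unif_eq_density ennreal_indicator)
  then have "(LINT u|unif. h u) = (LINT u|density lborel (\<lambda>u. ennreal (indicator {0..<1} u)). h u)"
    by (rule arg_cong)
  also have "\<dots> = (LINT u|lborel. indicator {0..<1} u *\<^sub>R h u)"
    by (rule integral_density) auto
  finally show ?thesis .
qed

lemma measure_unif:
  assumes [measurable]: "A \<in> sets borel"
  shows "measure unif A = measure lborel (A \<inter> {0..<1})"
proof -
  have "emeasure unif A = emeasure lborel (A \<inter> {0..<1})"
    by (simp add: unif_def Int_commute divide_ennreal_def)
  then show ?thesis by (simp add: measure_def)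
qed

lemma real_distribution_unif: "real_distribution unif"
  using prob_space_unif by (simp add: real_distribution_def real_distribution_axioms_def)

lemma cdf_unif: "cdf unif t = max 0 (min 1 t)"
proof -
  have "measure unif {..t} = measure lborel ({..t} \<inter> {0..<1})"
    by (simp add: measure_unif)
  also have "{..t} \<inter> {0..<1} = (if t < 1 then {0..t} else {0..<1})" by auto
  finally show ?thesis by (auto simp: cdf_def)
qed

definition periodic1 :: "(real \<Rightarrow> 'b) \<Rightarrow> bool" where
  "periodic1 h \<longleftrightarrow> (\<forall>x. h (frac x) = h x)"

lemma periodic1_add_int: "periodic1 h \<Longrightarrow> h (x + of_int n) = h x"
proof -
  assume *: "periodic1 h"
  have "h (x + of_int n) = h (frac (x + of_int n))"
    using *[unfolded periodic1_def, rule_format, of "x + of_int n"] by (rule sym)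
  also have "frac (x + of_int n) = frac x" by (simp add: frac_def)
  also have "h (frac x) = h x" using * by (simp add: periodic1_def)
  finally show "h (x + of_int n) = h x" .
qed

lemma periodic1_add1: "periodic1 h \<Longrightarrow> h (x + 1) = h x"
  using periodic1_add_int[of h x 1] by simp

lemma periodic1_shift: "periodic1 h \<Longrightarrow> periodic1 (\<lambda>x. h (x + c))"
  unfolding periodic1_def
proof
  fix x assume "\<forall>x. h (frac x) = h x"
  then have "periodic1 h" by (simp add: periodic1_def)
  have "h (x + c) = h (frac x + c + of_int \<lfloor>x\<rfloor>)" by (simp add: frac_def algebra_simps)
  also have "\<dots> = h (frac x + c)" using periodic1_add_int[OF \<open>periodic1 h\<close>] .
  finally show "h (frac x + c) = h (x + c)" ..
qed

lemma integral_unif_shift: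
  fixes h :: "real \<Rightarrow> 'b::{banach, second_countable_topology}"
  assumes [measurable]: "h \<in> borel_measurable borel" and per: "periodic1 h"
    and bd: "\<And>x. norm (h x) \<le> B"
  shows "(LINT u|unif. h (u + c)) = (LINT u|unif. h u)"
proof -
  define d where "d = frac c"
  have d: "0 \<le> d" "d < 1" by (auto simp: d_def frac_lt_1)
  have "h (u + c) = h (u + d)" for u
    using periodic1_add_int[OF per, of "u + d" "\<lfloor>c\<rfloor>"] by (simp add: d_def frac_def algebra_simps)
  then have "(LINT u|unif. h (u + c)) = (LINT u|unif. h (u + d))" by simp
  also have "\<dots> = (LINT u|lborel. indicator {0..<1} u *\<^sub>R h (u + d))"
    by (simp add: integral_unif)
  also have "\<dots> = (LINT u|lborel. indicator {d..<1+d} u *\<^sub>R h u)"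
    by (subst lborel_integral_real_affine[where c=1 and t="-d"])
       (auto intro!: Bochner_Integration.integral_cong simp: indicator_def algebra_simps)
  also have "\<dots> = (LINT u|lborel. indicator {d..<1} u *\<^sub>R h u + indicator {1..<1+d} u *\<^sub>R h u)"
    using d by (auto intro!: Bochner_Integration.integral_cong simp: indicator_def)
  also have "\<dots> = (LINT u|lborel. indicator {d..<1} u *\<^sub>R h u) + (LINT u|lborel. indicator {1..<1+d} u *\<^sub>R h u)"
  proof (rule Bochner_Integration.integral_add)
    have *: "integrable lborel (\<lambda>u. indicator {a..<b} u *\<^sub>R h u)" for a b :: real
      by (rule integrableI_bounded_set_indicator[where B=B])
        (use bd in \<open>auto simp: emeasure_lborel_Ico_finite\<close>)
    show "integrable lborel (\<lambda>u. indicator {d..<1} u *\<^sub>R h u)"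
      "integrable lborel (\<lambda>u. indicator {1..<1+d} u *\<^sub>R h u)" by (rule *)+
  qed
  also have "(LINT u|lborel. indicator {1..<1+d} u *\<^sub>R h u) = (LINT u|lborel. indicator {0..<d} u *\<^sub>R h u)"
    by (subst lborel_integral_real_affine[where c=1 and t="1"])
       (auto intro!: Bochner_Integration.integral_cong
          simp: indicator_def algebra_simps periodic1_add1[OF per])
  also have "(LINT u|lborel. indicator {d..<1} u *\<^sub>R h u) + (LINT u|lborel. indicator {0..<d} u *\<^sub>R h u)
     = (LINT u|lborel. indicator {d..<1} u *\<^sub>R h u + indicator {0..<d} u *\<^sub>R h u)"
  proof (rule Bochner_Integration.integral_add[symmetric])
    have *: "integrable lborel (\<lambda>u. indicator {a..<b} u *\<^sub>R h u)" for a b :: real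
      by (rule integrableI_bounded_set_indicator[where B=B])
        (use bd in \<open>auto simp: emeasure_lborel_Ico_finite\<close>)
    show "integrable lborel (\<lambda>u. indicator {d..<1} u *\<^sub>R h u)"
      "integrable lborel (\<lambda>u. indicator {0..<d} u *\<^sub>R h u)" by (rule *)+
  qed
  also have "\<dots> = (LINT u|lborel. indicator {0..<1} u *\<^sub>R h u)"
    using d by (auto intro!: Bochner_Integration.integral_cong simp: indicator_def)
  finally show ?thesis by (simp add: integral_unif)
qed

text \<open>
  A function \<open>h\<close> on the circle has variation at most \<open>V\<close> over one period.  The dominating
  nondecreasing function is part of the data because in this form the property passes to
  products, Lipschitz images and averages of translates without any suprema over partitions.
\<close>

definition circ_bv :: "real \<Rightarrow> (real \<Rightarrow> 'b::real_normed_vector) \<Rightarrow> bool" where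
  "circ_bv V h \<longleftrightarrow> (\<exists>w::real \<Rightarrow> real. mono w \<and> (\<forall>x. w (x + 1) = w x + V) \<and>
     (\<forall>x y. x \<le> y \<longrightarrow> norm (h y - h x) \<le> w y - w x))"

lemma circ_bv_nonneg: "circ_bv V h \<Longrightarrow> 0 \<le> V"
proof -
  assume "circ_bv V h"
  then obtain w :: "real \<Rightarrow> real" where "mono w" "w (0 + 1) = w 0 + V"
    unfolding circ_bv_def by blast
  moreover from \<open>mono w\<close> have "w 0 \<le> w (0 + 1)" by (rule monoD) simp
  ultimately show ?thesis by simp
qed

lemma circ_bv_const: "circ_bv 0 (\<lambda>_. c)"
  unfolding circ_bv_def by (intro exI[of _ "\<lambda>_. 0"]) (auto simp: mono_def)

lemma circ_bv_lipschitz: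
  assumes "circ_bv V h" "\<And>x y. norm (G (h y) - G (h x)) \<le> c * norm (h y - h x)" "0 \<le> c"
  shows "circ_bv (c * V) (\<lambda>x. G (h x))"
proof -
  obtain w where w: "mono w" "\<And>x. w (x + 1) = w x + V"
    "\<And>x y. x \<le> y \<Longrightarrow> norm (h y - h x) \<le> w y - w x"
    using assms(1) unfolding circ_bv_def by blast
  show ?thesis
    unfolding circ_bv_def
  proof (intro exI[of _ "\<lambda>x. c * w x"] conjI allI impI)
    show "mono (\<lambda>x. c * w x)" using w(1) assms(3) by (auto simp: mono_def mult_left_mono)
    show "c * w (x + 1) = c * w x + c * V" for x by (simp add: w(2) distrib_left)
    fix x y :: real assume "x \<le> y"
    have "norm (G (h y) - G (h x)) \<le> c * norm (h y - h x)" by (rule assms(2))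
    also have "\<dots> \<le> c * (w y - w x)" using w(3)[OF \<open>x \<le> y\<close>] assms(3) by (rule mult_left_mono)
    finally show "norm (G (h y) - G (h x)) \<le> c * w y - c * w x" by (simp add: algebra_simps)
  qed
qed

lemma circ_bv_add:
  assumes "circ_bv V h" "circ_bv V' h'"
  shows "circ_bv (V + V') (\<lambda>x. h x + h' x)"
proof -
  obtain w where w: "mono w" "\<And>x. w (x + 1) = w x + V"
    "\<And>x y. x \<le> y \<Longrightarrow> norm (h y - h x) \<le> w y - w x"
    using assms(1) unfolding circ_bv_def by blast
  obtain w' where w': "mono w'" "\<And>x. w' (x + 1) = w' x + V'"
    "\<And>x y. x \<le> y \<Longrightarrow> norm (h' y - h' x) \<le> w' y - w' x"
    using assms(2) unfolding circ_bv_def by blast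
  show ?thesis
    unfolding circ_bv_def
  proof (intro exI[of _ "\<lambda>x. w x + w' x"] conjI allI impI)
    show "mono (\<lambda>x. w x + w' x)" using w(1) w'(1) by (auto simp: mono_def add_mono)
    show "w (x + 1) + w' (x + 1) = w x + w' x + (V + V')" for x by (simp add: w w')
    fix x y :: real assume "x \<le> y"
    then show "norm (h y + h' y - (h x + h' x)) \<le> w y + w' y - (w x + w' x)"
      using w(3)[of x y] w'(3)[of x y] norm_triangle_ineq[of "h y - h x" "h' y - h' x"]
      by (simp add: algebra_simps)
  qed
qed

lemma circ_bv_sum:
  assumes "\<And>i. i \<in> I \<Longrightarrow> circ_bv (V i) (h i)"
  shows "circ_bv (\<Sum>i\<in>I. V i) (\<lambda>x. \<Sum>i\<in>I. h i x)"
  using assms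
proof (induction I rule: infinite_finite_induct)
  case (insert i I)
  then show ?case using circ_bv_add[of "V i" "h i" "\<Sum>i\<in>I. V i" "\<lambda>x. \<Sum>i\<in>I. h i x"] by simp
qed (auto intro: circ_bv_const)

lemma circ_bv_cmult:
  fixes c :: real
  shows "circ_bv V h \<Longrightarrow> circ_bv (\<bar>c\<bar> * V) (\<lambda>x. c * h x)"
  by (rule circ_bv_lipschitz[where G="\<lambda>y. c * y"]) (simp_all add: abs_mult flip: right_diff_distrib)

lemma circ_bv_mult:
  fixes h h' :: "real \<Rightarrow> 'b::real_normed_algebra"
  assumes "circ_bv V h" "circ_bv V' h'" "\<And>x. norm (h x) \<le> 1" "\<And>x. norm (h' x) \<le> 1"
  shows "circ_bv (V + V') (\<lambda>x. h x * h' x)"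
proof -
  obtain w where w: "mono w" "\<And>x. w (x + 1) = w x + V"
    "\<And>x y. x \<le> y \<Longrightarrow> norm (h y - h x) \<le> w y - w x"
    using assms(1) unfolding circ_bv_def by blast
  obtain w' where w': "mono w'" "\<And>x. w' (x + 1) = w' x + V'"
    "\<And>x y. x \<le> y \<Longrightarrow> norm (h' y - h' x) \<le> w' y - w' x"
    using assms(2) unfolding circ_bv_def by blast
  show ?thesis
    unfolding circ_bv_def
  proof (intro exI[of _ "\<lambda>x. w x + w' x"] conjI allI impI)
    show "mono (\<lambda>x. w x + w' x)" using w(1) w'(1) by (auto simp: mono_def add_mono)
    show "w (x + 1) + w' (x + 1) = w x + w' x + (V + V')" for x by (simp add: w w')
    fix x y :: real assume "x \<le> y"
    have "norm (h y * h' y - h x * h' x) = norm ((h y - h x) * h' y + h x * (h' y - h' x))"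
      by (simp add: algebra_simps)
    also have "\<dots> \<le> norm ((h y - h x) * h' y) + norm (h x * (h' y - h' x))"
      by (rule norm_triangle_ineq)
    also have "norm ((h y - h x) * h' y) \<le> norm (h y - h x) * 1"
      by (rule order_trans[OF norm_mult_ineq]) (intro mult_left_mono assms norm_ge_zero)
    also have "norm (h x * (h' y - h' x)) \<le> 1 * norm (h' y - h' x)"
      by (rule order_trans[OF norm_mult_ineq]) (intro mult_right_mono assms norm_ge_zero)
    finally show "norm (h y * h' y - h x * h' x) \<le> w y + w' y - (w x + w' x)"
      using w(3)[OF \<open>x \<le> y\<close>] w'(3)[OF \<open>x \<le> y\<close>] by simp
  qed
qed

lemma circ_bv_shift:
  assumes "circ_bv V h" shows "circ_bv V (\<lambda>x. h (x + c))"
proof -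
  obtain w where w: "mono w" "\<And>x. w (x + 1) = w x + V"
    "\<And>x y. x \<le> y \<Longrightarrow> norm (h y - h x) \<le> w y - w x"
    using assms(1) unfolding circ_bv_def by blast
  have "w (x + 1 + c) = w (x + c) + V" for x
    using w(2)[of "x + c"] by (simp add: algebra_simps)
  with w show ?thesis
    unfolding circ_bv_def by (intro exI[of _ "\<lambda>x. w (x + c)"]) (auto simp: mono_def)
qed

text \<open>Averaging over random translates does not increase the variation.  The dominating function
  is averaged over the fractional part of the translation, since it need not be integrable
  otherwise.\<close>

lemma circ_bv_average:
  fixes h :: "real \<Rightarrow> 'b::{banach, second_countable_topology}"
  assumes "prob_space N" and [measurable]: "Y \<in> borel_measurable N" "h \<in> borel_measurable borel"
    and bv: "circ_bv V h" and per: "periodic1 h" and bd: "\<And>x. norm (h x) \<le> B"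
  shows "circ_bv V (\<lambda>x. LINT \<omega>|N. h (x + Y \<omega>))"
proof -
  interpret prob_space N by fact
  obtain w where w: "mono w" "\<And>x. w (x + 1) = w x + V"
    "\<And>x y. x \<le> y \<Longrightarrow> norm (h y - h x) \<le> w y - w x"
    using bv unfolding circ_bv_def by blast
  have [measurable]: "w \<in> borel_measurable borel" by (rule borel_measurable_mono) fact
  have [measurable]: "(\<lambda>\<omega>. frac (Y \<omega>)) \<in> borel_measurable N"
    unfolding frac_def by measurable
  have wint: "integrable N (\<lambda>\<omega>. w (x + frac (Y \<omega>)))" for x
  proof (rule integrable_const_bound[where B="\<bar>w x\<bar> + \<bar>w (x + 1)\<bar>"], rule AE_I2)
    fix \<omega>
    have "w x \<le> w (x + frac (Y \<omega>))" "w (x + frac (Y \<omega>)) \<le> w (x + 1)"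
      using frac_lt_1[of "Y \<omega>"] frac_ge_0[of "Y \<omega>"] by (auto intro!: monoD[OF w(1)] simp: less_imp_le)
    then show "norm (w (x + frac (Y \<omega>))) \<le> \<bar>w x\<bar> + \<bar>w (x + 1)\<bar>" by simp
  qed simp
  have hint: "integrable N (\<lambda>\<omega>. h (x + Y \<omega>))" for x
    by (rule integrable_const_bound[where B=B]) (use bd in auto)
  have hfrac: "h (x + Y \<omega>) = h (x + frac (Y \<omega>))" for x \<omega>
    using periodic1_add_int[OF per, of "x + frac (Y \<omega>)" "\<lfloor>Y \<omega>\<rfloor>"] by (simp add: frac_def)
  show ?thesis
    unfolding circ_bv_def
  proof (intro exI[of _ "\<lambda>x. LINT \<omega>|N. w (x + frac (Y \<omega>))"] conjI allI impI)
    show "mono (\<lambda>x. LINT \<omega>|N. w (x + frac (Y \<omega>)))"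
      by (intro monoI integral_mono wint) (auto intro: monoD[OF w(1)])
    fix x
    have "w (x + 1 + frac (Y \<omega>)) = w (x + frac (Y \<omega>)) + V" for \<omega>
      using w(2)[of "x + frac (Y \<omega>)"] by (simp add: algebra_simps)
    then have "(LINT \<omega>|N. w (x + 1 + frac (Y \<omega>))) = (LINT \<omega>|N. w (x + frac (Y \<omega>)) + V)" by simp
    also have "\<dots> = (LINT \<omega>|N. w (x + frac (Y \<omega>))) + V"
      by (subst Bochner_Integration.integral_add) (auto simp: wint prob_space)
    finally show "(LINT \<omega>|N. w (x + 1 + frac (Y \<omega>))) = (LINT \<omega>|N. w (x + frac (Y \<omega>))) + V" .
    fix y assume "x \<le> y"
    have "norm ((LINT \<omega>|N. h (y + Y \<omega>)) - (LINT \<omega>|N. h (x + Y \<omega>)))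
        = norm (LINT \<omega>|N. h (y + Y \<omega>) - h (x + Y \<omega>))"
      by (subst Bochner_Integration.integral_diff) (auto simp: hint)
    also have "\<dots> \<le> (LINT \<omega>|N. norm (h (y + Y \<omega>) - h (x + Y \<omega>)))"
      by (rule integral_norm_bound)
    also have "\<dots> \<le> (LINT \<omega>|N. w (y + frac (Y \<omega>)) - w (x + frac (Y \<omega>)))"
    proof (rule integral_mono)
      show "integrable N (\<lambda>\<omega>. norm (h (y + Y \<omega>) - h (x + Y \<omega>)))"
        by (intro integrable_norm Bochner_Integration.integrable_diff hint)
      show "integrable N (\<lambda>\<omega>. w (y + frac (Y \<omega>)) - w (x + frac (Y \<omega>)))"
        by (intro Bochner_Integration.integrable_diff wint)
      show "norm (h (y + Y \<omega>) - h (x + Y \<omega>)) \<le> w (y + frac (Y \<omega>)) - w (x + frac (Y \<omega>))" for \<omega>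
        using w(3)[of "x + frac (Y \<omega>)" "y + frac (Y \<omega>)"] \<open>x \<le> y\<close> by (simp add: hfrac)
    qed
    also have "\<dots> = (LINT \<omega>|N. w (y + frac (Y \<omega>))) - (LINT \<omega>|N. w (x + frac (Y \<omega>)))"
      by (rule Bochner_Integration.integral_diff) (auto simp: wint)
    finally show "norm ((LINT \<omega>|N. h (y + Y \<omega>)) - (LINT \<omega>|N. h (x + Y \<omega>)))
        \<le> (LINT \<omega>|N. w (y + frac (Y \<omega>))) - (LINT \<omega>|N. w (x + frac (Y \<omega>)))" .
  qed
qed

text \<open>An interval of the circle has two end points; the formula
  \<open>1[frac x < t] = \<lfloor>x\<rfloor> - \<lfloor>x - t\<rfloor>\<close> exhibits the two monotone parts.\<close>

lemma indicator_frac_eq: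
  assumes "0 \<le> t" "t \<le> 1"
  shows "(indicator {0..<t} (frac x) :: real) = of_int \<lfloor>x\<rfloor> - of_int \<lfloor>x - t\<rfloor>"
proof (cases "frac x < t")
  case True
  have "\<lfloor>x - t\<rfloor> = \<lfloor>x\<rfloor> - 1"
    using True assms frac_lt_1[of x] frac_ge_0[of x] unfolding frac_def
    by (intro floor_unique) (simp_all, linarith+)
  with True show ?thesis by simp
next
  case False
  have "\<lfloor>x - t\<rfloor> = \<lfloor>x\<rfloor>"
    using False assms frac_lt_1[of x] unfolding frac_def
    by (intro floor_unique) linarith+
  with False show ?thesis by simp
qed

lemma circ_bv_indicator:
  assumes "0 \<le> t" "t \<le> 1"
  shows "circ_bv 2 (\<lambda>x. indicator {0..<t} (frac x) :: real)"
  unfolding circ_bv_def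
proof (intro exI[of _ "\<lambda>x. of_int \<lfloor>x\<rfloor> + of_int \<lfloor>x - t\<rfloor>"] conjI allI impI)
  show "mono (\<lambda>x. real_of_int \<lfloor>x\<rfloor> + real_of_int \<lfloor>x - t\<rfloor>)"
    by (auto simp: mono_def intro!: add_mono floor_mono)
  show "real_of_int \<lfloor>x + 1\<rfloor> + real_of_int \<lfloor>x + 1 - t\<rfloor> = real_of_int \<lfloor>x\<rfloor> + real_of_int \<lfloor>x - t\<rfloor> + 2" for x
  proof -
    have "\<lfloor>x + 1 - t\<rfloor> = \<lfloor>x - t\<rfloor> + 1" using floor_add_int[of "x - t" 1] by (simp add: algebra_simps)
    then show ?thesis by simp
  qed
  fix x y :: real assume "x \<le> y"
  then have "\<lfloor>x\<rfloor> \<le> \<lfloor>y\<rfloor>" "\<lfloor>x - t\<rfloor> \<le> \<lfloor>y - t\<rfloor>" by (auto intro: floor_mono)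
  then have "real_of_int \<lfloor>x\<rfloor> \<le> real_of_int \<lfloor>y\<rfloor>" "real_of_int \<lfloor>x - t\<rfloor> \<le> real_of_int \<lfloor>y - t\<rfloor>"
    by simp_all
  then show "norm (indicator {0..<t} (frac y) - indicator {0..<t} (frac x) :: real)
    \<le> real_of_int \<lfloor>y\<rfloor> + real_of_int \<lfloor>y - t\<rfloor> - (real_of_int \<lfloor>x\<rfloor> + real_of_int \<lfloor>x - t\<rfloor>)"
    using assms by (simp add: indicator_frac_eq)
qed

text \<open>Layer cake: the superlevel sets of a monotone function are half lines, whose
  probabilities under the two laws differ by at most the Kolmogorov distance.\<close>

lemma cdf_close_upset:
  assumes "real_distribution D1" "real_distribution D2"
    and cl: "\<And>t. \<bar>cdf D1 t - cdf D2 t\<bar> \<le> \<epsilon>"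
    and up: "\<And>x y. x \<in> A \<Longrightarrow> x \<le> y \<Longrightarrow> y \<in> A"
  shows "\<bar>measure D1 A - measure D2 A\<bar> \<le> \<epsilon>"
proof -
  interpret D1: real_distribution D1 by fact
  interpret D2: real_distribution D2 by fact
  have e: "0 \<le> \<epsilon>" using cl[of 0] by linarith
  have c1: "measure D1 (- B) = 1 - measure D1 B" if "B \<in> sets borel" for B
    using D1.prob_compl[of B] that by (simp add: Compl_eq_Diff_UNIV)
  have c2: "measure D2 (- B) = 1 - measure D2 B" if "B \<in> sets borel" for B
    using D2.prob_compl[of B] that by (simp add: Compl_eq_Diff_UNIV)
  consider "A = {}" | "A = UNIV" | "A \<noteq> {}" "A \<noteq> UNIV" by blast
  then show ?thesis
  proof cases
    case 3
    define a where "a = Inf A"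
    obtain z where z: "z \<notin> A" using 3 by auto
    have zlb: "z \<le> x" if "x \<in> A" for x using up[OF that, of z] z by linarith
    then have bb: "bdd_below A" by (intro bdd_belowI[where m=z])
    have "x \<in> A" if "a < x" for x
    proof -
      from that 3 obtain y where "y \<in> A" "y < x" unfolding a_def using cInf_lessD by metis
      then show ?thesis using up by force
    qed
    moreover have "a \<le> x" if "x \<in> A" for x unfolding a_def using bb that by (rule cInf_lower[rotated])
    ultimately have "A = - {..a} \<or> A = - {..<a}"
      by (cases "a \<in> A") (auto simp: not_le not_less less_le)
    then show ?thesis
    proof
      assume "A = - {..a}"
      then show ?thesis using cl[of a] c1[of "{..a}"] c2[of "{..a}"] by (simp add: cdf_def del: Compl_atMost)
    next
      assume A: "A = - {..<a}"
      have "((\<lambda>t. \<bar>cdf D1 t - cdf D2 t\<bar>) \<longlongrightarrow> \<bar>measure D1 {..<a} - measure D2 {..<a}\<bar>) (at_left a)"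
        by (intro tendsto_intros D1.cdf_at_left D2.cdf_at_left)
      then have "\<bar>measure D1 {..<a} - measure D2 {..<a}\<bar> \<le> \<epsilon>"
        by (rule tendsto_upperbound) (auto simp: cl)
      with A show ?thesis using c1[of "{..<a}"] c2[of "{..<a}"] by (simp del: Compl_lessThan)
    qed
  qed (use e D1.prob_space D2.prob_space in auto)
qed

lemma cdf_close_integral_mono:
  assumes "real_distribution D1" "real_distribution D2"
    and cl: "\<And>t. \<bar>cdf D1 t - cdf D2 t\<bar> \<le> \<epsilon>"
    and w: "mono w" and bd: "\<And>x. a \<le> w x" "\<And>x. w x \<le> a + V"
  shows "\<bar>(LINT x|D1. w x) - (LINT x|D2. w x)\<bar> \<le> V * \<epsilon>"
proof -
  have V: "0 \<le> V" using bd[of 0] by linarith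
  have [measurable]: "w \<in> borel_measurable borel" by (rule borel_measurable_mono) fact
  have bnd: "\<bar>w x\<bar> \<le> \<bar>a\<bar> + \<bar>a + V\<bar>" for x using bd[of x] by linarith
  have lay: "(LINT x|D. w x) = a + (LINT s|lborel. indicator {a..<a+V} s * measure D {x. s < w x})"
    and layint: "integrable lborel (\<lambda>s. indicator {a..<a+V} s * measure D {x. s < w x})"
    if "real_distribution D" for D
  proof -
    interpret D: real_distribution D by fact
    let ?f = "\<lambda>x s. indicator {a..<a+V} s * (if s < w x then 1 else 0 :: real)"
    interpret P: pair_sigma_finite D lborel ..
    have fin: "emeasure (D \<Otimes>\<^sub>M lborel) (UNIV \<times> {a..<a+V}) < \<infinity>"
      using V by (subst lborel.emeasure_pair_measure_Times)
        (use D.emeasure_space_1 in auto)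
    have int: "integrable (D \<Otimes>\<^sub>M lborel) (\<lambda>(x, s). ?f x s)"
    proof -
      have "integrable (D \<Otimes>\<^sub>M lborel) (\<lambda>z. indicator (UNIV \<times> {a..<a+V}) z *\<^sub>R (if snd z < w (fst z) then 1 else 0 :: real))"
      proof (rule integrableI_bounded_set_indicator[where B=1])
        show "UNIV \<times> {a..<a+V} \<in> sets (D \<Otimes>\<^sub>M lborel)" by (rule pair_measureI) auto
        show "(\<lambda>z. if snd z < w (fst z) then 1 else 0 :: real) \<in> borel_measurable (D \<Otimes>\<^sub>M lborel)"
          by measurable
      qed (use fin in auto)
      also have "(\<lambda>z. indicator (UNIV \<times> {a..<a+V}) z *\<^sub>R (if snd z < w (fst z) then 1 else 0 :: real))
         = (\<lambda>(x, s). ?f x s)" by (auto simp: fun_eq_iff indicator_def)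
      finally show ?thesis .
    qed
    have inner: "(LINT s|lborel. ?f x s) = w x - a" for x
    proof -
      have "(LINT s|lborel. ?f x s) = (LINT s|lborel. indicator {a..<w x} s)"
        using bd[of x] by (intro Bochner_Integration.integral_cong) (auto simp: indicator_def)
      also have "\<dots> = w x - a" using bd[of x] by simp
      finally show ?thesis .
    qed
    have inner': "(LINT x|D. ?f x s) = indicator {a..<a+V} s * measure D {x. s < w x}" for s
    proof -
      have "(LINT x|D. (if s < w x then 1 else 0 :: real)) = (LINT x|D. indicator {x. s < w x} x)"
        by (intro Bochner_Integration.integral_cong) auto
      then show ?thesis by simp
    qed
    have wint: "integrable D w"
      by (rule D.integrable_const_bound[where B="\<bar>a\<bar> + \<bar>a + V\<bar>"]) (use bnd in auto)
    have "(LINT s|lborel. LINT x|D. ?f x s) = (LINT x|D. LINT s|lborel. ?f x s)"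
      by (rule P.Fubini_integral) (use int in simp)
    then have "(LINT s|lborel. indicator {a..<a+V} s * measure D {x. s < w x}) = (LINT x|D. w x - a)"
      by (simp only: inner inner')
    also have "\<dots> = (LINT x|D. w x) - a"
      by (subst Bochner_Integration.integral_diff)
         (auto simp: D.prob_space[simplified] wint)
    finally show "(LINT x|D. w x) = a + (LINT s|lborel. indicator {a..<a+V} s * measure D {x. s < w x})"
      by simp
    have "integrable lborel (\<lambda>s. LINT x|D. ?f x s)"
      using P.integrable_snd[of ?f] int by simp
    then show "integrable lborel (\<lambda>s. indicator {a..<a+V} s * measure D {x. s < w x})"
      by (simp only: inner')
  qed
  have "\<bar>(LINT x|D1. w x) - (LINT x|D2. w x)\<bar>
     = \<bar>LINT s|lborel. indicator {a..<a+V} s * measure D1 {x. s < w x} - indicator {a..<a+V} s * measure D2 {x. s < w x}\<bar>"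
    by (subst Bochner_Integration.integral_diff) (simp_all add: lay assms layint)
  also have "\<dots> \<le> (LINT s|lborel. \<epsilon> * indicator {a..<a+V} s)"
  proof (rule order_trans[OF integral_abs_bound], rule integral_mono)
    show "integrable lborel (\<lambda>s. \<bar>indicator {a..<a+V} s * measure D1 {x. s < w x} - indicator {a..<a+V} s * measure D2 {x. s < w x}\<bar>)"
      by (intro integrable_abs Bochner_Integration.integrable_diff layint assms)
    show "integrable lborel (\<lambda>s. \<epsilon> * indicator {a..<a+V} s)"
      by (intro integrable_mult_right) (simp add: integrable_indicator_iff emeasure_lborel_Ico_finite)
    fix s
    have "\<bar>measure D1 {x. s < w x} - measure D2 {x. s < w x}\<bar> \<le> \<epsilon>"
      by (rule cdf_close_upset[OF assms(1,2) cl]) (use monoD[OF w] in force)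
    then show "\<bar>indicator {a..<a+V} s * measure D1 {x. s < w x} - indicator {a..<a+V} s * measure D2 {x. s < w x}\<bar>
       \<le> \<epsilon> * indicator {a..<a+V} s" by (auto simp: indicator_def)
  qed
  also have "\<dots> = V * \<epsilon>" using V by simp
  finally show ?thesis .
qed

text \<open>Koksma's inequality: apply the preceding bound to the monotone functions \<open>w\<close> and \<open>w + h\<close>,
  where \<open>w\<close> dominates the variation of \<open>h\<close>.\<close>

lemma koksma:
  fixes h :: "real \<Rightarrow> real"
  assumes "prob_space N" and Y[measurable]: "Y \<in> borel_measurable N"
    and cl: "\<And>t. t \<in> {0..1} \<Longrightarrow> \<bar>measure N {\<omega> \<in> space N. frac (Y \<omega>) \<le> t} - t\<bar> \<le> \<epsilon>"
    and per: "periodic1 h" and bv: "circ_bv V h"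
  shows "\<bar>(LINT \<omega>|N. h (Y \<omega>)) - (LINT u|unif. h u)\<bar> \<le> 3 * V * \<epsilon>"
proof -
  interpret N: prob_space N by fact
  obtain w where w: "mono w" "\<And>x. w (x + 1) = w x + V"
    "\<And>x y. x \<le> y \<Longrightarrow> norm (h y - h x) \<le> w y - w x"
    using bv unfolding circ_bv_def by blast
  have V: "0 \<le> V" using bv by (rule circ_bv_nonneg)
  define c where "c x = max 0 (min 1 x)" for x :: real
  have c: "mono c" "\<And>x. 0 \<le> c x" "\<And>x. c x \<le> 1" by (auto simp: c_def mono_def)
  have cid: "c x = x" if "0 \<le> x" "x < 1" for x using that by (auto simp: c_def)
  define w1 where "w1 x = w (c x)" for x
  define w2 where "w2 x = w (c x) + h (c x)" for x
  have fr[measurable]: "(\<lambda>\<omega>. frac (Y \<omega>)) \<in> borel_measurable N" unfolding frac_def by measurable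
  define D where "D = distr N borel (\<lambda>\<omega>. frac (Y \<omega>))"
  have D: "real_distribution D"
    unfolding D_def by (rule N.real_distribution_distr) simp
  have e: "0 \<le> \<epsilon>" using order_trans[OF abs_ge_zero cl[of 0]] by simp
  have cdfD: "cdf D t = measure N {\<omega> \<in> space N. frac (Y \<omega>) \<le> t}" for t
    unfolding cdf_def D_def by (subst measure_distr) (auto intro!: arg_cong[where f="measure N"])
  have cl': "\<bar>cdf D t - cdf unif t\<bar> \<le> \<epsilon>" for t
  proof -
    consider "t < 0" | "t \<in> {0..1}" | "1 < t" by fastforce
    then show ?thesis
    proof cases
      case 1
      then have *: "{\<omega> \<in> space N. frac (Y \<omega>) \<le> t} = {}"
        using frac_ge_0 by (auto simp: not_le intro: less_le_trans)
      show ?thesis unfolding cdfD * using 1 e by (simp add: cdf_unif)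
    next
      case 2 then show ?thesis using cl[of t] by (simp add: cdfD cdf_unif)
    next
      case 3
      then have *: "{\<omega> \<in> space N. frac (Y \<omega>) \<le> t} = space N"
        using frac_lt_1 by (auto intro: less_imp_le less_trans)
      show ?thesis unfolding cdfD * using 3 e by (simp add: cdf_unif N.prob_space)
    qed
  qed
  have w1m: "mono w1" using w(1) c(1) by (auto simp: w1_def mono_def)
  have hw: "\<bar>h y - h x\<bar> \<le> w y - w x" if "x \<le> y" for x y using w(3)[OF that] by simp
  have w2m: "mono w2"
  proof (rule monoI)
    fix x y :: real assume "x \<le> y"
    then have "c x \<le> c y" using c(1) by (rule monoD[rotated])
    from hw[OF this] show "w2 x \<le> w2 y" unfolding w2_def by linarith
  qed
  have [measurable]: "w1 \<in> borel_measurable borel" "w2 \<in> borel_measurable borel"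
    by (auto intro: borel_measurable_mono w1m w2m)
  have wV: "w 1 = w 0 + V" using w(2)[of 0] by simp
  have b1: "w 0 \<le> w1 x" "w1 x \<le> w 0 + V" for x
    using monoD[OF w(1), of 0 "c x"] monoD[OF w(1), of "c x" 1] c wV by (auto simp: w1_def)
  have b2: "w 0 + h 0 \<le> w2 x" "w2 x \<le> w 0 + h 0 + 2 * V" for x
    using hw[of 0 "c x"] monoD[OF w(1), of "c x" 1] c(2,3)[of x] wV unfolding w2_def by linarith+
  have n1: "\<bar>w1 x\<bar> \<le> \<bar>w 0\<bar> + \<bar>w 0 + V\<bar>" for x using b1[of x] by linarith
  have n2: "\<bar>w2 x\<bar> \<le> \<bar>w 0 + h 0\<bar> + \<bar>w 0 + h 0 + 2 * V\<bar>" for x using b2[of x] by linarith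
  have 1: "\<bar>(LINT x|D. w1 x) - (LINT x|unif. w1 x)\<bar> \<le> V * \<epsilon>"
    by (rule cdf_close_integral_mono[OF D real_distribution_unif cl' w1m b1])
  have 2: "\<bar>(LINT x|D. w2 x) - (LINT x|unif. w2 x)\<bar> \<le> (2 * V) * \<epsilon>"
    by (rule cdf_close_integral_mono[OF D real_distribution_unif cl' w2m b2])
  have "h (Y \<omega>) = w2 (frac (Y \<omega>)) - w1 (frac (Y \<omega>))" for \<omega>
    using per by (simp add: w1_def w2_def cid frac_lt_1 periodic1_def)
  then have "(LINT \<omega>|N. h (Y \<omega>)) = (LINT \<omega>|N. w2 (frac (Y \<omega>)) - w1 (frac (Y \<omega>)))" by simp
  also have "\<dots> = (LINT x|D. w2 x - w1 x)"
    unfolding D_def by (subst integral_distr) auto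
  finally have e1: "(LINT \<omega>|N. h (Y \<omega>)) = (LINT x|D. w2 x - w1 x)" .
  have "AE u in unif. h u = w2 u - w1 u"
    using AE_unif by eventually_elim (auto simp: w1_def w2_def cid)
  moreover have "h \<in> borel_measurable borel"
  proof -
    have "mono (\<lambda>x. w x + h x)"
    proof (rule monoI)
      fix x y :: real assume "x \<le> y"
      from hw[OF this] show "w x + h x \<le> w y + h y" by linarith
    qed
    then have [measurable]: "(\<lambda>x. w x + h x) \<in> borel_measurable borel" by (rule borel_measurable_mono)
    have [measurable]: "w \<in> borel_measurable borel" by (rule borel_measurable_mono) fact
    have "(\<lambda>x. (w x + h x) - w x) \<in> borel_measurable borel" by measurable
    then show ?thesis by simp
  qed
  ultimately have e2: "(LINT u|unif. h u) = (LINT u|unif. w2 u - w1 u)"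
    by (intro integral_cong_AE) auto
  have int: "integrable D' w1" "integrable D' w2" if "real_distribution D'" for D'
  proof -
    interpret D': real_distribution D' by fact
    show "integrable D' w1"
      using n1 by (intro D'.integrable_const_bound[where B="\<bar>w 0\<bar> + \<bar>w 0 + V\<bar>"]) auto
    show "integrable D' w2"
      using n2 by (intro D'.integrable_const_bound[where B="\<bar>w 0 + h 0\<bar> + \<bar>w 0 + h 0 + 2 * V\<bar>"]) auto
  qed
  have e3: "(LINT x|D'. w2 x - w1 x) = (LINT x|D'. w2 x) - (LINT x|D'. w1 x)" if "real_distribution D'" for D'
    by (rule Bochner_Integration.integral_diff) (use int[OF that] in auto)
  have "(2 * V) * \<epsilon> + V * \<epsilon> = 3 * V * \<epsilon>" by simp
  then show ?thesis
    unfolding e1 e2 e3[OF D] e3[OF real_distribution_unif] using 1 2 by linarith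
qed

section \<open>The random walk as a semigroup of averaging operators\<close>

definition bounded_borel :: "(real \<Rightarrow> 'b::{real_normed_field, banach, second_countable_topology}) \<Rightarrow> bool" where
  "bounded_borel h \<longleftrightarrow> h \<in> borel_measurable borel \<and> (\<exists>B. \<forall>x. norm (h x) \<le> B)"

lemma bounded_borelI: "h \<in> borel_measurable borel \<Longrightarrow> (\<And>x. norm (h x) \<le> B) \<Longrightarrow> bounded_borel h"
  unfolding bounded_borel_def by blast

lemma bounded_borel_measurable: "bounded_borel h \<Longrightarrow> h \<in> borel_measurable borel"
  unfolding bounded_borel_def by blast

lemma bounded_borel_bound:
  assumes "bounded_borel h" obtains B where "0 \<le> B" "\<And>x. norm (h x) \<le> B"
proof -
  from assms obtain B where B: "\<And>x. norm (h x) \<le> B" unfolding bounded_borel_def by blast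
  moreover have "0 \<le> B" using order_trans[OF norm_ge_zero B[of 0]] .
  ultimately show ?thesis by (rule that[rotated])
qed

lemma bounded_borel_const [simp]: "bounded_borel (\<lambda>_. c)"
  by (rule bounded_borelI[where B="norm c"]) auto

lemma bounded_borel_mult:
  assumes f: "bounded_borel f" and g: "bounded_borel g" shows "bounded_borel (\<lambda>x. f x * g x)"
proof -
  note [measurable] = bounded_borel_measurable[OF f] bounded_borel_measurable[OF g]
  obtain B where B: "0 \<le> B" "\<And>x. norm (f x) \<le> B" using bounded_borel_bound[OF f] by blast
  obtain C where C: "0 \<le> C" "\<And>x. norm (g x) \<le> C" using bounded_borel_bound[OF g] by blast
  show ?thesis
    by (rule bounded_borelI[where B="B * C"]) (auto simp: norm_mult intro!: mult_mono B C)
qed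

lemma bounded_borel_add:
  assumes f: "bounded_borel f" and g: "bounded_borel g" shows "bounded_borel (\<lambda>x. f x + g x)"
proof -
  note [measurable] = bounded_borel_measurable[OF f] bounded_borel_measurable[OF g]
  obtain B where B: "0 \<le> B" "\<And>x. norm (f x) \<le> B" using bounded_borel_bound[OF f] by blast
  obtain C where C: "0 \<le> C" "\<And>x. norm (g x) \<le> C" using bounded_borel_bound[OF g] by blast
  show ?thesis
    by (rule bounded_borelI[where B="B + C"]) (auto intro!: norm_triangle_mono B C)
qed

lemma bounded_borel_sum:
  "(\<And>i. i \<in> I \<Longrightarrow> bounded_borel (f i)) \<Longrightarrow> bounded_borel (\<lambda>x. \<Sum>i\<in>I. f i x)"
  by (induction I rule: infinite_finite_induct) (auto intro: bounded_borel_add)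

locale circle_walk = prob_space M for M :: "'a measure" +
  fixes X :: "nat \<Rightarrow> 'a \<Rightarrow> real" and \<delta> :: real
  assumes iid: "iid_seq M X"
    and delta_pos: "0 < \<delta>"
    and decay: "bdd_above ((\<lambda>k. real k powr (1 + \<delta>) * psi M X k) ` {1..})"
begin

abbreviation S :: "nat \<Rightarrow> 'a \<Rightarrow> real" where "S \<equiv> partial_sum X"
abbreviation \<psi> :: "nat \<Rightarrow> real" where "\<psi> \<equiv> psi M X"

lemma X_measurable [measurable]: "1 \<le> j \<Longrightarrow> X j \<in> borel_measurable M"
  using iid unfolding iid_seq_def indep_vars_def by auto

lemma indep_X: "indep_vars (\<lambda>_. borel) X {1..}"
  using iid unfolding iid_seq_def by auto

lemma X_law: "1 \<le> j \<Longrightarrow> distr M borel (X j) = distr M borel (X 1)"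
  using iid unfolding iid_seq_def by blast

lemma S_measurable [measurable]: "S k \<in> borel_measurable M"
  unfolding partial_sum_def by (rule borel_measurable_sum) auto

lemma S_0 [simp]: "S 0 \<omega> = 0" by (simp add: partial_sum_def)

lemma S_Suc: "S (Suc k) \<omega> = S k \<omega> + X (Suc k) \<omega>" by (simp add: partial_sum_def)

text \<open>Independence and identical distribution enter here only: the last step may be replaced by an
  independent copy of the first one.  Everything else follows from the resulting Markov property
  of the operators below.\<close>

lemma expectation_last_step:
  fixes G :: "(nat \<Rightarrow> real) \<times> real \<Rightarrow> 'b::{banach, second_countable_topology}"
  assumes G[measurable]: "G \<in> borel_measurable (PiM {1..N} (\<lambda>_. borel) \<Otimes>\<^sub>M borel)"
    and bd: "\<And>v y. norm (G (v, y)) \<le> B"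
  shows "(LINT \<omega>|M. G (restrict (\<lambda>i. X i \<omega>) {1..N}, X (Suc N) \<omega>))
    = (LINT \<omega>|M. LINT \<omega>'|M. G (restrict (\<lambda>i. X i \<omega>) {1..N}, X 1 \<omega>'))"
proof -
  let ?P = "PiM {1..N} (\<lambda>_. borel :: real measure)" and ?Q = "PiM {Suc N} (\<lambda>_. borel :: real measure)"
  let ?pre = "\<lambda>\<omega>. restrict (\<lambda>i. X i \<omega>) {1..N}" and ?last = "\<lambda>\<omega>. restrict (\<lambda>i. X i \<omega>) {Suc N}"
  have "indep_var ?P ?pre ?Q ?last"
    by (rule indep_var_restrict[OF indep_X]) auto
  then have eq: "distr M ?P ?pre \<Otimes>\<^sub>M distr M ?Q ?last = distr M (?P \<Otimes>\<^sub>M ?Q) (\<lambda>\<omega>. (?pre \<omega>, ?last \<omega>))"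
    and pre[measurable]: "?pre \<in> measurable M ?P" and last[measurable]: "?last \<in> measurable M ?Q"
    by (auto simp: indep_var_distribution_eq)
  have law: "distr M borel (X (Suc N)) = distr M borel (X 1)" by (rule X_law) simp
  interpret A: prob_space "distr M ?P ?pre" by (rule prob_space_distr) simp
  interpret B: prob_space "distr M ?Q ?last" by (rule prob_space_distr) simp
  interpret AB: pair_prob_space "distr M ?P ?pre" "distr M ?Q ?last" ..
  define H where "H z = G (fst z, snd z (Suc N))" for z
  have comp[measurable]: "(\<lambda>u. u (Suc N)) \<in> borel_measurable ?Q"
    by (rule measurable_component_singleton) simp
  have H[measurable]: "H \<in> borel_measurable (?P \<Otimes>\<^sub>M ?Q)" unfolding H_def by measurable
  have inner: "(LINT u|distr M ?Q ?last. H (v, u)) = (LINT \<omega>'|M. G (v, X 1 \<omega>'))" if [simp]: "v \<in> space ?P" for v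
  proof -
    have Gv: "(\<lambda>y. G (v, y)) \<in> borel_measurable borel"
      by (rule measurable_compose[OF measurable_Pair1' G]) (rule that)
    have "(LINT u|distr M ?Q ?last. H (v, u)) = (LINT \<omega>'|M. G (v, X (Suc N) \<omega>'))"
    proof (subst integral_distr)
      show "(\<lambda>u. H (v, u)) \<in> borel_measurable ?Q"
        by (rule measurable_compose[OF measurable_Pair1' H]) (rule that)
    qed (auto simp: H_def)
    also have "\<dots> = (LINT y|distr M borel (X (Suc N)). G (v, y))"
      by (rule integral_distr[symmetric, OF _ Gv]) simp
    also have "\<dots> = (LINT \<omega>'|M. G (v, X 1 \<omega>'))"
      unfolding law by (rule integral_distr[OF _ Gv]) simp
    finally show ?thesis .
  qed
  have "(LINT \<omega>|M. G (?pre \<omega>, X (Suc N) \<omega>))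
     = (LINT z|distr M (?P \<Otimes>\<^sub>M ?Q) (\<lambda>\<omega>. (?pre \<omega>, ?last \<omega>)). H z)"
    by (subst integral_distr[OF _ H]) (auto simp: H_def)
  also have "\<dots> = (LINT z|(distr M ?P ?pre \<Otimes>\<^sub>M distr M ?Q ?last). H z)"
    unfolding eq ..
  also have "\<dots> = (LINT v|distr M ?P ?pre. LINT u|distr M ?Q ?last. H (v, u))"
  proof (rule AB.integral_fst'[symmetric])
    show "integrable (distr M ?P ?pre \<Otimes>\<^sub>M distr M ?Q ?last) H"
    proof (rule AB.P.integrable_const_bound[where B=B])
      show "H \<in> borel_measurable (distr M ?P ?pre \<Otimes>\<^sub>M distr M ?Q ?last)" by measurable
    qed (use bd in \<open>simp add: H_def\<close>)
  qed
  also have "\<dots> = (LINT \<omega>|M. LINT u|distr M ?Q ?last. H (?pre \<omega>, u))"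
  proof (rule integral_distr[OF pre])
    have "(\<lambda>(v, u). H (v, u)) \<in> borel_measurable (?P \<Otimes>\<^sub>M distr M ?Q ?last)"
      by (simp only: case_prod_eta) measurable
    then show "(\<lambda>v. LINT u|distr M ?Q ?last. H (v, u)) \<in> borel_measurable ?P"
      by (rule B.borel_measurable_lebesgue_integral)
  qed
  also have "\<dots> = (LINT \<omega>|M. LINT \<omega>'|M. G (?pre \<omega>, X 1 \<omega>'))"
    by (intro Bochner_Integration.integral_cong refl inner) (auto simp: space_PiM)
  finally show ?thesis .
qed

text \<open>The operator \<open>T k\<close> averages over the law of \<open>S k\<close>; \<open>W \<phi> N\<close> is the weighted
  (Feynman--Kac) version.  Exponentials of sums along the walk have this product form.\<close>

definition T :: "nat \<Rightarrow> (real \<Rightarrow> 'b::{real_normed_field, banach, second_countable_topology}) \<Rightarrow> real \<Rightarrow> 'b" where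
  "T k h x = (LINT \<omega>|M. h (x + S k \<omega>))"

definition W :: "(nat \<Rightarrow> real \<Rightarrow> 'b::{real_normed_field, banach, second_countable_topology}) \<Rightarrow> nat
    \<Rightarrow> (real \<Rightarrow> 'b) \<Rightarrow> real \<Rightarrow> 'b" where
  "W \<phi> N h x = (LINT \<omega>|M. (\<Prod>k=1..N. \<phi> k (x + S k \<omega>)) * h (x + S N \<omega>))"

lemma W_one: "W (\<lambda>_ _. 1) N h = T N h"
  by (simp add: W_def T_def fun_eq_iff)

lemma W_0: "W \<phi> 0 h x = h x"
  by (simp add: W_def prob_space)

lemma T_1: "T 1 h x = (LINT \<omega>|M. h (x + X 1 \<omega>))"
  by (simp add: T_def partial_sum_def)

lemma T_measurable [measurable]:
  assumes [measurable]: "h \<in> borel_measurable borel" shows "T k h \<in> borel_measurable borel"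
  unfolding T_def by measurable

lemma norm_integral_le:
  fixes g :: "'a \<Rightarrow> 'b::{banach, second_countable_topology}"
  assumes "\<And>\<omega>. norm (g \<omega>) \<le> B" shows "norm (LINT \<omega>|M. g \<omega>) \<le> B"
proof -
  have B: "0 \<le> B" using order_trans[OF norm_ge_zero assms] .
  show ?thesis
  proof (cases "integrable M g")
    case True
    have "norm (LINT \<omega>|M. g \<omega>) \<le> (LINT \<omega>|M. norm (g \<omega>))" by (rule integral_norm_bound)
    also have "\<dots> \<le> (LINT \<omega>|M. B)" by (rule integral_mono) (use True assms in auto)
    finally show ?thesis by (simp add: prob_space)
  qed (use B in \<open>simp add: not_integrable_integral_eq\<close>)
qed

lemma norm_T_le: "(\<And>x. norm (h x) \<le> B) \<Longrightarrow> norm (T k h x) \<le> B"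
  unfolding T_def by (rule norm_integral_le)

lemma bounded_borel_T: assumes h: "bounded_borel h" shows "bounded_borel (T k h)"
proof -
  note [measurable] = bounded_borel_measurable[OF h]
  obtain B where B: "0 \<le> B" "\<And>x. norm (h x) \<le> B" using bounded_borel_bound[OF h] by blast
  show ?thesis by (rule bounded_borelI[OF _ norm_T_le]) (use B in auto)
qed

lemma integrable_comp_S:
  assumes h: "bounded_borel h" shows "integrable M (\<lambda>\<omega>. h (x + S k \<omega>))"
proof -
  note [measurable] = bounded_borel_measurable[OF h]
  obtain B where B: "0 \<le> B" "\<And>x. norm (h x) \<le> B" using bounded_borel_bound[OF h] by blast
  show ?thesis by (rule integrable_const_bound[where B=B]) (use B in auto)
qed

lemma prod_bounded_borel:
  assumes \<phi>: "\<And>k. bounded_borel (\<phi> k)"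
  obtains B where "0 \<le> B" "\<And>y. norm (\<Prod>k=1..N. \<phi> k (y k)) \<le> B"
proof -
  have "\<forall>k. \<exists>B. \<forall>x. norm (\<phi> k x) \<le> B" using \<phi> unfolding bounded_borel_def by blast
  then obtain B where B: "\<And>k x. norm (\<phi> k x) \<le> B k" by metis
  have B0: "0 \<le> B k" for k using order_trans[OF norm_ge_zero B] .
  show ?thesis
  proof (rule that)
    show "0 \<le> (\<Prod>k=1..N. B k)" by (intro prod_nonneg) (use B0 in auto)
    show "norm (\<Prod>k=1..N. \<phi> k (y k)) \<le> (\<Prod>k=1..N. B k)" for y
      unfolding prod_norm[symmetric] by (intro prod_mono) (use B in auto)
  qed
qed

lemma integrable_W:
  assumes \<phi>: "\<And>k. bounded_borel (\<phi> k)" and h: "bounded_borel h"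
  shows "integrable M (\<lambda>\<omega>. (\<Prod>k=1..N. \<phi> k (x + S k \<omega>)) * h (x + S N \<omega>))"
proof -
  note [measurable] = bounded_borel_measurable[OF h] bounded_borel_measurable[OF \<phi>]
  obtain B where B: "0 \<le> B" "\<And>x. norm (h x) \<le> B" using bounded_borel_bound[OF h] by blast
  obtain C where C: "0 \<le> C" "\<And>y. norm (\<Prod>k=1..N. \<phi> k (y k)) \<le> C"
    using prod_bounded_borel[where \<phi>=\<phi> and N=N, OF \<phi>] by blast
  show ?thesis
    by (rule integrable_const_bound[where B="C * B"])
      (auto simp: norm_mult intro!: mult_mono B C(1) C(2)[of "\<lambda>k. x + S k _"] AE_I2 simp del: One_nat_def)
qed

lemma bounded_borel_W:
  assumes \<phi>: "\<And>k. bounded_borel (\<phi> k)" and h: "bounded_borel h"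
  shows "bounded_borel (W \<phi> N h)"
proof -
  note [measurable] = bounded_borel_measurable[OF h] bounded_borel_measurable[OF \<phi>]
  obtain B where B: "0 \<le> B" "\<And>x. norm (h x) \<le> B" using bounded_borel_bound[OF h] by blast
  obtain C where C: "0 \<le> C" "\<And>y. norm (\<Prod>k=1..N. \<phi> k (y k)) \<le> C"
    using prod_bounded_borel[where \<phi>=\<phi> and N=N, OF \<phi>] by blast
  show ?thesis
  proof (rule bounded_borelI)
    show "W \<phi> N h \<in> borel_measurable borel" unfolding W_def by measurable
    show "norm (W \<phi> N h x) \<le> C * B" for x
      unfolding W_def
      by (rule norm_integral_le)
        (auto simp: norm_mult intro!: mult_mono B C(1) C(2)[of "\<lambda>k. x + S k _"] simp del: One_nat_def)
  qed
qed

lemma W_Suc: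
  assumes \<phi>: "\<And>k. bounded_borel (\<phi> k)" and h: "bounded_borel h"
  shows "W \<phi> (Suc N) h x = W \<phi> N (T 1 (\<lambda>y. \<phi> (Suc N) y * h y)) x"
proof -
  note [measurable] = bounded_borel_measurable[OF h] bounded_borel_measurable[OF \<phi>]
  obtain B where B: "0 \<le> B" "\<And>x. norm (h x) \<le> B" using bounded_borel_bound[OF h] by blast
  obtain C where C: "0 \<le> C" "\<And>y. norm (\<Prod>k=1..Suc N. \<phi> k (y k)) \<le> C"
    using prod_bounded_borel[where \<phi>=\<phi> and N="Suc N", OF \<phi>] by blast
  define F where "F v = (\<Prod>k=1..N. \<phi> k (x + (\<Sum>j=1..k. v j)))" for v :: "nat \<Rightarrow> real"
  define s where "s v = x + (\<Sum>j=1..N. v j)" for v :: "nat \<Rightarrow> real"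
  define G where "G z = F (fst z) * (\<phi> (Suc N) (s (fst z) + snd z) * h (s (fst z) + snd z))" for z
  have comp[measurable]: "(\<lambda>v. \<Sum>j=1..k. v j) \<in> borel_measurable (PiM {1..N} (\<lambda>_. borel :: real measure))"
    if "k \<le> N" for k
    using that by (intro borel_measurable_sum measurable_component_singleton) auto
  have [measurable]: "F \<in> borel_measurable (PiM {1..N} (\<lambda>_. borel))"
    unfolding F_def
  proof (rule borel_measurable_prod)
    fix k assume "k \<in> {1..N}"
    then have [measurable]: "(\<lambda>v. \<Sum>j=1..k. v j) \<in> borel_measurable (PiM {1..N} (\<lambda>_. borel :: real measure))"
      by (intro comp) auto
    show "(\<lambda>v. \<phi> k (x + (\<Sum>j=1..k. v j))) \<in> borel_measurable (PiM {1..N} (\<lambda>_. borel))"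
      by measurable
  qed
  have [measurable]: "s \<in> borel_measurable (PiM {1..N} (\<lambda>_. borel))"
    unfolding s_def using comp[of N] by measurable
  have GB: "norm (G (v, y)) \<le> C * B" for v y
  proof -
    let ?v = "\<lambda>k. if k = Suc N then s v + y else x + (\<Sum>j=1..k. v j)"
    have "G (v, y) = (\<Prod>k=1..Suc N. \<phi> k (?v k)) * h (s v + y)"
      by (simp add: G_def F_def mult.assoc)
    then show ?thesis
      by (simp only: norm_mult) (intro mult_mono B C norm_ge_zero)
  qed
  have Fe: "F (restrict (\<lambda>i. X i \<omega>) {1..N}) = (\<Prod>k=1..N. \<phi> k (x + S k \<omega>))" for \<omega>
    unfolding F_def partial_sum_def by (intro prod.cong refl) (auto intro!: arg_cong2[where f="(+)"] arg_cong[where f="\<phi> _"] sum.cong)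
  have se: "s (restrict (\<lambda>i. X i \<omega>) {1..N}) = x + S N \<omega>" for \<omega>
    unfolding s_def partial_sum_def by simp
  have "W \<phi> (Suc N) h x = (LINT \<omega>|M. G (restrict (\<lambda>i. X i \<omega>) {1..N}, X (Suc N) \<omega>))"
    unfolding W_def G_def by (simp add: Fe se S_Suc mult.assoc add.assoc del: One_nat_def)
  also have "\<dots> = (LINT \<omega>|M. LINT \<omega>'|M. G (restrict (\<lambda>i. X i \<omega>) {1..N}, X 1 \<omega>'))"
  proof (rule expectation_last_step[where B="C * B"])
    show "G \<in> borel_measurable (PiM {1..N} (\<lambda>_. borel) \<Otimes>\<^sub>M borel)" unfolding G_def by measurable
  qed (rule GB)
  also have "\<dots> = W \<phi> N (T 1 (\<lambda>y. \<phi> (Suc N) y * h y)) x"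
    unfolding W_def T_1 G_def by (simp add: Fe se del: One_nat_def)
  finally show ?thesis .
qed

lemma W_add:
  assumes \<phi>: "\<And>k. bounded_borel (\<phi> k)" and h: "bounded_borel h"
  shows "W \<phi> (N + N') h x = W \<phi> N (W (\<lambda>k. \<phi> (k + N)) N' h) x"
  using h
proof (induction N' arbitrary: h)
  case 0
  have "W (\<lambda>k. \<phi> (k + N)) 0 h = h" by (simp add: fun_eq_iff W_0)
  then show ?case by simp
next
  case (Suc N')
  have b: "bounded_borel (T 1 (\<lambda>y. \<phi> (Suc N' + N) y * h y))"
    by (intro bounded_borel_T bounded_borel_mult \<phi> Suc.prems)
  have "W \<phi> (N + Suc N') h x = W \<phi> (N + N') (T 1 (\<lambda>y. \<phi> (Suc N' + N) y * h y)) x"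
    using W_Suc[where \<phi>=\<phi> and N="N + N'" and h=h, OF \<phi> Suc.prems] by (simp add: add.commute)
  also have "\<dots> = W \<phi> N (W (\<lambda>k. \<phi> (k + N)) N' (T 1 (\<lambda>y. \<phi> (Suc N' + N) y * h y))) x"
    by (rule Suc.IH[OF b])
  also have "W (\<lambda>k. \<phi> (k + N)) N' (T 1 (\<lambda>y. \<phi> (Suc N' + N) y * h y)) = W (\<lambda>k. \<phi> (k + N)) (Suc N') h"
    using W_Suc[where \<phi>="\<lambda>k. \<phi> (k + N)" and N=N' and h=h, OF \<phi> Suc.prems] by (simp add: fun_eq_iff)
  finally show ?case .
qed

lemma W_cong: "(\<And>k. 1 \<le> k \<Longrightarrow> k \<le> N \<Longrightarrow> \<phi> k = \<phi>' k) \<Longrightarrow> W \<phi> N h = W \<phi>' N h"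
  unfolding W_def by (auto intro!: ext Bochner_Integration.integral_cong arg_cong2[where f="(*)"] prod.cong)

lemma T_add: "bounded_borel h \<Longrightarrow> T (j + k) h x = T j (T k h) x"
  using W_add[where \<phi>="\<lambda>_ _. 1" and N=j and N'=k and h=h] by (simp add: W_one)

lemma expectation_two_times:
  assumes f: "bounded_borel f" and g: "bounded_borel g" and jk: "1 \<le> j" "j \<le> k"
  shows "(LINT \<omega>|M. f (x + S j \<omega>) * g (x + S k \<omega>)) = T j (\<lambda>y. f y * T (k - j) g y) x"
proof -
  define \<phi> where "\<phi> i = (if i = j then f else (\<lambda>_. 1))" for i
  have \<phi>: "bounded_borel (\<phi> i)" for i using f by (simp add: \<phi>_def)
  have pr: "(\<Prod>i=1..m. \<phi> i (y i)) = f (y j)" if "j \<le> m" for m and y :: "nat \<Rightarrow> real"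
  proof -
    have "(\<Prod>i=1..m. \<phi> i (y i)) = (\<Prod>i=1..m. if i = j then f (y j) else 1)"
      by (intro prod.cong) (auto simp: \<phi>_def)
    with that jk show ?thesis by simp
  qed
  have "(LINT \<omega>|M. f (x + S j \<omega>) * g (x + S k \<omega>)) = W \<phi> (j + (k - j)) g x"
    unfolding W_def using pr[of k "\<lambda>i. x + S i _"] jk by simp
  also have "\<dots> = W \<phi> j (W (\<lambda>i. \<phi> (i + j)) (k - j) g) x"
    by (rule W_add[OF \<phi> g])
  also have "W (\<lambda>i. \<phi> (i + j)) (k - j) g = W (\<lambda>_ _. 1) (k - j) g"
    by (rule W_cong) (auto simp: \<phi>_def)
  also have "W \<phi> j (W (\<lambda>_ _. 1) (k - j) g) x = T j (\<lambda>y. f y * T (k - j) g y) x"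
    unfolding W_one unfolding W_def T_def using pr[of j "\<lambda>i. x + S i _"] by simp
  finally show ?thesis .
qed

lemma periodic1_T: assumes "periodic1 h" shows "periodic1 (T k h)"
proof -
  have "h (frac x + s) = h (x + s)" for x s
    using periodic1_shift[OF assms] unfolding periodic1_def by blast
  then show ?thesis unfolding T_def periodic1_def by simp
qed

lemma periodic1_W:
  assumes "\<And>k. periodic1 (\<phi> k)" "periodic1 h" shows "periodic1 (W \<phi> N h)"
proof -
  have "\<phi> k (frac x + s) = \<phi> k (x + s)" "h (frac x + s) = h (x + s)" for k x s
    using periodic1_shift[OF assms(1)] periodic1_shift[OF assms(2)] unfolding periodic1_def by blast+
  then show ?thesis unfolding W_def periodic1_def by simp
qed

text \<open>The last step of the walk is peeled off: averaging does not increase the variation, and each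
  of the \<open>N\<close> factors, being bounded by 1, adds its own.\<close>

lemma circ_bv_W:
  assumes \<phi>: "\<And>k. bounded_borel (\<phi> k)" "\<And>k. periodic1 (\<phi> k)" "\<And>k x. norm (\<phi> k x) \<le> 1" "\<And>k. circ_bv V (\<phi> k)"
    and h: "bounded_borel h" "periodic1 h" "\<And>x. norm (h x) \<le> 1" "circ_bv V' h"
  shows "circ_bv (V' + real N * V) (W \<phi> N h)"
  using h
proof (induction N arbitrary: h V')
  case 0
  have "W \<phi> 0 h = h" by (simp add: fun_eq_iff W_0)
  with 0 show ?case by simp
next
  case (Suc N)
  let ?g = "\<lambda>y. \<phi> (Suc N) y * h y"
  have g: "bounded_borel ?g" by (intro bounded_borel_mult \<phi> Suc.prems)
  have gp: "periodic1 ?g" using \<phi>(2) Suc.prems(2) unfolding periodic1_def by simp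
  have gb: "norm (?g x) \<le> 1" for x
    unfolding norm_mult using \<phi>(3) Suc.prems(3) by (intro mult_le_one) auto
  have gv: "circ_bv (V + V') ?g"
    by (rule circ_bv_mult) (use \<phi> Suc.prems in auto)
  have "circ_bv (V + V') (T 1 ?g)"
    unfolding T_def
    by (rule circ_bv_average[OF prob_space_axioms S_measurable bounded_borel_measurable[OF g] gv gp gb])
  then have "circ_bv (V + V' + real N * V) (W \<phi> N (T 1 ?g))"
    by (intro Suc.IH bounded_borel_T g periodic1_T gp norm_T_le gb)
  moreover have "W \<phi> (Suc N) h = W \<phi> N (T 1 ?g)"
    using W_Suc[OF \<phi>(1) Suc.prems(1)] by (simp add: fun_eq_iff)
  ultimately show ?case by (simp add: algebra_simps)
qed

lemma integral_unif_T:
  assumes h: "bounded_borel h" and per: "periodic1 h"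
  shows "(LINT u|unif. T k h u) = (LINT u|unif. h u)"
proof -
  note [measurable] = bounded_borel_measurable[OF h]
  obtain B where B: "0 \<le> B" "\<And>x. norm (h x) \<le> B" using bounded_borel_bound[OF h] by blast
  interpret U: prob_space unif by (rule prob_space_unif)
  interpret P: pair_prob_space unif M ..
  have "(LINT u|unif. T k h u) = (LINT \<omega>|M. LINT u|unif. h (u + S k \<omega>))"
    unfolding T_def
  proof (rule P.Fubini_integral[symmetric])
    show "integrable (unif \<Otimes>\<^sub>M M) (\<lambda>(u, \<omega>). h (u + S k \<omega>))"
      by (rule P.P.integrable_const_bound[where B=B]) (use B in \<open>auto intro!: AE_I2\<close>)
  qed
  also have "\<dots> = (LINT \<omega>|M. LINT u|unif. h u)"
    using integral_unif_shift[OF _ per B(2)] by simp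
  finally show ?thesis by (simp add: prob_space)
qed

subsection \<open>Decay of correlations\<close>

lemma psi_bound: "t \<in> {0..1} \<Longrightarrow> \<bar>measure M {\<omega> \<in> space M. frac (S k \<omega>) \<le> t} - t\<bar> \<le> \<psi> k"
  unfolding psi_def
proof (rule cSUP_upper)
  have "\<bar>measure M A - s\<bar> \<le> 1" if "s \<in> {0..1}" for s A
    using that prob_le_1[of A] measure_nonneg[of M A] unfolding abs_le_iff atLeastAtMost_iff by linarith
  then show "bdd_above ((\<lambda>t. \<bar>measure M {\<omega> \<in> space M. frac (S k \<omega>) \<le> t} - t\<bar>) ` {0..1})"
    by (intro bdd_aboveI2[where M=1])
qed

lemma psi_nonneg: "0 \<le> \<psi> k"
  by (rule order_trans[OF abs_ge_zero psi_bound[of 0]]) simp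

lemma psi_decay: obtains C where "0 \<le> C" "\<And>k. 1 \<le> k \<Longrightarrow> \<psi> k \<le> C * real k powr (-(1 + \<delta>))"
proof -
  from decay obtain C where C: "\<And>k. 1 \<le> k \<Longrightarrow> real k powr (1 + \<delta>) * \<psi> k \<le> C"
    unfolding bdd_above_def by auto
  have "\<psi> k \<le> max 0 C * real k powr (-(1 + \<delta>))" if "1 \<le> k" for k
  proof -
    have "real k powr (1 + \<delta>) > 0" using that by simp
    moreover have "real k powr (1 + \<delta>) * \<psi> k \<le> max 0 C" using C[OF that] by simp
    ultimately have "\<psi> k \<le> max 0 C / real k powr (1 + \<delta>)" by (simp add: pos_le_divide_eq mult.commute)
    then show ?thesis by (simp only: powr_minus divide_inverse)
  qed
  then show ?thesis by (intro that[of "max 0 C"]) auto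
qed

lemma summable_psi: "summable (\<lambda>k. \<psi> (Suc k))"
proof -
  obtain C where C: "0 \<le> C" "\<And>k. 1 \<le> k \<Longrightarrow> \<psi> k \<le> C * real k powr (-(1 + \<delta>))" using psi_decay by blast
  have "summable (\<lambda>k. real k powr (-(1 + \<delta>)))"
    using delta_pos by (simp add: summable_real_powr_iff)
  then have "summable (\<lambda>k. real (Suc k) powr (-(1 + \<delta>)))"
    by (subst summable_Suc_iff)
  then have "summable (\<lambda>k. C * real (Suc k) powr (-(1 + \<delta>)))" by (rule summable_mult)
  then show ?thesis
    by (rule summable_comparison_test_ev[rotated])
      (use C psi_nonneg in \<open>auto intro!: always_eventually simp del: of_nat_Suc\<close>)
qed

definition psi_total :: real where "psi_total = (\<Sum>k. \<psi> (Suc k))"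

lemma psi_total_nonneg: "0 \<le> psi_total"
  unfolding psi_total_def by (intro suminf_nonneg summable_psi psi_nonneg)

lemma sum_psi_le: "finite I \<Longrightarrow> 0 \<notin> I \<Longrightarrow> sum \<psi> I \<le> psi_total"
proof -
  assume I: "finite I" "0 \<notin> I"
  then have img: "I = Suc ` ((\<lambda>k. k - 1) ` I)"
    unfolding image_image by (intro image_cong[where g=id, simplified, symmetric]) (auto intro!: Suc_pred gr0I)
  let ?J = "(\<lambda>k. k - 1) ` I"
  have "sum \<psi> I = sum \<psi> (Suc ` ?J)" using img by simp
  also have "\<dots> = (\<Sum>k\<in>?J. \<psi> (Suc k))" by (subst sum.reindex) (auto simp: comp_def)
  also have "\<dots> \<le> psi_total"
    unfolding psi_total_def using I by (intro sum_le_suminf summable_psi) (auto simp: psi_nonneg)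
  finally show ?thesis .
qed

text \<open>The translation by \<open>x\<close> changes neither the variation nor the mean over the circle, so Koksma's
  inequality applies uniformly in the starting point.\<close>

lemma T_equidistributes:
  fixes h :: "real \<Rightarrow> real"
  assumes "periodic1 h" "circ_bv V h"
  shows "\<bar>T k h x - (LINT u|unif. h u)\<bar> \<le> 3 * V * \<psi> k"
proof -
  have "(\<lambda>y. h (x + y)) = (\<lambda>y. h (y + x))" by (simp add: add.commute)
  then have "periodic1 (\<lambda>y. h (x + y))" "circ_bv V (\<lambda>y. h (x + y))"
    using periodic1_shift[OF assms(1)] circ_bv_shift[OF assms(2)] by simp_all
  then have k: "\<bar>T k h x - (LINT u|unif. h (x + u))\<bar> \<le> 3 * V * \<psi> k"
    unfolding T_def by (intro koksma[OF prob_space_axioms S_measurable psi_bound])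
  obtain w where w: "mono w" "\<And>x. w (x + 1) = w x + V" "\<And>x y. x \<le> y \<Longrightarrow> \<bar>h y - h x\<bar> \<le> w y - w x"
    using assms(2) unfolding circ_bv_def by auto
  have hb: "norm (h x) \<le> \<bar>h 0\<bar> + V" for x
  proof -
    have "\<bar>h (frac x) - h 0\<bar> \<le> w (frac x) - w 0" by (rule w(3)) simp
    also have "\<dots> \<le> w 1 - w 0" using monoD[OF w(1), of "frac x" 1] frac_lt_1[of x] by simp
    also have "\<dots> = V" using w(2)[of 0] by simp
    finally show ?thesis using assms(1) by (simp add: periodic1_def)
  qed
  have "mono (\<lambda>x. w x + h x)"
  proof (rule monoI)
    fix x y :: real assume "x \<le> y"
    from w(3)[OF this] show "w x + h x \<le> w y + h y" by linarith
  qed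
  then have [measurable]: "(\<lambda>x. w x + h x) \<in> borel_measurable borel" by (rule borel_measurable_mono)
  have [measurable]: "w \<in> borel_measurable borel" by (rule borel_measurable_mono) fact
  have "(\<lambda>x. (w x + h x) - w x) \<in> borel_measurable borel" by measurable
  then have "h \<in> borel_measurable borel" by simp
  from integral_unif_shift[OF this assms(1) hb, of x] k show ?thesis by (simp add: add.commute)
qed

lemma T_equidistributes_complex:
  fixes h :: "real \<Rightarrow> complex"
  assumes h: "bounded_borel h" and "periodic1 h" "circ_bv V h"
  shows "norm (T k h x - (LINT u|unif. h u)) \<le> 6 * V * \<psi> k"
proof -
  note [measurable] = bounded_borel_measurable[OF h]
  interpret U: prob_space unif by (rule prob_space_unif)
  obtain B where B: "0 \<le> B" "\<And>x. norm (h x) \<le> B" using bounded_borel_bound[OF h] by blast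
  have i: "integrable unif h" by (rule U.integrable_const_bound[where B=B]) (use B in auto)
  have iS: "integrable M (\<lambda>\<omega>. h (x + S k \<omega>))" by (rule integrable_comp_S[OF h])
  have "periodic1 (\<lambda>x. Re (h x))" "periodic1 (\<lambda>x. Im (h x))"
    using assms(2) unfolding periodic1_def by simp_all
  moreover have "circ_bv (1 * V) (\<lambda>x. Re (h x))"
    by (rule circ_bv_lipschitz[OF assms(3)]) (simp_all add: abs_Re_le_cmod flip: minus_complex.simps)
  moreover have "circ_bv (1 * V) (\<lambda>x. Im (h x))"
    by (rule circ_bv_lipschitz[OF assms(3)]) (simp_all add: abs_Im_le_cmod flip: minus_complex.simps)
  ultimately have "\<bar>T k (\<lambda>x. Re (h x)) x - (LINT u|unif. Re (h u))\<bar> \<le> 3 * V * \<psi> k"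
     "\<bar>T k (\<lambda>x. Im (h x)) x - (LINT u|unif. Im (h u))\<bar> \<le> 3 * V * \<psi> k"
    by (auto intro!: T_equidistributes)
  moreover have "T k (\<lambda>x. Re (h x)) x = Re (T k h x)" "T k (\<lambda>x. Im (h x)) x = Im (T k h x)"
    using iS by (simp_all add: T_def)
  ultimately have "\<bar>Re (T k h x - (LINT u|unif. h u))\<bar> \<le> 3 * V * \<psi> k"
    "\<bar>Im (T k h x - (LINT u|unif. h u))\<bar> \<le> 3 * V * \<psi> k"
    using i by simp_all
  then show ?thesis using cmod_le[of "T k h x - (LINT u|unif. h u)"] by simp
qed

end

section \<open>Central limit theorem for sums along the walk\<close>

lemma cesaro_mean:
  fixes a :: "nat \<Rightarrow> real"
  assumes "a \<longlonglongrightarrow> l"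
  shows "(\<lambda>n. (\<Sum>i<n. a i) / real n) \<longlonglongrightarrow> l"
proof (rule LIMSEQ_I)
  fix e :: real assume e: "0 < e"
  obtain N where N: "\<And>i. N \<le> i \<Longrightarrow> \<bar>a i - l\<bar> < e / 2"
    using LIMSEQ_D[OF assms, of "e/2"] e by auto
  define C where "C = (\<Sum>i<N. \<bar>a i - l\<bar>)"
  have C: "0 \<le> C" unfolding C_def by (rule sum_nonneg) simp
  define n0 where "n0 = max (Suc N) (nat \<lceil>2 * C / e\<rceil> + 1)"
  show "\<exists>no. \<forall>n\<ge>no. norm ((\<Sum>i<n. a i) / real n - l) < e"
  proof (intro exI[of _ n0] allI impI)
    fix n assume n: "n0 \<le> n"
    then have nN: "N \<le> n" "0 < n" and nC: "2 * C / e < real n" unfolding n0_def by linarith+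
    have "(\<Sum>i<n. a i) / real n - l = (\<Sum>i<n. a i - l) / real n"
      using nN by (simp add: sum_subtractf field_simps)
    also have "\<bar>\<dots>\<bar> \<le> (\<Sum>i<n. \<bar>a i - l\<bar>) / real n"
      by (simp add: divide_right_mono)
    also have "(\<Sum>i<n. \<bar>a i - l\<bar>) = C + (\<Sum>i=N..<n. \<bar>a i - l\<bar>)"
      unfolding C_def using nN by (simp add: lessThan_atLeast0 sum.atLeastLessThan_concat)
    also have "(\<Sum>i=N..<n. \<bar>a i - l\<bar>) \<le> (\<Sum>i=N..<n. e / 2)"
      by (intro sum_mono) (use N in \<open>auto intro: less_imp_le\<close>)
    also have "\<dots> \<le> real n * (e / 2)" using e by simp
    finally have "\<bar>(\<Sum>i<n. a i) / real n - l\<bar> \<le> (C + real n * (e / 2)) / real n"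
      using nN by (simp add: divide_right_mono)
    also have "C < real n * (e / 2)" using nC e by (simp add: field_simps)
    then have "(C + real n * (e / 2)) / real n < e" using nN by (simp add: field_simps)
    finally show "norm ((\<Sum>i<n. a i) / real n - l) < e" by simp
  qed
qed

lemma exp_minus_approx: fixes y :: real assumes "0 \<le> y" shows "\<bar>exp (- y) - (1 - y)\<bar> \<le> y\<^sup>2"
proof -
  have "1 - y \<le> exp (- y)" using exp_ge_add_one_self[of "- y"] by simp
  moreover have "exp (- y) \<le> 1 - y + y\<^sup>2"
  proof -
    have "exp (- y) \<le> 1 / (1 + y)"
      using exp_ge_add_one_self[of y] assms by (simp add: exp_minus inverse_eq_divide frac_le)
    also have "\<dots> \<le> 1 - y + y\<^sup>2"
    proof -
      have "1 \<le> (1 - y + y\<^sup>2) * (1 + y)"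
        using assms by (simp add: algebra_simps power2_eq_square)
      then show ?thesis using assms by (simp add: divide_le_eq)
    qed
    finally show ?thesis .
  qed
  ultimately show ?thesis by linarith
qed

lemma iexp_quadratic: "cmod (iexp y - (1 + \<i> * y - y\<^sup>2 / 2)) \<le> \<bar>y\<bar> ^ 3 / 6"
proof -
  have "(\<Sum>k\<le>2. (\<i> * complex_of_real y) ^ k / fact k) = 1 + \<i> * y - y\<^sup>2 / 2"
    by (simp add: numeral_2_eq_2) (simp add: complex_eq_iff)
  then show ?thesis using iexp_approx1[of y 2] by (simp add: numeral_3_eq_3 numeral_2_eq_2)
qed

lemma iexp_lipschitz: "cmod (iexp x - iexp y) \<le> \<bar>x - y\<bar>"
proof -
  have "iexp x - iexp y = iexp y * (iexp (x - y) - 1)"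
    by (simp add: algebra_simps flip: exp_add)
  then have "cmod (iexp x - iexp y) = cmod (iexp (x - y) - 1)" by (simp add: norm_mult)
  also have "\<dots> \<le> \<bar>x - y\<bar>" using iexp_approx1[of "x - y" 0] by simp
  finally show ?thesis .
qed

definition centered_bv :: "real \<Rightarrow> real \<Rightarrow> (real \<Rightarrow> real) \<Rightarrow> bool" where
  "centered_bv V B f \<longleftrightarrow> f \<in> borel_measurable borel \<and> periodic1 f \<and> circ_bv V f \<and>
     (\<forall>x. \<bar>f x\<bar> \<le> B) \<and> (LINT u|unif. f u) = 0"

lemma centered_bvD:
  assumes "centered_bv V B f"
  shows "f \<in> borel_measurable borel" "periodic1 f" "circ_bv V f" "\<bar>f x\<bar> \<le> B" "(LINT u|unif. f u) = 0"
    "bounded_borel f" "0 \<le> B" "0 \<le> V"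
proof -
  show *: "f \<in> borel_measurable borel" "periodic1 f" "circ_bv V f" "\<bar>f x\<bar> \<le> B" "(LINT u|unif. f u) = 0" for x
    using assms unfolding centered_bv_def by auto
  show "bounded_borel f" by (rule bounded_borelI[where B=B]) (use * in auto)
  show "0 \<le> B" using order_trans[OF abs_ge_zero *(4)] .
  show "0 \<le> V" using *(3) by (rule circ_bv_nonneg)
qed

context circle_walk
begin

lemma T_centered: "centered_bv V B f \<Longrightarrow> \<bar>T k f x\<bar> \<le> 3 * V * \<psi> k"
  using T_equidistributes[of f V k x] centered_bvD[of V B f] by simp

text \<open>The second factor decorrelates from the first one at rate \<open>\<psi>\<close>; only the first factor
  keeps its \<open>L\<^sup>1\<close> norm.  The sum over pairs is thus linear in these norms, uniformly in
  the starting point.\<close>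

lemma second_moment_bound:
  assumes f: "centered_bv V B f" and G: "finite G" "0 \<notin> G"
  shows "(LINT \<omega>|M. (\<Sum>k\<in>G. f (x + S k \<omega>))\<^sup>2)
     \<le> 2 * (B + 3 * V * psi_total) * (\<Sum>j\<in>G. T j (\<lambda>y. \<bar>f y\<bar>) x)"
proof -
  note fD = centered_bvD[OF f]
  note [measurable] = fD(1)
  define E where "E j k = (LINT \<omega>|M. f (x + S j \<omega>) * f (x + S k \<omega>))" for j k
  define e where "e j = T j (\<lambda>y. \<bar>f y\<bar>) x" for j
  define c where "c d = (if d = 0 then B else 3 * V * \<psi> d)" for d :: nat
  have int: "integrable M (\<lambda>\<omega>. f (x + S j \<omega>) * f (x + S k \<omega>))" for j k
    by (rule integrable_const_bound[where B="B * B"])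
      (auto simp: abs_mult intro!: mult_mono fD AE_I2)
  have babs: "bounded_borel (\<lambda>y. \<bar>f y\<bar>)" by (rule bounded_borelI[where B=B]) (use fD in auto)
  have e0: "0 \<le> e j" for j unfolding e_def T_def by (rule integral_nonneg_AE) auto
  have c0: "0 \<le> c d" for d unfolding c_def using fD(7,8) psi_nonneg by simp
  have Ele: "\<bar>E j k\<bar> \<le> e j * c (k - j)" if "1 \<le> j" "j \<le> k" for j k
  proof -
    have Tc: "\<bar>T (k - j) f y\<bar> \<le> c (k - j)" for y
    proof (cases "k - j = 0")
      case True
      then show ?thesis using norm_T_le[of f B "k - j" y] fD(4) by (simp add: c_def)
    next
      case False
      then show ?thesis using T_centered[OF f, of "k - j" y] by (simp add: c_def)
    qed
    have "\<bar>E j k\<bar> = \<bar>T j (\<lambda>y. f y * T (k - j) f y) x\<bar>"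
      unfolding E_def using expectation_two_times[OF fD(6) fD(6) that] by simp
    also have "\<dots> \<le> (LINT \<omega>|M. \<bar>f (x + S j \<omega>) * T (k - j) f (x + S j \<omega>)\<bar>)"
      unfolding T_def[of j] by (rule integral_abs_bound)
    also have "\<dots> \<le> (LINT \<omega>|M. \<bar>f (x + S j \<omega>)\<bar> * c (k - j))"
    proof (rule integral_mono)
      show "integrable M (\<lambda>\<omega>. \<bar>f (x + S j \<omega>) * T (k - j) f (x + S j \<omega>)\<bar>)"
        by (intro integrable_abs integrable_comp_S[where h="\<lambda>y. f y * T (k - j) f y"]
            bounded_borel_mult bounded_borel_T fD)
      show "integrable M (\<lambda>\<omega>. \<bar>f (x + S j \<omega>)\<bar> * c (k - j))"
        by (intro integrable_mult_left integrable_comp_S[OF babs])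
      show "\<bar>f (x + S j \<omega>) * T (k - j) f (x + S j \<omega>)\<bar> \<le> \<bar>f (x + S j \<omega>)\<bar> * c (k - j)" for \<omega>
        unfolding abs_mult by (intro mult_left_mono Tc) simp
    qed
    also have "\<dots> = e j * c (k - j)" unfolding e_def T_def by simp
    finally show ?thesis .
  qed
  have csum: "(\<Sum>k\<in>{k\<in>G. j \<le> k}. c (k - j)) \<le> B + 3 * V * psi_total" for j
  proof -
    let ?H = "{k\<in>G. j \<le> k}"
    have "(\<Sum>k\<in>?H. c (k - j)) = (\<Sum>d\<in>(\<lambda>k. k - j) ` ?H. c d)"
      by (subst sum.reindex) (auto simp: inj_on_def)
    also have "\<dots> \<le> (\<Sum>d\<in>insert 0 ((\<lambda>k. k - j) ` ?H - {0}). c d)"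
      using G c0 by (intro sum_mono2) auto
    also have "\<dots> = B + (\<Sum>d\<in>(\<lambda>k. k - j) ` ?H - {0}. 3 * V * \<psi> d)"
      using G by (subst sum.insert) (auto simp: c_def)
    also have "(\<Sum>d\<in>(\<lambda>k. k - j) ` ?H - {0}. 3 * V * \<psi> d) \<le> 3 * V * psi_total"
      unfolding sum_distrib_left[symmetric]
      by (intro mult_left_mono sum_psi_le) (use G fD in auto)
    finally show ?thesis by simp
  qed
  have "(LINT \<omega>|M. (\<Sum>k\<in>G. f (x + S k \<omega>))\<^sup>2) = (\<Sum>j\<in>G. \<Sum>k\<in>G. E j k)"
    unfolding E_def power2_eq_square sum_product
    by (subst Bochner_Integration.integral_sum, (auto intro!: Bochner_Integration.integrable_sum int)[1],
        intro sum.cong refl, subst Bochner_Integration.integral_sum, (auto intro!: int))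
  also have "\<dots> \<le> (\<Sum>j\<in>G. \<Sum>k\<in>G. (if j \<le> k then e j * c (k - j) else 0) + (if k \<le> j then e k * c (j - k) else 0))"
  proof (intro sum_mono)
    fix j k assume jk: "j \<in> G" "k \<in> G"
    then have "1 \<le> j" "1 \<le> k" using G by (auto simp: Suc_le_eq intro: gr0I)
    moreover have "E j k = E k j" unfolding E_def by (simp add: mult.commute)
    ultimately show "E j k \<le> (if j \<le> k then e j * c (k - j) else 0) + (if k \<le> j then e k * c (j - k) else 0)"
      using Ele[of j k] Ele[of k j] mult_nonneg_nonneg[OF e0[of k] c0[of 0]]
      by (cases j k rule: linorder_cases) (auto simp: mult.commute[of "c 0"])
  qed
  also have "\<dots> = 2 * (\<Sum>j\<in>G. \<Sum>k\<in>G. if j \<le> k then e j * c (k - j) else 0)"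
  proof -
    have "(\<Sum>j\<in>G. \<Sum>k\<in>G. if k \<le> j then e k * c (j - k) else 0) = (\<Sum>j\<in>G. \<Sum>k\<in>G. if j \<le> k then e j * c (k - j) else 0)"
      by (rule sum.swap)
    then show ?thesis by (simp add: sum.distrib)
  qed
  also have "(\<Sum>j\<in>G. \<Sum>k\<in>G. if j \<le> k then e j * c (k - j) else 0) = (\<Sum>j\<in>G. e j * (\<Sum>k\<in>{k\<in>G. j \<le> k}. c (k - j)))"
    using G by (simp add: sum_distrib_left flip: sum.inter_filter)
  also have "\<dots> \<le> (\<Sum>j\<in>G. e j * (B + 3 * V * psi_total))"
    by (intro sum_mono mult_left_mono csum e0)
  also have "(\<Sum>j\<in>G. e j * (B + 3 * V * psi_total)) = (B + 3 * V * psi_total) * (\<Sum>j\<in>G. e j)"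
    unfolding sum_distrib_right[symmetric] by (rule mult.commute)
  finally have "(LINT \<omega>|M. (\<Sum>k\<in>G. f (x + S k \<omega>))\<^sup>2)
      \<le> 2 * ((B + 3 * V * psi_total) * (\<Sum>j\<in>G. e j))" by simp
  then show ?thesis unfolding e_def by (simp only: mult.assoc)
qed

lemma second_moment_linear:
  assumes f: "centered_bv V B f" and G: "finite G" "0 \<notin> G"
  shows "(LINT \<omega>|M. (\<Sum>k\<in>G. f (x + S k \<omega>))\<^sup>2) \<le> 2 * (B + 3 * V * psi_total) * B * real (card G)"
proof -
  note fD = centered_bvD[OF f]
  have "T j (\<lambda>y. \<bar>f y\<bar>) x \<le> B" for j
    using norm_T_le[of "\<lambda>y. \<bar>f y\<bar>" B j x] fD(4) by simp
  then have "(\<Sum>j\<in>G. T j (\<lambda>y. \<bar>f y\<bar>) x) \<le> B * real (card G)"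
    using sum_bounded_above[of G "\<lambda>j. T j (\<lambda>y. \<bar>f y\<bar>) x" B] by (simp add: mult.commute)
  then have "2 * (B + 3 * V * psi_total) * (\<Sum>j\<in>G. T j (\<lambda>y. \<bar>f y\<bar>) x)
     \<le> 2 * (B + 3 * V * psi_total) * (B * real (card G))"
    by (intro mult_left_mono) (use fD psi_total_nonneg in auto)
  with second_moment_bound[OF assms, of x] show ?thesis by (simp add: mult.assoc)
qed

definition corr :: "(real \<Rightarrow> real) \<Rightarrow> nat \<Rightarrow> real" where
  "corr f k = (LINT u|unif. f u * T k f u)"

definition asymp_var :: "(real \<Rightarrow> real) \<Rightarrow> real" where
  "asymp_var f = corr f 0 + 2 * (\<Sum>k. corr f (Suc k))"

text \<open>The variance of a sum of \<open>L\<close> consecutive values is taken for a uniform starting point: the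
  walk is then stationary, and only the distances between the times matter.\<close>

definition stat_var :: "(real \<Rightarrow> real) \<Rightarrow> nat \<Rightarrow> real" where
  "stat_var f L = (LINT u|unif. LINT \<omega>|M. (\<Sum>k=1..L. f (u + S k \<omega>))\<^sup>2)"

lemma unif_integrable:
  fixes h :: "real \<Rightarrow> 'b::{real_normed_field, banach, second_countable_topology}"
  assumes h: "bounded_borel h" shows "integrable unif h"
proof -
  interpret U: prob_space unif by (rule prob_space_unif)
  note [measurable] = bounded_borel_measurable[OF h]
  obtain B where B: "0 \<le> B" "\<And>x. norm (h x) \<le> B" using bounded_borel_bound[OF h] by blast
  show ?thesis by (rule U.integrable_const_bound[where B=B]) (use B in auto)
qed

lemma unif_integral_le:
  fixes h :: "real \<Rightarrow> real"
  assumes h: "bounded_borel h" and "\<And>x. \<bar>h x\<bar> \<le> B" shows "\<bar>LINT u|unif. h u\<bar> \<le> B"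
proof -
  interpret U: prob_space unif by (rule prob_space_unif)
  have "\<bar>LINT u|unif. h u\<bar> \<le> (LINT u|unif. \<bar>h u\<bar>)" by (rule integral_abs_bound)
  also have "\<dots> \<le> (LINT u|unif. B)"
    by (rule integral_mono) (use assms unif_integrable[OF h] in auto)
  finally show ?thesis using U.prob_space by simp
qed

lemma corr_bound: assumes f: "centered_bv V B f" shows "\<bar>corr f k\<bar> \<le> B * (3 * V * \<psi> k)"
  unfolding corr_def
  by (rule unif_integral_le)
     (auto simp: abs_mult intro!: mult_mono T_centered[OF f] bounded_borel_mult bounded_borel_T centered_bvD[OF f])

lemma summable_corr: assumes f: "centered_bv V B f" shows "summable (\<lambda>k. corr f (Suc k))"
proof (rule summable_comparison_test_ev[OF always_eventually])
  show "summable (\<lambda>k. B * (3 * V * \<psi> (Suc k)))" by (intro summable_mult summable_psi)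
qed (use corr_bound[OF f] in auto)

lemma stationary_pair:
  assumes f: "centered_bv V B f" and "1 \<le> j" "j \<le> k"
  shows "(LINT u|unif. LINT \<omega>|M. f (u + S j \<omega>) * f (u + S k \<omega>)) = corr f (k - j)"
proof -
  note fD = centered_bvD[OF f]
  have "periodic1 (\<lambda>y. f y * T (k - j) f y)"
    using fD(2) periodic1_T[OF fD(2)] unfolding periodic1_def by simp
  then show ?thesis
    unfolding expectation_two_times[OF fD(6) fD(6) assms(2,3)] corr_def
    by (intro integral_unif_T bounded_borel_mult bounded_borel_T fD)
qed

lemma bounded_borel_pair:
  fixes f :: "real \<Rightarrow> real"
  assumes f: "bounded_borel f" shows "bounded_borel (\<lambda>u. LINT \<omega>|M. f (u + S j \<omega>) * f (u + S k \<omega>))"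
proof -
  note [measurable] = bounded_borel_measurable[OF f]
  obtain B where B: "0 \<le> B" "\<And>x. norm (f x) \<le> B" using bounded_borel_bound[OF f] by blast
  show ?thesis
  proof (rule bounded_borelI)
    show "norm (LINT \<omega>|M. f (u + S j \<omega>) * f (u + S k \<omega>)) \<le> B * B" for u
      by (rule norm_integral_le) (use B in \<open>auto simp: abs_mult norm_mult intro!: mult_mono\<close>)
  qed measurable
qed

lemma square_integral_expand:
  assumes f: "bounded_borel f"
  shows "(LINT \<omega>|M. (\<Sum>k\<in>G. f (u + S k \<omega>))\<^sup>2) = (\<Sum>j\<in>G. \<Sum>k\<in>G. LINT \<omega>|M. f (u + S j \<omega>) * f (u + S k \<omega>))"
proof -
  note [measurable] = bounded_borel_measurable[OF f]
  obtain B where B: "0 \<le> B" "\<And>x. norm (f x) \<le> B" using bounded_borel_bound[OF f] by blast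
  have int: "integrable M (\<lambda>\<omega>. f (u + S j \<omega>) * f (u + S k \<omega>))" for j k
    by (rule integrable_const_bound[where B="B * B"])
      (use B in \<open>auto simp: abs_mult norm_mult intro!: mult_mono AE_I2\<close>)
  show ?thesis
    unfolding power2_eq_square sum_product
    by (subst Bochner_Integration.integral_sum, (auto intro!: Bochner_Integration.integrable_sum int)[1],
        intro sum.cong refl, subst Bochner_Integration.integral_sum, (auto intro!: int))
qed

text \<open>Adding one term adds its correlations with all the previous ones.  The quotient by \<open>L\<close> is thus a
  Cesaro mean of partial sums of a convergent series.\<close>

lemma stat_var_Suc:
  assumes f: "centered_bv V B f"
  shows "stat_var f (Suc L) = stat_var f L + (corr f 0 + 2 * (\<Sum>k<L. corr f (Suc k)))"
proof -
  note fD = centered_bvD[OF f]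
  define E where "E j k = (LINT u|unif. LINT \<omega>|M. f (u + S j \<omega>) * f (u + S k \<omega>))" for j k
  have sym: "E j k = E k j" for j k unfolding E_def by (simp add: mult.commute)
  have sv: "stat_var f L = (\<Sum>j=1..L. \<Sum>k=1..L. E j k)" for L
    unfolding stat_var_def E_def square_integral_expand[OF fD(6)]
    by (subst Bochner_Integration.integral_sum,
        (intro Bochner_Integration.integrable_sum unif_integrable bounded_borel_pair fD),
        intro sum.cong refl, subst Bochner_Integration.integral_sum,
        (intro unif_integrable bounded_borel_pair fD), rule refl)
  have "(\<Sum>j=1..L. E j (Suc L)) = (\<Sum>j=1..L. corr f (Suc L - j))"
    unfolding E_def by (intro sum.cong refl stationary_pair[OF f]) auto
  also have "\<dots> = (\<Sum>k<L. corr f (Suc k))"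
    by (rule sum.reindex_bij_witness[where i="\<lambda>k. L - k" and j="\<lambda>j. L - j"]) (auto simp: Suc_diff_le)
  finally have 1: "(\<Sum>j=1..L. E j (Suc L)) = (\<Sum>k<L. corr f (Suc k))" .
  have 2: "E (Suc L) (Suc L) = corr f 0" unfolding E_def using stationary_pair[OF f, of "Suc L" "Suc L"] by simp
  have "stat_var f (Suc L) = stat_var f L + (\<Sum>j=1..L. E j (Suc L)) + (\<Sum>k=1..L. E (Suc L) k) + E (Suc L) (Suc L)"
    unfolding sv by (simp add: sum.distrib)
  also have "(\<Sum>k=1..L. E (Suc L) k) = (\<Sum>j=1..L. E j (Suc L))" using sym by (intro sum.cong refl)
  finally show ?thesis using 1 2 by simp
qed

lemma stat_var_asymp:
  assumes f: "centered_bv V B f"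
  shows "(\<lambda>L. stat_var f L / real L) \<longlonglongrightarrow> asymp_var f"
proof -
  have "stat_var f L = (\<Sum>i<L. corr f 0 + 2 * (\<Sum>k<i. corr f (Suc k)))" for L
  proof (induction L)
    case 0 show ?case by (simp add: stat_var_def)
  next
    case (Suc L) then show ?case using stat_var_Suc[OF f, of L] by simp
  qed
  moreover have "(\<lambda>i. corr f 0 + 2 * (\<Sum>k<i. corr f (Suc k))) \<longlonglongrightarrow> asymp_var f"
    unfolding asymp_var_def by (intro tendsto_intros summable_LIMSEQ summable_corr[OF f])
  ultimately show ?thesis using cesaro_mean by simp
qed

lemma stat_var_nonneg: "0 \<le> stat_var f L"
  unfolding stat_var_def by (intro integral_nonneg_AE AE_I2) auto

lemma stat_var_linear:
  assumes f: "centered_bv V B f"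
  shows "stat_var f L \<le> 2 * (B + 3 * V * psi_total) * B * real L"
proof -
  note fD = centered_bvD[OF f]
  interpret U: prob_space unif by (rule prob_space_unif)
  have "stat_var f L \<le> (LINT u|unif. 2 * (B + 3 * V * psi_total) * B * real L)"
    unfolding stat_var_def
  proof (rule integral_mono)
    show "integrable unif (\<lambda>u. LINT \<omega>|M. (\<Sum>k=1..L. f (u + S k \<omega>))\<^sup>2)"
      unfolding square_integral_expand[OF fD(6)]
      by (intro unif_integrable bounded_borel_sum bounded_borel_pair fD)
    show "(LINT \<omega>|M. (\<Sum>k=1..L. f (u + S k \<omega>))\<^sup>2) \<le> 2 * (B + 3 * V * psi_total) * B * real L" for u
      using second_moment_linear[OF f, of "{1..L}" u] by simp
  qed simp
  then show ?thesis using U.prob_space by simp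
qed

text \<open>For a uniform starting point the mean of the block sum vanishes, so its characteristic function
  agrees with the normal one up to the errors of the second order expansions of both
  exponentials.\<close>

lemma block_char:
  assumes f: "centered_bv V B f"
  shows "cmod ((LINT u|unif. W (\<lambda>_ x. iexp (\<theta> * f x)) L (\<lambda>_. 1) u) - exp (- (\<theta>\<^sup>2 * stat_var f L / 2)))
    \<le> \<bar>\<theta>\<bar> ^ 3 * (real L * B) * stat_var f L / 6 + (\<theta>\<^sup>2 * stat_var f L / 2)\<^sup>2"
proof -
  note fD = centered_bvD[OF f]
  note [measurable] = fD(1)
  interpret U: prob_space unif by (rule prob_space_unif)
  define Y where "Y u \<omega> = (\<Sum>k=1..L. f (u + S k \<omega>))" for u \<omega>
  define w where "w u = W (\<lambda>_ x. iexp (\<theta> * f x)) L (\<lambda>_. 1) u" for u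
  define m where "m u = (LINT \<omega>|M. Y u \<omega>)" for u
  define q where "q u = (LINT \<omega>|M. (Y u \<omega>)\<^sup>2)" for u
  have [measurable]: "(\<lambda>\<omega>. Y u \<omega>) \<in> borel_measurable M" for u unfolding Y_def by measurable
  have YB: "\<bar>Y u \<omega>\<bar> \<le> real L * B" for u \<omega>
    unfolding Y_def using sum_bounded_above[of "{1..L}" "\<lambda>k. \<bar>f (u + S k \<omega>)\<bar>" B] fD(4)
    by (intro order_trans[OF sum_abs]) simp
  have LB: "0 \<le> real L * B" using fD(7) by simp
  have intY: "integrable M (Y u)" for u
    by (rule integrable_const_bound[where B="real L * B"]) (use YB in auto)
  have intY2: "integrable M (\<lambda>\<omega>. (Y u \<omega>)\<^sup>2)" for u
    by (rule integrable_const_bound[where B="(real L * B)\<^sup>2"])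
      (use YB LB in \<open>auto intro!: AE_I2 simp: abs_le_square_iff[symmetric]\<close>)
  have wY: "w u = (LINT \<omega>|M. iexp (\<theta> * Y u \<omega>))" for u
    unfolding w_def W_def Y_def by (simp add: sum_distrib_left exp_sum)
  have bw: "bounded_borel w" unfolding w_def
  proof (rule bounded_borel_W)
    show "bounded_borel (\<lambda>x. iexp (\<theta> * f x))" by (rule bounded_borelI[where B=1]) auto
  qed simp
  have m_eq: "m u = (\<Sum>k=1..L. T k f u)" for u
    unfolding m_def Y_def T_def by (rule Bochner_Integration.integral_sum) (rule integrable_comp_S[OF fD(6)])
  have bm: "bounded_borel m" unfolding m_eq by (intro bounded_borel_sum bounded_borel_T fD)
  have "(LINT u|unif. m u) = (\<Sum>k=1..L. LINT u|unif. T k f u)"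
    unfolding m_eq by (rule Bochner_Integration.integral_sum) (intro unif_integrable bounded_borel_T fD)
  also have "\<dots> = 0" using integral_unif_T[OF fD(6) fD(2)] fD(5) by simp
  finally have m0: "(LINT u|unif. m u) = 0" .
  have bq: "bounded_borel q" unfolding q_def Y_def square_integral_expand[OF fD(6)]
    by (intro bounded_borel_sum bounded_borel_pair fD)
  have q: "(LINT u|unif. q u) = stat_var f L" unfolding q_def Y_def stat_var_def ..
  have pt: "cmod (w u - (1 + \<i> * \<theta> * m u - \<theta>\<^sup>2 * q u / 2)) \<le> \<bar>\<theta>\<bar> ^ 3 * (real L * B) * q u / 6" for u
  proof -
    have ie: "integrable M (\<lambda>\<omega>. iexp (\<theta> * Y u \<omega>))"
      by (rule integrable_const_bound[where B=1]) auto
    have *: "integrable M (\<lambda>\<omega>. 1 + \<i> * complex_of_real (\<theta> * Y u \<omega>) - complex_of_real ((\<theta> * Y u \<omega>)\<^sup>2) / 2)"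
      by (intro Bochner_Integration.integrable_diff Bochner_Integration.integrable_add
          integrable_divide integrable_mult_right integrable_of_real)
        (auto simp: power_mult_distrib intY intY2)
    have "1 + \<i> * \<theta> * m u - \<theta>\<^sup>2 * q u / 2 = (LINT \<omega>|M. 1 + \<i> * complex_of_real (\<theta> * Y u \<omega>) - complex_of_real ((\<theta> * Y u \<omega>)\<^sup>2) / 2)"
    proof (rule complex_eqI)
      have "Re (LINT \<omega>|M. 1 + \<i> * complex_of_real (\<theta> * Y u \<omega>) - complex_of_real ((\<theta> * Y u \<omega>)\<^sup>2) / 2)
         = (LINT \<omega>|M. 1 - (\<theta> * Y u \<omega>)\<^sup>2 / 2)"
        by (subst integral_Re[OF *, symmetric]) (simp del: of_real_mult of_real_power)
      then show "Re (1 + \<i> * \<theta> * m u - \<theta>\<^sup>2 * q u / 2) = Re (LINT \<omega>|M. 1 + \<i> * complex_of_real (\<theta> * Y u \<omega>) - complex_of_real ((\<theta> * Y u \<omega>)\<^sup>2) / 2)"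
        using intY2 by (simp add: q_def power_mult_distrib prob_space flip: of_real_mult of_real_power)
      have "Im (LINT \<omega>|M. 1 + \<i> * complex_of_real (\<theta> * Y u \<omega>) - complex_of_real ((\<theta> * Y u \<omega>)\<^sup>2) / 2)
         = (LINT \<omega>|M. \<theta> * Y u \<omega>)"
        by (subst integral_Im[OF *, symmetric]) (simp del: of_real_mult of_real_power)
      then show "Im (1 + \<i> * \<theta> * m u - \<theta>\<^sup>2 * q u / 2) = Im (LINT \<omega>|M. 1 + \<i> * complex_of_real (\<theta> * Y u \<omega>) - complex_of_real ((\<theta> * Y u \<omega>)\<^sup>2) / 2)"
        using intY by (simp add: m_def mult.assoc flip: of_real_mult of_real_power)
    qed
    then have "w u - (1 + \<i> * \<theta> * m u - \<theta>\<^sup>2 * q u / 2)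
       = (LINT \<omega>|M. iexp (\<theta> * Y u \<omega>) - (1 + \<i> * complex_of_real (\<theta> * Y u \<omega>) - complex_of_real ((\<theta> * Y u \<omega>)\<^sup>2) / 2))"
      unfolding wY using Bochner_Integration.integral_diff[OF ie *] by simp
    also have "cmod \<dots> \<le> (LINT \<omega>|M. cmod (iexp (\<theta> * Y u \<omega>) - (1 + \<i> * complex_of_real (\<theta> * Y u \<omega>) - complex_of_real ((\<theta> * Y u \<omega>)\<^sup>2) / 2)))"
      by (rule integral_norm_bound)
    also have "\<dots> \<le> (LINT \<omega>|M. \<bar>\<theta>\<bar> ^ 3 * (real L * B) / 6 * (Y u \<omega>)\<^sup>2)"
    proof (rule integral_mono)
      show "integrable M (\<lambda>\<omega>. cmod (iexp (\<theta> * Y u \<omega>) - (1 + \<i> * complex_of_real (\<theta> * Y u \<omega>) - complex_of_real ((\<theta> * Y u \<omega>)\<^sup>2) / 2)))"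
        by (intro integrable_norm Bochner_Integration.integrable_diff ie *)
      show "integrable M (\<lambda>\<omega>. \<bar>\<theta>\<bar> ^ 3 * (real L * B) / 6 * (Y u \<omega>)\<^sup>2)"
        by (intro integrable_mult_right intY2)
      fix \<omega>
      have "cmod (iexp (\<theta> * Y u \<omega>) - (1 + \<i> * complex_of_real (\<theta> * Y u \<omega>) - complex_of_real ((\<theta> * Y u \<omega>)\<^sup>2) / 2)) \<le> \<bar>\<theta> * Y u \<omega>\<bar> ^ 3 / 6"
        using iexp_quadratic[of "\<theta> * Y u \<omega>"] by simp
      also have "\<dots> = \<bar>\<theta>\<bar> ^ 3 / 6 * (\<bar>Y u \<omega>\<bar> * (Y u \<omega>)\<^sup>2)"
        by (simp add: abs_mult power_mult_distrib power3_eq_cube power2_eq_square flip: abs_mult)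
      also have "\<dots> \<le> \<bar>\<theta>\<bar> ^ 3 / 6 * ((real L * B) * (Y u \<omega>)\<^sup>2)"
        by (intro mult_left_mono mult_right_mono YB) auto
      finally show "cmod (iexp (\<theta> * Y u \<omega>) - (1 + \<i> * complex_of_real (\<theta> * Y u \<omega>) - complex_of_real ((\<theta> * Y u \<omega>)\<^sup>2) / 2)) \<le> \<bar>\<theta>\<bar> ^ 3 * (real L * B) / 6 * (Y u \<omega>)\<^sup>2"
        by (simp add: mult_ac)
    qed
    finally show ?thesis by (simp add: q_def)
  qed
  define y where "y = \<theta>\<^sup>2 * stat_var f L / 2"
  have *: "integrable unif (\<lambda>u. 1 + \<i> * \<theta> * m u - \<theta>\<^sup>2 * q u / 2)"
    using unif_integrable[OF bm] unif_integrable[OF bq] by auto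
  have "(LINT u|unif. w u) - (1 - y) = (LINT u|unif. w u - (1 + \<i> * \<theta> * m u - \<theta>\<^sup>2 * q u / 2))"
    using Bochner_Integration.integral_diff[OF unif_integrable[OF bw] *] unif_integrable[OF bm] unif_integrable[OF bq]
    by (simp add: m0 q y_def U.prob_space[simplified])
  also have "cmod \<dots> \<le> (LINT u|unif. cmod (w u - (1 + \<i> * \<theta> * m u - \<theta>\<^sup>2 * q u / 2)))"
    by (rule integral_norm_bound)
  also have "\<dots> \<le> (LINT u|unif. \<bar>\<theta>\<bar> ^ 3 * (real L * B) / 6 * q u)"
  proof (rule integral_mono)
    show "integrable unif (\<lambda>u. cmod (w u - (1 + \<i> * \<theta> * m u - \<theta>\<^sup>2 * q u / 2)))"
      by (intro integrable_norm Bochner_Integration.integrable_diff unif_integrable bw *)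
    show "integrable unif (\<lambda>u. \<bar>\<theta>\<bar> ^ 3 * (real L * B) / 6 * q u)"
      by (intro integrable_mult_right unif_integrable bq)
  qed (use pt in \<open>simp add: mult_ac\<close>)
  also have "\<dots> = \<bar>\<theta>\<bar> ^ 3 * (real L * B) * stat_var f L / 6" by (simp add: q)
  finally have 1: "cmod ((LINT u|unif. w u) - (1 - y)) \<le> \<bar>\<theta>\<bar> ^ 3 * (real L * B) * stat_var f L / 6" .
  have "0 \<le> y" unfolding y_def using stat_var_nonneg by simp
  then have "\<bar>exp (- y) - (1 - y)\<bar> \<le> y\<^sup>2" by (rule exp_minus_approx)
  then have 2: "cmod (complex_of_real (1 - y) - complex_of_real (exp (- y))) \<le> y\<^sup>2"
    by (simp only: norm_of_real abs_minus_commute flip: of_real_diff)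
  have "cmod ((LINT u|unif. w u) - exp (- y)) \<le> cmod ((LINT u|unif. w u) - (1 - y)) + cmod (complex_of_real (1 - y) - complex_of_real (exp (- y)))"
    by (rule order_trans[OF _ norm_triangle_ineq]) simp
  with 1 2 show ?thesis unfolding w_def y_def by linarith
qed

text \<open>The blocking argument: in each period of length \<open>g + L\<close> the first \<open>g\<close> steps are a gap,
  after which the position is nearly uniform, whatever happened before.  Hence the characteristic
  function of the sum over the blocks is nearly the power \<open>a ^ n\<close> of that of one stationary block.\<close>

lemma blocks_char:
  assumes f: "centered_bv V B f" and L: "1 \<le> L"
  shows "cmod (W (\<lambda>k x. if g \<le> (k - 1) mod (g + L) then iexp (\<theta> * f x) else 1) (n * (g + L)) (\<lambda>_. 1) x
      - (LINT u|unif. W (\<lambda>_ x. iexp (\<theta> * f x)) L (\<lambda>_. 1) u) ^ n)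
    \<le> real n * (6 * (real L * (\<bar>\<theta>\<bar> * V)) * \<psi> g)"
proof -
  note fD = centered_bvD[OF f]
  note [measurable] = fD(1)
  define e where "e x = iexp (\<theta> * f x)" for x
  define p where "p = g + L"
  define \<phi> where "\<phi> k = (if g \<le> (k - 1) mod p then e else (\<lambda>_. 1))" for k
  define H where "H = W (\<lambda>_. e) L (\<lambda>_. 1)"
  define a where "a = (LINT u|unif. H u)"
  define \<epsilon> where "\<epsilon> = 6 * (real L * (\<bar>\<theta>\<bar> * V)) * \<psi> g"
  have eb: "bounded_borel e" unfolding e_def by (rule bounded_borelI[where B=1]) auto
  have e1: "norm (e x) \<le> 1" for x by (simp add: e_def)
  have ep: "periodic1 e" using fD(2) unfolding periodic1_def e_def by simp
  have ev: "circ_bv (\<bar>\<theta>\<bar> * V) e" unfolding e_def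
  proof (rule circ_bv_lipschitz[OF fD(3)])
    fix x y
    show "cmod (iexp (\<theta> * f y) - iexp (\<theta> * f x)) \<le> \<bar>\<theta>\<bar> * norm (f y - f x)"
      using iexp_lipschitz[of "\<theta> * f y" "\<theta> * f x"] by (simp add: abs_mult flip: right_diff_distrib)
  qed simp
  have \<phi>b: "bounded_borel (\<phi> k)" for k unfolding \<phi>_def using eb by simp
  have \<phi>1: "norm (\<phi> k x) \<le> 1" for k x unfolding \<phi>_def using e1 by simp
  have Hb: "bounded_borel H" unfolding H_def by (intro bounded_borel_W eb) simp
  have Hp: "periodic1 H" unfolding H_def by (intro periodic1_W ep) (simp add: periodic1_def)
  have "circ_bv (0 + real L * (\<bar>\<theta>\<bar> * V)) H" unfolding H_def
    by (rule circ_bv_W) (use eb ep e1 ev circ_bv_const in \<open>auto simp: periodic1_def\<close>)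
  then have Hv: "circ_bv (real L * (\<bar>\<theta>\<bar> * V)) H" by simp
  have W1: "norm (W \<phi>' m h x) \<le> c" if "\<And>x. norm (h x) \<le> c" "\<And>k x. norm (\<phi>' k x) \<le> 1"
    for \<phi>' :: "nat \<Rightarrow> real \<Rightarrow> complex" and m h c x
    unfolding W_def
  proof (rule norm_integral_le)
    fix \<omega>
    have "norm ((\<Prod>k = 1..m. \<phi>' k (x + S k \<omega>)) * h (x + S m \<omega>)) \<le> 1 * c"
      unfolding norm_mult prod_norm[symmetric]
      by (intro mult_mono prod_le_1) (use that in auto)
    then show "norm ((\<Prod>k = 1..m. \<phi>' k (x + S k \<omega>)) * h (x + S m \<omega>)) \<le> c" by simp
  qed
  have a1: "norm a \<le> 1"
  proof -
    interpret U: prob_space unif by (rule prob_space_unif)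
    have "norm a \<le> (LINT u|unif. norm (H u))" unfolding a_def by (rule integral_norm_bound)
    also have "\<dots> \<le> (LINT u|unif. 1)"
      using unif_integrable[OF Hb] W1[of "\<lambda>_. 1" 1 "\<lambda>_. e" L] e1
      by (intro integral_mono) (auto simp: H_def)
    finally show ?thesis using U.prob_space by simp
  qed
  have period: "W \<phi> p (\<lambda>_. 1) x = T g H x" for x
  proof -
    have "W \<phi> p (\<lambda>_. 1) x = W \<phi> g (W (\<lambda>k. \<phi> (k + g)) L (\<lambda>_. 1)) x"
      unfolding p_def by (rule W_add[OF \<phi>b]) simp
    also have "W (\<lambda>k. \<phi> (k + g)) L (\<lambda>_. 1) = H"
      unfolding H_def
    proof (rule W_cong)
      fix k assume "1 \<le> k" "k \<le> L"
      then have "(k + g - 1) mod p = k + g - 1" unfolding p_def by (intro mod_less) simp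
      moreover have "g \<le> k + g - 1" using \<open>1 \<le> k\<close> by simp
      ultimately show "\<phi> (k + g) = e" unfolding \<phi>_def by simp
    qed
    also have "W \<phi> g H = W (\<lambda>_ _. 1) g H"
    proof (rule W_cong)
      fix k assume "1 \<le> k" "k \<le> g"
      then have "(k - 1) mod p = k - 1" "k - 1 < g" unfolding p_def by (auto intro!: mod_less)
      then show "\<phi> k = (\<lambda>_. 1)" by (simp add: \<phi>_def)
    qed
    finally show ?thesis by (simp add: W_one)
  qed
  have one: "norm (W \<phi> p (\<lambda>_. 1) x - a) \<le> \<epsilon>" for x
    unfolding period a_def \<epsilon>_def by (rule T_equidistributes_complex[OF Hb Hp Hv])
  have "norm (W \<phi> (n * p) (\<lambda>_. 1) x - a ^ n) \<le> real n * \<epsilon>" for x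
  proof (induction n)
    case 0 then show ?case by (simp add: W_0)
  next
    case (Suc n)
    let ?h = "\<lambda>y. W \<phi> p (\<lambda>_. 1) y - a"
    have bp: "bounded_borel (W \<phi> p (\<lambda>_. 1))" by (intro bounded_borel_W \<phi>b) simp
    have bh: "bounded_borel ?h" using bounded_borel_add[OF bp, of "\<lambda>_. - a"] by simp
    have "W \<phi> (Suc n * p) (\<lambda>_. 1) x = W \<phi> (n * p + p) (\<lambda>_. 1) x" by (simp add: add.commute)
    also have "\<dots> = W \<phi> (n * p) (W (\<lambda>k. \<phi> (k + n * p)) p (\<lambda>_. 1)) x"
      by (rule W_add[OF \<phi>b]) simp
    also have "W (\<lambda>k. \<phi> (k + n * p)) p (\<lambda>_. 1) = W \<phi> p (\<lambda>_. 1)"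
    proof (rule W_cong)
      fix k assume "1 \<le> k" "k \<le> p"
      then have "(k + n * p - 1) mod p = (k - 1) mod p"
        using mod_mult_self1[of "k - 1" n p] by (simp add: add.commute)
      then show "\<phi> (k + n * p) = \<phi> k" by (simp add: \<phi>_def)
    qed
    also have "W \<phi> (n * p) (W \<phi> p (\<lambda>_. 1)) x = W \<phi> (n * p) ?h x + a * W \<phi> (n * p) (\<lambda>_. 1) x"
      using integrable_W[where \<phi>=\<phi> and h="?h" and N="n * p" and x=x, OF \<phi>b bh]
        integrable_W[where \<phi>=\<phi> and h="\<lambda>_. 1" and N="n * p" and x=x, OF \<phi>b]
      unfolding W_def[of _ "n * p"]
      by (subst integral_mult_right_zero[symmetric], subst Bochner_Integration.integral_add[symmetric])
        (auto simp: algebra_simps)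
    finally have "W \<phi> (Suc n * p) (\<lambda>_. 1) x - a ^ Suc n = W \<phi> (n * p) ?h x + a * (W \<phi> (n * p) (\<lambda>_. 1) x - a ^ n)"
      by (simp add: algebra_simps)
    also have "norm \<dots> \<le> norm (W \<phi> (n * p) ?h x) + norm a * norm (W \<phi> (n * p) (\<lambda>_. 1) x - a ^ n)"
      by (rule order_trans[OF norm_triangle_ineq]) (simp add: norm_mult)
    also have "norm (W \<phi> (n * p) ?h x) \<le> \<epsilon>" by (rule W1[OF one \<phi>1])
    also have "norm a * norm (W \<phi> (n * p) (\<lambda>_. 1) x - a ^ n) \<le> 1 * (real n * \<epsilon>)"
      by (intro mult_mono a1 Suc.IH) auto
    finally show ?case by (simp add: algebra_simps)
  qed
  moreover have "(\<lambda>k x. if g \<le> (k - 1) mod (g + L) then iexp (\<theta> * f x) else 1) = \<phi>"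
    unfolding \<phi>_def p_def e_def by (auto simp: fun_eq_iff)
  ultimately show ?thesis unfolding a_def H_def \<epsilon>_def p_def e_def by simp
qed

lemma card_gap_indices:
  assumes p: "p = g + L" "0 < p"
  shows "card {k\<in>{1..N}. \<not> (g \<le> (k - 1) mod p \<and> k \<le> (N div p) * p)} \<le> (N div p) * g + p"
proof -
  let ?n = "N div p"
  have "{k\<in>{1..N}. \<not> (g \<le> (k - 1) mod p \<and> k \<le> ?n * p)}
      \<subseteq> (\<lambda>(i, r). Suc (i * p + r)) ` ({..<?n} \<times> {..<g}) \<union> {?n * p<..N}"
  proof
    fix k assume k: "k \<in> {k\<in>{1..N}. \<not> (g \<le> (k - 1) mod p \<and> k \<le> ?n * p)}"
    show "k \<in> (\<lambda>(i, r). Suc (i * p + r)) ` ({..<?n} \<times> {..<g}) \<union> {?n * p<..N}"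
    proof (cases "k \<le> ?n * p")
      case True
      with k have "1 \<le> k" "(k - 1) mod p < g" by auto
      moreover have "(k - 1) div p < ?n" using True \<open>1 \<le> k\<close> p by (simp add: less_mult_imp_div_less)
      moreover have "k = Suc ((k - 1) div p * p + (k - 1) mod p)" using \<open>1 \<le> k\<close> by simp
      ultimately show ?thesis by (intro UnI1 image_eqI[of _ _ "((k - 1) div p, (k - 1) mod p)"]) auto
    qed (use k in auto)
  qed
  then have "card {k\<in>{1..N}. \<not> (g \<le> (k - 1) mod p \<and> k \<le> ?n * p)}
      \<le> card ((\<lambda>(i, r). Suc (i * p + r)) ` ({..<?n} \<times> {..<g}) \<union> {?n * p<..N})"
    by (intro card_mono) auto
  also have "\<dots> \<le> card ((\<lambda>(i, r). Suc (i * p + r)) ` ({..<?n} \<times> {..<g})) + card {?n * p<..N}"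
    by (rule card_Un_le)
  also have "card ((\<lambda>(i, r). Suc (i * p + r)) ` ({..<?n} \<times> {..<g})) \<le> card ({..<?n} \<times> {..<g})"
    by (intro card_image_le) auto
  also have "card ({..<?n} \<times> {..<g}) = ?n * g" by simp
  also have "card {?n * p<..N} \<le> p"
  proof -
    have "N - ?n * p = N mod p" by (simp add: minus_div_mult_eq_mod)
    also have "\<dots> \<le> p" using p by (simp add: less_imp_le)
    finally show ?thesis by simp
  qed
  finally show ?thesis by simp
qed

text \<open>The three error terms: the terms of the sum outside the blocks are negligible in mean square;
  the blocks are nearly independent; each block is nearly normal.\<close>

lemma char_block_estimate:
  fixes N g :: nat
  assumes f: "centered_bv V B f" and L: "1 \<le> L"
  defines "n \<equiv> N div (g + L)"
  shows "cmod ((LINT \<omega>|M. iexp (\<theta> * (\<Sum>k=1..N. f (S k \<omega>)))) - exp (- (\<theta>\<^sup>2 * stat_var f L / 2)) ^ n)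
    \<le> \<bar>\<theta>\<bar> * sqrt (2 * (B + 3 * V * psi_total) * B * (real n * real g + real (g + L)))
      + real n * (6 * (real L * (\<bar>\<theta>\<bar> * V)) * \<psi> g)
      + real n * (\<bar>\<theta>\<bar> ^ 3 * (real L * B) * stat_var f L / 6 + (\<theta>\<^sup>2 * stat_var f L / 2)\<^sup>2)"
proof -
  note fD = centered_bvD[OF f]
  note [measurable] = fD(1)
  define p where "p = g + L"
  have p: "0 < p" "p = g + L" using L by (auto simp: p_def)
  define K where "K = 2 * (B + 3 * V * psi_total) * B"
  have K: "0 \<le> K" unfolding K_def using fD(7,8) psi_total_nonneg by simp
  define big where "big k \<longleftrightarrow> g \<le> (k - 1) mod p" for k
  define R where "R = {k\<in>{1..N}. \<not> (g \<le> (k - 1) mod p \<and> k \<le> n * p)}"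
  define \<phi> where "\<phi> k x = (if g \<le> (k - 1) mod p then iexp (\<theta> * f x) else 1)" for k x
  define a where "a = (LINT u|unif. W (\<lambda>_ x. iexp (\<theta> * f x)) L (\<lambda>_. 1) u)"
  have np: "n * p \<le> N" unfolding n_def p_def by (simp add: div_times_less_eq_dividend)
  have decomp: "(\<Sum>k=1..N. f (S k \<omega>)) = (\<Sum>k=1..n*p. if big k then f (S k \<omega>) else 0) + (\<Sum>k\<in>R. f (S k \<omega>))" for \<omega>
  proof -
    define A where "A = {k\<in>{1..N}. big k \<and> k \<le> n * p}"
    have A: "finite A" "finite R" "A \<inter> R = {}" "{1..N} = A \<union> R" by (auto simp: A_def R_def big_def)
    have "(\<Sum>k=1..n*p. if big k then f (S k \<omega>) else 0) = (\<Sum>k\<in>{k\<in>{1..n*p}. big k}. f (S k \<omega>))"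
      by (subst sum.inter_filter) auto
    also have "{k\<in>{1..n*p}. big k} = A" using np by (auto simp: A_def)
    finally show ?thesis unfolding A(4) using sum.union_disjoint[OF A(1-3)] by simp
  qed
  have Wbig: "(LINT \<omega>|M. iexp (\<theta> * (\<Sum>k=1..n*p. if big k then f (S k \<omega>) else 0))) = W \<phi> (n * p) (\<lambda>_. 1) 0"
  proof -
    have "iexp (\<theta> * (\<Sum>k=1..n*p. if big k then f (S k \<omega>) else 0)) = (\<Prod>k=1..n*p. \<phi> k (0 + S k \<omega>))" for \<omega>
      unfolding of_real_mult of_real_sum sum_distrib_left
      by (subst exp_sum) (auto intro!: prod.cong simp: \<phi>_def big_def)
    then show ?thesis unfolding W_def by simp
  qed
  have Rf: "finite R" "0 \<notin> R" by (auto simp: R_def)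
  have cardR: "real (card R) \<le> real n * real g + real (g + L)"
    using card_gap_indices[OF p(2,1), of N] unfolding R_def n_def p_def[symmetric]
    by (metis (mono_tags, lifting) of_nat_add of_nat_le_iff of_nat_mult)
  define Y where "Y \<omega> = (\<Sum>k\<in>R. f (S k \<omega>))" for \<omega>
  have Ym[measurable]: "Y \<in> borel_measurable M" unfolding Y_def by measurable
  have YB: "\<bar>Y \<omega>\<bar> \<le> real (card R) * B" for \<omega>
    unfolding Y_def using sum_bounded_above[of R "\<lambda>k. \<bar>f (S k \<omega>)\<bar>" B] fD(4)
    by (intro order_trans[OF sum_abs]) simp
  have RB: "0 \<le> real (card R) * B" using fD(7) by simp
  have intY: "integrable M Y"
    by (rule integrable_const_bound[where B="real (card R) * B"]) (use YB in auto)
  have intY2: "integrable M (\<lambda>\<omega>. (Y \<omega>)\<^sup>2)"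
    by (rule integrable_const_bound[where B="(real (card R) * B)\<^sup>2"])
      (use YB RB in \<open>auto intro!: AE_I2 simp: abs_le_square_iff[symmetric]\<close>)
  have EY: "(LINT \<omega>|M. \<bar>Y \<omega>\<bar>) \<le> sqrt (K * (real n * real g + real (g + L)))"
  proof (rule real_le_rsqrt)
    have "(LINT \<omega>|M. \<bar>Y \<omega>\<bar>)\<^sup>2 \<le> (LINT \<omega>|M. \<bar>Y \<omega>\<bar>\<^sup>2)"
      by (rule jensens_inequality[where I=UNIV]) (use intY intY2 convex_power2 in auto)
    also have "\<dots> \<le> K * real (card R)"
      using second_moment_linear[OF f Rf, of 0] by (simp add: Y_def K_def)
    also have "\<dots> \<le> K * (real n * real g + real (g + L))" by (intro mult_left_mono cardR K)
    finally show "(LINT \<omega>|M. \<bar>Y \<omega>\<bar>)\<^sup>2 \<le> K * (real n * real g + real (g + L))" .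
  qed
  let ?Z = "\<lambda>\<omega>. \<Sum>k=1..n*p. if big k then f (S k \<omega>) else 0"
  have i1: "integrable M (\<lambda>\<omega>. iexp (\<theta> * (\<Sum>k=1..N. f (S k \<omega>))))"
    by (rule integrable_const_bound[where B=1]) (auto simp del: of_real_mult of_real_sum)
  have i2: "integrable M (\<lambda>\<omega>. iexp (\<theta> * ?Z \<omega>))"
    by (rule integrable_const_bound[where B=1]) (auto simp del: of_real_mult of_real_sum)
  have "cmod ((LINT \<omega>|M. iexp (\<theta> * (\<Sum>k=1..N. f (S k \<omega>)))) - (LINT \<omega>|M. iexp (\<theta> * ?Z \<omega>)))
     = cmod (LINT \<omega>|M. iexp (\<theta> * (\<Sum>k=1..N. f (S k \<omega>))) - iexp (\<theta> * ?Z \<omega>))"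
    by (subst Bochner_Integration.integral_diff[OF i1 i2]) simp
  also have "\<dots> \<le> (LINT \<omega>|M. cmod (iexp (\<theta> * (\<Sum>k=1..N. f (S k \<omega>))) - iexp (\<theta> * ?Z \<omega>)))"
    by (rule integral_norm_bound)
  also have "\<dots> \<le> (LINT \<omega>|M. \<bar>\<theta>\<bar> * \<bar>Y \<omega>\<bar>)"
  proof (rule integral_mono)
    show "integrable M (\<lambda>\<omega>. cmod (iexp (\<theta> * (\<Sum>k=1..N. f (S k \<omega>))) - iexp (\<theta> * ?Z \<omega>)))"
      by (intro integrable_norm Bochner_Integration.integrable_diff i1 i2)
    show "integrable M (\<lambda>\<omega>. \<bar>\<theta>\<bar> * \<bar>Y \<omega>\<bar>)" using intY by simp
    fix \<omega>
    have "cmod (iexp (\<theta> * (\<Sum>k=1..N. f (S k \<omega>))) - iexp (\<theta> * ?Z \<omega>)) \<le> \<bar>\<theta> * (\<Sum>k=1..N. f (S k \<omega>)) - \<theta> * ?Z \<omega>\<bar>"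
      by (rule iexp_lipschitz)
    also have "\<theta> * (\<Sum>k=1..N. f (S k \<omega>)) - \<theta> * ?Z \<omega> = \<theta> * Y \<omega>"
      unfolding decomp Y_def by (simp add: algebra_simps)
    finally show "cmod (iexp (\<theta> * (\<Sum>k=1..N. f (S k \<omega>))) - iexp (\<theta> * ?Z \<omega>)) \<le> \<bar>\<theta>\<bar> * \<bar>Y \<omega>\<bar>"
      by (simp only: abs_mult)
  qed
  also have "\<dots> \<le> \<bar>\<theta>\<bar> * sqrt (K * (real n * real g + real (g + L)))"
    using EY by (simp add: mult_left_mono)
  finally have 1: "cmod ((LINT \<omega>|M. iexp (\<theta> * (\<Sum>k=1..N. f (S k \<omega>)))) - W \<phi> (n * p) (\<lambda>_. 1) 0)
     \<le> \<bar>\<theta>\<bar> * sqrt (K * (real n * real g + real (g + L)))" unfolding Wbig .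
  have 2: "cmod (W \<phi> (n * p) (\<lambda>_. 1) 0 - a ^ n) \<le> real n * (6 * (real L * (\<bar>\<theta>\<bar> * V)) * \<psi> g)"
    using blocks_char[OF f L, of g \<theta> n 0] unfolding \<phi>_def a_def p_def by simp
  define E where "E = exp (- (\<theta>\<^sup>2 * stat_var f L / 2))"
  have a1: "cmod a \<le> 1"
  proof -
    interpret U: prob_space unif by (rule prob_space_unif)
    have b: "bounded_borel (W (\<lambda>_ x. iexp (\<theta> * f x)) L (\<lambda>_. 1))"
      by (intro bounded_borel_W bounded_borelI[where B=1]) auto
    have "cmod (W (\<lambda>_ x. iexp (\<theta> * f x)) L (\<lambda>_. 1) u) \<le> 1" for u
      unfolding W_def by (rule norm_integral_le) (simp add: norm_mult flip: prod_norm)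
    then have "(LINT u|unif. cmod (W (\<lambda>_ x. iexp (\<theta> * f x)) L (\<lambda>_. 1) u)) \<le> (LINT u|unif. 1)"
      by (intro integral_mono integrable_norm unif_integrable b) auto
    then show ?thesis unfolding a_def using U.prob_space by (intro order_trans[OF integral_norm_bound]) simp
  qed
  have "cmod (a ^ n - complex_of_real E ^ n) \<le> real n * cmod (a - complex_of_real E)"
    by (rule norm_power_diff) (use a1 stat_var_nonneg in \<open>auto simp: E_def\<close>)
  also have "\<dots> \<le> real n * (\<bar>\<theta>\<bar> ^ 3 * (real L * B) * stat_var f L / 6 + (\<theta>\<^sup>2 * stat_var f L / 2)\<^sup>2)"
    unfolding a_def E_def by (intro mult_left_mono block_char[OF f]) simp
  finally have 3: "cmod (a ^ n - E ^ n) \<le> real n * (\<bar>\<theta>\<bar> ^ 3 * (real L * B) * stat_var f L / 6 + (\<theta>\<^sup>2 * stat_var f L / 2)\<^sup>2)"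
    by simp
  let ?I = "LINT \<omega>|M. iexp (\<theta> * (\<Sum>k=1..N. f (S k \<omega>)))"
  have "?I - E ^ n = (?I - W \<phi> (n * p) (\<lambda>_. 1) 0) + (W \<phi> (n * p) (\<lambda>_. 1) 0 - a ^ n) + (a ^ n - E ^ n)"
    by simp
  then have "cmod (?I - E ^ n) \<le> cmod (?I - W \<phi> (n * p) (\<lambda>_. 1) 0) + cmod (W \<phi> (n * p) (\<lambda>_. 1) 0 - a ^ n) + cmod (a ^ n - E ^ n)"
    by (metis norm_triangle_ineq norm_triangle_mono order_refl)
  with 1 2 3 show ?thesis unfolding E_def K_def by simp
qed

end

text \<open>Block lengths \<open>L\<close> of order \<open>N powr \<beta>\<close> and gaps of order \<open>N powr \<alpha>\<close> with
  \<open>1 / (2 * (1 + \<delta>)) < \<alpha> < \<beta> < 1 / 2\<close>: the lower bound makes the gaps long enough for the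
  mixing, the upper one makes single blocks negligible.\<close>

lemma block_scales:
  fixes \<delta> :: real
  assumes "0 < \<delta>"
  obtains g L :: "nat \<Rightarrow> nat" where
    "\<And>N. 1 \<le> L N" "\<And>N. 1 \<le> g N" "filterlim L at_top sequentially"
    "(\<lambda>N. real (g N) / real (L N)) \<longlonglongrightarrow> 0"
    "(\<lambda>N. real (L N) / sqrt (real N)) \<longlonglongrightarrow> 0"
    "(\<lambda>N. sqrt (real N) * real (g N) powr (-(1 + \<delta>))) \<longlonglongrightarrow> 0"
proof -
  have "1 / (2 * (1 + \<delta>)) < 1 / 2" using assms by (simp add: field_simps)
  then obtain \<beta> where b: "1 / (2 * (1 + \<delta>)) < \<beta>" "\<beta> < 1 / 2" using dense by blast
  then obtain \<alpha> where a: "1 / (2 * (1 + \<delta>)) < \<alpha>" "\<alpha> < \<beta>" using dense by blast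
  have pos: "0 < \<alpha>" using a(1) assms by (smt (verit) divide_pos_pos)
  then have posb: "0 < \<beta>" using a by simp
  have a2: "1 / 2 - \<alpha> * (1 + \<delta>) < 0" using a(1) assms by (simp add: field_simps)
  define fl where "fl c N = Suc (nat \<lfloor>real N powr c\<rfloor>)" for c :: real and N :: nat
  have fl_ge: "real N powr c \<le> real (fl c N)" for c N
    unfolding fl_def by (simp, linarith)
  have fl_le: "real (fl c N) \<le> 2 * real N powr c" if "1 \<le> N" "0 < c" for c N
  proof -
    have "1 \<le> real N powr c" using that by (simp add: ge_one_powr_ge_zero)
    moreover have "real (fl c N) \<le> real N powr c + 1" unfolding fl_def by simp
    ultimately show ?thesis by simp
  qed
  have powr0: "(\<lambda>N. real N powr c) \<longlonglongrightarrow> 0" if "c < 0" for c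
    by (rule tendsto_neg_powr[OF that filterlim_real_sequentially])
  show ?thesis
  proof (rule that[of "fl \<beta>" "fl \<alpha>"])
    show "1 \<le> fl \<beta> N" "1 \<le> fl \<alpha> N" for N by (simp_all add: fl_def)
    have "filterlim (\<lambda>N. real N powr \<beta>) at_top sequentially"
      using posb by real_asymp
    then have "filterlim (\<lambda>N. real (fl \<beta> N)) at_top sequentially"
      by (rule filterlim_at_top_mono) (simp add: fl_ge)
    then show "filterlim (fl \<beta>) at_top sequentially" by (simp add: filterlim_sequentially_iff_filterlim_real)
    show "(\<lambda>N. real (fl \<alpha> N) / real (fl \<beta> N)) \<longlonglongrightarrow> 0"
    proof (rule Lim_null_comparison)
      show "(\<lambda>N. 2 * real N powr (\<alpha> - \<beta>)) \<longlonglongrightarrow> 0"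
        using tendsto_mult_left[OF powr0[of "\<alpha> - \<beta>"], of 2] a by simp
      show "\<forall>\<^sub>F N in sequentially. norm (real (fl \<alpha> N) / real (fl \<beta> N)) \<le> 2 * real N powr (\<alpha> - \<beta>)"
        using eventually_ge_at_top[of 1]
      proof eventually_elim
        case (elim N)
        have "real (fl \<alpha> N) / real (fl \<beta> N) \<le> (2 * real N powr \<alpha>) / real N powr \<beta>"
          using elim pos fl_ge[of N \<beta>] fl_le[OF elim pos] by (intro frac_le) auto
        then show ?case by (simp add: powr_diff)
      qed
    qed
    show "(\<lambda>N. real (fl \<beta> N) / sqrt (real N)) \<longlonglongrightarrow> 0"
    proof (rule Lim_null_comparison)
      show "(\<lambda>N. 2 * real N powr (\<beta> - 1 / 2)) \<longlonglongrightarrow> 0"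
        using tendsto_mult_left[OF powr0[of "\<beta> - 1 / 2"], of 2] b by simp
      show "\<forall>\<^sub>F N in sequentially. norm (real (fl \<beta> N) / sqrt (real N)) \<le> 2 * real N powr (\<beta> - 1 / 2)"
        using eventually_ge_at_top[of 1]
      proof eventually_elim
        case (elim N)
        have "real (fl \<beta> N) / sqrt (real N) \<le> (2 * real N powr \<beta>) / sqrt (real N)"
          using fl_le[OF elim posb] by (intro divide_right_mono) auto
        then show ?case using elim by (simp add: powr_diff powr_half_sqrt)
      qed
    qed
    show "(\<lambda>N. sqrt (real N) * real (fl \<alpha> N) powr (-(1 + \<delta>))) \<longlonglongrightarrow> 0"
    proof (rule Lim_null_comparison)
      show "(\<lambda>N. real N powr (1 / 2 - \<alpha> * (1 + \<delta>))) \<longlonglongrightarrow> 0" by (rule powr0[OF a2])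
      show "\<forall>\<^sub>F N in sequentially. norm (sqrt (real N) * real (fl \<alpha> N) powr (-(1 + \<delta>))) \<le> real N powr (1 / 2 - \<alpha> * (1 + \<delta>))"
        using eventually_ge_at_top[of 1]
      proof eventually_elim
        case (elim N)
        have "real (fl \<alpha> N) powr (-(1 + \<delta>)) \<le> (real N powr \<alpha>) powr (-(1 + \<delta>))"
          using elim assms fl_ge[of N \<alpha>] by (intro powr_mono2') auto
        then have "sqrt (real N) * real (fl \<alpha> N) powr (-(1 + \<delta>)) \<le> real N powr (1/2) * (real N powr \<alpha>) powr (-(1 + \<delta>))"
          using elim by (simp add: powr_half_sqrt mult_left_mono)
        also have "\<dots> = real N powr (1 / 2 - \<alpha> * (1 + \<delta>))"
          by (simp add: powr_powr algebra_simps flip: powr_add)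
        finally show ?case by simp
      qed
    qed
  qed
qed

context circle_walk
begin

text \<open>With \<open>\<theta> = 1 / sqrt N\<close> and the scales above all three error terms of the block estimate tend
  to 0, and the exponent tends to \<open>- asymp_var f / 2\<close> because the blocks cover all but a vanishing
  proportion of the indices.\<close>

theorem clt_char:
  assumes f: "centered_bv V B f"
  shows "(\<lambda>N. LINT \<omega>|M. iexp (1 / sqrt (real N) * (\<Sum>k=1..N. f (S k \<omega>)))) \<longlonglongrightarrow> exp (- (asymp_var f / 2))"
proof -
  note fD = centered_bvD[OF f]
  obtain g L :: "nat \<Rightarrow> nat" where L1: "\<And>N. 1 \<le> L N" and g1: "\<And>N. 1 \<le> g N"
    and Linf: "filterlim L at_top sequentially"
    and gL: "(\<lambda>N. real (g N) / real (L N)) \<longlonglongrightarrow> 0"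
    and LN: "(\<lambda>N. real (L N) / sqrt (real N)) \<longlonglongrightarrow> 0"
    and gN: "(\<lambda>N. sqrt (real N) * real (g N) powr (-(1 + \<delta>))) \<longlonglongrightarrow> 0"
    by (rule block_scales[OF delta_pos]) (rule that)
  obtain C where C: "0 \<le> C" "\<And>k. 1 \<le> k \<Longrightarrow> \<psi> k \<le> C * real k powr (-(1 + \<delta>))" using psi_decay by blast
  define K where "K = 2 * (B + 3 * V * psi_total) * B"
  have K: "0 \<le> K" unfolding K_def using fD(7,8) psi_total_nonneg by simp
  define n where "n N = N div (g N + L N)" for N
  define Q where "Q N = stat_var f (L N)" for N
  have Q: "0 \<le> Q N" "Q N \<le> K * real (L N)" for N
    unfolding Q_def K_def using stat_var_nonneg stat_var_linear[OF f] by auto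
  define r where "r N = real (g N) / real (L N) + (real (g N) / real (L N)) * (real (L N) / sqrt (real N)) * (1 / sqrt (real N)) + (real (L N) / sqrt (real N)) * (1 / sqrt (real N))" for N
  have inv0: "(\<lambda>N. 1 / sqrt (real N)) \<longlonglongrightarrow> 0" by real_asymp
  have "r \<longlonglongrightarrow> 0 + 0 * 0 * 0 + 0 * 0" unfolding r_def by (intro tendsto_intros gL LN inv0)
  then have r0: "r \<longlonglongrightarrow> 0" by simp
  have nL: "real (n N) * real (L N) \<le> real N" for N
  proof -
    have "n N * L N \<le> n N * (g N + L N)" by simp
    also have "\<dots> \<le> N" unfolding n_def by (simp add: div_times_less_eq_dividend)
    finally show ?thesis by (metis of_nat_le_iff of_nat_mult)
  qed
  have rb: "real (n N) * real (g N) + real (g N + L N) \<le> r N * real N" if "1 \<le> N" for N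
  proof -
    have N: "0 < real N" "sqrt (real N) * sqrt (real N) = real N" using that by auto
    have Lp: "0 < real (L N)" using L1[of N] by linarith
    have "real (n N) * real (g N) = (real (n N) * real (L N)) * (real (g N) / real (L N))" using Lp by simp
    also have "\<dots> \<le> real N * (real (g N) / real (L N))" by (intro mult_right_mono nL) simp
    finally have "real (n N) * real (g N) \<le> real N * (real (g N) / real (L N))" .
    moreover have "r N * real N = real N * (real (g N) / real (L N)) + real (g N) + real (L N)"
      unfolding r_def using N Lp by (simp add: field_simps)
    ultimately show ?thesis by simp
  qed
  define b where "b N = sqrt (K * r N) + 6 * V * C * (sqrt (real N) * real (g N) powr (-(1 + \<delta>)))
     + (B * K / 6 * (real (L N) / sqrt (real N)) + K\<^sup>2 / 4 * ((real (L N) / sqrt (real N)) * (1 / sqrt (real N))))" for N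
  define E where "E N = exp (- (real (n N) * (1 / real N * Q N / 2)))" for N
  let ?I = "\<lambda>N. LINT \<omega>|M. iexp (1 / sqrt (real N) * (\<Sum>k=1..N. f (S k \<omega>)))"
  have "b \<longlonglongrightarrow> sqrt (K * 0) + 6 * V * C * 0 + (B * K / 6 * 0 + K\<^sup>2 / 4 * (0 * 0))"
    unfolding b_def by (intro tendsto_intros r0 gN LN inv0)
  then have b0: "b \<longlonglongrightarrow> 0" by simp
  have main: "cmod (?I N - E N) \<le> b N" if N1: "1 \<le> N" for N
  proof -
    define s where "s = sqrt (real N)"
    have s: "0 < s" "s * s = real N" using N1 by (auto simp: s_def)
    have Nss: "real N = s * s" using s by simp
    have est: "cmod (?I N - exp (- ((1 / s)\<^sup>2 * Q N / 2)) ^ n N)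
      \<le> \<bar>1 / s\<bar> * sqrt (K * (real (n N) * real (g N) + real (g N + L N)))
      + real (n N) * (6 * (real (L N) * (\<bar>1 / s\<bar> * V)) * \<psi> (g N))
      + real (n N) * (\<bar>1 / s\<bar> ^ 3 * (real (L N) * B) * Q N / 6 + ((1 / s)\<^sup>2 * Q N / 2)\<^sup>2)"
      using char_block_estimate[OF f L1[of N], of "1 / s" N "g N"] unfolding n_def Q_def K_def s_def by simp
    have "exp (- ((1 / s)\<^sup>2 * Q N / 2)) ^ n N = E N"
      unfolding E_def Nss exp_of_nat_mult[symmetric] using s by (simp add: power2_eq_square)
    moreover have "\<bar>1 / s\<bar> * sqrt (K * (real (n N) * real (g N) + real (g N + L N))) \<le> sqrt (K * r N)"
    proof -
      have "\<bar>1 / s\<bar> * sqrt (K * (real (n N) * real (g N) + real (g N + L N))) \<le> (1 / s) * sqrt (K * (r N * real N))"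
        using s rb[OF N1] K by (auto intro!: mult_left_mono divide_right_mono)
      also have "sqrt (K * (r N * real N)) = sqrt (K * r N) * s" unfolding s_def real_sqrt_mult[symmetric] by (simp add: mult.assoc)
      finally show ?thesis using s by simp
    qed
    moreover have "real (n N) * (6 * (real (L N) * (\<bar>1 / s\<bar> * V)) * \<psi> (g N)) \<le> 6 * V * C * (s * real (g N) powr (-(1 + \<delta>)))"
    proof -
      have "real (n N) * (6 * (real (L N) * (\<bar>1 / s\<bar> * V)) * \<psi> (g N)) = (real (n N) * real (L N)) * (6 * V / s * \<psi> (g N))"
        using s by simp
      also have "\<dots> \<le> (s * s) * (6 * V / s * (C * real (g N) powr (-(1 + \<delta>))))"
        by (rule mult_mono[OF nL[of N, unfolded Nss] mult_left_mono[OF C(2)[OF g1]]])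
          (use s fD(8) psi_nonneg in auto)
      also have "\<dots> = 6 * V * C * (s * real (g N) powr (-(1 + \<delta>)))"
        using \<open>0 < s\<close> by (simp add: field_simps)
      finally show ?thesis .
    qed
    moreover have "real (n N) * (\<bar>1 / s\<bar> ^ 3 * (real (L N) * B) * Q N / 6 + ((1 / s)\<^sup>2 * Q N / 2)\<^sup>2)
      \<le> B * K / 6 * (real (L N) / s) + K\<^sup>2 / 4 * ((real (L N) / s) * (1 / s))"
    proof -
      have "real (n N) * (\<bar>1 / s\<bar> ^ 3 * (real (L N) * B) * Q N / 6) = (real (n N) * real (L N)) * (B / (6 * s ^ 3) * Q N)"
        using s by (simp add: power_divide)
      also have "\<dots> \<le> (s * s) * (B / (6 * s ^ 3) * (K * real (L N)))"
        by (rule mult_mono[OF nL[of N, unfolded Nss] mult_left_mono[OF Q(2)]])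
          (use s fD(7) Q[of N] in auto)
      also have "\<dots> = B * K / 6 * (real (L N) / s)" using s(1) by (simp add: field_simps power3_eq_cube)
      finally have 1: "real (n N) * (\<bar>1 / s\<bar> ^ 3 * (real (L N) * B) * Q N / 6) \<le> B * K / 6 * (real (L N) / s)" .
      have "real (n N) * ((1 / s)\<^sup>2 * Q N / 2)\<^sup>2 = real (n N) * ((Q N)\<^sup>2 / (4 * s ^ 4))"
        using s by (simp add: power_divide power_mult_distrib power2_eq_square power4_eq_xxxx)
      also have "\<dots> \<le> real (n N) * ((K * real (L N))\<^sup>2 / (4 * s ^ 4))"
        using Q[of N] s by (intro mult_left_mono divide_right_mono power_mono) auto
      also have "\<dots> = (real (n N) * real (L N)) * (K\<^sup>2 * real (L N) / (4 * s ^ 4))"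
        by (simp add: power2_eq_square)
      also have "\<dots> \<le> (s * s) * (K\<^sup>2 * real (L N) / (4 * s ^ 4))"
        using s nL[of N] by (intro mult_right_mono) (auto simp: Nss)
      also have "\<dots> = K\<^sup>2 / 4 * ((real (L N) / s) * (1 / s))"
        using s(1) by (simp add: field_simps power4_eq_xxxx)
      finally show ?thesis using 1 by (simp add: distrib_left)
    qed
    ultimately show ?thesis using est unfolding b_def s_def by simp
  qed
  have diff: "(\<lambda>N. ?I N - E N) \<longlonglongrightarrow> 0"
    by (rule Lim_null_comparison[OF eventually_sequentiallyI[OF main] b0])
  have q: "(\<lambda>N. Q N / real (L N)) \<longlonglongrightarrow> asymp_var f"
    unfolding Q_def using filterlim_compose[OF stat_var_asymp[OF f] Linf] .
  have nLN: "(\<lambda>N. real (n N) * real (L N) / real N) \<longlonglongrightarrow> 1"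
  proof (rule tendsto_sandwich)
    show "\<forall>\<^sub>F N in sequentially. 1 - r N \<le> real (n N) * real (L N) / real N"
      using eventually_ge_at_top[of 1]
    proof eventually_elim
      case (elim N)
      have "N \<le> n N * (g N + L N) + (g N + L N)"
        using div_mult_mod_eq[of N "g N + L N"] mod_less_divisor[of "g N + L N" N] L1[of N]
        unfolding n_def by linarith
      then have "real N \<le> real (n N) * (real (g N) + real (L N)) + real (g N + L N)"
        by (metis of_nat_add of_nat_le_iff of_nat_mult)
      then have "real N - r N * real N \<le> real (n N) * real (L N)"
        using rb[OF elim] by (simp add: algebra_simps)
      then show ?case using elim by (simp add: field_simps)
    qed
    show "\<forall>\<^sub>F N in sequentially. real (n N) * real (L N) / real N \<le> 1"
      using eventually_ge_at_top[of 1] by eventually_elim (use nL in \<open>auto simp: divide_le_eq\<close>)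
    show "(\<lambda>N. 1 - r N) \<longlonglongrightarrow> 1" using tendsto_diff[OF tendsto_const[of 1] r0] by simp
  qed simp
  have "(\<lambda>N. (real (n N) * real (L N) / real N) * (Q N / real (L N)) / 2) \<longlonglongrightarrow> 1 * asymp_var f / 2"
    by (intro tendsto_intros nLN q) simp
  moreover have "(real (n N) * real (L N) / real N) * (Q N / real (L N)) / 2 = real (n N) * (1 / real N * Q N / 2)" for N
    using L1[of N] by (simp add: field_simps)
  ultimately have "(\<lambda>N. real (n N) * (1 / real N * Q N / 2)) \<longlonglongrightarrow> asymp_var f / 2" by simp
  then have "E \<longlonglongrightarrow> exp (- (asymp_var f / 2))" unfolding E_def by (intro tendsto_intros)
  then have "(\<lambda>N. complex_of_real (E N)) \<longlonglongrightarrow> complex_of_real (exp (- (asymp_var f / 2)))"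
    by (rule tendsto_of_real)
  from tendsto_add[OF diff this] show ?thesis by simp
qed

end

section \<open>Tightness of the empirical process\<close>

lemma centered_ind_eq: "0 \<le> t \<Longrightarrow> centered_ind {0..<t} x = indicator {0..<t} (frac x) - t"
  by (simp add: centered_ind_def)

lemma frac_measurable [measurable]: "(frac :: real \<Rightarrow> real) \<in> borel_measurable borel"
  unfolding frac_def by measurable

lemma centered_ind_measurable [measurable]: "centered_ind {0..<t} \<in> borel_measurable borel"
  unfolding centered_ind_def by measurable

lemma indicator_integral_unif: "0 \<le> t \<Longrightarrow> t \<le> 1 \<Longrightarrow> (LINT u|unif. indicator {0..<t} (frac u)) = t"
proof -
  assume t: "0 \<le> t" "t \<le> 1"
  have "(LINT u|unif. indicator {0..<t} (frac u)) = (LINT u|unif. indicator {0..<t} u :: real)"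
    by (rule integral_cong_AE) (use AE_unif in \<open>auto simp: frac_eq\<close>)
  also have "\<dots> = measure unif {0..<t}" by simp
  also have "\<dots> = t" using t by (simp add: measure_unif min_def)
  finally show ?thesis .
qed

lemma circ_bv_increment:
  assumes "0 \<le> s" "s \<le> 1" "0 \<le> t" "t \<le> 1"
  shows "circ_bv 4 (\<lambda>x. indicator {0..<t} (frac x) - indicator {0..<s} (frac x) + c :: real)"
proof -
  have "circ_bv (\<bar>-1\<bar> * 2) (\<lambda>x. -1 * indicator {0..<s} (frac x) :: real)"
    by (intro circ_bv_cmult circ_bv_indicator assms)
  then have "circ_bv (2 + (2 + 0)) (\<lambda>x. indicator {0..<t} (frac x) + (-1 * indicator {0..<s} (frac x) + c) :: real)"
    by (intro circ_bv_add circ_bv_indicator circ_bv_const assms) simp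
  then show ?thesis by (simp add: algebra_simps)
qed

lemma centered_bv_increment:
  assumes "0 \<le> s" "s \<le> t" "t \<le> 1"
  shows "centered_bv 4 1 (\<lambda>x. centered_ind {0..<t} x - centered_ind {0..<s} x)"
proof -
  interpret U: prob_space unif by (rule prob_space_unif)
  have int: "integrable unif (\<lambda>u. indicator {0..<r} (frac u) :: real)" for r :: real
    by (rule U.integrable_const_bound[where B=1]) auto
  have eq: "(\<lambda>x. centered_ind {0..<t} x - centered_ind {0..<s} x)
      = (\<lambda>x. indicator {0..<t} (frac x) - indicator {0..<s} (frac x) + (s - t))"
    using assms by (simp add: centered_ind_eq fun_eq_iff)
  have "\<bar>indicator {0..<t} (frac x) - indicator {0..<s} (frac x) + (s - t)\<bar> \<le> 1" for x
    using assms by (auto simp: indicator_def)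
  moreover have "(LINT u|unif. indicator {0..<t} (frac u) - indicator {0..<s} (frac u) + (s - t)) = 0"
    using assms int U.prob_space by (simp add: indicator_integral_unif)
  ultimately show ?thesis
    unfolding centered_bv_def eq using circ_bv_increment[of s t "s - t"] assms
    by (auto simp: periodic1_def)
qed

lemma centered_ind_empty [simp]: "centered_ind {} = (\<lambda>x. 0)"
  by (simp add: centered_ind_def fun_eq_iff)

lemma centered_bv_ind: "0 \<le> t \<Longrightarrow> t \<le> 1 \<Longrightarrow> centered_bv 4 1 (centered_ind {0..<t})"
  using centered_bv_increment[of 0 t] by simp

lemma centered_bv_sum:
  assumes "\<And>i. i \<in> I \<Longrightarrow> centered_bv V B (f i)" "finite I"
  shows "centered_bv (\<Sum>i\<in>I. \<bar>c i\<bar> * V) (\<Sum>i\<in>I. \<bar>c i\<bar> * B) (\<lambda>x. \<Sum>i\<in>I. c i * f i x)"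
  unfolding centered_bv_def
proof (intro conjI allI)
  note fD = centered_bvD[OF assms(1)]
  interpret U: prob_space unif by (rule prob_space_unif)
  have int: "integrable unif (f i)" if "i \<in> I" for i
    by (rule U.integrable_const_bound[where B=B]) (use fD[OF that] in auto)
  show "(\<lambda>x. \<Sum>i\<in>I. c i * f i x) \<in> borel_measurable borel"
    by (intro borel_measurable_sum borel_measurable_times) (use fD in auto)
  show "periodic1 (\<lambda>x. \<Sum>i\<in>I. c i * f i x)" using fD(2) by (simp add: periodic1_def)
  show "circ_bv (\<Sum>i\<in>I. \<bar>c i\<bar> * V) (\<lambda>x. \<Sum>i\<in>I. c i * f i x)"
    by (intro circ_bv_sum circ_bv_cmult fD)
  show "\<bar>\<Sum>i\<in>I. c i * f i x\<bar> \<le> (\<Sum>i\<in>I. \<bar>c i\<bar> * B)" for x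
    by (rule order_trans[OF sum_abs]) (auto intro!: sum_mono mult_left_mono fD simp: abs_mult)
  show "(LINT u|unif. (\<Sum>i\<in>I. c i * f i u)) = 0"
    using int fD(5) by (subst Bochner_Integration.integral_sum) auto
qed

lemma exp_quadratic_bound: fixes y :: real assumes "\<bar>y\<bar> \<le> 1" shows "exp y \<le> 1 + y + y\<^sup>2"
proof (cases "0 \<le> y")
  case True then show ?thesis using exp_bound[of y] assms by simp
next
  case False then show ?thesis using exp_minus_approx[of "- y"] by simp
qed

context circle_walk
begin

lemma W_real_mono:
  fixes \<phi> :: "nat \<Rightarrow> real \<Rightarrow> real"
  assumes \<phi>: "\<And>k. bounded_borel (\<phi> k)" "\<And>k x. 0 \<le> \<phi> k x"
    and h: "bounded_borel h" and h': "bounded_borel h'" and le: "\<And>x. h x \<le> h' x"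
  shows "W \<phi> N h x \<le> W \<phi> N h' x"
  unfolding W_def
  by (intro integral_mono integrable_W \<phi> h h' mult_left_mono le prod_nonneg ballI)

lemma W_const: "W \<phi> N (\<lambda>_. c) x = W \<phi> N (\<lambda>_. 1) x * c"
  unfolding W_def by simp

lemma W_sup:
  fixes \<phi> :: "nat \<Rightarrow> real \<Rightarrow> real"
  assumes \<phi>: "\<And>k. bounded_borel (\<phi> k)" "\<And>k x. 0 \<le> \<phi> k x" "\<And>k x. \<phi> k x \<le> b"
  shows "W \<phi> N (\<lambda>_. 1) x \<le> b ^ N"
proof -
  have "norm (W \<phi> N (\<lambda>_. 1) x) \<le> b ^ N"
    unfolding W_def
  proof (rule norm_integral_le)
    fix \<omega>
    have "(\<Prod>k=1..N. \<phi> k (x + S k \<omega>)) \<le> (\<Prod>k=1..N. b)" by (intro prod_mono) (use \<phi> in auto)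
    moreover have "0 \<le> (\<Prod>k=1..N. \<phi> k (x + S k \<omega>))" by (intro prod_nonneg) (use \<phi> in auto)
    ultimately show "norm ((\<Prod>k=1..N. \<phi> k (x + S k \<omega>)) * 1) \<le> b ^ N" by simp
  qed
  then show ?thesis by simp
qed

text \<open>Period by period the worst case over the starting point is taken; the incomplete last period, and
  for \<open>\<phi>'\<close> also the first block, which no gap precedes, are estimated trivially by powers of
  \<open>b\<close>.\<close>

lemma W_blocks_bound:
  fixes e :: "real \<Rightarrow> real"
  assumes e: "bounded_borel e" "\<And>x. 0 \<le> e x" "\<And>x. e x \<le> b" "1 \<le> b" and L: "1 \<le> L"
    and one: "\<And>x. T L (W (\<lambda>_. e) L (\<lambda>_. 1)) x \<le> a" and a: "1 \<le> a"
  defines "\<phi> \<equiv> \<lambda>k::nat. if L \<le> (k - 1) mod (2 * L) then e else (\<lambda>_. 1)"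
  defines "\<phi>' \<equiv> \<lambda>k::nat. if L \<le> (k - 1) mod (2 * L) then (\<lambda>_. 1) else e"
  shows "W \<phi> N (\<lambda>_. 1) x \<le> b ^ (2 * L) * a ^ (N div (2 * L))"
    and "W \<phi>' N (\<lambda>_. 1) x \<le> b ^ (3 * L) * a ^ (N div (2 * L))"
proof -
  define p where "p = 2 * L"
  have p: "0 < p" using L by (simp add: p_def)
  have \<phi>: "bounded_borel (\<phi> k)" "0 \<le> \<phi> k x" "\<phi> k x \<le> b" for k x
    using e unfolding \<phi>_def by auto
  have \<phi>': "bounded_borel (\<phi>' k)" "0 \<le> \<phi>' k x" "\<phi>' k x \<le> b" for k x
    using e unfolding \<phi>'_def by auto
  have shift: "\<phi> (k + m * p) = \<phi> k" if "1 \<le> k" for k m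
  proof -
    have "(k + m * p - 1) mod p = (k - 1) mod p"
      using that mod_mult_self1[of "k - 1" m p] by (simp add: add.commute)
    then show ?thesis by (simp add: \<phi>_def p_def)
  qed
  have bp: "bounded_borel (W \<phi> m (\<lambda>_. 1))" for m by (intro bounded_borel_W \<phi>) simp
  have period: "W \<phi> p (\<lambda>_. 1) x \<le> a" for x
  proof -
    have "W \<phi> p (\<lambda>_. 1) x = W \<phi> L (W (\<lambda>k. \<phi> (k + L)) L (\<lambda>_. 1)) x"
      unfolding p_def mult_2 by (rule W_add[OF \<phi>(1)]) simp
    also have "W (\<lambda>k. \<phi> (k + L)) L (\<lambda>_. 1) = W (\<lambda>_. e) L (\<lambda>_. 1)"
    proof (rule W_cong)
      fix k assume k: "1 \<le> k" "k \<le> L"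
      then have "(k + L - 1) mod (2 * L) = k + L - 1" by (intro mod_less) simp
      moreover have "L \<le> k + L - 1" using k by simp
      ultimately show "\<phi> (k + L) = e" unfolding \<phi>_def by simp
    qed
    also have "W \<phi> L (W (\<lambda>_. e) L (\<lambda>_. 1)) = W (\<lambda>_ _. 1) L (W (\<lambda>_. e) L (\<lambda>_. 1))"
    proof (rule W_cong)
      fix k assume k: "1 \<le> k" "k \<le> L"
      then have "(k - 1) mod (2 * L) = k - 1" "k - 1 < L" by (auto intro!: mod_less)
      then show "\<phi> k = (\<lambda>_. 1)" by (simp add: \<phi>_def)
    qed
    finally show ?thesis using one by (simp add: W_one)
  qed
  have rep: "W \<phi> (n * p) (\<lambda>_. 1) x \<le> a ^ n" for n x
  proof (induction n)
    case 0 show ?case by (simp add: W_0)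
  next
    case (Suc n)
    have "W \<phi> (Suc n * p) (\<lambda>_. 1) x = W \<phi> (n * p + p) (\<lambda>_. 1) x" by (simp add: add.commute)
    also have "\<dots> = W \<phi> (n * p) (W (\<lambda>k. \<phi> (k + n * p)) p (\<lambda>_. 1)) x"
      by (rule W_add[OF \<phi>(1)]) simp
    also have "W (\<lambda>k. \<phi> (k + n * p)) p (\<lambda>_. 1) = W \<phi> p (\<lambda>_. 1)"
      by (rule W_cong) (rule shift)
    also have "W \<phi> (n * p) (W \<phi> p (\<lambda>_. 1)) x \<le> W \<phi> (n * p) (\<lambda>_. a) x"
      by (rule W_real_mono) (use \<phi> bp period in auto)
    also have "\<dots> \<le> a ^ n * a" unfolding W_const[of \<phi> "n * p" a] using Suc.IH a by (intro mult_right_mono) auto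
    finally show ?case by (simp add: mult.commute)
  qed
  have gen: "W \<phi> N (\<lambda>_. 1) x \<le> b ^ (2 * L) * a ^ (N div (2 * L))" for N x
  proof -
    let ?n = "N div p" and ?r = "N mod p"
    have "W \<phi> N (\<lambda>_. 1) x = W \<phi> (?n * p + ?r) (\<lambda>_. 1) x" by simp
    also have "\<dots> = W \<phi> (?n * p) (W (\<lambda>k. \<phi> (k + ?n * p)) ?r (\<lambda>_. 1)) x"
      by (rule W_add[OF \<phi>(1)]) simp
    also have "W (\<lambda>k. \<phi> (k + ?n * p)) ?r (\<lambda>_. 1) = W \<phi> ?r (\<lambda>_. 1)"
      by (rule W_cong) (rule shift)
    also have "W \<phi> (?n * p) (W \<phi> ?r (\<lambda>_. 1)) x \<le> W \<phi> (?n * p) (\<lambda>_. b ^ p) x"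
    proof (rule W_real_mono[OF \<phi>(1,2) bp])
      fix y
      have "W \<phi> ?r (\<lambda>_. 1) y \<le> b ^ ?r" by (rule W_sup) (use \<phi> in auto)
      also have "\<dots> \<le> b ^ p" using e(4) p by (intro power_increasing) (auto simp: less_imp_le)
      finally show "W \<phi> ?r (\<lambda>_. 1) y \<le> b ^ p" .
    qed simp
    also have "\<dots> \<le> a ^ ?n * b ^ p" unfolding W_const[of \<phi> "?n * p" "b ^ p"]
      using rep[of ?n x] e(4) by (intro mult_right_mono) auto
    finally show ?thesis by (simp add: p_def mult.commute)
  qed
  then show "W \<phi> N (\<lambda>_. 1) x \<le> b ^ (2 * L) * a ^ (N div (2 * L))" .
  show "W \<phi>' N (\<lambda>_. 1) x \<le> b ^ (3 * L) * a ^ (N div (2 * L))"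
  proof (cases "L \<le> N")
    case False
    have "W \<phi>' N (\<lambda>_. 1) x \<le> b ^ N" by (rule W_sup) (use \<phi>' in auto)
    also have "\<dots> \<le> b ^ (3 * L) * 1" using False e(4) by (simp add: power_increasing)
    also have "\<dots> \<le> b ^ (3 * L) * a ^ (N div (2 * L))"
      using e(4) a by (intro mult_left_mono) auto
    finally show ?thesis .
  next
    case True
    have "W \<phi>' N (\<lambda>_. 1) x = W \<phi>' (L + (N - L)) (\<lambda>_. 1) x" using True by simp
    also have "\<dots> = W \<phi>' L (W (\<lambda>k. \<phi>' (k + L)) (N - L) (\<lambda>_. 1)) x"
      by (rule W_add[OF \<phi>'(1)]) simp
    also have "W (\<lambda>k. \<phi>' (k + L)) (N - L) (\<lambda>_. 1) = W \<phi> (N - L) (\<lambda>_. 1)"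
    proof (rule W_cong)
      fix k :: nat assume k: "1 \<le> k"
      have "L \<le> (k + L - 1) mod (2 * L) \<longleftrightarrow> \<not> L \<le> (k - 1) mod (2 * L)"
      proof -
        define q where "q = (k - 1) mod (2 * L)"
        have q: "q < 2 * L" using L by (simp add: q_def)
        have "(k + L - 1) mod (2 * L) = (q + L) mod (2 * L)"
          using k mod_add_left_eq[of "k - 1" "2 * L" L] by (simp add: q_def)
        also have "\<dots> = (if q < L then q + L else q - L)"
          using q by (auto simp: mod_if)
        finally have *: "(k + L - 1) mod (2 * L) = (if q < L then q + L else q - L)" .
        show ?thesis unfolding * q_def[symmetric] using q by auto
      qed
      then show "\<phi>' (k + L) = \<phi> k" by (simp add: \<phi>_def \<phi>'_def)
    qed
    also have "W \<phi>' L (W \<phi> (N - L) (\<lambda>_. 1)) x \<le> W \<phi>' L (\<lambda>_. b ^ (2 * L) * a ^ (N div (2 * L))) x"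
    proof (rule W_real_mono[OF \<phi>'(1,2) bp])
      fix y
      have "W \<phi> (N - L) (\<lambda>_. 1) y \<le> b ^ (2 * L) * a ^ ((N - L) div (2 * L))" by (rule gen)
      also have "\<dots> \<le> b ^ (2 * L) * a ^ (N div (2 * L))"
        using e(4) a by (intro mult_left_mono power_increasing div_le_mono) auto
      finally show "W \<phi> (N - L) (\<lambda>_. 1) y \<le> b ^ (2 * L) * a ^ (N div (2 * L))" .
    qed simp
    also have "\<dots> = W \<phi>' L (\<lambda>_. 1) x * (b ^ (2 * L) * a ^ (N div (2 * L)))" by (rule W_const)
    also have "\<dots> \<le> b ^ L * (b ^ (2 * L) * a ^ (N div (2 * L)))"
      using W_sup[of \<phi>' b L x] \<phi>' e(4) a by (intro mult_right_mono) auto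
    finally show ?thesis by (simp add: power_add[symmetric] mult.assoc[symmetric])
  qed
qed

text \<open>Alternate blocks of length \<open>L\<close> are separated by gaps of length \<open>L\<close>, so that given the
  past each block sum has mean at most \<open>\<rho>\<close> and second moment at most \<open>v\<close>.  Its exponential moment is
  then at most \<open>exp (\<bar>\<theta>\<bar> * \<rho> + \<theta>\<^sup>2 * v)\<close> whatever the past, and these bounds multiply up.  Two such
  families of blocks cover all the indices, which costs half of the exponent.\<close>

lemma exp_moment_bound:
  assumes f: "centered_bv V 1 f" and L: "1 \<le> L" and \<theta>: "\<bar>\<theta>\<bar> * real L \<le> 1"
    and mean: "\<And>x. \<bar>\<Sum>k=L+1..2*L. T k f x\<bar> \<le> \<rho>"
    and var: "\<And>x. (LINT \<omega>|M. (\<Sum>k=L+1..2*L. f (x + S k \<omega>))\<^sup>2) \<le> v"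
  shows "(LINT \<omega>|M. exp (\<theta> / 2 * (\<Sum>k=1..N. f (S k \<omega>)))) \<le> exp 3 * exp (\<bar>\<theta>\<bar> * \<rho> + \<theta>\<^sup>2 * v) ^ (N div (2 * L))"
proof -
  note fD = centered_bvD[OF f]
  note [measurable] = fD(1)
  define e where "e x = exp (\<theta> * f x)" for x
  define b where "b = exp \<bar>\<theta>\<bar>"
  define a where "a = exp (\<bar>\<theta>\<bar> * \<rho> + \<theta>\<^sup>2 * v)"
  have "\<theta> * f x \<le> \<bar>\<theta>\<bar>" for x
    using mult_left_mono[OF fD(4)[of x] abs_ge_zero[of \<theta>]] abs_ge_self[of "\<theta> * f x"] by (simp add: abs_mult)
  then have eb: "e x \<le> b" for x by (simp add: e_def b_def)
  have e0: "0 \<le> e x" for x by (simp add: e_def)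
  have e: "bounded_borel e" unfolding e_def by (rule bounded_borelI[where B=b]) (use eb in \<open>auto simp: e_def\<close>)
  have b1: "1 \<le> b" by (simp add: b_def)
  have \<rho>: "0 \<le> \<rho>" using order_trans[OF abs_ge_zero mean] .
  have v: "0 \<le> v" by (rule order_trans[OF _ var]) (intro integral_nonneg_AE AE_I2, simp)
  have a1: "1 \<le> a" using \<rho> v by (simp add: a_def)
  have one: "T L (W (\<lambda>_. e) L (\<lambda>_. 1)) x \<le> a" for x
  proof -
    define Y where "Y \<omega> = (\<Sum>k=L+1..2*L. f (x + S k \<omega>))" for \<omega>
    have [measurable]: "Y \<in> borel_measurable M" unfolding Y_def by measurable
    have YL: "\<bar>Y \<omega>\<bar> \<le> real L" for \<omega>
      unfolding Y_def using sum_bounded_above[of "{L+1..2*L}" "\<lambda>k. \<bar>f (x + S k \<omega>)\<bar>" 1] fD(4)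
      by (intro order_trans[OF sum_abs]) simp
    have \<theta>Y: "\<bar>\<theta> * Y \<omega>\<bar> \<le> 1" for \<omega>
      unfolding abs_mult using mult_left_mono[OF YL[of \<omega>] abs_ge_zero[of \<theta>]] \<theta> by linarith
    have iY: "integrable M Y" by (rule integrable_const_bound[where B="real L"]) (use YL in auto)
    have iY2: "integrable M (\<lambda>\<omega>. (Y \<omega>)\<^sup>2)"
      by (rule integrable_const_bound[where B="(real L)\<^sup>2"]) (use YL in \<open>auto simp: abs_le_square_iff[symmetric]\<close>)
    have EY: "(LINT \<omega>|M. Y \<omega>) = (\<Sum>k=L+1..2*L. T k f x)"
      unfolding Y_def T_def by (rule Bochner_Integration.integral_sum) (rule integrable_comp_S[OF fD(6)])
    define \<phi> where "\<phi> k = (if L < k then e else (\<lambda>_. 1))" for k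
    have \<phi>b: "bounded_borel (\<phi> k)" for k using e by (simp add: \<phi>_def)
    have "T L (W (\<lambda>_. e) L (\<lambda>_. 1)) x = W \<phi> L (W (\<lambda>k. \<phi> (k + L)) L (\<lambda>_. 1)) x"
    proof -
      have "W \<phi> L h = W (\<lambda>_ _. 1) L h" for h by (rule W_cong) (simp add: \<phi>_def)
      moreover have "W (\<lambda>k. \<phi> (k + L)) L (\<lambda>_. 1) = W (\<lambda>_. e) L (\<lambda>_. 1)" by (rule W_cong) (simp add: \<phi>_def)
      ultimately show ?thesis by (simp add: W_one)
    qed
    also have "\<dots> = W \<phi> (L + L) (\<lambda>_. 1) x" by (rule W_add[OF \<phi>b, symmetric]) simp
    also have "\<dots> = (LINT \<omega>|M. exp (\<theta> * Y \<omega>))"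
    proof -
      have "(\<Prod>k=1..L+L. \<phi> k (x + S k \<omega>)) = exp (\<theta> * Y \<omega>)" for \<omega>
      proof -
        have "(\<Prod>k=1..L+L. \<phi> k (x + S k \<omega>)) = (\<Prod>k\<in>{k\<in>{1..L+L}. L < k}. e (x + S k \<omega>))"
          by (subst prod.inter_filter) (auto simp: \<phi>_def intro!: prod.cong)
        also have "{k\<in>{1..L+L}. L < k} = {L+1..2*L}" by auto
        finally show ?thesis by (simp add: e_def Y_def sum_distrib_left exp_sum)
      qed
      then show ?thesis unfolding W_def by simp
    qed
    also have "\<dots> \<le> (LINT \<omega>|M. 1 + \<theta> * Y \<omega> + \<theta>\<^sup>2 * (Y \<omega>)\<^sup>2)"
    proof (rule integral_mono)
      show "integrable M (\<lambda>\<omega>. exp (\<theta> * Y \<omega>))"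
        by (rule integrable_const_bound[where B="exp 1"]) (use \<theta>Y in \<open>auto simp: abs_le_iff\<close>)
      show "integrable M (\<lambda>\<omega>. 1 + \<theta> * Y \<omega> + \<theta>\<^sup>2 * (Y \<omega>)\<^sup>2)" using iY iY2 by simp
      show "exp (\<theta> * Y \<omega>) \<le> 1 + \<theta> * Y \<omega> + \<theta>\<^sup>2 * (Y \<omega>)\<^sup>2" for \<omega>
        using exp_quadratic_bound[OF \<theta>Y[of \<omega>]] by (simp add: power_mult_distrib)
    qed
    also have "\<dots> = 1 + \<theta> * (\<Sum>k=L+1..2*L. T k f x) + \<theta>\<^sup>2 * (LINT \<omega>|M. (Y \<omega>)\<^sup>2)"
      using iY iY2 by (simp add: EY prob_space)
    also have "\<dots> \<le> 1 + (\<bar>\<theta>\<bar> * \<rho> + \<theta>\<^sup>2 * v)"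
    proof -
      have "\<theta> * (\<Sum>k=L+1..2*L. T k f x) \<le> \<bar>\<theta>\<bar> * \<rho>"
        using mult_left_mono[OF mean[of x] abs_ge_zero[of \<theta>]] abs_ge_self[of "\<theta> * (\<Sum>k=L+1..2*L. T k f x)"]
        by (simp add: abs_mult)
      moreover have "\<theta>\<^sup>2 * (LINT \<omega>|M. (Y \<omega>)\<^sup>2) \<le> \<theta>\<^sup>2 * v"
        unfolding Y_def by (intro mult_left_mono var) simp
      ultimately show ?thesis by simp
    qed
    also have "\<dots> \<le> a" unfolding a_def by (rule exp_ge_add_one_self)
    finally show ?thesis .
  qed
  define \<phi>0 where "\<phi>0 k = (if L \<le> (k - 1) mod (2 * L) then e else (\<lambda>_. 1))" for k :: nat
  define \<phi>1 where "\<phi>1 k = (if L \<le> (k - 1) mod (2 * L) then (\<lambda>_. 1) else e)" for k :: nat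
  have b3: "b ^ (3 * L) \<le> exp 3"
    unfolding b_def exp_of_nat_mult[symmetric] using \<theta> by (simp add: mult.commute)
  have "b ^ (2 * L) \<le> b ^ (3 * L)" using b1 by (intro power_increasing) auto
  with b3 have b2: "b ^ (2 * L) \<le> exp 3" by simp
  have w0: "W \<phi>0 N (\<lambda>_. 1) 0 \<le> exp 3 * a ^ (N div (2 * L))"
  proof -
    have "W \<phi>0 N (\<lambda>_. 1) 0 \<le> b ^ (2 * L) * a ^ (N div (2 * L))"
      unfolding \<phi>0_def by (rule W_blocks_bound(1)[OF e e0 eb b1 L one a1])
    also have "\<dots> \<le> exp 3 * a ^ (N div (2 * L))" using b2 a1 by (intro mult_right_mono) auto
    finally show ?thesis .
  qed
  have w1: "W \<phi>1 N (\<lambda>_. 1) 0 \<le> exp 3 * a ^ (N div (2 * L))"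
  proof -
    have "W \<phi>1 N (\<lambda>_. 1) 0 \<le> b ^ (3 * L) * a ^ (N div (2 * L))"
      unfolding \<phi>1_def by (rule W_blocks_bound(2)[OF e e0 eb b1 L one a1])
    also have "\<dots> \<le> exp 3 * a ^ (N div (2 * L))" using b3 a1 by (intro mult_right_mono) auto
    finally show ?thesis .
  qed
  have \<phi>b: "bounded_borel (\<phi>0 k)" "bounded_borel (\<phi>1 k)" for k using e by (simp_all add: \<phi>0_def \<phi>1_def)
  let ?A = "\<lambda>\<omega>. \<Prod>k=1..N. \<phi>0 k (0 + S k \<omega>)" and ?B = "\<lambda>\<omega>. \<Prod>k=1..N. \<phi>1 k (0 + S k \<omega>)"
  have iA: "integrable M ?A" using integrable_W[where \<phi>=\<phi>0 and h="\<lambda>_. 1" and x=0, OF \<phi>b(1)] by simp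
  have iB: "integrable M ?B" using integrable_W[where \<phi>=\<phi>1 and h="\<lambda>_. 1" and x=0, OF \<phi>b(2)] by simp
  \<comment> \<open>the two families of blocks are combined by the inequality of arithmetic and geometric means\<close>
  have "(LINT \<omega>|M. exp (\<theta> / 2 * (\<Sum>k=1..N. f (S k \<omega>)))) \<le> (LINT \<omega>|M. (?A \<omega> + ?B \<omega>) / 2)"
  proof (rule integral_mono)
    have le: "exp (\<theta> / 2 * (\<Sum>k=1..N. f (S k \<omega>))) \<le> (?A \<omega> + ?B \<omega>) / 2" for \<omega>
    proof -
      have "?A \<omega> * ?B \<omega> = (\<Prod>k=1..N. e (S k \<omega>))"
        unfolding prod.distrib[symmetric] by (rule prod.cong) (auto simp: \<phi>0_def \<phi>1_def)
      also have "\<dots> = exp (\<theta> * (\<Sum>k=1..N. f (S k \<omega>)))" by (simp add: e_def sum_distrib_left exp_sum)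
      also have "\<dots> = (exp (\<theta> / 2 * (\<Sum>k=1..N. f (S k \<omega>))))\<^sup>2"
        by (simp add: power2_eq_square flip: exp_add)
      finally have "sqrt (?A \<omega> * ?B \<omega>) = exp (\<theta> / 2 * (\<Sum>k=1..N. f (S k \<omega>)))" by simp
      moreover have "0 \<le> ?A \<omega>" "0 \<le> ?B \<omega>" by (auto intro!: prod_nonneg simp: \<phi>0_def \<phi>1_def e0)
      ultimately show ?thesis using arith_geo_mean_sqrt[of "?A \<omega>" "?B \<omega>"] by simp
    qed
    show "integrable M (\<lambda>\<omega>. (?A \<omega> + ?B \<omega>) / 2)" using iA iB by simp
    then show "integrable M (\<lambda>\<omega>. exp (\<theta> / 2 * (\<Sum>k=1..N. f (S k \<omega>))))"
    proof (rule Bochner_Integration.integrable_bound)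
      show "AE \<omega> in M. norm (exp (\<theta> / 2 * (\<Sum>k=1..N. f (S k \<omega>)))) \<le> norm ((?A \<omega> + ?B \<omega>) / 2)"
        using le order_trans[OF le abs_ge_self] by (intro AE_I2) simp
    qed measurable
    show "exp (\<theta> / 2 * (\<Sum>k=1..N. f (S k \<omega>))) \<le> (?A \<omega> + ?B \<omega>) / 2" for \<omega> by (rule le)
  qed
  also have "\<dots> = (W \<phi>0 N (\<lambda>_. 1) 0 + W \<phi>1 N (\<lambda>_. 1) 0) / 2"
    using iA iB by (simp add: W_def)
  also have "\<dots> \<le> exp 3 * a ^ (N div (2 * L))" using w0 w1 by simp
  finally show ?thesis unfolding a_def .
qed

end

text \<open>Scales for the tail estimate: the exponent \<open>s\<close> may grow like a small power of \<open>N\<close>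
  when the block length \<open>L\<close> is of order \<open>N powr \<beta>\<close> with \<open>1 / (2 * (1 + \<delta>)) < \<beta> < 1 / 2\<close>.\<close>

lemma tail_scales:
  fixes \<delta> :: real
  assumes d: "0 < \<delta>"
  obtains \<rho> :: real where "0 < \<rho>" "\<rho> \<le> 1 / 2"
    "\<And>N s. 1 \<le> N \<Longrightarrow> 0 < s \<Longrightarrow> 2 * s \<le> real N powr \<rho> \<Longrightarrow>
       \<exists>L::nat. 1 \<le> L \<and> s * real L \<le> sqrt (real N) \<and> s\<^sup>2 \<le> real L \<and>
         s * sqrt (real N) * real L powr (-(1 + \<delta>)) \<le> 1"
proof -
  have "1 / (2 * (1 + \<delta>)) < 1 / 2" using d by (simp add: field_simps)
  then obtain \<beta> where b: "1 / (2 * (1 + \<delta>)) < \<beta>" "\<beta> < 1 / 2" using dense by blast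
  have pos: "0 < \<beta>" using b(1) d by (smt (verit) divide_pos_pos)
  have b2: "0 < \<beta> * (1 + \<delta>) - 1 / 2" using b(1) d by (simp add: field_simps)
  define \<rho> where "\<rho> = min (1 / 2) (min (1 / 2 - \<beta>) (min (\<beta> / 2) (\<beta> * (1 + \<delta>) - 1 / 2)))"
  have \<rho>: "0 < \<rho>" "\<rho> \<le> 1 / 2" "\<rho> \<le> 1 / 2 - \<beta>" "\<rho> \<le> \<beta> / 2" "\<rho> \<le> \<beta> * (1 + \<delta>) - 1 / 2"
    unfolding \<rho>_def using b pos b2 by linarith+
  show ?thesis
  proof (rule that[OF \<rho>(1,2)])
    fix N :: nat and s :: real
    assume N: "1 \<le> N" and s: "0 < s" "2 * s \<le> real N powr \<rho>"
    define L where "L = Suc (nat \<lfloor>real N powr \<beta>\<rfloor>)"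
    have N1: "1 \<le> real N" using N by simp
    have Lge: "real N powr \<beta> \<le> real L" unfolding L_def by (simp, linarith)
    have Lle: "real L \<le> 2 * real N powr \<beta>"
    proof -
      have "1 \<le> real N powr \<beta>" using N1 pos by (simp add: ge_one_powr_ge_zero)
      moreover have "real L \<le> real N powr \<beta> + 1" unfolding L_def by simp
      ultimately show ?thesis by simp
    qed
    show "\<exists>L::nat. 1 \<le> L \<and> s * real L \<le> sqrt (real N) \<and> s\<^sup>2 \<le> real L \<and>
         s * sqrt (real N) * real L powr (-(1 + \<delta>)) \<le> 1"
    proof (intro exI[of _ L] conjI)
      show "1 \<le> L" by (simp add: L_def)
      have "s * real L \<le> (real N powr \<rho> / 2) * (2 * real N powr \<beta>)"
        using s Lle by (intro mult_mono) auto
      also have "\<dots> = real N powr (\<rho> + \<beta>)" by (simp add: powr_add)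
      also have "\<dots> \<le> real N powr (1 / 2)" using N1 \<rho>(3) by (intro powr_mono) auto
      finally show "s * real L \<le> sqrt (real N)" by (simp add: powr_half_sqrt)
      have "s\<^sup>2 \<le> (real N powr \<rho>)\<^sup>2" using s by (intro power_mono) auto
      also have "\<dots> = real N powr (\<rho> + \<rho>)" unfolding power2_eq_square powr_add ..
      also have "\<dots> \<le> real N powr \<beta>" using N1 \<rho>(4) by (intro powr_mono) auto
      finally show "s\<^sup>2 \<le> real L" using Lge by simp
      have "real L powr (-(1 + \<delta>)) \<le> (real N powr \<beta>) powr (-(1 + \<delta>))"
        using N1 d Lge by (intro powr_mono2') auto
      then have "s * sqrt (real N) * real L powr (-(1 + \<delta>))
          \<le> real N powr \<rho> * real N powr (1 / 2) * (real N powr \<beta>) powr (-(1 + \<delta>))"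
        using s by (intro mult_mono) (auto simp: powr_half_sqrt)
      also have "\<dots> = real N powr (\<rho> + 1 / 2 - \<beta> * (1 + \<delta>))"
        by (simp add: powr_powr algebra_simps flip: powr_add)
      also have "\<dots> \<le> real N powr 0" using N1 \<rho>(5) by (intro powr_mono) auto
      finally show "s * sqrt (real N) * real L powr (-(1 + \<delta>)) \<le> 1" using N1 by simp
    qed
  qed
qed

context circle_walk
begin

definition G :: "nat \<Rightarrow> 'a \<Rightarrow> real \<Rightarrow> real" where
  "G N \<omega> t = sqrt (real N) * (emp X N \<omega> t - t)"

lemma G_eq: assumes "0 \<le> t" shows "G N \<omega> t = 1 / sqrt (real N) * (\<Sum>k=1..N. centered_ind {0..<t} (S k \<omega>))"
proof (cases "N = 0")
  case False
  then have N: "0 < real N" by simp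
  have "(\<Sum>k=1..N. centered_ind {0..<t} (S k \<omega>)) = (\<Sum>k=1..N. indicator {0..<t} (frac (S k \<omega>))) - real N * t"
    using assms by (simp add: centered_ind_eq sum_subtractf)
  also have "\<dots> = real N * (emp X N \<omega> t - t)"
    using N by (simp add: emp_def field_simps)
  finally have *: "(\<Sum>k=1..N. centered_ind {0..<t} (S k \<omega>)) = real N * (emp X N \<omega> t - t)" .
  have "1 / sqrt (real N) * (real N * (emp X N \<omega> t - t)) = (real N / sqrt (real N)) * (emp X N \<omega> t - t)" by simp
  also have "real N / sqrt (real N) = sqrt (real N)" by (rule real_div_sqrt) simp
  finally show ?thesis unfolding * by (simp add: G_def)
qed (simp add: G_def)

lemma G_measurable [measurable]: "(\<lambda>\<omega>. G N \<omega> t) \<in> borel_measurable M"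
  unfolding G_def emp_def by measurable

lemma markov:
  assumes "integrable M u" "\<And>\<omega>. 0 \<le> u \<omega>" "0 < (c::real)"
  shows "measure M {\<omega>\<in>space M. c \<le> u \<omega>} \<le> (LINT \<omega>|M. u \<omega>) / c"
  using integral_Markov_inequality_measure[of M u "{}" c] assms by simp

text \<open>The increment has \<open>L\<^sup>1\<close> norm \<open>O(b - a)\<close> on the circle, and the mean along the walk differs from it by
  at most \<open>O(\<psi> j)\<close>.  Summing over \<open>j\<close>, the second moment of a block of length \<open>L\<close> is of order
  \<open>L * (b - a) + 1\<close>, which is what makes the tails below good on short intervals.\<close>

lemma increment_abs_mean:
  assumes "0 \<le> a" "a \<le> b" "b \<le> 1"
  shows "T j (\<lambda>y. \<bar>centered_ind {0..<b} y - centered_ind {0..<a} y\<bar>) x \<le> 2 * (b - a) + 12 * \<psi> j"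
proof -
  interpret U: prob_space unif by (rule prob_space_unif)
  define g where "g y = (indicator {0..<b} (frac y) - indicator {0..<a} (frac y) + 0 :: real)" for y
  have [measurable]: "g \<in> borel_measurable borel" unfolding g_def by measurable
  have gb: "bounded_borel g" by (rule bounded_borelI[where B=2]) (auto simp: g_def indicator_def)
  have g: "\<bar>centered_ind {0..<b} y - centered_ind {0..<a} y\<bar> \<le> g y + (b - a)" for y
    using assms by (auto simp: centered_ind_eq g_def indicator_def)
  have "circ_bv 4 g" unfolding g_def by (rule circ_bv_increment) (use assms in auto)
  moreover have "periodic1 g" by (simp add: periodic1_def g_def)
  ultimately have "\<bar>T j g x - (LINT u|unif. g u)\<bar> \<le> 3 * 4 * \<psi> j" by (intro T_equidistributes)
  moreover have "(LINT u|unif. g u) = b - a"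
  proof -
    have int: "integrable unif (\<lambda>u. indicator {0..<r} (frac u) :: real)" for r :: real
      by (rule U.integrable_const_bound[where B=1]) auto
    show ?thesis unfolding g_def using assms int by (simp add: indicator_integral_unif)
  qed
  ultimately have Tg: "T j g x \<le> (b - a) + 12 * \<psi> j" by linarith
  have ig: "integrable M (\<lambda>\<omega>. g (x + S j \<omega>))" by (rule integrable_comp_S[OF gb])
  have "T j (\<lambda>y. \<bar>centered_ind {0..<b} y - centered_ind {0..<a} y\<bar>) x \<le> (LINT \<omega>|M. g (x + S j \<omega>) + (b - a))"
    unfolding T_def
  proof (rule integral_mono)
    show "integrable M (\<lambda>\<omega>. \<bar>centered_ind {0..<b} (x + S j \<omega>) - centered_ind {0..<a} (x + S j \<omega>)\<bar>)"
      by (rule integrable_const_bound[where B=1])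
        (use centered_bvD(4)[OF centered_bv_increment[OF assms]] in auto)
    show "integrable M (\<lambda>\<omega>. g (x + S j \<omega>) + (b - a))" using ig by simp
  qed (rule g)
  also have "\<dots> = T j g x + (b - a)" using ig by (simp add: T_def prob_space)
  finally show ?thesis using Tg by simp
qed

text \<open>On intervals of length at most \<open>1 / s\<^sup>2\<close> the variance of \<open>s\<close> times the increment is bounded, and the
  block length can be chosen so that the exponential moment of order \<open>s\<close> is bounded as well, as long
  as \<open>s\<close> is at most a small power of \<open>N\<close>; Markov's inequality does the rest.\<close>

lemma increment_tail:
  obtains C1 \<rho> :: real where "0 \<le> C1" "0 < \<rho>" "\<rho> \<le> 1 / 2"
    "\<And>N a b s \<epsilon>. 1 \<le> N \<Longrightarrow> 0 \<le> a \<Longrightarrow> a \<le> b \<Longrightarrow> b \<le> 1 \<Longrightarrow> 0 < s \<Longrightarrow> 2 * s \<le> real N powr \<rho> \<Longrightarrow>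
       s\<^sup>2 * (b - a) \<le> 1 \<Longrightarrow> measure M {\<omega>\<in>space M. \<epsilon> \<le> \<bar>G N \<omega> b - G N \<omega> a\<bar>} \<le> C1 * exp (- (s * \<epsilon> / 2))"
proof -
  obtain \<rho> :: real where \<rho>: "0 < \<rho>" "\<rho> \<le> 1 / 2"
    and scale: "\<And>N s. 1 \<le> N \<Longrightarrow> 0 < s \<Longrightarrow> 2 * s \<le> real N powr \<rho> \<Longrightarrow>
       \<exists>L::nat. 1 \<le> L \<and> s * real L \<le> sqrt (real N) \<and> s\<^sup>2 \<le> real L \<and>
         s * sqrt (real N) * real L powr (-(1 + \<delta>)) \<le> 1"
    by (rule tail_scales[OF delta_pos]) (rule that)
  obtain C where C: "0 \<le> C" "\<And>k. 1 \<le> k \<Longrightarrow> \<psi> k \<le> C * real k powr (-(1 + \<delta>))" using psi_decay by blast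
  define K1 where "K1 = 2 * (1 + 3 * 4 * psi_total)"
  have K1: "0 \<le> K1" using psi_total_nonneg by (simp add: K1_def)
  define D where "D = 6 * C + K1 * (1 + 6 * psi_total)"
  show ?thesis
  proof (rule that[OF _ \<rho>])
    show "0 \<le> 2 * (exp 3 * exp D)" by simp
    fix N :: nat and a b s \<epsilon> :: real
    assume N: "1 \<le> N" and ab: "0 \<le> a" "a \<le> b" "b \<le> 1" and s: "0 < s" "2 * s \<le> real N powr \<rho>"
      and sab: "s\<^sup>2 * (b - a) \<le> 1"
    obtain L :: nat where L: "1 \<le> L" "s * real L \<le> sqrt (real N)" "s\<^sup>2 \<le> real L"
      "s * sqrt (real N) * real L powr (-(1 + \<delta>)) \<le> 1" using scale[OF N s] by blast
    define f where "f x = centered_ind {0..<b} x - centered_ind {0..<a} x" for x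
    have f: "centered_bv 4 1 f" unfolding f_def by (rule centered_bv_increment[OF ab])
    note fD = centered_bvD[OF f]
    note [measurable] = fD(1)
    define q where "q = sqrt (real N)"
    have q: "0 < q" "q * q = real N" using N by (auto simp: q_def)
    define y where "y = real L powr (-(1 + \<delta>))"
    have Lp: "0 < real L" using L by linarith
    define m where "m = 12 * C * real L * y"
    define v where "v = K1 * (2 * (b - a) * real L + 12 * psi_total)"
    have mean: "\<bar>\<Sum>k=L+1..2*L. T k f x\<bar> \<le> m" for x
    proof -
      have "\<bar>T k f x\<bar> \<le> 12 * C * y" if "k \<in> {L+1..2*L}" for k
      proof -
        have "\<psi> k \<le> C * real k powr (-(1 + \<delta>))" using that by (intro C) auto
        also have "\<dots> \<le> C * y" unfolding y_def
          using that Lp delta_pos C by (intro mult_left_mono powr_mono2') auto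
        finally show ?thesis using T_centered[OF f, of k x] by simp
      qed
      then have "(\<Sum>k=L+1..2*L. \<bar>T k f x\<bar>) \<le> real (card {L+1..2*L}) * (12 * C * y)"
        by (rule sum_bounded_above)
      then show ?thesis unfolding m_def by (intro order_trans[OF sum_abs]) (simp add: mult_ac)
    qed
    have var: "(LINT \<omega>|M. (\<Sum>k=L+1..2*L. f (x + S k \<omega>))\<^sup>2) \<le> v" for x
    proof -
      have "(LINT \<omega>|M. (\<Sum>k=L+1..2*L. f (x + S k \<omega>))\<^sup>2) \<le> K1 * (\<Sum>j=L+1..2*L. T j (\<lambda>y. \<bar>f y\<bar>) x)"
        unfolding K1_def using second_moment_bound[OF f, of "{L+1..2*L}" x] by simp
      also have "(\<Sum>j=L+1..2*L. T j (\<lambda>y. \<bar>f y\<bar>) x) \<le> (\<Sum>j=L+1..2*L. 2 * (b - a) + 12 * \<psi> j)"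
        unfolding f_def by (intro sum_mono increment_abs_mean ab)
      also have "\<dots> = 2 * (b - a) * real L + 12 * (\<Sum>j=L+1..2*L. \<psi> j)"
        by (simp add: sum.distrib sum_distrib_left)
      also have "\<dots> \<le> 2 * (b - a) * real L + 12 * psi_total"
        by (intro add_left_mono mult_left_mono sum_psi_le) auto
      finally show ?thesis using K1 by (simp add: v_def mult_left_mono)
    qed
    have nb: "real (N div (2 * L)) * (2 * real L) \<le> q * q"
    proof -
      have "N div (2 * L) * (2 * L) \<le> N" by simp
      then show ?thesis unfolding q(2) by (metis of_nat_le_iff of_nat_mult of_nat_numeral)
    qed
    have expo: "real (N div (2 * L)) * (s / q * m + (s / q)\<^sup>2 * v) \<le> D"
    proof -
      have "real (N div (2 * L)) * (s / q * m) = (real (N div (2 * L)) * (2 * real L)) * (s / q * (6 * C * y))"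
        by (simp add: m_def)
      also have "\<dots> \<le> (q * q) * (s / q * (6 * C * y))"
        using s q C by (intro mult_right_mono nb) (auto simp: y_def)
      also have "\<dots> = 6 * C * (s * q * y)" using q(1) by simp
      also have "\<dots> \<le> 6 * C * 1" using L(4) C by (intro mult_left_mono) (auto simp: q_def y_def)
      finally have 1: "real (N div (2 * L)) * (s / q * m) \<le> 6 * C" by simp
      have "real (N div (2 * L)) * ((s / q)\<^sup>2 * v)
         = (real (N div (2 * L)) * (2 * real L)) * ((s / q)\<^sup>2 * K1 * ((b - a) + 6 * psi_total / real L))"
      proof -
        have "v = 2 * real L * (K1 * ((b - a) + 6 * psi_total / real L))"
          using Lp by (simp add: v_def distrib_left)
        then show ?thesis by simp
      qed
      also have "\<dots> \<le> (q * q) * ((s / q)\<^sup>2 * K1 * ((b - a) + 6 * psi_total / real L))"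
        using ab K1 psi_total_nonneg by (intro mult_right_mono nb) auto
      also have "\<dots> = K1 * (s\<^sup>2 * (b - a) + 6 * psi_total * (s\<^sup>2 / real L))"
        using q(1) by (simp add: power_divide power2_eq_square field_simps)
      also have "\<dots> \<le> K1 * (1 + 6 * psi_total * 1)"
        using sab L(3) Lp K1 psi_total_nonneg by (intro mult_left_mono add_mono) auto
      finally show ?thesis using 1 by (simp add: D_def distrib_left)
    qed
    have one: "measure M {\<omega>\<in>space M. \<epsilon> \<le> \<sigma> * (G N \<omega> b - G N \<omega> a)} \<le> exp 3 * exp D * exp (- (s * \<epsilon> / 2))"
      if \<sigma>: "\<bar>\<sigma>\<bar> = 1" for \<sigma> :: real
    proof -
      define \<theta> where "\<theta> = \<sigma> * (s / q)"
      have \<theta>: "\<bar>\<theta>\<bar> = s / q" using \<sigma> s q by (simp add: \<theta>_def abs_mult)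
      then have \<theta>2: "\<theta>\<^sup>2 = (s / q)\<^sup>2" by (metis power2_abs)
      have \<theta>L: "\<bar>\<theta>\<bar> * real L \<le> 1" unfolding \<theta> using L(2) q(1) by (simp add: q_def field_simps)
      define u where "u \<omega> = exp (\<theta> / 2 * (\<Sum>k=1..N. f (S k \<omega>)))" for \<omega>
      have ub: "\<bar>\<theta> / 2 * (\<Sum>k=1..N. f (S k \<omega>))\<bar> \<le> \<bar>\<theta> / 2\<bar> * real N" for \<omega>
      proof -
        have "\<bar>\<Sum>k=1..N. f (S k \<omega>)\<bar> \<le> real N"
          using sum_bounded_above[of "{1..N}" "\<lambda>k. \<bar>f (S k \<omega>)\<bar>" 1] fD(4)
          by (intro order_trans[OF sum_abs]) simp
        then show ?thesis unfolding abs_mult by (rule mult_left_mono) simp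
      qed
      have iu: "integrable M u"
      proof (rule integrable_const_bound[where B="exp (\<bar>\<theta> / 2\<bar> * real N)"])
        show "AE \<omega> in M. norm (u \<omega>) \<le> exp (\<bar>\<theta> / 2\<bar> * real N)"
          using ub unfolding u_def abs_le_iff by (intro AE_I2) simp
      qed (unfold u_def, measurable)
      have "(LINT \<omega>|M. u \<omega>) \<le> exp 3 * exp (\<bar>\<theta>\<bar> * m + \<theta>\<^sup>2 * v) ^ (N div (2 * L))"
        unfolding u_def by (rule exp_moment_bound[OF f L(1) \<theta>L mean var])
      also have "\<dots> \<le> exp 3 * exp D"
        unfolding exp_of_nat_mult[symmetric] \<theta> \<theta>2 using expo by simp
      finally have Eu: "(LINT \<omega>|M. u \<omega>) \<le> exp 3 * exp D" .
      have "G N \<omega> b - G N \<omega> a = 1 / q * (\<Sum>k=1..N. f (S k \<omega>))" for \<omega>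
        using ab unfolding f_def q_def by (simp add: G_eq sum_subtractf right_diff_distrib diff_divide_distrib)
      then have "\<theta> / 2 * (\<Sum>k=1..N. f (S k \<omega>)) = s / 2 * (\<sigma> * (G N \<omega> b - G N \<omega> a))" for \<omega>
        by (simp add: \<theta>_def mult_ac)
      then have "{\<omega>\<in>space M. \<epsilon> \<le> \<sigma> * (G N \<omega> b - G N \<omega> a)} = {\<omega>\<in>space M. exp (s * \<epsilon> / 2) \<le> u \<omega>}"
        using s unfolding u_def by auto
      also have "measure M \<dots> \<le> (LINT \<omega>|M. u \<omega>) / exp (s * \<epsilon> / 2)"
        by (rule markov[OF iu]) (auto simp: u_def)
      also have "\<dots> \<le> (exp 3 * exp D) / exp (s * \<epsilon> / 2)" using Eu by (intro divide_right_mono) auto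
      finally show ?thesis by (simp add: exp_minus field_simps)
    qed
    have "{\<omega>\<in>space M. \<epsilon> \<le> \<bar>G N \<omega> b - G N \<omega> a\<bar>}
        \<subseteq> {\<omega>\<in>space M. \<epsilon> \<le> 1 * (G N \<omega> b - G N \<omega> a)} \<union> {\<omega>\<in>space M. \<epsilon> \<le> (-1) * (G N \<omega> b - G N \<omega> a)}"
      by auto
    then have "measure M {\<omega>\<in>space M. \<epsilon> \<le> \<bar>G N \<omega> b - G N \<omega> a\<bar>}
       \<le> measure M ({\<omega>\<in>space M. \<epsilon> \<le> 1 * (G N \<omega> b - G N \<omega> a)} \<union> {\<omega>\<in>space M. \<epsilon> \<le> (-1) * (G N \<omega> b - G N \<omega> a)})"
      by (rule finite_measure_mono) measurable
    also have "\<dots> \<le> measure M {\<omega>\<in>space M. \<epsilon> \<le> 1 * (G N \<omega> b - G N \<omega> a)} + measure M {\<omega>\<in>space M. \<epsilon> \<le> (-1) * (G N \<omega> b - G N \<omega> a)}"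
      by (rule measure_Un_le) measurable
    also have "\<dots> \<le> 2 * (exp 3 * exp D) * exp (- (s * \<epsilon> / 2))"
      using one[of 1] one[of "-1"] by simp
    finally show "measure M {\<omega>\<in>space M. \<epsilon> \<le> \<bar>G N \<omega> b - G N \<omega> a\<bar>} \<le> 2 * (exp 3 * exp D) * exp (- (s * \<epsilon> / 2))" .
  qed
qed

end

text \<open>Dyadic chaining: a point of level \<open>r\<close> is reached from its level \<open>m\<close> ancestor by at most
  one step on every intermediate level.\<close>

lemma dyadic_chaining:
  fixes F :: "real \<Rightarrow> real" and \<epsilon> :: "nat \<Rightarrow> real"
  assumes inc: "\<And>q i. m < q \<Longrightarrow> q \<le> R \<Longrightarrow> i < 2 ^ q \<Longrightarrow> \<bar>F (real (Suc i) / 2 ^ q) - F (real i / 2 ^ q)\<bar> \<le> \<epsilon> q"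
    and "m \<le> r" "r \<le> R" "i \<le> 2 ^ r"
  shows "\<bar>F (real i / 2 ^ r) - F (real (i div 2 ^ (r - m)) / 2 ^ m)\<bar> \<le> (\<Sum>q\<in>{m<..r}. \<epsilon> q)"
  using \<open>m \<le> r\<close> assms(3,4)
proof (induction r arbitrary: i rule: dec_induct)
  case base then show ?case by simp
next
  case (step r)
  define j where "j = i div 2"
  have j: "j \<le> 2 ^ r" using step.prems unfolding j_def by simp
  have e0: "0 \<le> \<epsilon> (Suc r)"
    by (rule order_trans[OF abs_ge_zero inc[of "Suc r" 0]]) (use step.hyps step.prems in auto)
  have half: "real (2 * k) / 2 ^ Suc r = real k / 2 ^ r" for k :: nat by simp
  have one: "\<bar>F (real i / 2 ^ Suc r) - F (real j / 2 ^ r)\<bar> \<le> \<epsilon> (Suc r)"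
  proof (cases "even i")
    case True
    then have "i = 2 * j" by (simp add: j_def)
    then show ?thesis using half[of j] e0 by simp
  next
    case False
    then have i: "i = Suc (2 * j)" by (simp add: j_def)
    then have "2 * j < 2 ^ Suc r" using step.prems by simp
    from inc[OF _ _ this] show ?thesis unfolding i half[of j, symmetric]
      using step.hyps step.prems by simp
  qed
  have A: "i div 2 ^ (Suc r - m) = j div 2 ^ (r - m)"
    using step.hyps by (simp add: j_def Suc_diff_le div_mult2_eq)
  have B: "\<bar>F (real j / 2 ^ r) - F (real (j div 2 ^ (r - m)) / 2 ^ m)\<bar> \<le> (\<Sum>q\<in>{m<..r}. \<epsilon> q)"
    by (rule step.IH) (use step.prems j in auto)
  have C: "(\<Sum>q\<in>{m<..Suc r}. \<epsilon> q) = (\<Sum>q\<in>{m<..r}. \<epsilon> q) + \<epsilon> (Suc r)"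
  proof -
    have "{m<..Suc r} = insert (Suc r) {m<..r}" using step.hyps by auto
    then show ?thesis by simp
  qed
  show ?case unfolding A C using B one by linarith
qed

definition grid :: "nat \<Rightarrow> real \<Rightarrow> real" where
  "grid m t = real (nat \<lfloor>2 ^ m * t\<rfloor>) / 2 ^ m"

lemma grid_props:
  assumes "0 \<le> t" "t \<le> 1"
  shows "nat \<lfloor>2 ^ m * t\<rfloor> \<le> 2 ^ m" "0 \<le> grid m t" "grid m t \<le> t" "t < grid m t + 1 / 2 ^ m"
proof -
  have 0: "0 \<le> 2 ^ m * t" "2 ^ m * t \<le> 2 ^ m * 1" using assms by auto
  have r: "real (nat \<lfloor>2 ^ m * t\<rfloor>) \<le> 2 ^ m * t" "2 ^ m * t < real (nat \<lfloor>2 ^ m * t\<rfloor>) + 1"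
    using 0(1) by auto
  have "\<lfloor>2 ^ m * t\<rfloor> \<le> \<lfloor>2 ^ m :: real\<rfloor>" using 0 by (intro floor_mono) simp
  also have "\<lfloor>2 ^ m :: real\<rfloor> = 2 ^ m" by (metis floor_of_int of_int_numeral of_int_power)
  finally show "nat \<lfloor>2 ^ m * t\<rfloor> \<le> 2 ^ m" by (simp add: nat_le_iff)
  show "0 \<le> grid m t" by (simp add: grid_def)
  show "grid m t \<le> t" "t < grid m t + 1 / 2 ^ m"
    using r by (simp_all add: grid_def field_simps)
qed

lemma grid_div:
  fixes t :: real
  assumes "m \<le> r" "0 \<le> t"
  shows "nat \<lfloor>2 ^ m * t\<rfloor> = nat \<lfloor>2 ^ r * t\<rfloor> div 2 ^ (r - m)"
proof -
  have "(2::real) ^ r = 2 ^ m * 2 ^ (r - m)" using assms by (simp flip: power_add)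
  then have "2 ^ m * t = (2 ^ r * t) / real (2 ^ (r - m))" by simp
  then have "\<lfloor>2 ^ m * t\<rfloor> = \<lfloor>2 ^ r * t\<rfloor> div int (2 ^ (r - m))"
    using floor_divide_real_eq_div[of "int (2 ^ (r - m))" "2 ^ r * t"] by simp
  then show ?thesis using assms by (simp add: nat_div_distrib nat_power_eq)
qed

context circle_walk
begin

lemma emp_mono: "s \<le> t \<Longrightarrow> emp X N \<omega> s \<le> emp X N \<omega> t"
  unfolding emp_def by (intro mult_left_mono sum_mono) (auto simp: indicator_def)

text \<open>Within a cell of level \<open>R\<close> chaining is replaced by the monotonicity of the empirical
  distribution function: \<open>G\<close> cannot deviate by more than its increment over the cell and the
  increment of \<open>sqrt N * t\<close>.\<close>

lemma G_below_grid:
  assumes t: "0 \<le> t" "t \<le> 1"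
    and inc: "\<And>i. i < 2 ^ R \<Longrightarrow> \<bar>G N \<omega> (real (Suc i) / 2 ^ R) - G N \<omega> (real i / 2 ^ R)\<bar> \<le> e"
    and e: "0 \<le> e"
  shows "\<bar>G N \<omega> t - G N \<omega> (grid R t)\<bar> \<le> e + sqrt (real N) / 2 ^ R"
proof -
  define i where "i = nat \<lfloor>2 ^ R * t\<rfloor>"
  define u where "u = real i / 2 ^ R"
  have u: "grid R t = u" by (simp add: grid_def u_def i_def)
  have ut: "u \<le> t" "t < u + 1 / 2 ^ R" using grid_props(3,4)[OF t, of R] by (simp_all add: u)
  have q: "0 \<le> sqrt (real N)" by simp
  show ?thesis
  proof (cases "i < 2 ^ R")
    case True
    have u': "real (Suc i) / 2 ^ R = u + 1 / 2 ^ R" by (simp add: u_def add_divide_distrib)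
    have "sqrt (real N) * emp X N \<omega> u \<le> sqrt (real N) * emp X N \<omega> t"
      "sqrt (real N) * emp X N \<omega> t \<le> sqrt (real N) * emp X N \<omega> (u + 1 / 2 ^ R)"
      using ut by (auto intro!: mult_left_mono emp_mono)
    moreover have "sqrt (real N) * u \<le> sqrt (real N) * t" "sqrt (real N) * t \<le> sqrt (real N) * (u + 1 / 2 ^ R)"
      using ut by (auto intro!: mult_left_mono)
    moreover have "sqrt (real N) * (u + 1 / 2 ^ R) = sqrt (real N) * u + sqrt (real N) / 2 ^ R"
      by (simp add: distrib_left)
    moreover have "\<bar>G N \<omega> (u + 1 / 2 ^ R) - G N \<omega> u\<bar> \<le> e"
      using inc[OF True] unfolding u' u_def[symmetric] .
    ultimately show ?thesis unfolding u G_def right_diff_distrib by linarith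
  next
    case False
    then have "i = 2 ^ R" using grid_props(1)[OF t, of R] by (simp add: i_def)
    then have "u = 1" by (simp add: u_def)
    then have "t = u" using ut t by simp
    then show ?thesis unfolding u using e by simp
  qed
qed

lemma geometric_superexp:
  fixes \<rho> C1 :: real
  assumes "0 < \<rho>"
  shows "summable (\<lambda>r::nat. 2 ^ r * (C1 * exp (- (2 powr (\<rho> * real r / 2) / 4))))"
proof -
  have "(\<lambda>r::nat. 4 ^ r * exp (- (2 powr (\<rho> * real r / 2) / 4))) \<longlonglongrightarrow> 0"
    using assms by real_asymp
  then have "eventually (\<lambda>r::nat. norm (4 ^ r * exp (- (2 powr (\<rho> * real r / 2) / 4))) < 1) sequentially"
    by (auto simp: tendsto_iff dist_norm)
  then have ev: "eventually (\<lambda>r::nat. norm (2 ^ r * exp (- (2 powr (\<rho> * real r / 2) / 4))) \<le> (1 / 2) ^ r) sequentially"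
  proof eventually_elim
    case (elim r)
    have "(4::real) ^ r = 2 ^ r * 2 ^ r" by (simp flip: power_mult_distrib)
    with elim have "2 ^ r * (2 ^ r * exp (- (2 powr (\<rho> * real r / 2) / 4))) < 1" by (simp add: mult.assoc)
    then show ?case by (simp add: power_divide field_simps)
  qed
  have "summable (\<lambda>r::nat. 2 ^ r * exp (- (2 powr (\<rho> * real r / 2) / 4)))"
    by (rule summable_comparison_test_ev[OF ev]) (rule summable_geometric, simp)
  from summable_mult[OF this, of C1] show ?thesis by (simp add: mult_ac)
qed

lemma tail_sum_tendsto_0:
  fixes a :: "nat \<Rightarrow> real"
  assumes a: "summable a" and pos: "\<And>n. 0 \<le> a n"
  obtains \<tau> where "\<tau> \<longlonglongrightarrow> 0" "\<And>m R. (\<Sum>r\<in>{m<..R}. a r) \<le> \<tau> m"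
proof -
  define \<tau> where "\<tau> m = (\<Sum>k. a (k + Suc m))" for m
  have "(\<lambda>n. \<Sum>k. a (k + n)) \<longlonglongrightarrow> 0" by (rule suminf_exist_split2[OF a])
  then have "\<tau> \<longlonglongrightarrow> 0" unfolding \<tau>_def by (rule LIMSEQ_Suc)
  moreover have "(\<Sum>r\<in>{m<..R}. a r) \<le> \<tau> m" for m R
  proof -
    have "(\<Sum>r\<in>{m<..R}. a r) = (\<Sum>k<R - m. a (k + Suc m))"
      by (rule sum.reindex_bij_witness[where i="\<lambda>k. k + Suc m" and j="\<lambda>r. r - Suc m"]) auto
    also have "\<dots> \<le> \<tau> m"
      unfolding \<tau>_def using a pos summable_ignore_initial_segment[OF a, of "Suc m"]
      by (intro sum_le_suminf) auto
    finally show ?thesis .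
  qed
  ultimately show ?thesis by (rule that)
qed

text \<open>On the dyadic level \<open>r\<close> there are \<open>2 ^ r\<close> increments.  With allowed size \<open>\<epsilon> r = 2 powr (- \<rho> * r / 2)\<close>,
  which is summable, and tail rate \<open>s r\<close> of order \<open>2 powr (\<rho> * r)\<close>, which the tail estimate permits as
  long as \<open>2 ^ r \<le> N\<close>, the probability that some increment is too large is at most
  \<open>2 ^ r * exp (- c * 2 powr (\<rho> * r / 2))\<close> up to a constant, again summable.  Chaining ends at the
  level \<open>R\<close> with \<open>2 ^ R \<le> N < 2 ^ Suc R\<close>, where monotonicity bounds the rest of
  the deviation by \<open>2 / sqrt N\<close>.\<close>

theorem tightness:
  obtains \<tau> \<eta> :: "nat \<Rightarrow> real" where "\<tau> \<longlonglongrightarrow> 0" "\<eta> \<longlonglongrightarrow> 0" "\<And>m. 0 \<le> \<eta> m"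
    "\<And>m N. 2 ^ Suc m \<le> N \<Longrightarrow> \<exists>A\<in>sets M. measure M A \<le> \<tau> m \<and>
       (\<forall>\<omega>\<in>space M - A. \<forall>t\<in>{0..1}. \<bar>G N \<omega> t - G N \<omega> (grid m t)\<bar> \<le> \<eta> m + 2 / sqrt (real N))"
proof -
  obtain C1 \<rho> :: real where C1: "0 \<le> C1" and \<rho>: "0 < \<rho>" "\<rho> \<le> 1 / 2"
    and tail: "\<And>N a b s \<epsilon>. 1 \<le> N \<Longrightarrow> 0 \<le> a \<Longrightarrow> a \<le> b \<Longrightarrow> b \<le> 1 \<Longrightarrow> 0 < s \<Longrightarrow> 2 * s \<le> real N powr \<rho> \<Longrightarrow>
       s\<^sup>2 * (b - a) \<le> 1 \<Longrightarrow> measure M {\<omega>\<in>space M. \<epsilon> \<le> \<bar>G N \<omega> b - G N \<omega> a\<bar>} \<le> C1 * exp (- (s * \<epsilon> / 2))"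
    by (rule increment_tail) (rule that)
  define s where "s r = 2 powr (\<rho> * real r) / 2" for r :: nat
  define \<epsilon> where "\<epsilon> r = 2 powr (- (\<rho> * real r / 2))" for r :: nat
  have s0: "0 < s r" for r by (simp add: s_def)
  have \<epsilon>0: "0 \<le> \<epsilon> r" for r by (simp add: \<epsilon>_def)
  have s\<epsilon>: "s r * \<epsilon> r / 2 = 2 powr (\<rho> * real r / 2) / 4" for r
    unfolding s_def \<epsilon>_def by (simp flip: powr_add)
  obtain \<tau> where \<tau>: "\<tau> \<longlonglongrightarrow> 0"
    "\<And>m R. (\<Sum>r\<in>{m<..R}. 2 ^ r * (C1 * exp (- (2 powr (\<rho> * real r / 2) / 4)))) \<le> \<tau> m"
    using tail_sum_tendsto_0[OF geometric_superexp[OF \<rho>(1), of C1]] C1 by auto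
  have "summable \<epsilon>"
  proof -
    have "\<epsilon> = (\<lambda>r. (2 powr (- (\<rho> / 2))) ^ r)"
    proof
      fix r
      show "\<epsilon> r = (2 powr (- (\<rho> / 2))) ^ r"
      unfolding \<epsilon>_def by (simp add: powr_powr mult.commute flip: powr_realpow)
    qed
    moreover have "(2::real) powr (- (\<rho> / 2)) < 1" using \<rho> powr_less_mono[of "- (\<rho> / 2)" 0 2] by simp
    ultimately show ?thesis by (simp add: summable_geometric)
  qed
  then obtain \<eta> where \<eta>: "\<eta> \<longlonglongrightarrow> 0" "\<And>m R. (\<Sum>r\<in>{m<..R}. \<epsilon> r) \<le> \<eta> m"
    using tail_sum_tendsto_0[of \<epsilon>] \<epsilon>0 by blast
  have \<eta>0: "0 \<le> \<eta> m" for m using \<eta>(2)[of m m] by simp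
  show ?thesis
  proof (rule that[of \<tau> "\<lambda>m. 2 * \<eta> m"])
    show "\<tau> \<longlonglongrightarrow> 0" by fact
    show "(\<lambda>m. 2 * \<eta> m) \<longlonglongrightarrow> 0" using tendsto_mult_left[OF \<eta>(1), of 2] by simp
    show "0 \<le> 2 * \<eta> m" for m using \<eta>0 by simp
    fix m N :: nat assume N: "2 ^ Suc m \<le> N"
    define R where "R = floor_log N"
    have N1: "1 \<le> N" using N by (metis le_trans one_le_numeral one_le_power)
    have R: "2 ^ R \<le> N" "N < 2 ^ Suc R"
      unfolding R_def using N1 floor_log_exp2_le[of N] floor_log_exp2_gt[of N] by auto
    have mR: "m < R"
    proof -
      have "(2::nat) ^ Suc m < 2 ^ Suc R" using N R by linarith
      then show ?thesis by simp
    qed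
    define D where "D r i = {\<omega>\<in>space M. \<epsilon> r \<le> \<bar>G N \<omega> (real (Suc i) / 2 ^ r) - G N \<omega> (real i / 2 ^ r)\<bar>}" for r i :: nat
    have Dm: "D r i \<in> sets M" for r i unfolding D_def by measurable
    have D: "measure M (D r i) \<le> C1 * exp (- (2 powr (\<rho> * real r / 2) / 4))"
      if "r \<in> {m<..R}" "i < 2 ^ r" for r i
    proof -
      have "(2::real) ^ r \<le> 2 ^ R" using that by (intro power_increasing) auto
      also have "\<dots> \<le> real N" using R(1) by (metis of_nat_le_iff of_nat_numeral of_nat_power)
      finally have "(2 ^ r) powr \<rho> \<le> real N powr \<rho>" using \<rho> by (intro powr_mono2) auto
      then have 1: "2 * s r \<le> real N powr \<rho>" unfolding s_def
        by (simp add: powr_powr mult.commute flip: powr_realpow)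
      have "(s r)\<^sup>2 \<le> 2 powr (\<rho> * real r) * 2 powr (\<rho> * real r)"
        unfolding s_def power2_eq_square by (intro mult_mono) auto
      also have "\<dots> = 2 powr (2 * \<rho> * real r)" by (simp add: mult.assoc flip: powr_add)
      also have "\<dots> \<le> 2 powr (real r)" using \<rho> by (intro powr_mono mult_left_le_one_le) auto
      finally have 2: "(s r)\<^sup>2 \<le> 2 ^ r" by (simp add: powr_realpow)
      have 3: "real (Suc i) / 2 ^ r - real i / 2 ^ r = 1 / 2 ^ r" by (simp add: diff_divide_distrib[symmetric])
      have 4: "real (Suc i) \<le> 2 ^ r" using that(2)
        by (metis Suc_leI of_nat_le_iff of_nat_numeral of_nat_power)
      have 5: "(s r)\<^sup>2 * (real (Suc i) / 2 ^ r - real i / 2 ^ r) \<le> 1" unfolding 3 using 2 by simp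
      have 6: "real (Suc i) / 2 ^ r \<le> 1" using 4 by simp
      show ?thesis unfolding D_def s\<epsilon>[symmetric]
        by (rule tail[OF N1 _ _ 6 s0 1 5]) (auto intro: divide_right_mono)
    qed
    define A where "A = (\<Union>r\<in>{m<..R}. \<Union>i<2 ^ r. D r i)"
    have "measure M A \<le> (\<Sum>r\<in>{m<..R}. measure M (\<Union>i<2 ^ r. D r i))"
      unfolding A_def by (rule finite_measure_subadditive_finite) (use Dm in auto)
    also have "\<dots> \<le> (\<Sum>r\<in>{m<..R}. \<Sum>i<2 ^ r. measure M (D r i))"
      by (intro sum_mono finite_measure_subadditive_finite) (use Dm in auto)
    also have "\<dots> \<le> (\<Sum>r\<in>{m<..R}. \<Sum>i<(2::nat) ^ r. C1 * exp (- (2 powr (\<rho> * real r / 2) / 4)))"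
      by (intro sum_mono D) auto
    also have "\<dots> = (\<Sum>r\<in>{m<..R}. 2 ^ r * (C1 * exp (- (2 powr (\<rho> * real r / 2) / 4))))" by simp
    also have "\<dots> \<le> \<tau> m" by (rule \<tau>(2))
    finally have PA: "measure M A \<le> \<tau> m" .
    have "\<bar>G N \<omega> t - G N \<omega> (grid m t)\<bar> \<le> 2 * \<eta> m + 2 / sqrt (real N)"
      if \<omega>: "\<omega> \<in> space M - A" and t: "t \<in> {0..1}" for \<omega> t
    proof -
      have inc: "\<bar>G N \<omega> (real (Suc i) / 2 ^ q) - G N \<omega> (real i / 2 ^ q)\<bar> \<le> \<epsilon> q"
        if "m < q" "q \<le> R" "i < 2 ^ q" for q i
      proof -
        have "\<omega> \<notin> D q i" using \<omega> that unfolding A_def by auto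
        with \<omega> show ?thesis unfolding D_def by simp
      qed
      have t': "0 \<le> t" "t \<le> 1" using t by auto
      have "\<epsilon> R \<le> \<eta> m"
      proof -
        have "\<epsilon> R \<le> (\<Sum>r\<in>{m<..R}. \<epsilon> r)" using mR \<epsilon>0 by (intro member_le_sum) auto
        then show ?thesis using \<eta>(2)[of m R] by simp
      qed
      moreover have "\<bar>G N \<omega> t - G N \<omega> (grid R t)\<bar> \<le> \<epsilon> R + sqrt (real N) / 2 ^ R"
        by (rule G_below_grid[OF t' _ \<epsilon>0]) (use inc mR in auto)
      moreover have "sqrt (real N) / 2 ^ R \<le> 2 / sqrt (real N)"
      proof -
        have "real N \<le> real (2 ^ Suc R)" using R(2) by (simp only: of_nat_le_iff)
        then have "sqrt (real N) * sqrt (real N) \<le> 2 * 2 ^ R" by simp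
        then show ?thesis using N1 by (simp add: field_simps)
      qed
      moreover have "\<bar>G N \<omega> (grid R t) - G N \<omega> (grid m t)\<bar> \<le> \<eta> m"
      proof -
        have "\<bar>G N \<omega> (real (nat \<lfloor>2 ^ R * t\<rfloor>) / 2 ^ R) - G N \<omega> (real (nat \<lfloor>2 ^ R * t\<rfloor> div 2 ^ (R - m)) / 2 ^ m)\<bar> \<le> (\<Sum>q\<in>{m<..R}. \<epsilon> q)"
          by (rule dyadic_chaining[OF inc]) (use mR grid_props(1)[OF t', of R] in auto)
        then show ?thesis
          using \<eta>(2)[of m R] mR t' unfolding grid_def grid_div[OF less_imp_le[OF mR] t'(1)] by linarith
      qed
      ultimately show ?thesis by linarith
    qed
    with PA Dm show "\<exists>A\<in>sets M. measure M A \<le> \<tau> m \<and>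
       (\<forall>\<omega>\<in>space M - A. \<forall>t\<in>{0..1}. \<bar>G N \<omega> t - G N \<omega> (grid m t)\<bar> \<le> 2 * \<eta> m + 2 / sqrt (real N))"
      unfolding A_def by (intro bexI[of _ A]) (auto simp: A_def)
  qed
qed

end

section \<open>Convergence of finite-dimensional functionals\<close>

lemma gaussian_integrable:
  assumes "prob_space P" and Y[measurable]: "Y \<in> borel_measurable P" and g: "gaussian_distr (distr P borel Y)"
  shows "integrable P Y" "integrable P (\<lambda>\<omega>. (Y \<omega>)\<^sup>2)"
proof -
  interpret prob_space P by fact
  have "integrable P Y \<and> integrable P (\<lambda>\<omega>. (Y \<omega>)\<^sup>2)"
  proof -
    consider m where "distr P borel Y = return borel m"
      | m \<sigma> where "\<sigma> > 0" "distr P borel Y = density lborel (\<lambda>x. ennreal (normal_density m \<sigma> x))"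
      using g unfolding gaussian_distr_def by blast
    then show ?thesis
    proof cases
      case 1
      have "AE x in distr P borel Y. x = m" unfolding 1 by (subst AE_return) auto
      then have ae: "AE \<omega> in P. Y \<omega> = m" by (subst (asm) AE_distr_iff) auto
      have "integrable P Y"
        by (rule integrable_const_bound[where B="\<bar>m\<bar>"]) (use ae in \<open>auto elim: eventually_mono\<close>)
      moreover have "integrable P (\<lambda>\<omega>. (Y \<omega>)\<^sup>2)"
        by (rule integrable_const_bound[where B="m\<^sup>2"]) (use ae in \<open>auto elim: eventually_mono\<close>)
      ultimately show ?thesis ..
    next
      case 2
      then have D: "distributed P lborel Y (normal_density m \<sigma>)"
        unfolding distributed_def by (simp cong: distr_cong)
      have i: "integrable P (\<lambda>\<omega>. (Y \<omega> - m) ^ k)" for k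
        using integrable_normal_moment[OF 2(1), of m k]
        by (subst distributed_integrable[OF D, symmetric]) auto
      have "integrable P (\<lambda>\<omega>. (Y \<omega> - m) + m)"
        using i[of 1] by (intro Bochner_Integration.integrable_add) auto
      moreover have "integrable P (\<lambda>\<omega>. (Y \<omega> - m)\<^sup>2 + 2 * m * (Y \<omega> - m) + m\<^sup>2)"
        using i[of 1] i[of 2] by (intro Bochner_Integration.integrable_add integrable_mult_right) auto
      moreover have "(Y \<omega> - m)\<^sup>2 + 2 * m * (Y \<omega> - m) + m\<^sup>2 = (Y \<omega>)\<^sup>2" for \<omega>
        by (simp add: power2_eq_square algebra_simps)
      ultimately show ?thesis by simp
    qed
  qed
  then show "integrable P Y" "integrable P (\<lambda>\<omega>. (Y \<omega>)\<^sup>2)" by auto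
qed

text \<open>Point masses count as normal distributions; a centered one is the point mass at 0.\<close>

lemma gaussian_centered_cases:
  assumes "prob_space P" and Y[measurable]: "Y \<in> borel_measurable P" and g: "gaussian_distr (distr P borel Y)"
    and mean: "(LINT \<omega>|P. Y \<omega>) = 0"
  shows "(AE \<omega> in P. Y \<omega> = 0) \<and> (LINT \<omega>|P. (Y \<omega>)\<^sup>2) = 0 \<or>
    (\<exists>\<sigma>>0. distributed P lborel Y (normal_density 0 \<sigma>) \<and> (LINT \<omega>|P. (Y \<omega>)\<^sup>2) = \<sigma>\<^sup>2)"
proof -
  interpret prob_space P by fact
  consider m where "distr P borel Y = return borel m"
    | m \<sigma> where "\<sigma> > 0" "distr P borel Y = density lborel (\<lambda>x. ennreal (normal_density m \<sigma> x))"
    using g unfolding gaussian_distr_def by blast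
  then show ?thesis
  proof cases
    case 1
    have "AE x in distr P borel Y. x = m" unfolding 1 by (subst AE_return) auto
    then have ae: "AE \<omega> in P. Y \<omega> = m" by (subst (asm) AE_distr_iff) auto
    have "(LINT \<omega>|P. Y \<omega>) = (LINT \<omega>|P. m)" by (rule integral_cong_AE) (use ae in auto)
    with mean have "m = 0" by (simp add: prob_space)
    with ae have ae0: "AE \<omega> in P. Y \<omega> = 0" by simp
    have "(LINT \<omega>|P. (Y \<omega>)\<^sup>2) = (LINT \<omega>|P. 0)" by (rule integral_cong_AE) (use ae0 in auto)
    with ae0 show ?thesis by simp
  next
    case 2
    then have D: "distributed P lborel Y (normal_density m \<sigma>)"
      unfolding distributed_def by (simp cong: distr_cong)
    have "m = 0" using normal_distributed_expectation[OF 2(1) D] mean by simp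
    moreover have "(LINT \<omega>|P. (Y \<omega>)\<^sup>2) = \<sigma>\<^sup>2"
      using normal_distributed_variance[OF 2(1) D] mean by simp
    ultimately show ?thesis using D 2(1) by auto
  qed
qed

lemma gaussian_char:
  assumes "prob_space P" and Y[measurable]: "Y \<in> borel_measurable P" and g: "gaussian_distr (distr P borel Y)"
    and mean: "(LINT \<omega>|P. Y \<omega>) = 0"
  shows "(LINT \<omega>|P. iexp (Y \<omega>)) = exp (- ((LINT \<omega>|P. (Y \<omega>)\<^sup>2) / 2))"
proof -
  interpret prob_space P by fact
  from gaussian_centered_cases[OF assms] show ?thesis
  proof (elim disjE exE conjE)
    assume ae: "AE \<omega> in P. Y \<omega> = 0" and 0: "(LINT \<omega>|P. (Y \<omega>)\<^sup>2) = 0"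
    have "(LINT \<omega>|P. iexp (Y \<omega>)) = (LINT \<omega>|P. 1)" by (rule integral_cong_AE) (use ae in auto)
    then show ?thesis using 0 by (simp add: prob_space)
  next
    fix \<sigma> :: real assume s: "0 < \<sigma>" and D: "distributed P lborel Y (normal_density 0 \<sigma>)"
      and v: "(LINT \<omega>|P. (Y \<omega>)\<^sup>2) = \<sigma>\<^sup>2"
    have "distributed P lborel (\<lambda>x. (Y x - 0) / \<sigma>) std_normal_density"
      using D normal_standard_normal_convert[OF s] by blast
    then have "distr P borel (\<lambda>x. Y x / \<sigma>) = std_normal_distribution"
      unfolding distributed_def by (simp cong: distr_cong)
    then have "char (distr P borel (\<lambda>x. Y x / \<sigma>)) \<sigma> = exp (- (\<sigma>\<^sup>2) / 2)"
      by (simp add: char_std_normal_distribution)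
    moreover have "char (distr P borel (\<lambda>x. Y x / \<sigma>)) \<sigma> = (LINT \<omega>|P. iexp (Y \<omega>))"
      unfolding char_def using s by (subst integral_distr) (auto simp del: of_real_mult)
    ultimately show ?thesis by (simp add: v)
  qed
qed

text \<open>Trigonometric polynomials in the first \<open>d\<close> coordinates.  They form an algebra, and their
  expectations are determined by the characteristic functions.\<close>

inductive trig :: "nat \<Rightarrow> ((nat \<Rightarrow> real) \<Rightarrow> real) \<Rightarrow> bool" for d where
  trig_cos: "trig d (\<lambda>x. a * cos ((\<Sum>i<d. c i * x i) + b))"
| trig_add: "trig d F \<Longrightarrow> trig d F' \<Longrightarrow> trig d (\<lambda>x. F x + F' x)"

lemma trig_mult:
  assumes "trig d F" "trig d F'" shows "trig d (\<lambda>x. F x * F' x)"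
  using assms
proof (induction F rule: trig.induct)
  case (trig_cos a c b)
  then show ?case
  proof (induction F' rule: trig.induct)
    case (trig_cos a' c' b')
    have "trig d (\<lambda>x. (a * a' / 2) * cos ((\<Sum>i<d. (c i - c' i) * x i) + (b - b'))
        + (a * a' / 2) * cos ((\<Sum>i<d. (c i + c' i) * x i) + (b + b')))"
      by (intro trig.intros)
    also have "(\<lambda>x. (a * a' / 2) * cos ((\<Sum>i<d. (c i - c' i) * x i) + (b - b'))
        + (a * a' / 2) * cos ((\<Sum>i<d. (c i + c' i) * x i) + (b + b')))
      = (\<lambda>x. a * cos ((\<Sum>i<d. c i * x i) + b) * (a' * cos ((\<Sum>i<d. c' i * x i) + b')))"
    proof
      fix x :: "nat \<Rightarrow> real"
      let ?u = "(\<Sum>i<d. c i * x i) + b" and ?v = "(\<Sum>i<d. c' i * x i) + b'"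
      have A: "(\<Sum>i<d. (c i - c' i) * x i) + (b - b') = ?u - ?v"
        by (simp add: left_diff_distrib sum_subtractf)
      have B: "(\<Sum>i<d. (c i + c' i) * x i) + (b + b') = ?u + ?v"
        by (simp add: distrib_right sum.distrib)
      have C: "cos (?u - ?v) + cos (?u + ?v) = 2 * (cos ?u * cos ?v)"
        by (simp add: cos_diff cos_add)
      show "(a * a' / 2) * cos ((\<Sum>i<d. (c i - c' i) * x i) + (b - b'))
        + (a * a' / 2) * cos ((\<Sum>i<d. (c i + c' i) * x i) + (b + b')) = a * cos ?u * (a' * cos ?v)"
        unfolding A B distrib_left[symmetric] C by simp
    qed
    finally show ?case .
  next
    case (trig_add F1 F2)
    then show ?case using trig.trig_add[of d] by (simp add: distrib_left)
  qed
next
  case (trig_add F1 F2)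
  then show ?case using trig.trig_add[of d] by (simp add: distrib_right)
qed

lemma trig_const: "trig d (\<lambda>_. c)"
  using trig_cos[of d c "\<lambda>_. 0" 0] by simp

lemma trig_sin: assumes "i < d" shows "trig d (\<lambda>x. sin (x i / R))"
proof -
  have "(\<Sum>j<d. (if j = i then 1 / R else 0) * x j) = x i / R" for x :: "nat \<Rightarrow> real"
  proof -
    have "(\<Sum>j<d. (if j = i then 1 / R else 0) * x j) = (\<Sum>j<d. if j = i then x i / R else 0)"
      by (intro sum.cong) auto
    then show ?thesis using assms by simp
  qed
  then show ?thesis
    using trig_cos[of d 1 "\<lambda>j. if j = i then 1 / R else 0" "- (pi / 2)"]
    by (simp add: cos_diff flip: diff_conv_add_uminus)
qed

lemma trig_expectation:
  fixes Y :: "nat \<Rightarrow> nat \<Rightarrow> 'a \<Rightarrow> real" and Z :: "nat \<Rightarrow> 'b \<Rightarrow> real"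
  assumes M: "prob_space M" and P: "prob_space P"
    and Y[measurable]: "\<And>n i. Y n i \<in> borel_measurable M" and Z[measurable]: "\<And>i. Z i \<in> borel_measurable P"
    and char: "\<And>c. (\<lambda>n. LINT \<omega>|M. iexp (\<Sum>i<d. c i * Y n i \<omega>)) \<longlonglongrightarrow> (LINT \<omega>|P. iexp (\<Sum>i<d. c i * Z i \<omega>))"
    and F: "trig d F"
  shows "(\<forall>n. integrable M (\<lambda>\<omega>. F (\<lambda>i. Y n i \<omega>))) \<and> integrable P (\<lambda>\<omega>. F (\<lambda>i. Z i \<omega>)) \<and>
    (\<lambda>n. LINT \<omega>|M. F (\<lambda>i. Y n i \<omega>)) \<longlonglongrightarrow> (LINT \<omega>|P. F (\<lambda>i. Z i \<omega>))"
  using F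
proof (induction F rule: trig.induct)
  case (trig_cos a c b)
  have cosRe: "a * cos (u + b) = Re (complex_of_real a * iexp b * iexp u)" for u
    by (simp add: cos_add algebra_simps flip: exp_of_real cis_conv_exp)
  have iY: "complex_integrable M (\<lambda>\<omega>. iexp (\<Sum>i<d. c i * Y n i \<omega>))" for n
    by (rule finite_measure.integrable_const_bound[OF prob_space.finite_measure[OF M], where B=1]) (auto simp del: of_real_sum of_real_mult)
  have iZ: "complex_integrable P (\<lambda>\<omega>. iexp (\<Sum>i<d. c i * Z i \<omega>))"
    by (rule finite_measure.integrable_const_bound[OF prob_space.finite_measure[OF P], where B=1]) (auto simp del: of_real_sum of_real_mult)
  have iY': "complex_integrable M (\<lambda>\<omega>. complex_of_real a * iexp b * iexp (\<Sum>i<d. c i * Y n i \<omega>))" for n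
    by (intro integrable_mult_right iY)
  have iZ': "complex_integrable P (\<lambda>\<omega>. complex_of_real a * iexp b * iexp (\<Sum>i<d. c i * Z i \<omega>))"
    by (intro integrable_mult_right iZ)
  have "(\<lambda>n. Re (complex_of_real a * iexp b * (LINT \<omega>|M. iexp (\<Sum>i<d. c i * Y n i \<omega>))))
     \<longlonglongrightarrow> Re (complex_of_real a * iexp b * (LINT \<omega>|P. iexp (\<Sum>i<d. c i * Z i \<omega>)))"
    by (intro tendsto_intros char)
  then show ?case
    unfolding cosRe
    by (simp only: integral_Re[OF iY'] integral_Re[OF iZ'] integral_mult_right_zero integrable_Re[OF iY'] integrable_Re[OF iZ']) simp
next
  case (trig_add F1 F2)
  then show ?case by (auto intro!: tendsto_add)
qed

text \<open>There is no error where the sine is inverted exactly; elsewhere \<open>\<bar>x\<bar>\<close> is at least \<open>R\<close>, and the linear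
  error is dominated by a quadratic one.\<close>

lemma arcsin_sin_error:
  fixes x R :: real assumes "0 < R" shows "\<bar>x - R * arcsin (sin (x / R))\<bar> \<le> 2 * x\<^sup>2 / R"
proof -
  define y where "y = x / R"
  have "\<bar>y - arcsin (sin y)\<bar> \<le> 2 * y\<^sup>2"
  proof (cases "\<bar>y\<bar> \<le> pi / 2")
    case True then show ?thesis using arcsin_sin[of y] by (simp add: abs_le_iff)
  next
    case False
    have 1: "1 \<le> \<bar>y\<bar>" using False pi_gt3 by linarith
    have "- (pi / 2) \<le> arcsin (sin y) \<and> arcsin (sin y) \<le> pi / 2" by (rule arcsin_bounded) auto
    then have "\<bar>arcsin (sin y)\<bar> \<le> pi / 2" by linarith
    then have "\<bar>y - arcsin (sin y)\<bar> \<le> 2 * \<bar>y\<bar>" using False by linarith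
    also have "\<dots> \<le> 2 * (\<bar>y\<bar> * \<bar>y\<bar>)" using mult_right_mono[OF 1 abs_ge_zero[of y]] by simp
    finally show ?thesis by (simp add: power2_eq_square)
  qed
  then have "R * \<bar>y - arcsin (sin y)\<bar> \<le> R * (2 * y\<^sup>2)" using assms by (intro mult_left_mono) auto
  moreover have "R * \<bar>y - arcsin (sin y)\<bar> = \<bar>x - R * arcsin (sin (x / R))\<bar>"
  proof -
    have "R * (y - arcsin (sin y)) = x - R * arcsin (sin (x / R))"
      using assms by (simp add: y_def right_diff_distrib)
    then show ?thesis using assms abs_mult[of R "y - arcsin (sin y)"] by simp
  qed
  moreover have "R * (2 * y\<^sup>2) = 2 * x\<^sup>2 / R" using assms by (simp add: y_def power2_eq_square)
  ultimately show ?thesis by simp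
qed

text \<open>Approximation by trigonometric polynomials, uniformly on the whole space up to the error of
  replacing \<open>x i\<close> by \<open>R * arcsin (sin (x i / R))\<close>.  This periodic truncation is the identity
  where \<open>\<bar>x i\<bar> \<le> R * pi / 2\<close>, and in the variables \<open>sin (x i / R)\<close> the theorem of
  Stone and Weierstrass applies on a cube.\<close>

lemma trig_approx:
  fixes h :: "(nat \<Rightarrow> real) \<Rightarrow> real"
  assumes lip: "\<And>x y. \<bar>h x - h y\<bar> \<le> A * (\<Sum>i<d. \<bar>x i - y i\<bar>)" and R: "0 < R" and e: "0 < e" and A: "0 \<le> A"
  obtains F where "trig d F" "\<And>x. \<bar>h x - F x\<bar> \<le> A * (\<Sum>i<d. 2 * (x i)\<^sup>2 / R) + e"
proof -
  define S :: "(nat \<Rightarrow> real) set" where "S = (\<Pi>\<^sub>E i\<in>UNIV. if i < d then {-1..1} else {0})"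
  define \<sigma> where "\<sigma> x i = (if i < d then sin (x i / R) else 0)" for x :: "nat \<Rightarrow> real" and i
  define f where "f s = h (\<lambda>i. R * arcsin (s i))" for s :: "nat \<Rightarrow> real"
  have "compactin (product_topology (\<lambda>_. euclidean) UNIV) S"
    unfolding S_def compactin_PiE by auto
  then have compact: "compact S" by (simp add: euclidean_product_topology)
  have Sd: "s i \<in> {-1..1}" if "s \<in> S" for s i using that unfolding S_def by (auto simp: PiE_iff split: if_splits dest!: spec[of _ i])
  have coord: "continuous_on S (\<lambda>s. s i)" for i
    using continuous_on_product_coordinates[of i] by (rule continuous_on_subset) simp
  have contf: "continuous_on S f"
  proof -
    have ca: "continuous_on S (\<lambda>s. \<Sum>i<d. \<bar>R * arcsin (s i) - R * arcsin (s0 i)\<bar>)" for s0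
      by (intro continuous_intros coord) (use Sd in auto)
    show ?thesis
      unfolding continuous_on_def
    proof
      fix s0 assume s0: "s0 \<in> S"
      have "((\<lambda>s. A * (\<Sum>i<d. \<bar>R * arcsin (s i) - R * arcsin (s0 i)\<bar>)) \<longlongrightarrow> A * (\<Sum>i<d. \<bar>R * arcsin (s0 i) - R * arcsin (s0 i)\<bar>)) (at s0 within S)"
        using ca[of s0] s0 unfolding continuous_on_def by (intro tendsto_mult_left) blast
      then have lim0: "((\<lambda>s. A * (\<Sum>i<d. \<bar>R * arcsin (s i) - R * arcsin (s0 i)\<bar>)) \<longlongrightarrow> 0) (at s0 within S)"
        by simp
      have "((\<lambda>s. f s - f s0) \<longlongrightarrow> 0) (at s0 within S)"
        by (rule Lim_null_comparison[OF _ lim0]) (auto simp: f_def intro!: always_eventually lip)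
      then show "(f \<longlongrightarrow> f s0) (at s0 within S)" by (rule LIM_zero_cancel)
    qed
  qed
  have "\<exists>g. (continuous_on S g \<and> trig d (\<lambda>x. g (\<sigma> x))) \<and> (\<forall>x\<in>S. \<bar>f x - g x\<bar> < e)"
  proof (rule Stone_Weierstrass_HOL[OF compact _ _ _ _ _ contf e])
    fix x y :: "nat \<Rightarrow> real" assume xy: "x \<in> S \<and> y \<in> S \<and> x \<noteq> y"
    then obtain i where i: "x i \<noteq> y i" by auto
    have "i < d"
    proof (rule ccontr)
      assume "\<not> i < d"
      then have "x i = 0" "y i = 0" using xy unfolding S_def by (auto simp: PiE_iff dest!: spec[of _ i])
      with i show False by simp
    qed
    then have "trig d (\<lambda>x. \<sigma> x i)" unfolding \<sigma>_def by (simp add: trig_sin)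
    with i coord[of i] show "\<exists>f. (continuous_on S f \<and> trig d (\<lambda>x. f (\<sigma> x))) \<and> f x \<noteq> f y"
      by (intro exI[of _ "\<lambda>s. s i"]) auto
  qed (auto intro: trig_const trig_add trig_mult continuous_intros)
  then obtain g where g: "trig d (\<lambda>x. g (\<sigma> x))" "\<And>s. s \<in> S \<Longrightarrow> \<bar>f s - g s\<bar> < e" by blast
  show ?thesis
  proof (rule that[OF g(1)])
    fix x :: "nat \<Rightarrow> real"
    have "\<sigma> x \<in> S" unfolding S_def \<sigma>_def by auto
    then have 1: "\<bar>f (\<sigma> x) - g (\<sigma> x)\<bar> < e" by (rule g(2))
    have "\<bar>h x - f (\<sigma> x)\<bar> \<le> A * (\<Sum>i<d. \<bar>x i - R * arcsin (\<sigma> x i)\<bar>)" unfolding f_def by (rule lip)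
    also have "\<dots> \<le> A * (\<Sum>i<d. 2 * (x i)\<^sup>2 / R)"
      using arcsin_sin_error[OF R] by (intro mult_left_mono[OF _ A] sum_mono) (auto simp: \<sigma>_def)
    finally show "\<bar>h x - g (\<sigma> x)\<bar> \<le> A * (\<Sum>i<d. 2 * (x i)\<^sup>2 / R) + e" using 1 by linarith
  qed
qed

lemma lipschitz_measurable:
  fixes h :: "(nat \<Rightarrow> real) \<Rightarrow> real"
  assumes lip: "\<And>x y. \<bar>h x - h y\<bar> \<le> A * (\<Sum>i<d. \<bar>x i - y i\<bar>)"
    and Y: "\<And>i. Y i \<in> borel_measurable M"
  shows "(\<lambda>\<omega>. h (\<lambda>i. Y i \<omega>)) \<in> borel_measurable M"
proof -
  have coord: "continuous_on UNIV (\<lambda>s::nat \<Rightarrow> real. s i)" for i by (rule continuous_on_product_coordinates)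
  have "continuous_on UNIV h"
    unfolding continuous_on_def
  proof
    fix s0 :: "nat \<Rightarrow> real"
    have "continuous_on UNIV (\<lambda>s. A * (\<Sum>i<d. \<bar>s i - s0 i\<bar>))" by (intro continuous_intros coord)
    then have "((\<lambda>s. A * (\<Sum>i<d. \<bar>s i - s0 i\<bar>)) \<longlongrightarrow> A * (\<Sum>i<d. \<bar>s0 i - s0 i\<bar>)) (at s0)"
      unfolding continuous_on_def by blast
    then have "((\<lambda>s. A * (\<Sum>i<d. \<bar>s i - s0 i\<bar>)) \<longlongrightarrow> 0) (at s0)" by simp
    then have "((\<lambda>s. h s - h s0) \<longlongrightarrow> 0) (at s0)"
      by (rule Lim_null_comparison[rotated]) (auto intro!: always_eventually lip)
    then show "(h \<longlongrightarrow> h s0) (at s0)" by (rule LIM_zero_cancel)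
  qed
  then have "h \<in> borel_measurable borel" by (rule borel_measurable_continuous_onI)
  moreover have "(\<lambda>\<omega> i. Y i \<omega>) \<in> borel_measurable M"
    by (rule measurable_coordinatewise_then_product) (rule Y)
  ultimately show ?thesis by (rule measurable_compose[rotated])
qed

text \<open>Instead of continuity of characteristic functions in several dimensions, \<open>h\<close> is approximated by
  trigonometric polynomials, whose expectations converge.  The quadratic error term of the
  approximation is small for large \<open>R\<close> because the second moments are bounded.\<close>

theorem cramer_wold:
  fixes Y :: "nat \<Rightarrow> nat \<Rightarrow> 'a \<Rightarrow> real" and Z :: "nat \<Rightarrow> 'b \<Rightarrow> real" and h :: "(nat \<Rightarrow> real) \<Rightarrow> real"
  assumes M: "prob_space M" and P: "prob_space P"
    and Y: "\<And>n i. Y n i \<in> borel_measurable M" and Z: "\<And>i. Z i \<in> borel_measurable P"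
    and char: "\<And>c. (\<lambda>n. LINT \<omega>|M. iexp (\<Sum>i<d. c i * Y n i \<omega>)) \<longlonglongrightarrow> (LINT \<omega>|P. iexp (\<Sum>i<d. c i * Z i \<omega>))"
    and Y2: "\<And>n i. i < d \<Longrightarrow> integrable M (\<lambda>\<omega>. (Y n i \<omega>)\<^sup>2)" "\<And>n i. i < d \<Longrightarrow> (LINT \<omega>|M. (Y n i \<omega>)\<^sup>2) \<le> C"
    and Z2: "\<And>i. i < d \<Longrightarrow> integrable P (\<lambda>\<omega>. (Z i \<omega>)\<^sup>2)" "\<And>i. i < d \<Longrightarrow> (LINT \<omega>|P. (Z i \<omega>)\<^sup>2) \<le> C"
    and lip: "\<And>x y. \<bar>h x - h y\<bar> \<le> A * (\<Sum>i<d. \<bar>x i - y i\<bar>)" and A: "0 \<le> A"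
    and bd: "\<And>x. \<bar>h x\<bar> \<le> B"
  shows "(\<lambda>n. LINT \<omega>|M. h (\<lambda>i. Y n i \<omega>)) \<longlonglongrightarrow> (LINT \<omega>|P. h (\<lambda>i. Z i \<omega>))"
proof (rule LIMSEQ_I)
  fix r :: real assume r: "0 < r"
  interpret M: prob_space M by fact
  interpret P: prob_space P by fact
  define Q where "Q = A * (real d * (2 * \<bar>C\<bar>))"
  have Q: "0 \<le> Q" using A by (simp add: Q_def)
  define e where "e = r / 6"
  define R where "R = Q / e + 1"
  have e: "0 < e" using r by (simp add: e_def)
  then have R: "0 < R" using Q by (simp add: R_def add_nonneg_pos)
  have QR: "Q / R \<le> e" using R e Q unfolding R_def by (simp add: field_simps)
  obtain F where F: "trig d F" "\<And>x. \<bar>h x - F x\<bar> \<le> A * (\<Sum>i<d. 2 * (x i)\<^sup>2 / R) + e"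
    using trig_approx[OF lip R e A] by blast
  note T = trig_expectation[OF M P Y Z char F(1)]
  have key: "\<bar>(LINT \<omega>|N. h (\<lambda>i. V i \<omega>)) - (LINT \<omega>|N. F (\<lambda>i. V i \<omega>))\<bar> \<le> 2 * e"
    if N: "prob_space N" and V: "\<And>i. V i \<in> borel_measurable N" and iF: "integrable N (\<lambda>\<omega>. F (\<lambda>i. V i \<omega>))"
      and V2: "\<And>i. i < d \<Longrightarrow> integrable N (\<lambda>\<omega>. (V i \<omega>)\<^sup>2)" "\<And>i. i < d \<Longrightarrow> (LINT \<omega>|N. (V i \<omega>)\<^sup>2) \<le> C"
    for N :: "'c measure" and V
  proof -
    interpret N: prob_space N by fact
    have ih: "integrable N (\<lambda>\<omega>. h (\<lambda>i. V i \<omega>))"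
      by (rule N.integrable_const_bound[where B=B]) (use bd lipschitz_measurable[OF lip V] in auto)
    have iV: "integrable N (\<lambda>\<omega>. \<Sum>i<d. 2 * (V i \<omega>)\<^sup>2 / R)"
      using V2(1) by (intro Bochner_Integration.integrable_sum integrable_divide integrable_mult_right) auto
    have "\<bar>(LINT \<omega>|N. h (\<lambda>i. V i \<omega>)) - (LINT \<omega>|N. F (\<lambda>i. V i \<omega>))\<bar> = \<bar>LINT \<omega>|N. h (\<lambda>i. V i \<omega>) - F (\<lambda>i. V i \<omega>)\<bar>"
      by (subst Bochner_Integration.integral_diff[OF ih iF]) simp
    also have "\<dots> \<le> (LINT \<omega>|N. \<bar>h (\<lambda>i. V i \<omega>) - F (\<lambda>i. V i \<omega>)\<bar>)" by (rule integral_abs_bound)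
    also have "\<dots> \<le> (LINT \<omega>|N. A * (\<Sum>i<d. 2 * (V i \<omega>)\<^sup>2 / R) + e)"
      by (rule integral_mono) (use ih iF iV F(2) in auto)
    also have "\<dots> = A * (LINT \<omega>|N. (\<Sum>i<d. 2 * (V i \<omega>)\<^sup>2 / R)) + e"
      using iV by (simp add: N.prob_space)
    also have "(LINT \<omega>|N. (\<Sum>i<d. 2 * (V i \<omega>)\<^sup>2 / R)) = (\<Sum>i<d. 2 * (LINT \<omega>|N. (V i \<omega>)\<^sup>2) / R)"
      using V2(1) by (subst Bochner_Integration.integral_sum) auto
    also have "\<dots> \<le> (\<Sum>i<d. 2 * \<bar>C\<bar> / R)"
      using V2(2) R by (intro sum_mono divide_right_mono) (force simp: abs_if)+
    finally have "\<bar>(LINT \<omega>|N. h (\<lambda>i. V i \<omega>)) - (LINT \<omega>|N. F (\<lambda>i. V i \<omega>))\<bar> \<le> A * (\<Sum>i<d. 2 * \<bar>C\<bar> / R) + e"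
      using A by (simp add: mult_left_mono)
    also have "A * (\<Sum>i<d. 2 * \<bar>C\<bar> / R) = Q / R" by (simp add: Q_def)
    finally show ?thesis using QR by simp
  qed
  obtain n0 where n0: "\<And>n. n0 \<le> n \<Longrightarrow> \<bar>(LINT \<omega>|M. F (\<lambda>i. Y n i \<omega>)) - (LINT \<omega>|P. F (\<lambda>i. Z i \<omega>))\<bar> < e"
    using LIMSEQ_D[OF T[THEN conjunct2, THEN conjunct2] e] by auto
  show "\<exists>no. \<forall>n\<ge>no. norm ((LINT \<omega>|M. h (\<lambda>i. Y n i \<omega>)) - (LINT \<omega>|P. h (\<lambda>i. Z i \<omega>))) < r"
  proof (intro exI[of _ n0] allI impI)
    fix n assume n: "n0 \<le> n"
    have 1: "\<bar>(LINT \<omega>|M. h (\<lambda>i. Y n i \<omega>)) - (LINT \<omega>|M. F (\<lambda>i. Y n i \<omega>))\<bar> \<le> 2 * e"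
      by (rule key[OF M Y _ Y2]) (use T in auto)
    have 2: "\<bar>(LINT \<omega>|P. h (\<lambda>i. Z i \<omega>)) - (LINT \<omega>|P. F (\<lambda>i. Z i \<omega>))\<bar> \<le> 2 * e"
      by (rule key[OF P Z _ Z2]) (use T in auto)
    from 1 2 n0[OF n] have "\<bar>(LINT \<omega>|M. h (\<lambda>i. Y n i \<omega>)) - (LINT \<omega>|P. h (\<lambda>i. Z i \<omega>))\<bar> < 5 * e + e"
      using e by linarith
    then show "norm ((LINT \<omega>|M. h (\<lambda>i. Y n i \<omega>)) - (LINT \<omega>|P. h (\<lambda>i. Z i \<omega>))) < r" by (simp add: e_def)
  qed
qed

section \<open>Convergence of Lipschitz functionals of the empirical process\<close>

context circle_walk
begin

definition cross_corr :: "(real \<Rightarrow> real) \<Rightarrow> (real \<Rightarrow> real) \<Rightarrow> nat \<Rightarrow> real" where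
  "cross_corr f g k = (LINT u|unif. f u * T k g u)"

lemma T_0: "T 0 g = g"
  by (simp add: T_def prob_space fun_eq_iff)

lemma unif_expectation_eq:
  assumes f: "bounded_borel f" and g: "bounded_borel g"
  shows "unif_expectation M (\<lambda>u \<omega>. f u * g (u + S k \<omega>)) = cross_corr f g k"
proof -
  note [measurable] = bounded_borel_measurable[OF f] bounded_borel_measurable[OF g]
  obtain B where B: "0 \<le> B" "\<And>x. norm (f x) \<le> B" using bounded_borel_bound[OF f] by blast
  obtain C where C: "0 \<le> C" "\<And>x. norm (g x) \<le> C" using bounded_borel_bound[OF g] by blast
  interpret U: prob_space unif by (rule prob_space_unif)
  interpret UM: pair_prob_space unif M ..
  have m: "(\<lambda>z. f (fst z) * g (fst z + S k (snd z))) \<in> borel_measurable (unif \<Otimes>\<^sub>M M)"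
    by measurable
  have i: "integrable (unif \<Otimes>\<^sub>M M) (\<lambda>z. f (fst z) * g (fst z + S k (snd z)))"
    by (rule UM.P.integrable_const_bound[where B="B * C"])
      (use B C m in \<open>auto simp: abs_mult intro!: AE_I2 mult_mono\<close>)
  have "unif_expectation M (\<lambda>u \<omega>. f u * g (u + S k \<omega>)) = (LINT z|(unif \<Otimes>\<^sub>M M). f (fst z) * g (fst z + S k (snd z)))"
    unfolding unif_expectation_def unif_def ..
  also have "\<dots> = (LINT u|unif. LINT \<omega>|M. f u * g (u + S k \<omega>))"
    using UM.integral_fst'[OF i] by simp
  finally show ?thesis by (simp add: cross_corr_def T_def)
qed

lemma cov_form_eq:
  assumes f: "bounded_borel f" and g: "bounded_borel g"
  shows "cov_form M X f g = cross_corr f g 0 + (\<Sum>k. cross_corr f g (Suc k)) + (\<Sum>k. cross_corr g f (Suc k))"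
  unfolding cov_form_def using unif_expectation_eq[OF f g, of 0]
  by (simp add: unif_expectation_eq[OF f g] unif_expectation_eq[OF g f])

lemma summable_cross_corr:
  assumes f: "centered_bv V B f" and g: "centered_bv V' B' g"
  shows "summable (\<lambda>k. cross_corr f g (Suc k))"
proof (rule summable_comparison_test_ev[OF always_eventually])
  show "summable (\<lambda>k. B * (3 * V' * \<psi> (Suc k)))" by (intro summable_mult summable_psi)
  show "\<forall>k. norm (cross_corr f g (Suc k)) \<le> B * (3 * V' * \<psi> (Suc k))"
    unfolding cross_corr_def real_norm_def
    by (intro allI unif_integral_le)
     (auto simp: abs_mult intro!: mult_mono T_centered[OF g] bounded_borel_mult bounded_borel_T centered_bvD[OF f] centered_bvD(6)[OF g])
qed

lemma T_sum:
  assumes "\<And>i. i \<in> I \<Longrightarrow> bounded_borel (f i)"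
  shows "T k (\<lambda>x. \<Sum>i\<in>I. c i * f i x) u = (\<Sum>i\<in>I. c i * T k (f i) (u::real) :: real)"
  unfolding T_def using assms
  by (subst Bochner_Integration.integral_sum) (auto intro!: integrable_mult_right integrable_comp_S)

lemma cross_corr_sum:
  fixes f :: "'i \<Rightarrow> real \<Rightarrow> real"
  assumes f: "\<And>i. i \<in> I \<Longrightarrow> bounded_borel (f i)"
  shows "corr (\<lambda>x. \<Sum>i\<in>I. c i * f i x) k = (\<Sum>i\<in>I. \<Sum>j\<in>I. c i * c j * cross_corr (f i) (f j) k)"
proof -
  have int: "integrable unif (\<lambda>u. c i * f i u * (c j * T k (f j) u))" if "i \<in> I" "j \<in> I" for i j
    by (intro unif_integrable bounded_borel_mult bounded_borel_const bounded_borel_T f that)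
  have "corr (\<lambda>x. \<Sum>i\<in>I. c i * f i x) k = (LINT u|unif. (\<Sum>i\<in>I. \<Sum>j\<in>I. c i * f i u * (c j * T k (f j) u)))"
    unfolding corr_def by (simp add: T_sum[OF f] sum_product)
  also have "\<dots> = (\<Sum>i\<in>I. \<Sum>j\<in>I. LINT u|unif. c i * f i u * (c j * T k (f j) u))"
    by (subst Bochner_Integration.integral_sum, (intro Bochner_Integration.integrable_sum int; assumption),
        intro sum.cong refl, subst Bochner_Integration.integral_sum, (intro int; assumption), rule refl)
  also have "\<dots> = (\<Sum>i\<in>I. \<Sum>j\<in>I. c i * c j * cross_corr (f i) (f j) k)"
  proof (intro sum.cong refl)
    fix i j assume "i \<in> I" "j \<in> I"
    have "(\<lambda>u. c i * f i u * (c j * T k (f j) u)) = (\<lambda>u. c i * c j * (f i u * T k (f j) u))"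
      by (simp add: fun_eq_iff)
    then show "(LINT u|unif. c i * f i u * (c j * T k (f j) u)) = c i * c j * cross_corr (f i) (f j) k"
      by (simp add: cross_corr_def)
  qed
  finally show ?thesis .
qed

text \<open>The asymptotic variance is the quadratic form of the bilinear form \<open>cov_form\<close>: the two series of
  correlations become equal after summation over all pairs.\<close>

lemma asymp_var_sum:
  fixes f :: "'i \<Rightarrow> real \<Rightarrow> real"
  assumes I: "finite I" and f: "\<And>i. i \<in> I \<Longrightarrow> centered_bv V B (f i)"
  shows "asymp_var (\<lambda>x. \<Sum>i\<in>I. c i * f i x) = (\<Sum>i\<in>I. \<Sum>j\<in>I. c i * c j * cov_form M X (f i) (f j))"
proof -
  have fb: "bounded_borel (f i)" if "i \<in> I" for i using centered_bvD(6)[OF f[OF that]] .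
  have cs: "corr (\<lambda>x. \<Sum>i\<in>I. c i * f i x) k = (\<Sum>i\<in>I. \<Sum>j\<in>I. c i * c j * cross_corr (f i) (f j) k)" for k
    by (rule cross_corr_sum) (rule fb)
  define s where "s i j = (\<Sum>k. cross_corr (f i) (f j) (Suc k))" for i j
  have sm: "summable (\<lambda>k. c i * c j * cross_corr (f i) (f j) (Suc k))" if "i \<in> I" "j \<in> I" for i j
    by (intro summable_mult summable_cross_corr[OF f[OF that(1)] f[OF that(2)]])
  have "(\<Sum>k. corr (\<lambda>x. \<Sum>i\<in>I. c i * f i x) (Suc k)) = (\<Sum>k. \<Sum>i\<in>I. \<Sum>j\<in>I. c i * c j * cross_corr (f i) (f j) (Suc k))"
    by (simp add: cs)
  also have "\<dots> = (\<Sum>i\<in>I. \<Sum>k. \<Sum>j\<in>I. c i * c j * cross_corr (f i) (f j) (Suc k))"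
    by (rule suminf_sum) (intro summable_sum sm)
  also have "\<dots> = (\<Sum>i\<in>I. \<Sum>j\<in>I. c i * c j * s i j)"
  proof (intro sum.cong refl)
    fix i assume i: "i \<in> I"
    have "(\<Sum>k. \<Sum>j\<in>I. c i * c j * cross_corr (f i) (f j) (Suc k)) = (\<Sum>j\<in>I. \<Sum>k. c i * c j * cross_corr (f i) (f j) (Suc k))"
      by (rule suminf_sum) (intro sm i)
    also have "\<dots> = (\<Sum>j\<in>I. c i * c j * s i j)"
      unfolding s_def by (intro sum.cong refl suminf_mult summable_cross_corr[OF f[OF i] f])
    finally show "(\<Sum>k. \<Sum>j\<in>I. c i * c j * cross_corr (f i) (f j) (Suc k)) = (\<Sum>j\<in>I. c i * c j * s i j)" .
  qed
  finally have S1: "(\<Sum>k. corr (\<lambda>x. \<Sum>i\<in>I. c i * f i x) (Suc k)) = (\<Sum>i\<in>I. \<Sum>j\<in>I. c i * c j * s i j)" .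
  have S2: "(\<Sum>i\<in>I. \<Sum>j\<in>I. c i * c j * s j i) = (\<Sum>i\<in>I. \<Sum>j\<in>I. c i * c j * s i j)"
    by (subst sum.swap) (simp add: mult.commute mult.left_commute)
  have "(\<Sum>i\<in>I. \<Sum>j\<in>I. c i * c j * cov_form M X (f i) (f j))
     = (\<Sum>i\<in>I. \<Sum>j\<in>I. c i * c j * cross_corr (f i) (f j) 0 + (c i * c j * s i j + c i * c j * s j i))"
    by (intro sum.cong refl) (simp add: cov_form_eq fb s_def distrib_left)
  also have "\<dots> = (\<Sum>i\<in>I. \<Sum>j\<in>I. c i * c j * cross_corr (f i) (f j) 0)
     + ((\<Sum>i\<in>I. \<Sum>j\<in>I. c i * c j * s i j) + (\<Sum>i\<in>I. \<Sum>j\<in>I. c i * c j * s j i))"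
    by (simp add: sum.distrib)
  finally show ?thesis unfolding asymp_var_def S1 S2 cs[of 0] by simp
qed

lemma G_second_moment:
  assumes "0 \<le> t" "t \<le> 1"
  shows "integrable M (\<lambda>\<omega>. (G N \<omega> t)\<^sup>2)" "(LINT \<omega>|M. (G N \<omega> t)\<^sup>2) \<le> 2 * (1 + 12 * psi_total)"
proof -
  note f = centered_bv_ind[OF assms]
  note fD = centered_bvD[OF f]
  note [measurable] = fD(1)
  let ?Y = "\<lambda>\<omega>. \<Sum>k=1..N. centered_ind {0..<t} (S k \<omega>)"
  have "\<bar>?Y \<omega>\<bar> \<le> real N" for \<omega>
    using sum_bounded_above[of "{1..N}" "\<lambda>k. \<bar>centered_ind {0..<t} (S k \<omega>)\<bar>" 1] fD(4)
    by (intro order_trans[OF sum_abs]) simp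
  then have "integrable M (\<lambda>\<omega>. (?Y \<omega>)\<^sup>2)"
    by (intro integrable_const_bound[where B="(real N)\<^sup>2"]) (auto simp flip: abs_le_square_iff)
  then have i: "integrable M (\<lambda>\<omega>. 1 / real N * (?Y \<omega>)\<^sup>2)" by simp
  have eq: "(G N \<omega> t)\<^sup>2 = 1 / real N * (?Y \<omega>)\<^sup>2" for \<omega>
    unfolding G_eq[OF assms(1)] power_mult_distrib by (simp add: power_divide)
  show "integrable M (\<lambda>\<omega>. (G N \<omega> t)\<^sup>2)" unfolding eq by (rule i)
  have "(LINT \<omega>|M. (G N \<omega> t)\<^sup>2) = 1 / real N * (LINT \<omega>|M. (?Y \<omega>)\<^sup>2)" unfolding eq by simp
  also have "\<dots> \<le> 1 / real N * (2 * (1 + 3 * 4 * psi_total) * 1 * real (card {1..N}))"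
    using second_moment_linear[OF f, of "{1..N}" 0] by (intro mult_left_mono) auto
  also have "\<dots> \<le> 2 * (1 + 12 * psi_total)" using psi_total_nonneg by simp
  finally show "(LINT \<omega>|M. (G N \<omega> t)\<^sup>2) \<le> 2 * (1 + 12 * psi_total)" .
qed

end

locale gaussian_limit = circle_walk M X \<delta> for M :: "'a measure" and X \<delta> +
  fixes P :: "'b measure" and K :: "real \<Rightarrow> 'b \<Rightarrow> real"
  assumes K_gauss: "gaussian_process P {0..1} K"
    and K_mean: "\<forall>t\<in>{0..1}. (LINT \<omega>|P. K t \<omega>) = 0"
    and K_cov: "\<forall>s\<in>{0..1}. \<forall>t\<in>{0..1}. covariance P (K s) (K t) = Gamma_cov M X s t"
begin

lemma prob_space_P: "prob_space P"
  using K_gauss unfolding gaussian_process_def by blast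

lemma K_measurable [measurable (raw)]: "t \<in> {0..1} \<Longrightarrow> K t \<in> borel_measurable P"
  using K_gauss unfolding gaussian_process_def by blast

lemma K_integrable:
  assumes t: "t \<in> {0..1}" shows "integrable P (K t)" "integrable P (\<lambda>\<omega>. (K t \<omega>)\<^sup>2)"
proof -
  have "\<forall>F c. finite F \<longrightarrow> F \<subseteq> {0..1} \<longrightarrow> gaussian_distr (distr P borel (\<lambda>\<omega>. \<Sum>t\<in>F. c t * K t \<omega>))"
    using K_gauss unfolding gaussian_process_def by blast
  from this[rule_format, of "{t}" "\<lambda>_. 1"] t have "gaussian_distr (distr P borel (K t))" by simp
  then show "integrable P (K t)" "integrable P (\<lambda>\<omega>. (K t \<omega>)\<^sup>2)"
    using gaussian_integrable[OF prob_space_P K_measurable[OF t]] by auto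
qed

lemma K_prod_integrable:
  assumes "s \<in> {0..1}" "t \<in> {0..1}" shows "integrable P (\<lambda>\<omega>. K s \<omega> * K t \<omega>)"
proof (rule Bochner_Integration.integrable_bound)
  show "integrable P (\<lambda>\<omega>. (K s \<omega>)\<^sup>2 + (K t \<omega>)\<^sup>2)" using K_integrable assms by auto
  show "AE \<omega> in P. norm (K s \<omega> * K t \<omega>) \<le> norm ((K s \<omega>)\<^sup>2 + (K t \<omega>)\<^sup>2)"
  proof (rule AE_I2)
    fix \<omega>
    have "2 * (\<bar>K s \<omega>\<bar> * \<bar>K t \<omega>\<bar>) \<le> (K s \<omega>)\<^sup>2 + (K t \<omega>)\<^sup>2"
      using sum_squares_bound[of "\<bar>K s \<omega>\<bar>" "\<bar>K t \<omega>\<bar>"] by simp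
    moreover have "0 \<le> \<bar>K s \<omega>\<bar> * \<bar>K t \<omega>\<bar>" by simp
    ultimately have "\<bar>K s \<omega>\<bar> * \<bar>K t \<omega>\<bar> \<le> (K s \<omega>)\<^sup>2 + (K t \<omega>)\<^sup>2" by linarith
    then show "norm (K s \<omega> * K t \<omega>) \<le> norm ((K s \<omega>)\<^sup>2 + (K t \<omega>)\<^sup>2)" by (simp add: abs_mult)
  qed
qed (use assms in measurable)

lemma K_prod: "s \<in> {0..1} \<Longrightarrow> t \<in> {0..1} \<Longrightarrow> (LINT \<omega>|P. K s \<omega> * K t \<omega>) = Gamma_cov M X s t"
  using K_cov K_mean unfolding covariance_def by auto

text \<open>The variance comes from bilinearity of the covariance, by \<open>asymp_var_sum\<close>.  The times have to be
  distinct because Gaussian processes are defined by combinations over sets of times.\<close>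

lemma K_combination:
  fixes t :: "nat \<Rightarrow> real"
  assumes t: "inj_on t {..<d}" "\<And>i. i < d \<Longrightarrow> t i \<in> {0..1}"
  shows "(\<lambda>\<omega>. \<Sum>i<d. c i * K (t i) \<omega>) \<in> borel_measurable P"
    "gaussian_distr (distr P borel (\<lambda>\<omega>. \<Sum>i<d. c i * K (t i) \<omega>))"
    "(LINT \<omega>|P. (\<Sum>i<d. c i * K (t i) \<omega>)) = 0"
    "(LINT \<omega>|P. (\<Sum>i<d. c i * K (t i) \<omega>)\<^sup>2) = asymp_var (\<lambda>x. \<Sum>i<d. c i * centered_ind {0..<t i} x)"
proof -
  show "(\<lambda>\<omega>. \<Sum>i<d. c i * K (t i) \<omega>) \<in> borel_measurable P"
    by (intro borel_measurable_sum borel_measurable_times borel_measurable_const K_measurable t) auto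
  define c' where "c' s = c (the_inv_into {..<d} t s)" for s
  have "(\<Sum>i<d. c i * K (t i) \<omega>) = (\<Sum>s\<in>t ` {..<d}. c' s * K s \<omega>)" for \<omega>
    unfolding c'_def by (subst sum.reindex[OF t(1)]) (simp add: the_inv_into_f_f[OF t(1)])
  moreover have "t ` {..<d} \<subseteq> {0..1}" using t(2) by auto
  ultimately show "gaussian_distr (distr P borel (\<lambda>\<omega>. \<Sum>i<d. c i * K (t i) \<omega>))"
    using K_gauss unfolding gaussian_process_def by simp
  show "(LINT \<omega>|P. (\<Sum>i<d. c i * K (t i) \<omega>)) = 0"
    using t(2) K_integrable(1) K_mean by (subst Bochner_Integration.integral_sum) auto
  have int: "integrable P (\<lambda>\<omega>. c i * K (t i) \<omega> * (c j * K (t j) \<omega>))" if "i < d" "j < d" for i j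
  proof -
    have "integrable P (\<lambda>\<omega>. c i * c j * (K (t i) \<omega> * K (t j) \<omega>))"
      by (intro integrable_mult_right K_prod_integrable t that)
    then show ?thesis by (simp add: mult_ac)
  qed
  have "(LINT \<omega>|P. (\<Sum>i<d. c i * K (t i) \<omega>)\<^sup>2) = (\<Sum>i<d. \<Sum>j<d. LINT \<omega>|P. c i * K (t i) \<omega> * (c j * K (t j) \<omega>))"
    unfolding power2_eq_square sum_product
    by (subst Bochner_Integration.integral_sum, (intro Bochner_Integration.integrable_sum int; simp),
        intro sum.cong refl, subst Bochner_Integration.integral_sum, (intro int; simp), rule refl)
  also have "\<dots> = (\<Sum>i<d. \<Sum>j<d. c i * c j * cov_form M X (centered_ind {0..<t i}) (centered_ind {0..<t j}))"
  proof (intro sum.cong refl)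
    fix i j assume "i \<in> {..<d}" "j \<in> {..<d}"
    then have "(LINT \<omega>|P. K (t i) \<omega> * K (t j) \<omega>) = cov_form M X (centered_ind {0..<t i}) (centered_ind {0..<t j})"
      using K_prod[of "t i" "t j"] t(2) by (simp add: Gamma_cov_def)
    moreover have "(LINT \<omega>|P. c i * K (t i) \<omega> * (c j * K (t j) \<omega>)) = (LINT \<omega>|P. c i * c j * (K (t i) \<omega> * K (t j) \<omega>))"
      by (rule Bochner_Integration.integral_cong) auto
    ultimately show "(LINT \<omega>|P. c i * K (t i) \<omega> * (c j * K (t j) \<omega>)) = c i * c j * cov_form M X (centered_ind {0..<t i}) (centered_ind {0..<t j})"
      by simp
  qed
  also have "\<dots> = asymp_var (\<lambda>x. \<Sum>i<d. c i * centered_ind {0..<t i} x)"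
    by (rule asymp_var_sum[symmetric, where V=4 and B=1]) (use t(2) in \<open>auto intro: centered_bv_ind\<close>)
  finally show "(LINT \<omega>|P. (\<Sum>i<d. c i * K (t i) \<omega>)\<^sup>2) = asymp_var (\<lambda>x. \<Sum>i<d. c i * centered_ind {0..<t i} x)" .
qed

lemma fdd_char:
  fixes t :: "nat \<Rightarrow> real"
  assumes t: "inj_on t {..<d}" "\<And>i. i < d \<Longrightarrow> t i \<in> {0..1}"
  shows "(\<lambda>N. LINT \<omega>|M. iexp (\<Sum>i<d. c i * G N \<omega> (t i))) \<longlonglongrightarrow> (LINT \<omega>|P. iexp (\<Sum>i<d. c i * K (t i) \<omega>))"
proof -
  define f where "f x = (\<Sum>i<d. c i * centered_ind {0..<t i} x)" for x
  have f: "centered_bv (\<Sum>i<d. \<bar>c i\<bar> * 4) (\<Sum>i<d. \<bar>c i\<bar> * 1) f"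
    unfolding f_def by (rule centered_bv_sum) (use t(2) in \<open>auto intro: centered_bv_ind\<close>)
  have "(\<Sum>i<d. c i * G N \<omega> (t i)) = 1 / sqrt (real N) * (\<Sum>k=1..N. f (S k \<omega>))" for N \<omega>
  proof -
    have "(\<Sum>i<d. c i * G N \<omega> (t i)) = (\<Sum>i<d. \<Sum>k=1..N. 1 / sqrt (real N) * (c i * centered_ind {0..<t i} (S k \<omega>)))"
    proof (intro sum.cong refl)
      fix i assume "i \<in> {..<d}"
      then have "0 \<le> t i" using t(2) by auto
      then show "c i * G N \<omega> (t i) = (\<Sum>k=1..N. 1 / sqrt (real N) * (c i * centered_ind {0..<t i} (S k \<omega>)))"
        by (simp add: G_eq sum_distrib_left mult_ac)
    qed
    also have "\<dots> = (\<Sum>k=1..N. \<Sum>i<d. 1 / sqrt (real N) * (c i * centered_ind {0..<t i} (S k \<omega>)))"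
      by (rule sum.swap)
    finally show ?thesis by (simp add: f_def sum_distrib_left)
  qed
  then have "(\<lambda>N. LINT \<omega>|M. iexp (\<Sum>i<d. c i * G N \<omega> (t i))) \<longlonglongrightarrow> exp (- (asymp_var f / 2))"
    using clt_char[OF f] by (simp only:)
  moreover have "(LINT \<omega>|P. iexp (\<Sum>i<d. c i * K (t i) \<omega>)) = exp (- (asymp_var f / 2))"
    unfolding f_def using gaussian_char[OF prob_space_P K_combination(1-3)[OF t]] K_combination(4)[OF t] by simp
  ultimately show ?thesis by simp
qed

text \<open>The minimum keeps the points in the unit interval for every index, so that the coordinates of the
  discretized process are random variables without side conditions.\<close>

definition pt :: "nat \<Rightarrow> nat \<Rightarrow> real" where
  "pt m i = min 1 (real i / 2 ^ m)"

lemma pt_mem: "pt m i \<in> {0..1}"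
  by (simp add: pt_def)

lemma pt_eq: "i \<le> 2 ^ m \<Longrightarrow> pt m i = real i / 2 ^ m"
proof -
  assume "i \<le> 2 ^ m"
  then have "real i \<le> real (2 ^ m)" by (simp only: of_nat_le_iff)
  then show ?thesis by (simp add: pt_def)
qed

lemma inj_pt: "inj_on (pt m) {..<Suc (2 ^ m)}"
  by (auto simp: inj_on_def pt_eq)

lemma grid_pt:
  assumes "m \<le> R" "i \<le> 2 ^ R"
  shows "grid m (pt R i) = pt R (i div 2 ^ (R - m) * 2 ^ (R - m))"
proof -
  let ?j = "i div 2 ^ (R - m)"
  have "?j * 2 ^ (R - m) \<le> i" by simp
  then have le: "?j * 2 ^ (R - m) \<le> 2 ^ R" using assms by linarith
  have "(2::real) ^ R = 2 ^ m * 2 ^ (R - m)" using assms by (simp flip: power_add)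
  then have *: "real (?j * 2 ^ (R - m)) / 2 ^ R = real ?j / 2 ^ m" by simp
  have "nat \<lfloor>2 ^ m * (real i / 2 ^ R)\<rfloor> = ?j"
    using grid_div[OF assms(1), of "real i / 2 ^ R"] by simp
  then show ?thesis using assms le unfolding pt_eq[OF assms(2)] pt_eq[OF le] * grid_def by simp
qed

lemma fdd_functional:
  assumes lip: "\<And>x y. \<bar>h x - h y\<bar> \<le> A * (\<Sum>i<Suc (2 ^ m). \<bar>x i - y i\<bar>)" and A: "0 \<le> A"
    and bd: "\<And>x. \<bar>h x\<bar> \<le> B"
  shows "(\<lambda>N. LINT \<omega>|M. h (\<lambda>i. G N \<omega> (pt m i))) \<longlonglongrightarrow> (LINT \<omega>|P. h (\<lambda>i. K (pt m i) \<omega>))"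
proof (rule cramer_wold[OF prob_space_axioms prob_space_P _ _ _ _ _ _ _ lip A bd])
  define C where "C = 2 * (1 + 12 * psi_total) + (\<Sum>i<Suc (2 ^ m). LINT \<omega>|P. (K (pt m i) \<omega>)\<^sup>2)"
  have K0: "0 \<le> (LINT \<omega>|P. (K (pt m i) \<omega>)\<^sup>2)" for i by (intro integral_nonneg_AE AE_I2) simp
  show "(\<lambda>\<omega>. G n \<omega> (pt m i)) \<in> borel_measurable M" for n i by simp
  show "(\<lambda>\<omega>. K (pt m i) \<omega>) \<in> borel_measurable P" for i using K_measurable[OF pt_mem] by simp
  show "(\<lambda>N. LINT \<omega>|M. iexp (\<Sum>i<Suc (2 ^ m). c i * G N \<omega> (pt m i))) \<longlonglongrightarrow> (LINT \<omega>|P. iexp (\<Sum>i<Suc (2 ^ m). c i * K (pt m i) \<omega>))" for c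
    by (rule fdd_char[OF inj_pt pt_mem])
  fix i
  show "integrable M (\<lambda>\<omega>. (G n \<omega> (pt m i))\<^sup>2)" for n using G_second_moment[of "pt m i"] pt_mem[of m i] by simp
  have "0 \<le> (\<Sum>i<Suc (2 ^ m). LINT \<omega>|P. (K (pt m i) \<omega>)\<^sup>2)" by (intro sum_nonneg K0)
  then show "(LINT \<omega>|M. (G n \<omega> (pt m i))\<^sup>2) \<le> C" for n
    using G_second_moment(2)[of "pt m i" n] pt_mem[of m i] unfolding C_def by simp
  show "integrable P (\<lambda>\<omega>. (K (pt m i) \<omega>)\<^sup>2)" by (rule K_integrable[OF pt_mem])
  assume i: "i < Suc (2 ^ m)"
  have "(LINT \<omega>|P. (K (pt m i) \<omega>)\<^sup>2) \<le> (\<Sum>i<Suc (2 ^ m). LINT \<omega>|P. (K (pt m i) \<omega>)\<^sup>2)"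
    by (rule member_le_sum) (use i K0 in auto)
  then show "(LINT \<omega>|P. (K (pt m i) \<omega>)\<^sup>2) \<le> C" unfolding C_def
    by (rule add_increasing[rotated]) (use psi_total_nonneg in simp)
qed

definition step :: "nat \<Rightarrow> (nat \<Rightarrow> real) \<Rightarrow> real \<Rightarrow> real" where
  "step m x t = x (nat \<lfloor>2 ^ m * t\<rfloor>)"

lemma step_pt: assumes "t \<in> {0..1}" shows "step m (\<lambda>i. f (pt m i)) t = f (grid m t)"
  using grid_props(1)[of t m] assms by (simp add: step_def pt_eq grid_def)

text \<open>For \<open>x i = F (i / 2 ^ R)\<close> this is the largest deviation, over the grid of level \<open>R\<close>, of \<open>F\<close> from its
  value at the last point of the coarser grid of level \<open>m\<close>.\<close>

definition osc :: "nat \<Rightarrow> nat \<Rightarrow> (nat \<Rightarrow> real) \<Rightarrow> real" where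
  "osc m R x = (MAX i\<in>{..2 ^ R}. \<bar>x i - x (i div 2 ^ (R - m) * 2 ^ (R - m))\<bar>)"

lemma osc_ge: "i \<le> 2 ^ R \<Longrightarrow> \<bar>x i - x (i div 2 ^ (R - m) * 2 ^ (R - m))\<bar> \<le> osc m R x"
  unfolding osc_def by (rule Max_ge) auto

lemma osc_le: "(\<And>i. i \<le> 2 ^ R \<Longrightarrow> \<bar>x i - x (i div 2 ^ (R - m) * 2 ^ (R - m))\<bar> \<le> e) \<Longrightarrow> osc m R x \<le> e"
  unfolding osc_def by (rule Max.boundedI) auto

lemma osc_nonneg: "0 \<le> osc m R x"
  by (rule order_trans[OF abs_ge_zero osc_ge[of 0]]) simp

lemma osc_lipschitz: "\<bar>min 1 (osc m R x) - min 1 (osc m R y)\<bar> \<le> 2 * (\<Sum>i<Suc (2 ^ R). \<bar>x i - y i\<bar>)"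
proof -
  have one: "osc m R x \<le> osc m R y + 2 * (\<Sum>i<Suc (2 ^ R). \<bar>x i - y i\<bar>)" for x y
  proof (rule osc_le)
    fix i :: nat assume i: "i \<le> 2 ^ R"
    let ?j = "i div 2 ^ (R - m) * 2 ^ (R - m)"
    have "?j \<le> i" by simp
    with i have j: "?j \<le> 2 ^ R" by linarith
    have "\<bar>x k - y k\<bar> \<le> (\<Sum>i<Suc (2 ^ R). \<bar>x i - y i\<bar>)" if "k \<le> 2 ^ R" for k
      by (rule member_le_sum) (use that in auto)
    from this[OF i] this[OF j] osc_ge[OF i, of y m]
    show "\<bar>x i - x ?j\<bar> \<le> osc m R y + 2 * (\<Sum>i<Suc (2 ^ R). \<bar>x i - y i\<bar>)" by linarith
  qed
  have "(\<Sum>i<Suc (2 ^ R). \<bar>y i - x i\<bar>) = (\<Sum>i<Suc (2 ^ R). \<bar>x i - y i\<bar>)" by (simp add: abs_minus_commute)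
  with one[of x y] one[of y x] show ?thesis by linarith
qed

lemma osc_pt_mono:
  assumes "m \<le> R"
  shows "osc m R (\<lambda>i. F (pt R i)) \<le> osc m (Suc R) (\<lambda>i. F (pt (Suc R) i))"
proof (rule osc_le)
  fix i :: nat assume i: "i \<le> 2 ^ R"
  have i2: "2 * i \<le> 2 ^ Suc R" using i by simp
  have p: "pt (Suc R) (2 * i) = pt R i" by (simp add: pt_eq[OF i] pt_eq[OF i2])
  have 1: "\<bar>F (pt R i) - F (grid m (pt R i))\<bar> = \<bar>F (pt (Suc R) (2 * i)) - F (grid m (pt (Suc R) (2 * i)))\<bar>"
    by (simp add: p)
  have "m \<le> Suc R" using assms by simp
  from 1 show "\<bar>F (pt R i) - F (pt R (i div 2 ^ (R - m) * 2 ^ (R - m)))\<bar> \<le> osc m (Suc R) (\<lambda>i. F (pt (Suc R) i))"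
    using osc_ge[OF i2, of "\<lambda>i. F (pt (Suc R) i)" m]
    unfolding grid_pt[OF assms i] grid_pt[OF \<open>m \<le> Suc R\<close> i2] by simp
qed

text \<open>\<open>\<Phi>\<close> of the process and of its discretization on the dyadic
  grid are close, for the empirical process by tightness, for \<open>K\<close> because its oscillation over
  finite grids inherits the bounds of the empirical process; the discretized functionals converge
  by the finite-dimensional limit theorem.\<close>

theorem functional_convergence:
  fixes \<Phi> :: "(real \<Rightarrow> real) \<Rightarrow> real" and \<D> :: "(real \<Rightarrow> real) set"
  assumes lip: "\<And>f g e. f \<in> \<D> \<Longrightarrow> g \<in> \<D> \<Longrightarrow> (\<And>t. t \<in> {0..1} \<Longrightarrow> \<bar>f t - g t\<bar> \<le> e) \<Longrightarrow> \<bar>\<Phi> f - \<Phi> g\<bar> \<le> 2 * e"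
    and stepD: "\<And>m x. step m x \<in> \<D>"
    and GD: "\<And>N \<omega>. G N \<omega> \<in> \<D>"
    and KD: "\<And>\<omega>. \<omega> \<in> space P \<Longrightarrow> (\<lambda>t. K t \<omega>) \<in> \<D>"
    and GM: "\<And>N. (\<lambda>\<omega>. \<Phi> (G N \<omega>)) \<in> borel_measurable M"
    and KM: "(\<lambda>\<omega>. \<Phi> (\<lambda>t. K t \<omega>)) \<in> borel_measurable P"
    and sep: "\<And>\<omega> m t e. \<omega> \<in> space P \<Longrightarrow> t \<in> {0..1} \<Longrightarrow>
       (\<And>R i. m \<le> R \<Longrightarrow> i \<le> 2 ^ R \<Longrightarrow> \<bar>K (pt R i) \<omega> - K (grid m (pt R i)) \<omega>\<bar> \<le> e) \<Longrightarrow>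
       \<bar>K t \<omega> - K (grid m t) \<omega>\<bar> \<le> e"
  shows "weak_conv_m (\<lambda>N. distr M borel (\<lambda>\<omega>. \<Phi> (G N \<omega>))) (distr P borel (\<lambda>\<omega>. \<Phi> (\<lambda>t. K t \<omega>)))"
proof (rule levy_continuity)
  interpret P: prob_space P by (rule prob_space_P)
  note [measurable] = GM KM
  show "real_distribution (distr M borel (\<lambda>\<omega>. \<Phi> (G N \<omega>)))" for N
    by (rule real_distribution_distr) (rule GM)
  show "real_distribution (distr P borel (\<lambda>\<omega>. \<Phi> (\<lambda>t. K t \<omega>)))"
    by (rule P.real_distribution_distr) (rule KM)
  fix u :: real
  obtain \<tau> \<eta> :: "nat \<Rightarrow> real" where \<tau>: "\<tau> \<longlonglongrightarrow> 0" and \<eta>: "\<eta> \<longlonglongrightarrow> 0" "\<And>m. 0 \<le> \<eta> m"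
    and tight: "\<And>m N. 2 ^ Suc m \<le> N \<Longrightarrow> \<exists>A\<in>sets M. measure M A \<le> \<tau> m \<and>
       (\<forall>\<omega>\<in>space M - A. \<forall>t\<in>{0..1}. \<bar>G N \<omega> t - G N \<omega> (grid m t)\<bar> \<le> \<eta> m + 2 / sqrt (real N))"
    by (rule tightness) (rule that)
  define xG where "xG m N \<omega> = (\<lambda>i. G N \<omega> (pt m i))" for m N \<omega>
  define xK where "xK m \<omega> = (\<lambda>i. K (pt m i) \<omega>)" for m \<omega>
  have xGm: "(\<lambda>\<omega>. xG m N \<omega> i) \<in> borel_measurable M" for m N i by (simp add: xG_def)
  have xKm: "(\<lambda>\<omega>. xK m \<omega> i) \<in> borel_measurable P" for m i using K_measurable[OF pt_mem] by (simp add: xK_def)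
  have steplip: "\<bar>\<Phi> (step m x) - \<Phi> (step m y)\<bar> \<le> 2 * (\<Sum>i<Suc (2 ^ m). \<bar>x i - y i\<bar>)" for m x y
  proof (rule lip[OF stepD stepD])
    fix t :: real assume "t \<in> {0..1}"
    then have "nat \<lfloor>2 ^ m * t\<rfloor> < Suc (2 ^ m)"
      by (intro le_imp_less_Suc grid_props(1)) auto
    then show "\<bar>step m x t - step m y t\<bar> \<le> (\<Sum>i<Suc (2 ^ m). \<bar>x i - y i\<bar>)"
      unfolding step_def by (intro member_le_sum[of _ _ "\<lambda>i. \<bar>x i - y i\<bar>"]) auto
  qed
  have stepm: "(\<lambda>\<omega>. \<Phi> (step m (xG m N \<omega>))) \<in> borel_measurable M" "(\<lambda>\<omega>. \<Phi> (step m (xK m \<omega>))) \<in> borel_measurable P" for m N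
    using lipschitz_measurable[OF steplip, of "\<lambda>i \<omega>. xG m N \<omega> i" M m, OF xGm]
      lipschitz_measurable[OF steplip, of "\<lambda>i \<omega>. xK m \<omega> i" P m, OF xKm] by auto
  have oscm: "(\<lambda>\<omega>. min 1 (osc m R (xG R N \<omega>))) \<in> borel_measurable M" "(\<lambda>\<omega>. min 1 (osc m R (xK R \<omega>))) \<in> borel_measurable P" for m R N
    using lipschitz_measurable[OF osc_lipschitz[of m R], of "\<lambda>i \<omega>. xG R N \<omega> i" M, OF xGm]
      lipschitz_measurable[OF osc_lipschitz[of m R], of "\<lambda>i \<omega>. xK R \<omega> i" P, OF xKm] by auto
  have osc01: "\<bar>min 1 (osc m R x)\<bar> \<le> 1" for m R x using osc_nonneg[of m R x] by simp
  have grid01: "grid m t \<in> {0..1}" if "t \<in> {0..1}" for m t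
    using grid_props(2,3)[of t m] that by auto
  \<comment> \<open>truncation at 1 makes the oscillation over a finite grid a bounded Lipschitz function of
    finitely many coordinates, so the bound passes from \<open>G\<close> to \<open>K\<close>\<close>
  have oscK: "(LINT \<omega>|P. min 1 (osc m R (xK R \<omega>))) \<le> \<tau> m + \<eta> m" if mR: "m \<le> R" for m R
  proof (rule LIMSEQ_le)
    show "(\<lambda>N. LINT \<omega>|M. min 1 (osc m R (xG R N \<omega>))) \<longlonglongrightarrow> (LINT \<omega>|P. min 1 (osc m R (xK R \<omega>)))"
      unfolding xG_def xK_def by (rule fdd_functional[OF osc_lipschitz _ osc01]) simp
    have "(\<lambda>N. \<tau> m + (\<eta> m + 2 / sqrt (real N))) \<longlonglongrightarrow> \<tau> m + (\<eta> m + 0)"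
      by (intro tendsto_intros) real_asymp
    then show "(\<lambda>N. \<tau> m + (\<eta> m + 2 / sqrt (real N))) \<longlonglongrightarrow> \<tau> m + \<eta> m" by simp
    show "\<exists>n. \<forall>N\<ge>n. (LINT \<omega>|M. min 1 (osc m R (xG R N \<omega>))) \<le> \<tau> m + (\<eta> m + 2 / sqrt (real N))"
    proof (intro exI[of _ "2 ^ Suc m"] allI impI)
      fix N :: nat assume "2 ^ Suc m \<le> N"
      from tight[OF this] obtain A where A: "A \<in> sets M" "measure M A \<le> \<tau> m"
        and good: "\<And>\<omega> t. \<omega> \<in> space M - A \<Longrightarrow> t \<in> {0..1} \<Longrightarrow> \<bar>G N \<omega> t - G N \<omega> (grid m t)\<bar> \<le> \<eta> m + 2 / sqrt (real N)"
        by blast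
      let ?e = "\<eta> m + 2 / sqrt (real N)"
      have e: "0 \<le> ?e" using \<eta>(2)[of m] by simp
      have "(LINT \<omega>|M. min 1 (osc m R (xG R N \<omega>))) \<le> (LINT \<omega>|M. indicator A \<omega> + ?e)"
      proof (rule integral_mono)
        show "integrable M (\<lambda>\<omega>. min 1 (osc m R (xG R N \<omega>)))"
          by (rule integrable_const_bound[where B=1]) (use osc01 oscm in auto)
        show "integrable M (\<lambda>\<omega>. indicator A \<omega> + ?e)"
          by (intro Bochner_Integration.integrable_add integrable_real_indicator A integrable_const)
            (simp add: less_top[symmetric])
        fix \<omega> assume \<omega>: "\<omega> \<in> space M"
        show "min 1 (osc m R (xG R N \<omega>)) \<le> indicator A \<omega> + ?e"
        proof (cases "\<omega> \<in> A")
          case False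
          have "osc m R (xG R N \<omega>) \<le> ?e"
          proof (rule osc_le)
            fix i :: nat assume i: "i \<le> 2 ^ R"
            show "\<bar>xG R N \<omega> i - xG R N \<omega> (i div 2 ^ (R - m) * 2 ^ (R - m))\<bar> \<le> ?e"
              using good[of \<omega> "pt R i"] False \<omega> pt_mem[of R i] unfolding xG_def grid_pt[OF mR i] by simp
          qed
          then show ?thesis using False by simp
        qed (use e in simp)
      qed
      also have "\<dots> = measure M A + ?e"
      proof -
        have "integrable M (indicator A :: _ \<Rightarrow> real)" using A by (auto simp: less_top[symmetric])
        then show ?thesis using A
          by (subst Bochner_Integration.integral_add) (auto simp: prob_space)
      qed
      finally show "(LINT \<omega>|M. min 1 (osc m R (xG R N \<omega>))) \<le> \<tau> m + ?e" using A(2) by simp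
    qed
  qed
  \<comment> \<open>by monotone convergence in \<open>R\<close> the bound holds for the oscillation over all dyadic points, and
    by separability that oscillation controls the whole path\<close>
  let ?IK = "LINT \<omega>|P. iexp (u * \<Phi> (\<lambda>t. K t \<omega>))"
  let ?JK = "\<lambda>m. LINT \<omega>|P. iexp (u * \<Phi> (step m (xK m \<omega>)))"
  have iIK: "complex_integrable P (\<lambda>\<omega>. iexp (u * \<Phi> (\<lambda>t. K t \<omega>)))"
    by (rule P.integrable_const_bound[where B=1]) (auto simp del: of_real_mult)
  have iJK: "complex_integrable P (\<lambda>\<omega>. iexp (u * \<Phi> (step m (xK m \<omega>))))" for m
    by (rule P.integrable_const_bound[where B=1]) (use stepm in \<open>auto simp del: of_real_mult\<close>)
  have errK: "cmod (?IK - ?JK m) \<le> (2 + 2 * \<bar>u\<bar>) * (\<tau> m + \<eta> m)" for m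
  proof -
    define ms where "ms n \<omega> = min 1 (osc m (m + n) (xK (m + n) \<omega>))" for n \<omega>
    define \<Lambda> where "\<Lambda> \<omega> = (SUP n. ms n \<omega>)" for \<omega>
    have om: "ms n \<in> borel_measurable P" for n using oscm(2)[of m "m + n"] unfolding ms_def .
    have ms01: "0 \<le> ms n \<omega>" "ms n \<omega> \<le> 1" for n \<omega> using osc_nonneg[of m "m + n"] by (auto simp: ms_def)
    have bdd: "bdd_above (range (\<lambda>n. ms n \<omega>))" for \<omega> using ms01 by (intro bdd_aboveI2[where M=1])
    have inc: "incseq (\<lambda>n. ms n \<omega>)" for \<omega>
    proof (rule incseq_SucI)
      fix n
      show "ms n \<omega> \<le> ms (Suc n) \<omega>"
        using osc_pt_mono[of m "m + n" "\<lambda>t. K t \<omega>"] unfolding ms_def xK_def by (simp add: min.mono)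
    qed
    have lim: "(\<lambda>n. ms n \<omega>) \<longlonglongrightarrow> \<Lambda> \<omega>" for \<omega>
      unfolding \<Lambda>_def by (rule LIMSEQ_incseq_SUP[OF bdd inc])
    have \<Lambda>m: "\<Lambda> \<in> borel_measurable P"
      by (rule borel_measurable_LIMSEQ_real[OF lim]) (rule om)
    have ole: "ms n \<omega> \<le> \<Lambda> \<omega>" for n \<omega> unfolding \<Lambda>_def by (rule cSUP_upper[OF _ bdd]) simp
    have \<Lambda>01: "0 \<le> \<Lambda> \<omega>" "\<Lambda> \<omega> \<le> 1" for \<omega>
      by (rule order_trans[OF ms01(1) ole]) (rule LIMSEQ_le_const2[OF lim], use ms01(2) in auto)
    have i\<Lambda>: "integrable P \<Lambda>" by (rule P.integrable_const_bound[where B=1]) (use \<Lambda>01 \<Lambda>m in auto)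
    have "(\<lambda>n. LINT \<omega>|P. ms n \<omega>) \<longlonglongrightarrow> (LINT \<omega>|P. \<Lambda> \<omega>)"
      by (rule integral_dominated_convergence[where w="\<lambda>_. 1"]) (use om \<Lambda>m lim ms01 in \<open>auto intro!: AE_I2\<close>)
    then have E\<Lambda>: "(LINT \<omega>|P. \<Lambda> \<omega>) \<le> \<tau> m + \<eta> m"
      by (rule LIMSEQ_le_const2) (use oscK[of m] in \<open>auto simp: ms_def\<close>)
    have pt: "cmod (iexp (u * \<Phi> (\<lambda>t. K t \<omega>)) - iexp (u * \<Phi> (step m (xK m \<omega>)))) \<le> (2 + 2 * \<bar>u\<bar>) * \<Lambda> \<omega>"
      if \<omega>: "\<omega> \<in> space P" for \<omega>
    proof (cases "\<Lambda> \<omega> < 1")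
      case True
      have "\<bar>K t \<omega> - K (grid m t) \<omega>\<bar> \<le> \<Lambda> \<omega>" if "t \<in> {0..1}" for t
      proof (rule sep[OF \<omega> that])
        fix R i :: nat assume mR: "m \<le> R" and i: "i \<le> 2 ^ R"
        have "ms (R - m) \<omega> < 1" using ole[of "R - m" \<omega>] True by simp
        then have "ms (R - m) \<omega> = osc m R (xK R \<omega>)" using mR by (simp add: ms_def min_def split: if_splits)
        moreover have "\<bar>K (pt R i) \<omega> - K (grid m (pt R i)) \<omega>\<bar> \<le> osc m R (xK R \<omega>)"
          using osc_ge[OF i, of "xK R \<omega>" m] unfolding xK_def grid_pt[OF mR i] .
        ultimately show "\<bar>K (pt R i) \<omega> - K (grid m (pt R i)) \<omega>\<bar> \<le> \<Lambda> \<omega>" using ole[of "R - m" \<omega>] by simp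
      qed
      then have "\<bar>\<Phi> (\<lambda>t. K t \<omega>) - \<Phi> (step m (xK m \<omega>))\<bar> \<le> 2 * \<Lambda> \<omega>"
        by (intro lip[OF KD[OF \<omega>] stepD]) (simp add: xK_def step_pt[where f="\<lambda>t. K t \<omega>"])
      then have "\<bar>u\<bar> * \<bar>\<Phi> (\<lambda>t. K t \<omega>) - \<Phi> (step m (xK m \<omega>))\<bar> \<le> \<bar>u\<bar> * (2 * \<Lambda> \<omega>)"
        by (rule mult_left_mono) simp
      moreover have "cmod (iexp (u * \<Phi> (\<lambda>t. K t \<omega>)) - iexp (u * \<Phi> (step m (xK m \<omega>)))) \<le> \<bar>u\<bar> * \<bar>\<Phi> (\<lambda>t. K t \<omega>) - \<Phi> (step m (xK m \<omega>))\<bar>"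
        using iexp_lipschitz[of "u * \<Phi> (\<lambda>t. K t \<omega>)" "u * \<Phi> (step m (xK m \<omega>))"]
        unfolding right_diff_distrib[symmetric] abs_mult .
      moreover have "\<bar>u\<bar> * (2 * \<Lambda> \<omega>) \<le> (2 + 2 * \<bar>u\<bar>) * \<Lambda> \<omega>" using \<Lambda>01[of \<omega>] by (simp add: algebra_simps)
      ultimately show ?thesis by linarith
    next
      case False
      then have "\<Lambda> \<omega> = 1" using \<Lambda>01[of \<omega>] by simp
      moreover have "cmod (iexp (u * \<Phi> (\<lambda>t. K t \<omega>)) - iexp (u * \<Phi> (step m (xK m \<omega>)))) \<le> 1 + 1"
        by (rule order_trans[OF norm_triangle_ineq4]) (simp del: of_real_mult)
      ultimately show ?thesis by simp
    qed
    have "cmod (?IK - ?JK m) = cmod (LINT \<omega>|P. iexp (u * \<Phi> (\<lambda>t. K t \<omega>)) - iexp (u * \<Phi> (step m (xK m \<omega>))))"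
      by (subst Bochner_Integration.integral_diff[OF iIK iJK]) simp
    also have "\<dots> \<le> (LINT \<omega>|P. cmod (iexp (u * \<Phi> (\<lambda>t. K t \<omega>)) - iexp (u * \<Phi> (step m (xK m \<omega>)))))"
      by (rule integral_norm_bound)
    also have "\<dots> \<le> (LINT \<omega>|P. (2 + 2 * \<bar>u\<bar>) * \<Lambda> \<omega>)"
      by (rule integral_mono)
        (use pt i\<Lambda> in \<open>auto intro!: integrable_norm Bochner_Integration.integrable_diff iIK iJK simp del: of_real_mult\<close>)
    also have "\<dots> \<le> (2 + 2 * \<bar>u\<bar>) * (\<tau> m + \<eta> m)" using E\<Lambda> by (simp add: mult_left_mono)
    finally show ?thesis .
  qed
  \<comment> \<open>off the exceptional event of \<open>tightness\<close> the Lipschitz bound applies, on it the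
    characteristic functions differ by at most 2\<close>
  let ?IG = "\<lambda>N. LINT \<omega>|M. iexp (u * \<Phi> (G N \<omega>))"
  let ?JG = "\<lambda>m N. LINT \<omega>|M. iexp (u * \<Phi> (step m (xG m N \<omega>)))"
  have iIG: "complex_integrable M (\<lambda>\<omega>. iexp (u * \<Phi> (G N \<omega>)))" for N
    by (rule integrable_const_bound[where B=1]) (auto simp del: of_real_mult)
  have iJG: "complex_integrable M (\<lambda>\<omega>. iexp (u * \<Phi> (step m (xG m N \<omega>))))" for m N
    by (rule integrable_const_bound[where B=1]) (use stepm in \<open>auto simp del: of_real_mult\<close>)
  have errG: "cmod (?IG N - ?JG m N) \<le> 2 * \<tau> m + 2 * \<bar>u\<bar> * (\<eta> m + 2 / sqrt (real N))" if N: "2 ^ Suc m \<le> N" for m N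
  proof -
    from tight[OF N] obtain A where A: "A \<in> sets M" "measure M A \<le> \<tau> m"
      and good: "\<And>\<omega> t. \<omega> \<in> space M - A \<Longrightarrow> t \<in> {0..1} \<Longrightarrow> \<bar>G N \<omega> t - G N \<omega> (grid m t)\<bar> \<le> \<eta> m + 2 / sqrt (real N)"
      by blast
    let ?e = "\<eta> m + 2 / sqrt (real N)"
    have e: "0 \<le> ?e" using \<eta>(2)[of m] by simp
    have pt: "cmod (iexp (u * \<Phi> (G N \<omega>)) - iexp (u * \<Phi> (step m (xG m N \<omega>)))) \<le> 2 * indicator A \<omega> + \<bar>u\<bar> * (2 * ?e)"
      if \<omega>: "\<omega> \<in> space M" for \<omega>
    proof (cases "\<omega> \<in> A")
      case True
      have "cmod (iexp (u * \<Phi> (G N \<omega>)) - iexp (u * \<Phi> (step m (xG m N \<omega>)))) \<le> 1 + 1"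
        by (rule order_trans[OF norm_triangle_ineq4]) (simp del: of_real_mult)
      moreover have "0 \<le> \<bar>u\<bar> * (2 * ?e)" using e by (intro mult_nonneg_nonneg) auto
      ultimately show ?thesis using True by simp
    next
      case False
      have "\<bar>\<Phi> (G N \<omega>) - \<Phi> (step m (xG m N \<omega>))\<bar> \<le> 2 * ?e"
        using good[of \<omega>] False \<omega> by (intro lip[OF GD stepD]) (simp add: xG_def step_pt[where f="G N \<omega>"])
      then have "\<bar>u\<bar> * \<bar>\<Phi> (G N \<omega>) - \<Phi> (step m (xG m N \<omega>))\<bar> \<le> \<bar>u\<bar> * (2 * ?e)"
        by (rule mult_left_mono) simp
      moreover have "cmod (iexp (u * \<Phi> (G N \<omega>)) - iexp (u * \<Phi> (step m (xG m N \<omega>)))) \<le> \<bar>u\<bar> * \<bar>\<Phi> (G N \<omega>) - \<Phi> (step m (xG m N \<omega>))\<bar>"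
        using iexp_lipschitz[of "u * \<Phi> (G N \<omega>)" "u * \<Phi> (step m (xG m N \<omega>))"]
        unfolding right_diff_distrib[symmetric] abs_mult .
      ultimately show ?thesis using False by simp
    qed
    have "cmod (?IG N - ?JG m N) = cmod (LINT \<omega>|M. iexp (u * \<Phi> (G N \<omega>)) - iexp (u * \<Phi> (step m (xG m N \<omega>))))"
      by (subst Bochner_Integration.integral_diff[OF iIG iJG]) simp
    also have "\<dots> \<le> (LINT \<omega>|M. cmod (iexp (u * \<Phi> (G N \<omega>)) - iexp (u * \<Phi> (step m (xG m N \<omega>)))))"
      by (rule integral_norm_bound)
    also have "\<dots> \<le> (LINT \<omega>|M. 2 * indicator A \<omega> + \<bar>u\<bar> * (2 * ?e))"
      by (rule integral_mono)
        (use pt A in \<open>auto intro!: integrable_norm Bochner_Integration.integrable_diff iIG iJG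
          Bochner_Integration.integrable_add integrable_mult_right integrable_real_indicator
          simp: less_top[symmetric] simp del: of_real_mult\<close>)
    also have "\<dots> = 2 * measure M A + \<bar>u\<bar> * (2 * ?e)"
    proof -
      have "integrable M (indicator A :: _ \<Rightarrow> real)" using A by (auto simp: less_top[symmetric])
      then show ?thesis using A
        by (subst Bochner_Integration.integral_add) (auto simp: prob_space)
    qed
    finally show ?thesis using A(2) by (simp add: algebra_simps)
  qed
  \<comment> \<open>the real and imaginary parts of the exponential are Lipschitz functions of the
    finitely many grid values\<close>
  have J: "(\<lambda>N. ?JG m N) \<longlonglongrightarrow> ?JK m" for m
  proof -
    have lipc: "\<bar>cos (u * \<Phi> (step m x)) - cos (u * \<Phi> (step m y))\<bar> \<le> (\<bar>u\<bar> * 2) * (\<Sum>i<Suc (2 ^ m). \<bar>x i - y i\<bar>)"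
      and lips: "\<bar>sin (u * \<Phi> (step m x)) - sin (u * \<Phi> (step m y))\<bar> \<le> (\<bar>u\<bar> * 2) * (\<Sum>i<Suc (2 ^ m). \<bar>x i - y i\<bar>)" for x y
    proof -
      let ?a = "u * \<Phi> (step m x)" and ?b = "u * \<Phi> (step m y)"
      have ab: "\<bar>?a - ?b\<bar> \<le> (\<bar>u\<bar> * 2) * (\<Sum>i<Suc (2 ^ m). \<bar>x i - y i\<bar>)"
        unfolding right_diff_distrib[symmetric] abs_mult mult.assoc by (intro mult_left_mono steplip) simp
      have "cmod (iexp ?a - iexp ?b) \<le> \<bar>?a - ?b\<bar>" by (rule iexp_lipschitz)
      moreover have "Re (iexp v) = cos v" "Im (iexp v) = sin v" for v
        by (simp_all add: Re_exp Im_exp)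
      then have "\<bar>cos ?a - cos ?b\<bar> \<le> cmod (iexp ?a - iexp ?b)" "\<bar>sin ?a - sin ?b\<bar> \<le> cmod (iexp ?a - iexp ?b)"
        using abs_Re_le_cmod[of "iexp ?a - iexp ?b"] abs_Im_le_cmod[of "iexp ?a - iexp ?b"] by (simp_all del: of_real_mult)
      ultimately show "\<bar>cos ?a - cos ?b\<bar> \<le> (\<bar>u\<bar> * 2) * (\<Sum>i<Suc (2 ^ m). \<bar>x i - y i\<bar>)"
        "\<bar>sin ?a - sin ?b\<bar> \<le> (\<bar>u\<bar> * 2) * (\<Sum>i<Suc (2 ^ m). \<bar>x i - y i\<bar>)" using ab by linarith+
    qed
    have reim: "Re (iexp v) = cos v" "Im (iexp v) = sin v" for v
      by (simp_all add: Re_exp Im_exp)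
    have "(\<lambda>N. LINT \<omega>|M. cos (u * \<Phi> (step m (xG m N \<omega>)))) \<longlonglongrightarrow> (LINT \<omega>|P. cos (u * \<Phi> (step m (xK m \<omega>))))"
      unfolding xG_def xK_def by (rule fdd_functional[OF lipc _ abs_cos_le_one]) simp
    moreover have "(\<lambda>N. LINT \<omega>|M. sin (u * \<Phi> (step m (xG m N \<omega>)))) \<longlonglongrightarrow> (LINT \<omega>|P. sin (u * \<Phi> (step m (xK m \<omega>))))"
      unfolding xG_def xK_def by (rule fdd_functional[OF lips _ abs_sin_le_one]) simp
    moreover have "Re (?JG m N) = (LINT \<omega>|M. cos (u * \<Phi> (step m (xG m N \<omega>))))" "Im (?JG m N) = (LINT \<omega>|M. sin (u * \<Phi> (step m (xG m N \<omega>))))" for N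
      unfolding integral_Re[OF iJG, symmetric] integral_Im[OF iJG, symmetric] reim by (rule refl)+
    moreover have "Re (?JK m) = (LINT \<omega>|P. cos (u * \<Phi> (step m (xK m \<omega>))))" "Im (?JK m) = (LINT \<omega>|P. sin (u * \<Phi> (step m (xK m \<omega>))))"
      unfolding integral_Re[OF iJK, symmetric] integral_Im[OF iJK, symmetric] reim by (rule refl)+
    ultimately show ?thesis unfolding tendsto_complex_iff by (simp only:)
  qed
  have "?IG \<longlonglongrightarrow> ?IK"
  proof (rule LIMSEQ_I)
    fix r :: real assume r: "0 < r"
    define b where "b m = (2 + 2 * \<bar>u\<bar>) * (\<tau> m + \<eta> m) + (2 * \<tau> m + 2 * \<bar>u\<bar> * \<eta> m)" for m
    have "b \<longlonglongrightarrow> (2 + 2 * \<bar>u\<bar>) * (0 + 0) + (2 * 0 + 2 * \<bar>u\<bar> * 0)"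
      unfolding b_def by (intro tendsto_intros \<tau> \<eta>(1))
    then have "b \<longlonglongrightarrow> 0" by simp
    from LIMSEQ_D[OF this, of "r / 3"] r obtain m where m: "\<bar>b m\<bar> < r / 3" by auto
    obtain n1 where n1: "\<And>N. n1 \<le> N \<Longrightarrow> cmod (?JG m N - ?JK m) < r / 3"
      using LIMSEQ_D[OF J[of m], of "r / 3"] r by auto
    have "(\<lambda>N. 2 * \<bar>u\<bar> * (2 / sqrt (real N))) \<longlonglongrightarrow> 2 * \<bar>u\<bar> * 0"
      by (intro tendsto_intros) real_asymp
    from LIMSEQ_D[OF this, of "r / 3"] r obtain n2 where n2: "\<And>N. n2 \<le> N \<Longrightarrow> 2 * \<bar>u\<bar> * (2 / sqrt (real N)) < r / 3" by auto
    show "\<exists>no. \<forall>N\<ge>no. norm (?IG N - ?IK) < r"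
    proof (intro exI[of _ "max (2 ^ Suc m) (max n1 n2)"] allI impI)
      fix N assume N: "max (2 ^ Suc m) (max n1 n2) \<le> N"
      have tri: "cmod (a + b - c) \<le> cmod a + cmod b + cmod c" for a b c
        using norm_triangle_ineq4[of "a + b" c] norm_triangle_ineq[of a b] by linarith
      have eq: "?IG N - ?IK = (?IG N - ?JG m N) + (?JG m N - ?JK m) - (?IK - ?JK m)" by simp
      have "cmod (?IG N - ?IK) \<le> cmod (?IG N - ?JG m N) + cmod (?JG m N - ?JK m) + cmod (?IK - ?JK m)"
        unfolding eq by (rule tri)
      moreover have "cmod (?IG N - ?JG m N) \<le> 2 * \<tau> m + 2 * \<bar>u\<bar> * \<eta> m + 2 * \<bar>u\<bar> * (2 / sqrt (real N))"
        using errG[of m N] N by (simp add: distrib_left)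
      ultimately show "norm (?IG N - ?IK) < r"
        using errK[of m] n1[of N] n2[of N] N m unfolding b_def by linarith
    qed
  qed
  moreover have "char (distr M borel (\<lambda>\<omega>. \<Phi> (G N \<omega>))) u = ?IG N" for N
    unfolding char_def by (subst integral_distr) (auto simp del: of_real_mult)
  moreover have "char (distr P borel (\<lambda>\<omega>. \<Phi> (\<lambda>t. K t \<omega>))) u = ?IK"
    unfolding char_def by (subst integral_distr) (auto simp del: of_real_mult)
  ultimately show "(\<lambda>N. char (distr M borel (\<lambda>\<omega>. \<Phi> (G N \<omega>))) u) \<longlonglongrightarrow> char (distr P borel (\<lambda>\<omega>. \<Phi> (\<lambda>t. K t \<omega>))) u"
    by simp
qed

end

section \<open>The discrepancy functionals on Skorohod paths\<close>

text \<open>Near every interior point of a Skorohod path there is an open interval, possibly to one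
  side of the point, on which the path stays close to its value there.  Countable dense sets and
  sets of full measure therefore see all values.\<close>

lemma skorohod_interval:
  assumes f: "f \<in> skorohod_D" and t: "0 < t" "t < 1" and ab: "a < t" "t < b" and e: "0 < e"
  obtains x y where "x < y" "a \<le> x" "y \<le> b" "0 \<le> x" "y \<le> 1" "\<And>s. x < s \<Longrightarrow> s < y \<Longrightarrow> \<bar>f s - f t\<bar> < e"
proof -
  from f consider "\<forall>t\<in>{0..<1}. continuous (at_right t) f" | "\<forall>t\<in>{0<..1}. continuous (at_left t) f"
    unfolding skorohod_D_def by blast
  then show ?thesis
  proof cases
    case 1
    then have "(f \<longlongrightarrow> f t) (at_right t)" using t by (simp add: continuous_within)
    then have "eventually (\<lambda>s. dist (f s) (f t) < e) (at_right t)" using e by (rule tendstoD)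
    then obtain c where c: "t < c" "\<And>s. t < s \<Longrightarrow> s < c \<Longrightarrow> \<bar>f s - f t\<bar> < e"
      unfolding eventually_at_right_field dist_real_def by blast
    show ?thesis by (rule that[of t "min c (min b 1)"]) (use c t ab in auto)
  next
    case 2
    then have "(f \<longlongrightarrow> f t) (at_left t)" using t by (simp add: continuous_within)
    then have "eventually (\<lambda>s. dist (f s) (f t) < e) (at_left t)" using e by (rule tendstoD)
    then obtain c where c: "c < t" "\<And>s. c < s \<Longrightarrow> s < t \<Longrightarrow> \<bar>f s - f t\<bar> < e"
      unfolding eventually_at_left_field dist_real_def by blast
    show ?thesis by (rule that[of "max c (max a 0)" t]) (use c t ab in auto)
  qed
qed

lemma skorohod_limits:
  assumes "f \<in> skorohod_D"
  shows "0 \<le> x \<Longrightarrow> x < 1 \<Longrightarrow> \<exists>l. (f \<longlongrightarrow> l) (at_right x)" "0 < x \<Longrightarrow> x \<le> 1 \<Longrightarrow> \<exists>l. (f \<longlongrightarrow> l) (at_left x)"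
  using assms unfolding skorohod_D_def mem_Collect_eq Ball_def atLeastLessThan_iff greaterThanAtMost_iff by blast+

text \<open>One-sided limits bound the path near every point; compactness of the interval does the rest.\<close>

lemma skorohod_bounded:
  assumes f: "f \<in> skorohod_D" obtains B where "0 \<le> B" "\<And>t. t \<in> {0..1} \<Longrightarrow> \<bar>f t\<bar> \<le> B"
proof -
  define Q where "Q a b \<longleftrightarrow> (\<exists>B. \<forall>s\<in>{a..b} \<inter> {0..1}. \<bar>f s\<bar> \<le> B)" for a b :: real
  have "Q 0 1"
  proof (rule Bolzano)
    fix a b c assume ab: "Q a b" "Q b c" "a \<le> b" "b \<le> c"
    then obtain B B' where "\<forall>s\<in>{a..b} \<inter> {0..1}. \<bar>f s\<bar> \<le> B" "\<forall>s\<in>{b..c} \<inter> {0..1}. \<bar>f s\<bar> \<le> B'"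
      unfolding Q_def by blast
    then show "Q a c" unfolding Q_def by (intro exI[of _ "max B B'"]) (force simp: le_max_iff_disj)
  next
    fix x :: real assume x: "0 \<le> x" "x \<le> 1"
    have "\<exists>r l. x < r \<and> (\<forall>s. x < s \<longrightarrow> s < r \<longrightarrow> s \<le> 1 \<longrightarrow> \<bar>f s\<bar> \<le> l)"
    proof (cases "x < 1")
      case True
      then obtain l where "(f \<longlongrightarrow> l) (at_right x)" using skorohod_limits(1)[OF f x(1)] by blast
      then have "eventually (\<lambda>s. dist (f s) l < 1) (at_right x)" by (rule tendstoD) simp
      then obtain r where "x < r" "\<And>s. x < s \<Longrightarrow> s < r \<Longrightarrow> \<bar>f s - l\<bar> < 1"
        unfolding eventually_at_right_field dist_real_def by blast
      then show ?thesis by (intro exI[of _ r] exI[of _ "\<bar>l\<bar> + 1"]) force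
    qed (auto intro!: exI[of _ "x + 1"])
    then obtain r l where r: "x < r" "\<And>s. x < s \<Longrightarrow> s < r \<Longrightarrow> s \<le> 1 \<Longrightarrow> \<bar>f s\<bar> \<le> l" by blast
    have "\<exists>r' l'. r' < x \<and> (\<forall>s. r' < s \<longrightarrow> s < x \<longrightarrow> 0 \<le> s \<longrightarrow> \<bar>f s\<bar> \<le> l')"
    proof (cases "0 < x")
      case True
      then obtain l where "(f \<longlongrightarrow> l) (at_left x)" using skorohod_limits(2)[OF f _ x(2)] by blast
      then have "eventually (\<lambda>s. dist (f s) l < 1) (at_left x)" by (rule tendstoD) simp
      then obtain r where "r < x" "\<And>s. r < s \<Longrightarrow> s < x \<Longrightarrow> \<bar>f s - l\<bar> < 1"
        unfolding eventually_at_left_field dist_real_def by blast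
      then show ?thesis by (intro exI[of _ r] exI[of _ "\<bar>l\<bar> + 1"]) force
    qed (auto intro!: exI[of _ "x - 1"])
    then obtain r' l' where r': "r' < x" "\<And>s. r' < s \<Longrightarrow> s < x \<Longrightarrow> 0 \<le> s \<Longrightarrow> \<bar>f s\<bar> \<le> l'" by blast
    show "\<exists>d>0. \<forall>a b. a \<le> x \<and> x \<le> b \<and> b - a < d \<longrightarrow> Q a b"
    proof (intro exI[of _ "min (r - x) (x - r')"] conjI allI impI)
      show "0 < min (r - x) (x - r')" using r r' by simp
      fix a b assume ab: "a \<le> x \<and> x \<le> b \<and> b - a < min (r - x) (x - r')"
      show "Q a b" unfolding Q_def
      proof (intro exI[of _ "max \<bar>f x\<bar> (max l l')"] ballI)
        fix s assume s: "s \<in> {a..b} \<inter> {0..1}"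
        consider "s < x" | "s = x" | "x < s" by linarith
        then show "\<bar>f s\<bar> \<le> max \<bar>f x\<bar> (max l l')"
        proof cases
          case 1 then show ?thesis using r'(2)[of s] s ab by (simp add: le_max_iff_disj)
        next
          case 2 then show ?thesis by simp
        next
          case 3 then show ?thesis using r(2)[of s] s ab by (simp add: le_max_iff_disj)
        qed
      qed
    qed
  qed simp
  then obtain B where B: "\<And>s. s \<in> {0..1} \<Longrightarrow> \<bar>f s\<bar> \<le> B" unfolding Q_def Int_absorb by blast
  show ?thesis by (rule that[of "\<bar>B\<bar>"]) (use B in force)+
qed

lemma prob_space_Icc: "prob_space (lebesgue_on {0..1::real})"
  by (rule prob_spaceI) (simp add: emeasure_restrict_space space_restrict_space)

lemma borel_lebesgue_on: "f \<in> borel_measurable borel \<Longrightarrow> f \<in> borel_measurable (lebesgue_on S)"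
  by (intro measurable_restrict_space1 measurable_completion) simp

lemma AE_Icc_neq: "AE t in lebesgue_on {0..1::real}. t \<noteq> c"
proof -
  have "AE t in lebesgue. t \<noteq> (c::real)"
    by (rule AE_completion) (rule AE_lborel_singleton)
  then show ?thesis by (subst AE_restrict_space_iff) (auto elim: eventually_mono)
qed

text \<open>Rounding \<open>t\<close> to a grid point strictly on one side of it makes the sampled path converge to
  its value at \<open>t\<close> when it is continuous from that side; the rounding to the right fails only at
  \<open>t = 1\<close>, the rounding to the left at \<open>t = 0\<close>.\<close>

definition right_grid :: "nat \<Rightarrow> real \<Rightarrow> real" where
  "right_grid n t = min 1 ((of_int \<lfloor>real (Suc n) * t\<rfloor> + 1) / real (Suc n))"

definition left_grid :: "nat \<Rightarrow> real \<Rightarrow> real" where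
  "left_grid n t = max 0 ((of_int \<lceil>real (Suc n) * t\<rceil> - 1) / real (Suc n))"

lemma right_grid_lim: assumes "0 \<le> t" "t < 1" shows "filterlim (\<lambda>n. right_grid n t) (at_right t) sequentially"
proof -
  have b: "t < right_grid n t" "right_grid n t \<le> t + 1 / real (Suc n)" for n
  proof -
    have "real (Suc n) * t < of_int \<lfloor>real (Suc n) * t\<rfloor> + 1" "of_int \<lfloor>real (Suc n) * t\<rfloor> \<le> real (Suc n) * t"
      by linarith+
    then have "t < (of_int \<lfloor>real (Suc n) * t\<rfloor> + 1) / real (Suc n)"
      "(of_int \<lfloor>real (Suc n) * t\<rfloor> + 1) / real (Suc n) \<le> t + 1 / real (Suc n)"
      by (simp_all add: field_simps del: of_nat_Suc)
    then show "t < right_grid n t" "right_grid n t \<le> t + 1 / real (Suc n)"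
      using assms unfolding right_grid_def by linarith+
  qed
  have "(\<lambda>n. t + 1 / real (Suc n)) \<longlonglongrightarrow> t + 0" by (intro tendsto_intros LIMSEQ_Suc lim_1_over_n)
  note l = this
  have "(\<lambda>n. right_grid n t) \<longlonglongrightarrow> t"
    by (rule tendsto_sandwich[OF _ _ tendsto_const[of t], where h="\<lambda>n. t + 1 / real (Suc n)"])
      (use l b less_imp_le[OF b(1)] in simp_all)
  moreover have "eventually (\<lambda>n. right_grid n t \<in> {t<..} \<and> right_grid n t \<noteq> t) sequentially"
  proof (intro always_eventually allI conjI)
    show "right_grid n t \<in> {t<..}" "right_grid n t \<noteq> t" for n using b(1)[of n] by simp_all
  qed
  ultimately show ?thesis unfolding filterlim_at by blast
qed

lemma left_grid_lim: assumes "0 < t" "t \<le> 1" shows "filterlim (\<lambda>n. left_grid n t) (at_left t) sequentially"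
proof -
  have b: "left_grid n t < t" "t - 1 / real (Suc n) \<le> left_grid n t" for n
  proof -
    have "of_int \<lceil>real (Suc n) * t\<rceil> - 1 < real (Suc n) * t" "real (Suc n) * t \<le> of_int \<lceil>real (Suc n) * t\<rceil>"
      by linarith+
    then have "(of_int \<lceil>real (Suc n) * t\<rceil> - 1) / real (Suc n) < t"
      "t - 1 / real (Suc n) \<le> (of_int \<lceil>real (Suc n) * t\<rceil> - 1) / real (Suc n)"
      by (simp_all add: field_simps del: of_nat_Suc)
    then show "left_grid n t < t" "t - 1 / real (Suc n) \<le> left_grid n t"
      using assms unfolding left_grid_def by linarith+
  qed
  have "(\<lambda>n. t - 1 / real (Suc n)) \<longlonglongrightarrow> t - 0" by (intro tendsto_intros LIMSEQ_Suc lim_1_over_n)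
  note l = this
  have "(\<lambda>n. left_grid n t) \<longlonglongrightarrow> t"
    by (rule tendsto_sandwich[OF _ _ _ tendsto_const[of t], where f="\<lambda>n. t - 1 / real (Suc n)"])
      (use l b less_imp_le[OF b(1)] in simp_all)
  moreover have "eventually (\<lambda>n. left_grid n t \<in> {..<t} \<and> left_grid n t \<noteq> t) sequentially"
  proof (intro always_eventually allI conjI)
    show "left_grid n t \<in> {..<t}" "left_grid n t \<noteq> t" for n using b(1)[of n] by simp_all
  qed
  ultimately show ?thesis unfolding filterlim_at by blast
qed

lemma grid_step_measurable:
  "(\<lambda>t. f (right_grid n t) :: real) \<in> borel_measurable borel" "(\<lambda>t. f (left_grid n t) :: real) \<in> borel_measurable borel"
proof -
  have "(\<lambda>t. (\<lambda>i. f (min 1 ((of_int i + 1) / real (Suc n)))) \<lfloor>real (Suc n) * t\<rfloor>) \<in> borel_measurable borel"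
    by (rule measurable_compose[of "\<lambda>t. \<lfloor>real (Suc n) * t\<rfloor>" borel "count_space UNIV"
        "\<lambda>i. f (min 1 ((of_int i + 1) / real (Suc n)))"]) measurable
  then show "(\<lambda>t. f (right_grid n t)) \<in> borel_measurable borel" by (simp add: right_grid_def)
  have "(\<lambda>t. (\<lambda>i. f (max 0 ((of_int i - 1) / real (Suc n)))) \<lceil>real (Suc n) * t\<rceil>) \<in> borel_measurable borel"
    by (rule measurable_compose[of "\<lambda>t. \<lceil>real (Suc n) * t\<rceil>" borel "count_space UNIV"
        "\<lambda>i. f (max 0 ((of_int i - 1) / real (Suc n)))"]) measurable
  then show "(\<lambda>t. f (left_grid n t)) \<in> borel_measurable borel" by (simp add: left_grid_def)
qed

lemma skorohod_grid_lim:
  assumes f: "f \<in> skorohod_D"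
  obtains \<gamma> c where "\<gamma> = right_grid \<or> \<gamma> = left_grid" "\<And>t. t \<in> {0..1} \<Longrightarrow> t \<noteq> c \<Longrightarrow> (\<lambda>n. f (\<gamma> n t)) \<longlonglongrightarrow> f t"
proof -
  from f consider "\<forall>t\<in>{0..<1}. continuous (at_right t) f" | "\<forall>t\<in>{0<..1}. continuous (at_left t) f"
    unfolding skorohod_D_def by blast
  then show ?thesis
  proof cases
    case 1
    have "(\<lambda>n. f (right_grid n t)) \<longlonglongrightarrow> f t" if t: "t \<in> {0..1}" "t \<noteq> 1" for t
    proof (rule filterlim_compose[OF _ right_grid_lim])
      show "(f \<longlongrightarrow> f t) (at_right t)" using 1 t by (simp add: continuous_within)
    qed (use t in auto)
    then show ?thesis by (intro that[of right_grid 1]) auto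
  next
    case 2
    have "(\<lambda>n. f (left_grid n t)) \<longlonglongrightarrow> f t" if t: "t \<in> {0..1}" "t \<noteq> 0" for t
    proof (rule filterlim_compose[OF _ left_grid_lim])
      show "(f \<longlongrightarrow> f t) (at_left t)" using 2 t by (simp add: continuous_within)
    qed (use t in auto)
    then show ?thesis by (intro that[of left_grid 0]) auto
  qed
qed

lemma skorohod_measurable:
  assumes f: "f \<in> skorohod_D" shows "f \<in> borel_measurable (lebesgue_on {0..1})"
proof -
  obtain \<gamma> c where \<gamma>: "\<gamma> = right_grid \<or> \<gamma> = left_grid"
    and lim: "\<And>t. t \<in> {0..1} \<Longrightarrow> t \<noteq> c \<Longrightarrow> (\<lambda>n. f (\<gamma> n t)) \<longlonglongrightarrow> f t" by (rule skorohod_grid_lim[OF f]) (rule that)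
  have m: "(\<lambda>t. f (\<gamma> n t)) \<in> borel_measurable borel" for n using \<gamma> grid_step_measurable by auto
  have "(\<lambda>t. if t = c then f c else f (\<gamma> n t)) \<in> borel_measurable (lebesgue_on {0..1})" for n
    by (rule borel_lebesgue_on) (use m in measurable)
  then show ?thesis
  proof (rule borel_measurable_LIMSEQ_real[rotated])
    fix t :: real assume "t \<in> space (lebesgue_on {0..1})"
    then show "(\<lambda>n. if t = c then f c else f (\<gamma> n t)) \<longlonglongrightarrow> f t"
      using lim[of t] by (cases "t = c") (auto simp: space_restrict_space)
  qed
qed

lemma step_integral:
  assumes m: "g \<in> borel_measurable (lebesgue_on {0..1})"
    and c: "\<And>i t. i < Suc n \<Longrightarrow> real i / real (Suc n) < t \<Longrightarrow> t < real (Suc i) / real (Suc n) \<Longrightarrow> g t = c i"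
  shows "(LINT t|lebesgue_on {0..1}. g t) = (\<Sum>i<Suc n. c i) / real (Suc n)"
proof -
  interpret L: prob_space "lebesgue_on {0..1::real}" by (rule prob_space_Icc)
  let ?N = "real (Suc n)"
  let ?I = "\<lambda>i. {real i / ?N<..<real (Suc i) / ?N}"
  have N: "0 < ?N" by simp
  have sub: "?I i \<subseteq> {0..1}" if "i < Suc n" for i
  proof -
    have "real (Suc i) \<le> ?N" using that by simp
    then have "real (Suc i) / ?N \<le> 1" using N by (simp add: divide_le_eq_1)
    moreover have "0 \<le> real i / ?N" by simp
    ultimately show ?thesis
      by (intro subsetI) (unfold greaterThanLessThan_iff atLeastAtMost_iff, linarith)
  qed
  have len: "measure (lebesgue_on {0..1}) (?I i) = 1 / ?N" if "i < Suc n" for i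
  proof -
    have "measure (lebesgue_on {0..1}) (?I i) = measure lborel (?I i)"
      using sub[OF that] by (simp add: measure_restrict_space)
    also have "\<dots> = real (Suc i) / ?N - real i / ?N" by (simp add: divide_right_mono del: of_nat_Suc)
    also have "\<dots> = 1 / ?N" by (simp add: diff_divide_distrib[symmetric])
    finally show ?thesis .
  qed
  have sets: "?I i \<in> sets (lebesgue_on {0..1})" if "i < Suc n" for i
    using sub[OF that] by (simp add: sets_restrict_space_iff)
  have "AE t in lebesgue_on {0..1}. \<forall>i\<in>{..Suc n}. t \<noteq> real i / ?N"
    by (rule AE_finite_allI) (auto intro: AE_Icc_neq)
  moreover have "AE t in lebesgue_on {0..1}. t \<in> {0..1}" by (rule AE_I2) (simp add: space_restrict_space)
  ultimately have ae: "AE t in lebesgue_on {0..1}. g t = (\<Sum>i<Suc n. c i * indicator (?I i) t)"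
  proof eventually_elim
    case (elim t)
    define j where "j = nat \<lfloor>?N * t\<rfloor>"
    have jr: "real j \<le> ?N * t" "?N * t < real j + 1" using elim(2) N unfolding j_def by (auto simp del: of_nat_Suc)
    have "t \<noteq> 1" using elim(1)[rule_format, of "Suc n"] by simp
    then have "?N * t < ?N * 1" using elim(2) by (intro mult_strict_left_mono) auto
    from le_less_trans[OF jr(1) this] have "real j < ?N" by (simp only: mult_1_right)
    then have jn: "j < Suc n" by simp
    then have "t \<noteq> real j / ?N" using elim(1)[rule_format, of j] by simp
    moreover have "real j / ?N \<le> t" using jr N by (simp add: divide_le_eq mult.commute del: of_nat_Suc)
    ultimately have lo: "real j / ?N < t" by simp
    have jr2: "?N * t < real (Suc j)" using jr(2) by (simp only: of_nat_Suc add.commute)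
    have hi: "t < real (Suc j) / ?N"
      by (subst pos_less_divide_eq[OF N]) (use jr2 in \<open>simp only: mult.commute\<close>)
    have uniq: "t \<in> ?I i \<longleftrightarrow> i = j" for i
    proof
      assume "t \<in> ?I i"
      then have "real i / ?N < t" "t < real (Suc i) / ?N" by auto
      then have "real i < t * ?N" "t * ?N < real (Suc i)"
        unfolding pos_divide_less_eq[OF N] pos_less_divide_eq[OF N] .
      then have a: "real i < ?N * t" "?N * t < real (Suc i)" by (simp_all only: mult.commute)
      have "real i < real (Suc j)" using less_trans[OF a(1) jr2] .
      moreover have "real j < real (Suc i)" using le_less_trans[OF jr(1) a(2)] .
      ultimately show "i = j" by linarith
    qed (use lo hi in auto)
    have "(\<Sum>i<Suc n. c i * indicator (?I i) t) = (\<Sum>i<Suc n. if i = j then c j else 0)"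
      by (intro sum.cong refl) (auto simp only: indicator_def uniq, simp_all)
    also have "\<dots> = c j" using jn by simp
    finally show ?case using c[OF jn lo hi] by simp
  qed
  have "(LINT t|lebesgue_on {0..1}. g t) = (LINT t|lebesgue_on {0..1}. (\<Sum>i<Suc n. c i * indicator (?I i) t))"
    by (rule integral_cong_AE[OF m _ ae])
      (intro borel_measurable_sum borel_measurable_times borel_measurable_const borel_measurable_indicator sets; simp)
  also have "\<dots> = (\<Sum>i<Suc n. c i * measure (lebesgue_on {0..1}) (?I i))"
  proof -
    have ind: "(LINT t|lebesgue_on {0..1}. c i * indicator (?I i) t) = c i * measure (lebesgue_on {0..1}) (?I i)"
      "integrable (lebesgue_on {0..1}) (\<lambda>t. c i * indicator (?I i) t)" if "i < Suc n" for i
    proof -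
      have "integrable (lebesgue_on {0..1}) (indicator (?I i) :: real \<Rightarrow> real)"
        by (rule integrable_real_indicator[OF sets[OF that]]) (simp add: L.emeasure_finite less_top[symmetric])
      then show "integrable (lebesgue_on {0..1}) (\<lambda>t. c i * indicator (?I i) t)" by (rule integrable_mult_right)
      have Ie: "?I i \<inter> space (lebesgue_on {0..1}) = ?I i" using sets.sets_into_space[OF sets[OF that]] by (rule Int_absorb2)
      then show "(LINT t|lebesgue_on {0..1}. c i * indicator (?I i) t) = c i * measure (lebesgue_on {0..1}) (?I i)"
        by (simp only: integral_mult_right_zero Bochner_Integration.integral_indicator Ie)
    qed
    have "(LINT t|lebesgue_on {0..1}. (\<Sum>i<Suc n. c i * indicator (?I i) t))
        = (\<Sum>i<Suc n. LINT t|lebesgue_on {0..1}. c i * indicator (?I i) t)"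
      by (rule Bochner_Integration.integral_sum) (rule ind(2), simp)
    also have "\<dots> = (\<Sum>i<Suc n. c i * measure (lebesgue_on {0..1}) (?I i))"
      by (intro sum.cong refl ind(1)) simp
    finally show ?thesis .
  qed
  also have "\<dots> = (\<Sum>i<Suc n. c i) / ?N" using len by (simp add: sum_divide_distrib del: sum.lessThan_Suc of_nat_Suc)
  finally show ?thesis .
qed

text \<open>Riemann sums converge for Skorohod paths; left and right sums differ by the boundary terms
  only, so a single sequence of finite-dimensional functionals serves both normalisations.\<close>

lemma riemann_sums:
  fixes \<phi> :: "real \<Rightarrow> real"
  assumes f: "f \<in> skorohod_D" and \<phi>: "continuous_on UNIV \<phi>"
  shows "integrable (lebesgue_on {0..1}) (\<lambda>t. \<phi> (f t))"
    "(\<lambda>n. (\<Sum>i<Suc n. \<phi> (f (real i / real (Suc n)))) / real (Suc n)) \<longlonglongrightarrow> (LINT t|lebesgue_on {0..1}. \<phi> (f t))"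
proof -
  interpret L: prob_space "lebesgue_on {0..1::real}" by (rule prob_space_Icc)
  obtain B where B: "0 \<le> B" "\<And>t. t \<in> {0..1} \<Longrightarrow> \<bar>f t\<bar> \<le> B" using skorohod_bounded[OF f] by blast
  have "bounded (\<phi> ` {-B..B})"
    by (intro compact_imp_bounded compact_continuous_image continuous_on_subset[OF \<phi>]) auto
  then obtain C where C': "\<forall>y\<in>{-B..B}. \<bar>\<phi> y\<bar> \<le> C" unfolding bounded_iff by auto
  have C: "\<bar>\<phi> (f t)\<bar> \<le> C" if "t \<in> {0..1}" for t using C'[rule_format, of "f t"] B(2)[OF that] by (simp add: abs_le_iff)
  have \<phi>m: "\<phi> \<in> borel_measurable borel" using \<phi> by (rule borel_measurable_continuous_onI)
  have fm: "(\<lambda>t. \<phi> (f t)) \<in> borel_measurable (lebesgue_on {0..1})"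
    by (rule measurable_compose[OF skorohod_measurable[OF f] \<phi>m])
  show "integrable (lebesgue_on {0..1}) (\<lambda>t. \<phi> (f t))"
    by (rule L.integrable_const_bound[where B=C]) (use C fm in \<open>auto intro!: AE_I2 simp: space_restrict_space\<close>)
  obtain \<gamma> c where \<gamma>: "\<gamma> = right_grid \<or> \<gamma> = left_grid"
    and lim: "\<And>t. t \<in> {0..1} \<Longrightarrow> t \<noteq> c \<Longrightarrow> (\<lambda>n. f (\<gamma> n t)) \<longlonglongrightarrow> f t" by (rule skorohod_grid_lim[OF f]) (rule that)
  have \<gamma>01: "\<gamma> n t \<in> {0..1}" if "t \<in> {0..1}" for n t
  proof -
    have "0 \<le> real (Suc n) * t" "real (Suc n) * t \<le> real (Suc n)" using that by (auto intro: mult_left_le simp del: of_nat_Suc)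
    then have "0 \<le> \<lfloor>real (Suc n) * t\<rfloor>" "\<lceil>real (Suc n) * t\<rceil> \<le> int (Suc n)" by (auto simp: ceiling_le_iff)
    then have "0 \<le> (of_int \<lfloor>real (Suc n) * t\<rfloor> + 1) / real (Suc n)" "(of_int \<lceil>real (Suc n) * t\<rceil> - 1) / real (Suc n) \<le> 1"
      by (auto simp: divide_le_eq)
    then show ?thesis using \<gamma> by (auto simp: right_grid_def left_grid_def)
  qed
  have gm: "(\<lambda>t. \<phi> (f (\<gamma> n t))) \<in> borel_measurable (lebesgue_on {0..1})" for n
    using \<gamma> by (auto intro!: borel_lebesgue_on measurable_compose[OF _ \<phi>m] grid_step_measurable)
  have int: "(\<lambda>n. LINT t|lebesgue_on {0..1}. \<phi> (f (\<gamma> n t))) \<longlonglongrightarrow> (LINT t|lebesgue_on {0..1}. \<phi> (f t))"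
  proof (rule integral_dominated_convergence[where w="\<lambda>_. C"])
    show "AE t in lebesgue_on {0..1}. (\<lambda>n. \<phi> (f (\<gamma> n t))) \<longlonglongrightarrow> \<phi> (f t)"
      using AE_Icc_neq[of c] AE_space
    proof eventually_elim
      case (elim t)
      then have "(\<lambda>n. f (\<gamma> n t)) \<longlonglongrightarrow> f t" by (intro lim) (auto simp: space_restrict_space)
      moreover have "isCont \<phi> (f t)" using \<phi> by (simp add: continuous_on_eq_continuous_at)
      ultimately show ?case by (rule isCont_tendsto_compose[rotated])
    qed
    show "AE t in lebesgue_on {0..1}. norm (\<phi> (f (\<gamma> n t))) \<le> C" for n
      by (rule AE_I2) (use C \<gamma>01 in \<open>auto simp: space_restrict_space\<close>)
  qed (use fm gm in auto)
  define a where "a n i = \<phi> (f (real i / real (Suc n)))" for n i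
  have cell: "(\<lfloor>real (Suc n) * t\<rfloor> = int i) \<and> (\<lceil>real (Suc n) * t\<rceil> = int i + 1)"
    if "real i / real (Suc n) < t" "t < real (Suc i) / real (Suc n)" for n i t
  proof -
    have "real i < real (Suc n) * t" "real (Suc n) * t < real (Suc i)"
      using that pos_divide_less_eq[of "real (Suc n)" "real i" t] pos_less_divide_eq[of "real (Suc n)" t "real (Suc i)"]
      by (simp_all add: mult.commute del: of_nat_Suc)
    then show ?thesis by (auto simp del: of_nat_Suc simp: floor_eq_iff ceiling_eq_iff)
  qed
  have ai: "\<bar>a n i\<bar> \<le> C" if "i \<le> Suc n" for n i
  proof -
    have "real i \<le> real (Suc n)" using that by simp
    then show ?thesis unfolding a_def by (intro C) (simp add: divide_le_eq_1)
  qed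
  let ?R = "\<lambda>n. (\<Sum>i<Suc n. a n i) / real (Suc n)"
  have diff: "\<bar>?R n - (LINT t|lebesgue_on {0..1}. \<phi> (f (\<gamma> n t)))\<bar> \<le> 2 * C * (1 / real (Suc n))" for n
  proof -
    have C0: "0 \<le> C" using order_trans[OF abs_ge_zero ai[of 0 n]] by simp
    from \<gamma> show ?thesis
    proof
      assume \<gamma>: "\<gamma> = right_grid"
      have "(LINT t|lebesgue_on {0..1}. \<phi> (f (\<gamma> n t))) = (\<Sum>i<Suc n. a n (Suc i)) / real (Suc n)"
      proof (rule step_integral[OF gm])
        fix i t assume i: "i < Suc n" and t: "real i / real (Suc n) < t" "t < real (Suc i) / real (Suc n)"
        have "real (Suc i) \<le> real (Suc n)" using i by simp
        then have "right_grid n t = real (Suc i) / real (Suc n)"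
          using cell[OF t] by (simp add: right_grid_def divide_le_eq_1 add.commute min_def)
        then show "\<phi> (f (\<gamma> n t)) = a n (Suc i)" by (simp only: \<gamma> a_def)
      qed
      moreover have "(\<Sum>i<Suc n. a n (Suc i)) = (\<Sum>i<Suc n. a n i) + (a n (Suc n) - a n 0)"
        using sum_lessThan_telescope[of "a n" "Suc n"] by (simp add: sum_subtractf del: sum.lessThan_Suc)
      ultimately have "?R n - (LINT t|lebesgue_on {0..1}. \<phi> (f (\<gamma> n t))) = (a n 0 - a n (Suc n)) / real (Suc n)"
        by (simp add: diff_divide_distrib add_divide_distrib del: sum.lessThan_Suc of_nat_Suc)
      also have "\<bar>\<dots>\<bar> \<le> (2 * C) / real (Suc n)"
        using ai[of 0 n] ai[of "Suc n" n] unfolding abs_divide by (intro frac_le) auto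
      finally show ?thesis by simp
    next
      assume \<gamma>: "\<gamma> = left_grid"
      have "(LINT t|lebesgue_on {0..1}. \<phi> (f (\<gamma> n t))) = (\<Sum>i<Suc n. a n i) / real (Suc n)"
      proof (rule step_integral[OF gm])
        fix i t assume i: "i < Suc n" and t: "real i / real (Suc n) < t" "t < real (Suc i) / real (Suc n)"
        have "left_grid n t = real i / real (Suc n)"
          using cell[OF t] by (simp add: left_grid_def)
        then show "\<phi> (f (\<gamma> n t)) = a n i" by (simp only: \<gamma> a_def)
      qed
      then show ?thesis using C0 by simp
    qed
  qed
  have "(\<lambda>n. 2 * C * (1 / real (Suc n))) \<longlonglongrightarrow> 2 * C * 0" by (intro tendsto_intros LIMSEQ_Suc lim_1_over_n)
  then have lim0: "(\<lambda>n. 2 * C * (1 / real (Suc n))) \<longlonglongrightarrow> 0" by simp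
  have "(\<lambda>n. ?R n - (LINT t|lebesgue_on {0..1}. \<phi> (f (\<gamma> n t)))) \<longlonglongrightarrow> 0"
    by (rule Lim_null_comparison[OF always_eventually lim0]) (intro allI, unfold real_norm_def, rule diff)
  from tendsto_add[OF this int] show "(\<lambda>n. (\<Sum>i<Suc n. \<phi> (f (real i / real (Suc n)))) / real (Suc n)) \<longlonglongrightarrow> (LINT t|lebesgue_on {0..1}. \<phi> (f t))"
    by (simp add: a_def del: sum.lessThan_Suc of_nat_Suc)
qed

lemma measure_Icc [simp]: "measure (lebesgue_on {0..1::real}) {0..1} = 1"
  using prob_space.prob_space[OF prob_space_Icc] by (simp add: space_restrict_space)

text \<open>This class contains the Skorohod paths and the step functions of discretized paths, and the
  functionals are finite on it, so that their Lipschitz bounds are meaningful.\<close>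

definition admissible :: "(real \<Rightarrow> real) set" where
  "admissible = {f. f \<in> borel_measurable (lebesgue_on {0..1}) \<and> (\<exists>B. \<forall>t\<in>{0..1}. \<bar>f t\<bar> \<le> B)}"

lemma skorohod_admissible: assumes "f \<in> skorohod_D" shows "f \<in> admissible"
proof -
  obtain B where "\<forall>t\<in>{0..1}. \<bar>f t\<bar> \<le> B" using skorohod_bounded[OF assms] by metis
  then show ?thesis unfolding admissible_def using skorohod_measurable[OF assms] by auto
qed

lemma admissibleD:
  assumes "f \<in> admissible"
  shows "f \<in> borel_measurable (lebesgue_on {0..1})" "\<exists>B\<ge>0. \<forall>t\<in>{0..1}. \<bar>f t\<bar> \<le> B"
proof -
  show "f \<in> borel_measurable (lebesgue_on {0..1})" using assms by (simp add: admissible_def)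
  obtain B where B: "\<forall>t\<in>{0..1}. \<bar>f t\<bar> \<le> B" using assms by (auto simp: admissible_def)
  moreover have "0 \<le> B" using order_trans[OF abs_ge_zero B[rule_format, of 0]] by simp
  ultimately show "\<exists>B\<ge>0. \<forall>t\<in>{0..1}. \<bar>f t\<bar> \<le> B" by blast
qed

lemma sup_increment_le:
  assumes "\<And>s t. 0 \<le> s \<Longrightarrow> s < t \<Longrightarrow> t \<le> 1 \<Longrightarrow> \<bar>f t - f s\<bar> \<le> a"
  shows "sup_increment f \<le> a"
  unfolding sup_increment_def
proof (rule cSUP_least)
  have "(0, 1) \<in> {(s, t). 0 \<le> s \<and> s < t \<and> t \<le> (1::real)}" by simp
  then show "{(s, t). 0 \<le> s \<and> s < t \<and> t \<le> (1::real)} \<noteq> {}" by blast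
qed (use assms in auto)

lemma sup_increment_ge:
  assumes f: "f \<in> admissible" and st: "0 \<le> s" "s < t" "t \<le> 1"
  shows "\<bar>f t - f s\<bar> \<le> sup_increment f"
proof -
  obtain B where B: "\<forall>t\<in>{0..1}. \<bar>f t\<bar> \<le> B" using admissibleD(2)[OF f] by blast
  have "bdd_above ((\<lambda>(s, t). \<bar>f t - f s\<bar>) ` {(s, t). 0 \<le> s \<and> s < t \<and> t \<le> 1})"
  proof (rule bdd_aboveI2[where M="2 * B"], clarify)
    fix s t :: real assume "0 \<le> s" "s < t" "t \<le> 1"
    then show "\<bar>f t - f s\<bar> \<le> 2 * B" using B[rule_format, of s] B[rule_format, of t] by simp
  qed
  from cSUP_upper[OF _ this, of "(s, t)"] st show ?thesis unfolding sup_increment_def by simp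
qed

lemma sup_increment_lipschitz:
  assumes f: "f \<in> admissible" and g: "g \<in> admissible" and e: "\<And>t. t \<in> {0..1} \<Longrightarrow> \<bar>f t - g t\<bar> \<le> e"
  shows "\<bar>sup_increment f - sup_increment g\<bar> \<le> 2 * e"
proof -
  have one: "sup_increment f \<le> sup_increment g + 2 * e"
    if g: "g \<in> admissible" and e: "\<And>t. t \<in> {0..1} \<Longrightarrow> \<bar>f t - g t\<bar> \<le> e" for f g
  proof (rule sup_increment_le)
    fix s t :: real assume st: "0 \<le> s" "s < t" "t \<le> 1"
    then show "\<bar>f t - f s\<bar> \<le> sup_increment g + 2 * e"
      using sup_increment_ge[OF g st] e[of s] e[of t] by simp
  qed
  have "\<bar>g t - f t\<bar> \<le> e" if "t \<in> {0..1}" for t using e[OF that] by (simp add: abs_minus_commute)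
  with one[OF g e] one[OF f, of g] show ?thesis by fastforce
qed

lemma sup_increment_scale:
  assumes f: "f \<in> admissible" and c: "0 \<le> c"
  shows "sup_increment (\<lambda>t. c * f t) = c * sup_increment f"
proof (cases "c = 0")
  case True
  have "(\<lambda>t. 0) \<in> admissible" by (auto simp: admissible_def)
  from sup_increment_ge[OF this, of 0 1] have "0 \<le> sup_increment (\<lambda>t. 0)" by simp
  moreover have "sup_increment (\<lambda>t. 0) \<le> 0" by (rule sup_increment_le) simp
  ultimately have "sup_increment (\<lambda>t. 0) = 0" by simp
  with True show ?thesis by simp
next
  case False
  with c have c: "0 < c" by simp
  have cf: "(\<lambda>t. c * f t) \<in> admissible"
  proof -
    obtain B where B: "0 \<le> B" "\<forall>t\<in>{0..1}. \<bar>f t\<bar> \<le> B" using admissibleD(2)[OF f] by blast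
    have "\<forall>t\<in>{0..1}. \<bar>c * f t\<bar> \<le> c * B" using B c by (auto simp: abs_mult)
    then show ?thesis using admissibleD(1)[OF f] unfolding admissible_def by auto
  qed
  show ?thesis
  proof (rule antisym)
    show "sup_increment (\<lambda>t. c * f t) \<le> c * sup_increment f"
    proof (rule sup_increment_le)
      fix s t :: real assume st: "0 \<le> s" "s < t" "t \<le> 1"
      have "\<bar>c * f t - c * f s\<bar> = c * \<bar>f t - f s\<bar>" using c by (simp add: abs_mult flip: right_diff_distrib)
      also have "\<dots> \<le> c * sup_increment f" using c by (intro mult_left_mono sup_increment_ge[OF f st]) simp
      finally show "\<bar>c * f t - c * f s\<bar> \<le> c * sup_increment f" .
    qed
    have "sup_increment f \<le> sup_increment (\<lambda>t. c * f t) / c"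
    proof (rule sup_increment_le)
      fix s t :: real assume st: "0 \<le> s" "s < t" "t \<le> 1"
      have "c * \<bar>f t - f s\<bar> = \<bar>c * f t - c * f s\<bar>" using c by (simp add: abs_mult flip: right_diff_distrib)
      also have "\<dots> \<le> sup_increment (\<lambda>t. c * f t)" by (rule sup_increment_ge[OF cf st])
      finally show "\<bar>f t - f s\<bar> \<le> sup_increment (\<lambda>t. c * f t) / c" using c by (simp add: pos_le_divide_eq mult.commute)
    qed
    then show "c * sup_increment f \<le> sup_increment (\<lambda>t. c * f t)" using c by (simp add: pos_le_divide_eq mult.commute)
  qed
qed

text \<open>Comparison of the \<open>L\<^sup>q\<close> norm with the \<open>L\<^sup>1\<close> norm and the triangle inequality for a constant summand
  both follow from convexity after normalising by the norm.\<close>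

definition Lq_norm :: "real \<Rightarrow> (real \<Rightarrow> real) \<Rightarrow> real" where
  "Lq_norm q f = (LINT t|lebesgue_on {0..1}. \<bar>f t\<bar> powr q) powr (1 / q)"

lemma admissible_powr_integrable:
  assumes f: "f \<in> admissible" and q: "0 \<le> q"
  shows "integrable (lebesgue_on {0..1}) (\<lambda>t. \<bar>f t\<bar> powr q)"
proof -
  interpret L: prob_space "lebesgue_on {0..1::real}" by (rule prob_space_Icc)
  note [measurable] = admissibleD(1)[OF f]
  obtain B where B: "0 \<le> B" "\<forall>t\<in>{0..1}. \<bar>f t\<bar> \<le> B" using admissibleD(2)[OF f] by blast
  show ?thesis
    by (rule L.integrable_const_bound[where B="B powr q"])
      (use B q in \<open>auto intro!: AE_I2 powr_mono2 simp: space_restrict_space\<close>)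
qed

lemma admissible_abs_integrable:
  assumes f: "f \<in> admissible" shows "integrable (lebesgue_on {0..1}) (\<lambda>t. \<bar>f t\<bar>)"
  using admissible_powr_integrable[OF f, of 1] by simp

lemma Lq_normI:
  assumes f: "f \<in> admissible" and q: "1 \<le> q" and b: "Lq_norm q f < b"
  shows "(LINT t|lebesgue_on {0..1}. \<bar>f t\<bar> powr q) \<le> b powr q" "0 < b"
proof -
  have b0: "0 \<le> Lq_norm q f" by (simp add: Lq_norm_def)
  then show "0 < b" using b by simp
  have I0: "0 \<le> (LINT t|lebesgue_on {0..1}. \<bar>f t\<bar> powr q)" by (intro integral_nonneg_AE AE_I2) simp
  have "(LINT t|lebesgue_on {0..1}. \<bar>f t\<bar> powr q) = Lq_norm q f powr q"
    unfolding Lq_norm_def using q I0 by (simp add: powr_powr)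
  also have "\<dots> \<le> b powr q" using b b0 q by (intro powr_mono2) auto
  finally show "(LINT t|lebesgue_on {0..1}. \<bar>f t\<bar> powr q) \<le> b powr q" .
qed

lemma Lq_norm_leI:
  assumes q: "1 \<le> q" and b: "0 \<le> b" and I: "(LINT t|lebesgue_on {0..1}. \<bar>f t\<bar> powr q) \<le> b powr q"
  shows "Lq_norm q f \<le> b"
proof -
  have I0: "0 \<le> (LINT t|lebesgue_on {0..1}. \<bar>f t\<bar> powr q)" by (intro integral_nonneg_AE AE_I2) simp
  have "Lq_norm q f \<le> (b powr q) powr (1 / q)"
    unfolding Lq_norm_def using q I I0 by (intro powr_mono2) auto
  also have "\<dots> = b" using q b by (simp add: powr_powr)
  finally show ?thesis .
qed

text \<open>Convexity of \<open>powr q\<close>, between \<open>y\<close> and 1.\<close>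

lemma powr_mixture:
  fixes y l q :: real
  assumes "0 \<le> y" "0 \<le> l" "l \<le> 1" "1 \<le> q"
  shows "(l * y + (1 - l)) powr q \<le> l * y powr q + (1 - l)"
proof (cases "y = 0")
  case True
  have "(1 - l) powr q \<le> 1 - l"
  proof (cases "l = 1")
    case False
    then have "(1 - l) powr q \<le> (1 - l) powr 1" using assms by (intro powr_mono') auto
    then show ?thesis using assms by simp
  qed simp
  with True show ?thesis by simp
next
  case False
  then have "0 < y" using assms by simp
  then show ?thesis
    using convex_onD[OF powr_convex[OF assms(4)], of "1 - l" y 1] assms by simp
qed

lemma Lq_norm_shift:
  assumes f: "f \<in> admissible" and g: "g \<in> admissible" and q: "1 \<le> q"
    and e: "\<And>t. t \<in> {0..1} \<Longrightarrow> \<bar>f t\<bar> \<le> \<bar>g t\<bar> + e" and e0: "0 \<le> e"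
  shows "Lq_norm q f \<le> Lq_norm q g + e"
proof (rule field_le_epsilon)
  fix r :: real assume r: "0 < r"
  interpret L: prob_space "lebesgue_on {0..1::real}" by (rule prob_space_Icc)
  define b where "b = Lq_norm q g + r"
  have b: "Lq_norm q g < b" using r by (simp add: b_def)
  note bI = Lq_normI[OF g q b]
  define l where "l = b / (b + e)"
  have l: "0 \<le> l" "l \<le> 1" "1 - l = e / (b + e)" using bI(2) e0 by (auto simp: l_def field_simps)
  have be: "0 < b + e" using bI(2) e0 by simp
  have ig: "integrable (lebesgue_on {0..1}) (\<lambda>t. \<bar>g t\<bar> powr q)" by (rule admissible_powr_integrable[OF g]) (use q in simp)
  have "(LINT t|lebesgue_on {0..1}. \<bar>f t\<bar> powr q)
      \<le> (LINT t|lebesgue_on {0..1}. (b + e) powr q * (l / b powr q * \<bar>g t\<bar> powr q + (1 - l)))"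
  proof (rule integral_mono)
    show "integrable (lebesgue_on {0..1}) (\<lambda>t. \<bar>f t\<bar> powr q)" by (rule admissible_powr_integrable[OF f]) (use q in simp)
    show "integrable (lebesgue_on {0..1}) (\<lambda>t. (b + e) powr q * (l / b powr q * \<bar>g t\<bar> powr q + (1 - l)))"
      by (intro integrable_mult_right Bochner_Integration.integrable_add ig L.integrable_const)
    fix t :: real assume "t \<in> space (lebesgue_on {0..1})"
    then have t: "t \<in> {0..1}" by (simp add: space_restrict_space)
    have "\<bar>f t\<bar> powr q \<le> (\<bar>g t\<bar> + e) powr q" using e[OF t] q by (intro powr_mono2) auto
    also have "\<bar>g t\<bar> + e = (b + e) * (l * (\<bar>g t\<bar> / b) + (1 - l))"
    proof -
      have "l * (\<bar>g t\<bar> / b) = \<bar>g t\<bar> / (b + e)" using bI(2) by (simp add: l_def)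
      then show ?thesis unfolding l(3) using be by (simp add: distrib_left)
    qed
    also have "\<dots> powr q = (b + e) powr q * (l * (\<bar>g t\<bar> / b) + (1 - l)) powr q"
      by (rule powr_mult)
    also have "\<dots> \<le> (b + e) powr q * (l * (\<bar>g t\<bar> / b) powr q + (1 - l))"
      using bI(2) l q by (intro mult_left_mono powr_mixture) auto
    also have "(\<bar>g t\<bar> / b) powr q = \<bar>g t\<bar> powr q / b powr q" by (rule powr_divide)
    finally show "\<bar>f t\<bar> powr q \<le> (b + e) powr q * (l / b powr q * \<bar>g t\<bar> powr q + (1 - l))" by simp
  qed
  also have "\<dots> = (b + e) powr q * (l / b powr q * (LINT t|lebesgue_on {0..1}. \<bar>g t\<bar> powr q) + (1 - l))"
    using ig by (simp add: L.prob_space)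
  also have "\<dots> \<le> (b + e) powr q * (l / b powr q * b powr q + (1 - l))"
    using bI l by (intro mult_left_mono add_right_mono) auto
  also have "\<dots> = (b + e) powr q" using bI(2) by simp
  finally have "Lq_norm q f \<le> b + e" by (intro Lq_norm_leI[OF q]) (use be in simp)
  then show "Lq_norm q f \<le> Lq_norm q g + e + r" by (simp add: b_def)
qed

lemma L1_le_Lq:
  assumes f: "f \<in> admissible" and q: "1 \<le> q"
  shows "(LINT t|lebesgue_on {0..1}. \<bar>f t\<bar>) \<le> Lq_norm q f"
proof (rule field_le_epsilon)
  fix r :: real assume r: "0 < r"
  interpret L: prob_space "lebesgue_on {0..1::real}" by (rule prob_space_Icc)
  define b where "b = Lq_norm q f + r"
  have b: "Lq_norm q f < b" using r by (simp add: b_def)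
  note bI = Lq_normI[OF f q b]
  have ig: "integrable (lebesgue_on {0..1}) (\<lambda>t. \<bar>f t\<bar> powr q)" by (rule admissible_powr_integrable[OF f]) (use q in simp)
  have "(LINT t|lebesgue_on {0..1}. \<bar>f t\<bar>) \<le> (LINT t|lebesgue_on {0..1}. b * (1 / q / b powr q * \<bar>f t\<bar> powr q + (1 - 1 / q)))"
  proof (rule integral_mono[OF admissible_abs_integrable[OF f]])
    show "integrable (lebesgue_on {0..1}) (\<lambda>t. b * (1 / q / b powr q * \<bar>f t\<bar> powr q + (1 - 1 / q)))"
      by (intro integrable_mult_right Bochner_Integration.integrable_add ig L.integrable_const)
    fix t
    have "((\<bar>f t\<bar> / b) powr q) powr (1 / q) * 1 powr (1 - 1 / q) \<le> 1 / q * (\<bar>f t\<bar> / b) powr q + (1 - 1 / q) * 1"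
    proof (cases "f t = 0")
      case False
      then have "0 < (\<bar>f t\<bar> / b) powr q" using bI(2) by simp
      then show ?thesis using q by (intro Youngs_inequality_0) auto
    qed (use q in simp)
    moreover have "((\<bar>f t\<bar> / b) powr q) powr (1 / q) = \<bar>f t\<bar> / b" using q bI(2) by (simp add: powr_powr)
    moreover have "(\<bar>f t\<bar> / b) powr q = \<bar>f t\<bar> powr q / b powr q" by (rule powr_divide)
    ultimately have "\<bar>f t\<bar> / b \<le> 1 / q / b powr q * \<bar>f t\<bar> powr q + (1 - 1 / q)" by simp
    then show "\<bar>f t\<bar> \<le> b * (1 / q / b powr q * \<bar>f t\<bar> powr q + (1 - 1 / q))"
      using bI(2) by (simp add: pos_divide_le_eq mult.commute)
  qed
  also have "\<dots> = b * (1 / q / b powr q * (LINT t|lebesgue_on {0..1}. \<bar>f t\<bar> powr q) + (1 - 1 / q))"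
    using ig by (simp add: L.prob_space)
  also have "\<dots> \<le> b * (1 / q / b powr q * b powr q + (1 - 1 / q))"
    using bI q by (intro mult_left_mono add_right_mono) auto
  also have "\<dots> = b" using bI(2) by simp
  finally show "(LINT t|lebesgue_on {0..1}. \<bar>f t\<bar>) \<le> Lq_norm q f + r" by (simp add: b_def)
qed

lemma Linf_le_iff:
  assumes f: "f \<in> admissible" and a: "0 \<le> a"
  shows "Lp_norm \<infinity> f \<le> a \<longleftrightarrow> (AE t in lebesgue_on {0..1}. \<bar>f t\<bar> \<le> a)"
proof -
  let ?L = "lebesgue_on {0..1::real}"
  let ?E = "esssup ?L (\<lambda>t. ennreal \<bar>f t\<bar>)"
  note [measurable] = admissibleD(1)[OF f]
  have m: "(\<lambda>t. ennreal \<bar>f t\<bar>) \<in> borel_measurable ?L" by measurable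
  obtain B where B: "0 \<le> B" "\<forall>t\<in>{0..1}. \<bar>f t\<bar> \<le> B" using admissibleD(2)[OF f] by blast
  have "?E \<le> ennreal B"
    by (rule esssup_I[OF m]) (use B in \<open>auto intro!: AE_I2 ennreal_leI simp: space_restrict_space\<close>)
  then have fin: "?E < top" using ennreal_less_top[of B] by (rule le_less_trans)
  show ?thesis
  proof
    assume "Lp_norm \<infinity> f \<le> a"
    then have "enn2real ?E \<le> a" by (simp add: Lp_norm_def)
    then have "ennreal (enn2real ?E) \<le> ennreal a" by (rule ennreal_leI)
    then have E: "?E \<le> ennreal a" using fin by simp
    show "AE t in ?L. \<bar>f t\<bar> \<le> a"
      using esssup_AE[of "\<lambda>t. ennreal \<bar>f t\<bar>" ?L]
    proof eventually_elim
      case (elim t)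
      from order_trans[OF this E] show ?case using a by simp
    qed
  next
    assume "AE t in ?L. \<bar>f t\<bar> \<le> a"
    then have "AE t in ?L. ennreal \<bar>f t\<bar> \<le> ennreal a" by eventually_elim (rule ennreal_leI)
    then have "?E \<le> ennreal a" by (rule esssup_I[OF m])
    then show "Lp_norm \<infinity> f \<le> a" using a by (simp add: Lp_norm_def enn2real_leI)
  qed
qed

lemma Lp_norm_finite: "p \<noteq> \<infinity> \<Longrightarrow> Lp_norm p f = Lq_norm (enn2real p) f"
  by (simp add: Lp_norm_def Lq_norm_def)

lemma Lp_norm_nonneg: "0 \<le> Lp_norm p f"
  by (simp add: Lp_norm_def)

lemma enn2real_ge_1: "1 \<le> p \<Longrightarrow> p \<noteq> \<infinity> \<Longrightarrow> 1 \<le> enn2real p"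
  by (cases p) (auto simp: ennreal_1[symmetric] simp del: ennreal_1)

lemma Lp_norm_shift:
  assumes f: "f \<in> admissible" and g: "g \<in> admissible" and p: "1 \<le> p"
    and e: "\<And>t. t \<in> {0..1} \<Longrightarrow> \<bar>f t\<bar> \<le> \<bar>g t\<bar> + e" and e0: "0 \<le> e"
  shows "Lp_norm p f \<le> Lp_norm p g + e"
proof (cases "p = \<infinity>")
  case False
  then show ?thesis using Lq_norm_shift[OF f g enn2real_ge_1[OF p False] e e0] by (simp add: Lp_norm_finite)
next
  case True
  have "AE t in lebesgue_on {0..1}. \<bar>g t\<bar> \<le> Lp_norm \<infinity> g"
    using Linf_le_iff[OF g Lp_norm_nonneg] by blast
  then have "AE t in lebesgue_on {0..1}. \<bar>f t\<bar> \<le> Lp_norm \<infinity> g + e"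
    using AE_space
  proof eventually_elim
    case (elim t)
    then show ?case using e[of t] by (simp add: space_restrict_space)
  qed
  then show ?thesis unfolding True using Linf_le_iff[OF f, of "Lp_norm \<infinity> g + e"] e0 Lp_norm_nonneg[of \<infinity> g] by simp
qed

lemma Lp_norm_lipschitz:
  assumes f: "f \<in> admissible" and g: "g \<in> admissible" and p: "1 \<le> p"
    and e: "\<And>t. t \<in> {0..1} \<Longrightarrow> \<bar>f t - g t\<bar> \<le> e"
  shows "\<bar>Lp_norm p f - Lp_norm p g\<bar> \<le> 2 * e"
proof -
  have e0: "0 \<le> e" using order_trans[OF abs_ge_zero e[of 0]] by simp
  have "Lp_norm p f \<le> Lp_norm p g + e"
    by (rule Lp_norm_shift[OF f g p _ e0]) (use e in force)
  moreover have "Lp_norm p g \<le> Lp_norm p f + e"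
    by (rule Lp_norm_shift[OF g f p _ e0]) (use e in force)
  ultimately show ?thesis using e0 by linarith
qed

lemma L1_le_Lp:
  assumes f: "f \<in> admissible" and p: "1 \<le> p"
  shows "(LINT t|lebesgue_on {0..1}. \<bar>f t\<bar>) \<le> Lp_norm p f"
proof (cases "p = \<infinity>")
  case False
  then show ?thesis using L1_le_Lq[OF f enn2real_ge_1[OF p False]] by (simp add: Lp_norm_finite)
next
  case True
  interpret L: prob_space "lebesgue_on {0..1::real}" by (rule prob_space_Icc)
  have "AE t in lebesgue_on {0..1}. \<bar>f t\<bar> \<le> Lp_norm \<infinity> f"
    using Linf_le_iff[OF f Lp_norm_nonneg] by blast
  then have "(LINT t|lebesgue_on {0..1}. \<bar>f t\<bar>) \<le> (LINT t|lebesgue_on {0..1::real}. Lp_norm \<infinity> f)"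
    by (intro integral_mono_AE admissible_abs_integrable f L.integrable_const)
  also have "\<dots> = Lp_norm \<infinity> f" using L.prob_space by simp
  finally show ?thesis by (simp add: True)
qed

lemma Lp_norm_scale:
  assumes f: "f \<in> admissible" and p: "1 \<le> p" and c: "0 \<le> c"
  shows "Lp_norm p (\<lambda>t. c * f t) = c * Lp_norm p f"
proof (cases "p = \<infinity>")
  case False
  define q where "q = enn2real p"
  have q: "1 \<le> q" unfolding q_def by (rule enn2real_ge_1[OF p False])
  have I0: "0 \<le> (LINT t|lebesgue_on {0..1}. \<bar>f t\<bar> powr q)" by (intro integral_nonneg_AE AE_I2) simp
  have "(LINT t|lebesgue_on {0..1}. \<bar>c * f t\<bar> powr q) = c powr q * (LINT t|lebesgue_on {0..1}. \<bar>f t\<bar> powr q)"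
    using c by (simp add: abs_mult powr_mult)
  then show ?thesis
    using c q I0 by (simp add: Lp_norm_finite[OF False] Lq_norm_def q_def[symmetric] powr_mult powr_powr)
next
  case True
  have adm: "(\<lambda>t. d * f t) \<in> admissible" for d :: real
  proof -
    obtain B where B: "0 \<le> B" "\<forall>t\<in>{0..1}. \<bar>f t\<bar> \<le> B" using admissibleD(2)[OF f] by blast
    have "\<forall>t\<in>{0..1}. \<bar>d * f t\<bar> \<le> \<bar>d\<bar> * B" using B by (auto simp: abs_mult mult_left_mono)
    then show ?thesis using admissibleD(1)[OF f] unfolding admissible_def by auto
  qed
  have "AE t in lebesgue_on {0..1}. \<bar>f t\<bar> \<le> Lp_norm \<infinity> f"
    using Linf_le_iff[OF f Lp_norm_nonneg] by blast
  then have "AE t in lebesgue_on {0..1}. \<bar>c * f t\<bar> \<le> c * Lp_norm \<infinity> f"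
    by eventually_elim (use c in \<open>simp add: abs_mult mult_left_mono\<close>)
  then have 1: "Lp_norm \<infinity> (\<lambda>t. c * f t) \<le> c * Lp_norm \<infinity> f"
    using Linf_le_iff[OF adm, of "c * Lp_norm \<infinity> f" c] c Lp_norm_nonneg[of \<infinity> f] by simp
  have 2: "c * Lp_norm \<infinity> f \<le> Lp_norm \<infinity> (\<lambda>t. c * f t)"
  proof (cases "c = 0")
    case True then show ?thesis using Lp_norm_nonneg by simp
  next
    case False
    with c have c: "0 < c" by simp
    have "AE t in lebesgue_on {0..1}. \<bar>c * f t\<bar> \<le> Lp_norm \<infinity> (\<lambda>t. c * f t)"
      using Linf_le_iff[OF adm Lp_norm_nonneg] by blast
    then have "AE t in lebesgue_on {0..1}. \<bar>f t\<bar> \<le> Lp_norm \<infinity> (\<lambda>t. c * f t) / c"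
      by eventually_elim (use c in \<open>simp add: abs_mult pos_le_divide_eq mult.commute\<close>)
    then have "Lp_norm \<infinity> f \<le> Lp_norm \<infinity> (\<lambda>t. c * f t) / c"
      using Linf_le_iff[OF f, of "Lp_norm \<infinity> (\<lambda>t. c * f t) / c"] c Lp_norm_nonneg[of \<infinity> "\<lambda>t. c * f t"] by simp
    then show ?thesis using c by (simp add: pos_le_divide_eq mult.commute)
  qed
  show ?thesis unfolding True using 1 2 by (rule antisym)
qed

lemma skorohod_rational:
  assumes f: "f \<in> skorohod_D" and u: "0 < u" "u < 1" and e: "0 < e"
  obtains d where "d \<in> \<rat>" "0 < d" "d < 1" "\<bar>f d - f u\<bar> < e"
proof -
  obtain x y where xy: "x < y" "0 \<le> x" "y \<le> 1" "\<And>s. x < s \<Longrightarrow> s < y \<Longrightarrow> \<bar>f s - f u\<bar> < e"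
    using skorohod_interval[OF f u, of 0 1 e] u e by metis
  obtain d where d: "d \<in> \<rat>" "x < d" "d < y" using Rats_dense_in_real[OF xy(1)] by blast
  show ?thesis by (rule that[OF d(1) _ _ xy(4)[OF d(2,3)]]) (use d xy in auto)
qed

text \<open>Rational times suffice for interior points by one-sided continuity, and the end points are
  rational themselves; the functional becomes measurable as a countable supremum.\<close>

lemma sup_increment_le_iff:
  assumes f: "f \<in> skorohod_D"
  shows "sup_increment f \<le> a \<longleftrightarrow> (\<forall>s\<in>\<rat> \<inter> {0..1}. \<forall>t\<in>\<rat> \<inter> {0..1}. s < t \<longrightarrow> \<bar>f t - f s\<bar> \<le> a)"
proof
  assume le: "sup_increment f \<le> a"
  show "\<forall>s\<in>\<rat> \<inter> {0..1}. \<forall>t\<in>\<rat> \<inter> {0..1}. s < t \<longrightarrow> \<bar>f t - f s\<bar> \<le> a"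
  proof (intro ballI impI)
    fix s t :: real assume "s \<in> \<rat> \<inter> {0..1}" "t \<in> \<rat> \<inter> {0..1}" "s < t"
    then show "\<bar>f t - f s\<bar> \<le> a"
      using order_trans[OF sup_increment_ge[OF skorohod_admissible[OF f], of s t] le] by auto
  qed
next
  assume R: "\<forall>s\<in>\<rat> \<inter> {0..1}. \<forall>t\<in>\<rat> \<inter> {0..1}. s < t \<longrightarrow> \<bar>f t - f s\<bar> \<le> a"
  have R': "\<bar>f t - f s\<bar> \<le> a" if "s \<in> \<rat> \<inter> {0..1}" "t \<in> \<rat> \<inter> {0..1}" for s t
  proof -
    have "0 \<le> a" by (rule order_trans[OF abs_ge_zero R[rule_format, of 0 1]]) auto
    then show ?thesis using R[rule_format, of s t] R[rule_format, of t s] that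
      by (cases s t rule: linorder_cases) (auto simp: abs_minus_commute)
  qed
  have ap: "\<exists>d\<in>\<rat> \<inter> {0..1}. \<bar>f d - f u\<bar> < e" if u: "u \<in> {0..1}" and e: "0 < e" for u e
  proof -
    consider "u = 0" | "u = 1" | "0 < u" "u < 1" using u by fastforce
    then show ?thesis
    proof cases
      case 3
      obtain d where "d \<in> \<rat>" "0 < d" "d < 1" "\<bar>f d - f u\<bar> < e" using skorohod_rational[OF f 3 e] by blast
      then show ?thesis by (intro bexI[of _ d]) auto
    qed (use e in \<open>auto intro!: bexI[of _ u]\<close>)
  qed
  show "sup_increment f \<le> a"
  proof (rule sup_increment_le, rule field_le_epsilon)
    fix s t r :: real assume st: "0 \<le> s" "s < t" "t \<le> 1" and r: "0 < r"
    obtain d where d: "d \<in> \<rat> \<inter> {0..1}" "\<bar>f d - f s\<bar> < r / 2" using ap[of s "r / 2"] st r by auto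
    obtain d' where d': "d' \<in> \<rat> \<inter> {0..1}" "\<bar>f d' - f t\<bar> < r / 2" using ap[of t "r / 2"] st r by auto
    show "\<bar>f t - f s\<bar> \<le> a + r" using R'[OF d(1) d'(1)] d(2) d'(2) by linarith
  qed
qed

text \<open>One-sided continuity turns a bound almost everywhere into one on the whole open interval.
  The end points are left out, since the path may have an isolated value there.\<close>

lemma Linf_le_iff_rational:
  assumes f: "f \<in> skorohod_D" and a: "0 \<le> a"
  shows "Lp_norm \<infinity> f \<le> a \<longleftrightarrow> (\<forall>t\<in>\<rat> \<inter> {0<..<1}. \<bar>f t\<bar> \<le> a)"
proof -
  have all: "(AE t in lebesgue_on {0..1}. \<bar>f t\<bar> \<le> a) \<longleftrightarrow> (\<forall>t\<in>{0<..<1}. \<bar>f t\<bar> \<le> a)"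
  proof
    assume ae: "AE t in lebesgue_on {0..1}. \<bar>f t\<bar> \<le> a"
    show "\<forall>t\<in>{0<..<1}. \<bar>f t\<bar> \<le> a"
    proof (rule ccontr)
      assume "\<not> ?thesis"
      then obtain t where t: "0 < t" "t < 1" "a < \<bar>f t\<bar>" by (auto simp: not_le)
      obtain x y where xy: "x < y" "0 \<le> x" "y \<le> 1" "\<And>s. x < s \<Longrightarrow> s < y \<Longrightarrow> \<bar>f s - f t\<bar> < \<bar>f t\<bar> - a"
        using skorohod_interval[OF f t(1,2), of 0 1 "\<bar>f t\<bar> - a"] t by (metis diff_gt_0_iff_gt)
      have big: "a < \<bar>f s\<bar>" if "s \<in> {x<..<y}" for s using xy(4)[of s] that by auto
      from ae have "AE s in lebesgue. s \<in> {0..1} \<longrightarrow> \<bar>f s\<bar> \<le> a" by (subst (asm) AE_restrict_space_iff) auto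
      then have "AE s in lebesgue. s \<notin> {x<..<y}"
        by eventually_elim (use big xy in fastforce)
      then have "{x<..<y} \<in> null_sets lebesgue" by (subst AE_iff_null_sets) auto
      then have "emeasure lebesgue {x<..<y} = 0" by auto
      then show False using xy(1) by simp
    qed
  next
    assume R: "\<forall>t\<in>{0<..<1}. \<bar>f t\<bar> \<le> a"
    show "AE t in lebesgue_on {0..1}. \<bar>f t\<bar> \<le> a"
      using AE_Icc_neq[of 0] AE_Icc_neq[of 1] AE_space
      by eventually_elim (use R in \<open>auto simp: space_restrict_space\<close>)
  qed
  have "(\<forall>t\<in>{0<..<1}. \<bar>f t\<bar> \<le> a) \<longleftrightarrow> (\<forall>t\<in>\<rat> \<inter> {0<..<1}. \<bar>f t\<bar> \<le> a)"
  proof (intro iffI ballI)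
    fix u :: real assume R: "\<forall>t\<in>\<rat> \<inter> {0<..<1}. \<bar>f t\<bar> \<le> a" and u: "u \<in> {0<..<1}"
    show "\<bar>f u\<bar> \<le> a"
    proof (rule field_le_epsilon)
      fix e :: real assume "0 < e"
      then obtain d where "d \<in> \<rat>" "0 < d" "d < 1" "\<bar>f d - f u\<bar> < e" using skorohod_rational[OF f, of u e] u by auto
      with R show "\<bar>f u\<bar> \<le> a + e" by (force dest: bspec[of _ _ d])
    qed
  qed auto
  then show ?thesis using Linf_le_iff[OF skorohod_admissible[OF f] a] all by simp
qed

text \<open>For finite \<open>p\<close> the integral is a limit of Riemann sums.\<close>

lemma functional_measurable:
  fixes F :: "'c \<Rightarrow> real \<Rightarrow> real"
  assumes m: "\<And>t. t \<in> {0..1} \<Longrightarrow> (\<lambda>\<omega>. F \<omega> t) \<in> borel_measurable N"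
    and F: "\<And>\<omega>. \<omega> \<in> space N \<Longrightarrow> F \<omega> \<in> skorohod_D"
  shows "(\<lambda>\<omega>. sup_increment (F \<omega>)) \<in> borel_measurable N"
    "1 \<le> p \<Longrightarrow> (\<lambda>\<omega>. Lp_norm p (F \<omega>)) \<in> borel_measurable N"
proof -
  have cQ: "countable (\<rat> \<inter> S :: real set)" for S by (rule countable_subset[OF _ countable_rat]) auto
  show "(\<lambda>\<omega>. sup_increment (F \<omega>)) \<in> borel_measurable N"
    unfolding borel_measurable_iff_le
  proof
    fix a :: real
    have "{\<omega>\<in>space N. sup_increment (F \<omega>) \<le> a} = {\<omega>\<in>space N. \<forall>s\<in>\<rat> \<inter> {0..1}. \<forall>t\<in>\<rat> \<inter> {0..1}. s < t \<longrightarrow> \<bar>F \<omega> t - F \<omega> s\<bar> \<le> a}"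
      using sup_increment_le_iff[OF F] by auto
    also have "\<dots> \<in> sets N"
    proof (intro sets.sets_Collect_countable_All' cQ)
      fix s t :: real assume "s \<in> \<rat> \<inter> {0..1}" "t \<in> \<rat> \<inter> {0..1}"
      then have [measurable]: "(\<lambda>\<omega>. F \<omega> s) \<in> borel_measurable N" "(\<lambda>\<omega>. F \<omega> t) \<in> borel_measurable N"
        by (auto intro: m)
      show "{\<omega>\<in>space N. s < t \<longrightarrow> \<bar>F \<omega> t - F \<omega> s\<bar> \<le> a} \<in> sets N" by measurable
    qed
    finally show "{\<omega>\<in>space N. sup_increment (F \<omega>) \<le> a} \<in> sets N" .
  qed
  assume p: "1 \<le> p"
  show "(\<lambda>\<omega>. Lp_norm p (F \<omega>)) \<in> borel_measurable N"
  proof (cases "p = \<infinity>")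
    case False
    define q where "q = enn2real p"
    have q: "1 \<le> q" unfolding q_def by (rule enn2real_ge_1[OF p False])
    have cont: "continuous_on UNIV (\<lambda>y::real. \<bar>y\<bar> powr q)"
      by (rule continuous_on_powr') (use q in \<open>auto intro!: continuous_intros\<close>)
    have "(\<lambda>\<omega>. LINT t|lebesgue_on {0..1}. \<bar>F \<omega> t\<bar> powr q) \<in> borel_measurable N"
    proof (rule borel_measurable_LIMSEQ_real)
      fix \<omega> assume "\<omega> \<in> space N"
      then show "(\<lambda>n. (\<Sum>i<Suc n. \<bar>F \<omega> (real i / real (Suc n))\<bar> powr q) / real (Suc n)) \<longlonglongrightarrow> (LINT t|lebesgue_on {0..1}. \<bar>F \<omega> t\<bar> powr q)"
        by (rule riemann_sums(2)[OF F cont])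
    next
      fix n
      have "(\<lambda>\<omega>. F \<omega> (real i / real (Suc n))) \<in> borel_measurable N" if "i \<in> {..<Suc n}" for i
        using that by (intro m) (auto simp: divide_le_eq_1)
      then show "(\<lambda>\<omega>. (\<Sum>i<Suc n. \<bar>F \<omega> (real i / real (Suc n))\<bar> powr q) / real (Suc n)) \<in> borel_measurable N"
        by (intro borel_measurable_divide borel_measurable_const borel_measurable_sum) measurable
    qed
    then show ?thesis unfolding Lp_norm_finite[OF False] Lq_norm_def q_def[symmetric] by measurable
  next
    case True
    show ?thesis unfolding True borel_measurable_iff_le
    proof
      fix a :: real
      show "{\<omega>\<in>space N. Lp_norm \<infinity> (F \<omega>) \<le> a} \<in> sets N"
      proof (cases "0 \<le> a")
        case True
        have "{\<omega>\<in>space N. Lp_norm \<infinity> (F \<omega>) \<le> a} = {\<omega>\<in>space N. \<forall>t\<in>\<rat> \<inter> {0<..<1}. \<bar>F \<omega> t\<bar> \<le> a}"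
          using Linf_le_iff_rational[OF F True] by auto
        also have "\<dots> \<in> sets N"
        proof (intro sets.sets_Collect_countable_All' cQ)
          fix t :: real assume "t \<in> \<rat> \<inter> {0<..<1}"
          then have [measurable]: "(\<lambda>\<omega>. F \<omega> t) \<in> borel_measurable N" by (auto intro: m)
          show "{\<omega>\<in>space N. \<bar>F \<omega> t\<bar> \<le> a} \<in> sets N" by measurable
        qed
        finally show ?thesis .
      next
        case False
        then have "{\<omega>\<in>space N. Lp_norm \<infinity> (F \<omega>) \<le> a} = {}"
          using Lp_norm_nonneg[of \<infinity>] by (auto dest: order_trans)
        then show ?thesis by (simp only: sets.empty_sets)
      qed
    qed
  qed
qed

section \<open>Convergence of the discrepancies\<close>

text \<open>As a function of the end point \<open>s\<close> of \<open>[0, s)\<close> the indicator jumps just after \<open>s = y\<close>, which makes it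
  left continuous.\<close>

lemma indicator_jump_limits:
  fixes t y :: real
  assumes "0 \<le> y"
  shows "\<exists>l. ((\<lambda>s. indicator {0..<s} y) \<longlongrightarrow> (l::real)) (at_right t)"
    and "((\<lambda>s. indicator {0..<s} y) \<longlongrightarrow> (indicator {0..<t} y :: real)) (at_left t)"
proof -
  show "\<exists>l. ((\<lambda>s. indicator {0..<s} y) \<longlongrightarrow> (l::real)) (at_right t)"
  proof (cases "t < y")
    case True
    have "\<forall>\<^sub>F s in at_right t. (indicator {0..<s} y :: real) = 0"
      using eventually_at_right_real[OF True] by eventually_elim simp
    then show ?thesis by (intro exI[of _ 0] tendsto_eventually)
  next
    case False
    have "\<forall>\<^sub>F s in at_right t. (indicator {0..<s} y :: real) = 1"
      using eventually_at_right_less[of t] by eventually_elim (use False assms in simp)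
    then show ?thesis by (intro exI[of _ 1] tendsto_eventually)
  qed
  show "((\<lambda>s. indicator {0..<s} y) \<longlongrightarrow> (indicator {0..<t} y :: real)) (at_left t)"
  proof (cases "y < t")
    case True
    show ?thesis
      by (rule tendsto_eventually, use eventually_at_left_real[OF True] in eventually_elim) (use True assms in auto)
  next
    case False
    have "\<forall>\<^sub>F s in at_left t. s < t" unfolding eventually_at_filter by simp
    then have "\<forall>\<^sub>F s in at_left t. (indicator {0..<s} y :: real) = indicator {0..<t} y"
      by eventually_elim (use False in auto)
    then show ?thesis by (rule tendsto_eventually)
  qed
qed

lemma (in circle_walk) G_skorohod: "G N \<omega> \<in> skorohod_D"
proof -
  define y where "y k = frac (S k \<omega>)" for k
  have y: "0 \<le> y k" for k by (simp add: y_def)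
  have G: "G N \<omega> = (\<lambda>t. sqrt (real N) * (1 / real N * (\<Sum>k=1..N. indicator {0..<t} (y k)) - t))"
    by (simp add: G_def emp_def y_def fun_eq_iff)
  have "\<exists>l. (G N \<omega> \<longlongrightarrow> l) (at_right t)" for t
  proof -
    have "\<forall>k. \<exists>l. ((\<lambda>s. indicator {0..<s} (y k)) \<longlongrightarrow> (l :: real)) (at_right t)"
      using indicator_jump_limits(1)[OF y] by blast
    then obtain l where l: "((\<lambda>s. indicator {0..<s} (y k)) \<longlongrightarrow> (l k :: real)) (at_right t)" for k
      by (auto dest!: choice)
    have "(G N \<omega> \<longlongrightarrow> sqrt (real N) * (1 / real N * (\<Sum>k=1..N. l k) - t)) (at_right t)"
      unfolding G by (intro tendsto_intros l)
    then show ?thesis by blast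
  qed
  moreover have "(G N \<omega> \<longlongrightarrow> G N \<omega> t) (at_left t)" for t
    unfolding G by (intro tendsto_intros indicator_jump_limits(2) y)
  ultimately show ?thesis unfolding skorohod_D_def continuous_within by blast
qed

lemma dyadic_dense:
  fixes x y :: real
  assumes "0 \<le> x" "x < y" "y \<le> 1"
  obtains R i where "m \<le> R" "i \<le> 2 ^ R" "x < real i / 2 ^ R" "real i / 2 ^ R < y"
proof -
  obtain r where r: "(1 / 2 :: real) ^ r < y - x"
    using real_arch_pow_inv[of "y - x" "1/2"] assms by auto
  define R where "R = max m r"
  have "(1 / 2 :: real) ^ R \<le> (1 / 2) ^ r" by (rule power_decreasing) (auto simp: R_def)
  with r have R: "1 / 2 ^ R < y - x" by (simp add: power_divide)
  define i where "i = nat \<lfloor>2 ^ R * x\<rfloor> + 1"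
  have "0 \<le> 2 ^ R * x" using assms by simp
  then have fl: "real i \<le> 2 ^ R * x + 1" "2 ^ R * x < real i"
    unfolding i_def using floor_correct[of "2 ^ R * x"] by simp_all linarith
  have 1: "x < real i / 2 ^ R" using fl by (simp add: field_simps)
  have "real i / 2 ^ R \<le> x + 1 / 2 ^ R" using fl by (simp add: field_simps)
  with R have 2: "real i / 2 ^ R < y" by simp
  with assms have "real i / 2 ^ R < 1" by linarith
  then have "real i < 2 ^ R" by (simp add: divide_less_eq)
  then have "real i < real (2 ^ R)" by simp
  then have "i \<le> 2 ^ R" by (simp only: of_nat_less_iff)
  with 1 2 show ?thesis by (intro that[of R i]) (auto simp: R_def)
qed

context gaussian_limit
begin

lemma step_admissible: "step m x \<in> admissible"
proof -
  have "(\<lambda>t::real. x (nat \<lfloor>2 ^ m * t\<rfloor>)) \<in> borel_measurable borel"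
    by (rule measurable_compose[of "\<lambda>t::real. nat \<lfloor>2 ^ m * t\<rfloor>" borel "count_space UNIV" x]) measurable
  then have "step m x \<in> borel_measurable (lebesgue_on {0..1})"
    by (intro borel_lebesgue_on) (simp add: step_def[abs_def])
  moreover have "\<bar>step m x t\<bar> \<le> (\<Sum>i\<le>2 ^ m. \<bar>x i\<bar>)" if "t \<in> {0..1}" for t
    unfolding step_def by (rule member_le_sum) (use grid_props(1)[of t m] that in auto)
  ultimately show ?thesis unfolding admissible_def by blast
qed

text \<open>A point strictly inside a cell of level \<open>m\<close> has dyadic points of the same cell, with nearly the same
  value of the path, on the side of continuity; points of the grid itself cause no error.\<close>

lemma pt_separates:
  assumes f: "f \<in> skorohod_D" and t: "t \<in> {0..1}"
    and e: "\<And>R i. m \<le> R \<Longrightarrow> i \<le> 2 ^ R \<Longrightarrow> \<bar>f (pt R i) - f (grid m (pt R i))\<bar> \<le> e"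
  shows "\<bar>f t - f (grid m t)\<bar> \<le> e"
proof (rule ccontr)
  assume neg: "\<not> \<bar>f t - f (grid m t)\<bar> \<le> e"
  have e0: "0 \<le> e" using e[of m 0] by simp
  have t01: "0 \<le> t" "t \<le> 1" using t by auto
  define a where "a = grid m t"
  define b where "b = a + 1 / 2 ^ m"
  have a: "0 \<le> a" "a \<le> t" "t < b" using grid_props[OF t01, of m] by (auto simp: a_def b_def)
  have "a \<noteq> t" using neg e0 by (auto simp: a_def)
  with a have at: "a < t" by simp
  have "grid m 1 = 1"
    using floor_of_nat[of "2 ^ m", where ?'a=real] by (simp add: grid_def)
  with \<open>a \<noteq> t\<close> t01 have t1: "t < 1" by (auto simp: a_def intro: le_neq_trans)
  have "0 < \<bar>f t - f a\<bar> - e" using neg by (simp add: a_def)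
  then obtain x y where xy: "x < y" "a \<le> x" "y \<le> b" "0 \<le> x" "y \<le> 1"
    and near: "\<And>s. x < s \<Longrightarrow> s < y \<Longrightarrow> \<bar>f s - f t\<bar> < \<bar>f t - f a\<bar> - e"
    by (rule skorohod_interval[OF f order_le_less_trans[OF a(1) at] t1 at a(3)]) (rule that)
  obtain R i where R: "m \<le> R" and i: "i \<le> 2 ^ R" "x < real i / 2 ^ R" "real i / 2 ^ R < y"
    by (rule dyadic_dense[OF xy(4,1,5)])
  let ?s = "real i / 2 ^ R"
  define k where "k = nat \<lfloor>2 ^ m * t\<rfloor>"
  have ak: "a = real k / 2 ^ m" by (simp add: a_def k_def grid_def)
  have "a \<le> ?s" "?s < b" using i xy by auto
  then have "real k \<le> 2 ^ m * ?s" "2 ^ m * ?s < real k + 1"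
    unfolding ak b_def by (auto simp: divide_le_eq less_divide_eq field_simps)
  then have "\<lfloor>2 ^ m * ?s\<rfloor> = int k" by (intro floor_unique) auto
  then have "grid m ?s = a" by (simp add: grid_def ak)
  then have "\<bar>f ?s - f a\<bar> \<le> e" using e[OF R i(1)] by (simp add: pt_eq[OF i(1)])
  with near[OF i(2,3)] show False by linarith
qed

end

locale skorohod_gaussian_limit = gaussian_limit +
  assumes K_skorohod: "\<forall>\<omega>\<in>space P. (\<lambda>t. K t \<omega>) \<in> skorohod_D"
begin

text \<open>Homogeneity moves the factor \<open>sqrt N\<close> into the functional, where it turns the empirical
  deviation into \<open>G\<close>.\<close>

lemma functional_converges:
  assumes lip: "\<And>f g e. f \<in> admissible \<Longrightarrow> g \<in> admissible \<Longrightarrow>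
      (\<And>t. t \<in> {0..1} \<Longrightarrow> \<bar>f t - g t\<bar> \<le> e) \<Longrightarrow> \<bar>\<Phi> f - \<Phi> g\<bar> \<le> 2 * e"
    and scale: "\<And>f c. f \<in> admissible \<Longrightarrow> 0 \<le> c \<Longrightarrow> \<Phi> (\<lambda>t. c * f t) = c * \<Phi> f"
    and GM: "\<And>N. (\<lambda>\<omega>. \<Phi> (G N \<omega>)) \<in> borel_measurable M"
    and KM: "(\<lambda>\<omega>. \<Phi> (\<lambda>t. K t \<omega>)) \<in> borel_measurable P"
  shows "conv_in_distr M (\<lambda>N \<omega>. sqrt (real N) * \<Phi> (\<lambda>t. emp X N \<omega> t - t)) P (\<lambda>\<omega>. \<Phi> (\<lambda>t. K t \<omega>))"
proof -
  have adm: "(\<lambda>t. emp X N \<omega> t - t) \<in> admissible" for N \<omega>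
  proof (cases "N = 0")
    case True
    have "(\<lambda>t::real. - t) \<in> borel_measurable (lebesgue_on {0..1})" by (rule borel_lebesgue_on) measurable
    then show ?thesis unfolding admissible_def using True by (auto simp: emp_def intro!: exI[of _ 1])
  next
    case False
    have eq: "(\<lambda>t. emp X N \<omega> t - t) = (\<lambda>t. G N \<omega> t / sqrt (real N))"
      using False by (simp add: G_def fun_eq_iff)
    have G: "G N \<omega> \<in> admissible" by (rule skorohod_admissible[OF G_skorohod])
    obtain B where B: "0 \<le> B" "\<forall>t\<in>{0..1}. \<bar>G N \<omega> t\<bar> \<le> B" using admissibleD(2)[OF G] by blast
    have "\<forall>t\<in>{0..1}. \<bar>G N \<omega> t / sqrt (real N)\<bar> \<le> B / sqrt (real N)"
      using B by (auto intro!: divide_right_mono)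
    moreover have "(\<lambda>t. G N \<omega> t / sqrt (real N)) \<in> borel_measurable (lebesgue_on {0..1})"
      by (intro borel_measurable_divide admissibleD(1)[OF G] borel_measurable_const)
    ultimately show ?thesis unfolding eq admissible_def by blast
  qed
  have eq: "sqrt (real N) * \<Phi> (\<lambda>t. emp X N \<omega> t - t) = \<Phi> (G N \<omega>)" for N \<omega>
    using scale[OF adm, of "sqrt (real N)" N \<omega>] by (simp add: G_def[abs_def])
  show ?thesis
    unfolding conv_in_distr_def eq
  proof (intro conjI allI GM KM functional_convergence[of admissible])
    show "G N \<omega> \<in> admissible" for N \<omega> by (rule skorohod_admissible[OF G_skorohod])
    show "(\<lambda>t. K t \<omega>) \<in> admissible" if "\<omega> \<in> space P" for \<omega>
      using that K_skorohod skorohod_admissible by blast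
    fix \<omega> m t e
    assume "\<omega> \<in> space P" "t \<in> {0..1::real}"
      "\<And>R i. m \<le> R \<Longrightarrow> i \<le> 2 ^ R \<Longrightarrow> \<bar>K (pt R i) \<omega> - K (grid m (pt R i)) \<omega>\<bar> \<le> e"
    then show "\<bar>K t \<omega> - K (grid m t) \<omega>\<bar> \<le> e"
      using pt_separates[of "\<lambda>t. K t \<omega>" t m e] K_skorohod by blast
  qed (use lip step_admissible in auto)
qed

lemma sup_increment_K_measurable: "(\<lambda>\<omega>. sup_increment (\<lambda>t. K t \<omega>)) \<in> borel_measurable P"
  by (rule functional_measurable(1)) (use K_measurable K_skorohod in auto)

lemma Lp_norm_K_measurable: "1 \<le> p \<Longrightarrow> (\<lambda>\<omega>. Lp_norm p (\<lambda>t. K t \<omega>)) \<in> borel_measurable P"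
  by (rule functional_measurable(2)) (use K_measurable K_skorohod in auto)

theorem discrepancy_converges:
  "conv_in_distr M (\<lambda>N \<omega>. sqrt (real N) * discrepancy X N \<omega>) P (\<lambda>\<omega>. sup_increment (\<lambda>t. K t \<omega>))"
  unfolding discrepancy_def
  by (rule functional_converges[OF sup_increment_lipschitz sup_increment_scale
        functional_measurable(1)[OF G_measurable G_skorohod] sup_increment_K_measurable])

theorem Lp_discrepancy_converges:
  assumes "1 \<le> p"
  shows "conv_in_distr M (\<lambda>N \<omega>. sqrt (real N) * Lp_discrepancy p X N \<omega>) P (\<lambda>\<omega>. Lp_norm p (\<lambda>t. K t \<omega>))"
  unfolding Lp_discrepancy_def
  by (rule functional_converges[OF Lp_norm_lipschitz[OF _ _ assms] Lp_norm_scale[OF _ assms]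
        functional_measurable(2)[OF G_measurable G_skorohod assms] Lp_norm_K_measurable[OF assms]])
     (use assms in auto)

end

section \<open>Nondegeneracy\<close>

subsection \<open>The variance of the cosine\<close>

definition circle_exp :: "real \<Rightarrow> complex" where
  "circle_exp x = cis (2 * pi * x)"

lemma circle_exp_props:
  "circle_exp \<in> borel_measurable borel" "norm (circle_exp x) = 1" "periodic1 circle_exp"
  "circ_bv (2 * pi) circle_exp" "circle_exp (x + y) = circle_exp x * circle_exp y"
proof -
  show m: "circle_exp \<in> borel_measurable borel"
    unfolding circle_exp_def[abs_def] cis_conv_exp by measurable
  show add: "circle_exp (x + y) = circle_exp x * circle_exp y" for x y
    by (simp add: circle_exp_def cis_mult distrib_left)
  show "norm (circle_exp x) = 1" by (simp add: circle_exp_def)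
  have int: "circle_exp (of_int n) = 1" for n by (simp add: circle_exp_def)
  have "circle_exp x = circle_exp (frac x) * circle_exp (of_int \<lfloor>x\<rfloor>)" for x
    unfolding add[symmetric] by (simp add: frac_def)
  then show "periodic1 circle_exp" unfolding periodic1_def int by simp
  have "norm (circle_exp y - circle_exp x) \<le> 2 * pi * y - 2 * pi * x" if "x \<le> y" for x y
    using iexp_lipschitz[of "2 * pi * y" "2 * pi * x"] that
    by (simp add: circle_exp_def cis_conv_exp mult_left_mono)
  moreover have "mono (\<lambda>x::real. 2 * pi * x)" by (intro monoI mult_left_mono) auto
  ultimately show "circ_bv (2 * pi) circle_exp"
    unfolding circ_bv_def by (intro exI[of _ "\<lambda>x. 2 * pi * x"]) (auto simp: algebra_simps)
qed

lemma circle_exp_bounded_borel: "bounded_borel circle_exp"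
  by (rule bounded_borelI[where B=1]) (simp_all add: circle_exp_props)

lemma circle_exp_integral: "(LINT u|unif. circle_exp u) = 0"
proof -
  have "circle_exp (u + 1 / 2) = - circle_exp u" for u
    unfolding circle_exp_props(5) by (simp add: circle_exp_def)
  then have "(LINT u|unif. - circle_exp u) = (LINT u|unif. circle_exp u)"
    using integral_unif_shift[of circle_exp 1 "1 / 2"] circle_exp_props by simp
  then show ?thesis by (simp add: equal_neg_zero)
qed

lemma circle_cos_sin: "cos (2 * pi * u) = Re (circle_exp u)" "sin (2 * pi * u) = Im (circle_exp u)"
  by (simp_all add: circle_exp_def)

text \<open>A quarter turn exchanges the squares of sine and cosine, which add up to 1, and changes the sign of
  their product.\<close>

lemma unif_cos_sin:
  "(LINT u|unif. cos (2 * pi * u) * cos (2 * pi * u)) = 1 / 2"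
  "(LINT u|unif. cos (2 * pi * u) * sin (2 * pi * u)) = 0"
proof -
  interpret U: prob_space unif by (rule prob_space_unif)
  have per: "periodic1 (\<lambda>u. cos (2 * pi * u))" "periodic1 (\<lambda>u. sin (2 * pi * u))"
    using circle_exp_props(3) unfolding periodic1_def circle_cos_sin by auto
  have shift: "cos (2 * pi * (u + 1 / 4)) = - sin (2 * pi * u)" "sin (2 * pi * (u + 1 / 4)) = cos (2 * pi * u)" for u
    by (simp_all add: distrib_left cos_add sin_add)
  have int: "integrable unif (\<lambda>u. cos (2 * pi * u) * cos (2 * pi * u))" "integrable unif (\<lambda>u. sin (2 * pi * u) * sin (2 * pi * u))"
    by (rule U.integrable_const_bound[where B=1, OF AE_I2]; simp flip: power2_eq_square add: abs_square_le_1)+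
  have "(LINT u|unif. sin (2 * pi * u) * sin (2 * pi * u)) = (LINT u|unif. cos (2 * pi * u) * cos (2 * pi * u))"
    using integral_unif_shift[of "\<lambda>u. cos (2 * pi * u) * cos (2 * pi * u)" 1 "1 / 4"] per
    by (simp add: shift periodic1_def) (simp flip: power2_eq_square add: abs_square_le_1)
  moreover have "(LINT u|unif. cos (2 * pi * u) * cos (2 * pi * u)) + (LINT u|unif. sin (2 * pi * u) * sin (2 * pi * u)) = (LINT u|unif. 1)"
    unfolding Bochner_Integration.integral_add[OF int, symmetric]
    by (simp flip: power2_eq_square)
  ultimately show "(LINT u|unif. cos (2 * pi * u) * cos (2 * pi * u)) = 1 / 2"
    using U.prob_space by simp
  have "(LINT u|unif. - (sin (2 * pi * u) * cos (2 * pi * u))) = (LINT u|unif. cos (2 * pi * u) * sin (2 * pi * u))"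
    using integral_unif_shift[of "\<lambda>u. cos (2 * pi * u) * sin (2 * pi * u)" 1 "1 / 4"] per
    by (simp add: shift periodic1_def abs_mult mult_le_one)
  then show "(LINT u|unif. cos (2 * pi * u) * sin (2 * pi * u)) = 0"
    by (simp add: mult.commute)
qed

context circle_walk
begin

definition step_coeff :: complex where
  "step_coeff = T 1 circle_exp 0"

text \<open>Characters of the circle are eigenfunctions of translations, hence of their averages.\<close>

lemma T_circle_exp: "T k circle_exp x = circle_exp x * step_coeff ^ k"
proof -
  have shift: "T k circle_exp x = circle_exp x * T k circle_exp 0" for k x
    by (simp add: T_def circle_exp_props(5))
  have "T k circle_exp 0 = step_coeff ^ k"
  proof (induction k)
    case 0
    show ?case by (simp add: T_0 circle_exp_def)
  next
    case (Suc k)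
    have "T (Suc k) circle_exp 0 = T k (T 1 circle_exp) 0"
      using T_add[OF circle_exp_bounded_borel, of k 1 0] by simp
    also have "T 1 circle_exp = (\<lambda>x. circle_exp x * step_coeff)"
      by (rule ext, unfold step_coeff_def, rule shift)
    also have "T k (\<lambda>x. circle_exp x * step_coeff) 0 = T k circle_exp 0 * step_coeff"
      by (simp add: T_def)
    finally show ?case by (simp add: Suc mult.commute)
  qed
  with shift[of k x] show ?thesis by simp
qed

text \<open>The \<open>k\<close>-th power of the eigenvalue is the mean of a centered function of bounded variation after
  \<open>k\<close> steps, which tends to 0.\<close>

lemma step_coeff_less_1: "norm step_coeff < 1"
proof (rule ccontr)
  assume "\<not> norm step_coeff < 1"
  then have ge: "1 \<le> norm step_coeff ^ k" for k by simp
  have "norm step_coeff ^ k \<le> 12 * pi * \<psi> k" for k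
    using T_equidistributes_complex[OF circle_exp_bounded_borel circle_exp_props(3,4), of k 0]
    by (simp add: T_circle_exp circle_exp_integral circle_exp_props(2) norm_mult norm_power)
  with ge have "1 \<le> 12 * pi * \<psi> (Suc k)" for k by (meson order_trans)
  moreover have "(\<lambda>k. 12 * pi * \<psi> (Suc k)) \<longlonglongrightarrow> 12 * pi * 0"
    by (intro tendsto_intros summable_LIMSEQ_zero summable_psi)
  ultimately show False using LIMSEQ_le_const[of "\<lambda>k. 12 * pi * \<psi> (Suc k)" 0 1] by force
qed

lemma corr_cos: "corr (\<lambda>x. cos (2 * pi * x)) k = Re (step_coeff ^ k) / 2"
proof -
  have "T k (\<lambda>x. cos (2 * pi * x)) u = Re (T k circle_exp u)" for u
    unfolding T_def circle_cos_sin
    by (rule integral_Re[OF integrable_comp_S[OF circle_exp_bounded_borel]])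
  then have T: "T k (\<lambda>x. cos (2 * pi * x)) u
      = Re (step_coeff ^ k) * cos (2 * pi * u) - Im (step_coeff ^ k) * sin (2 * pi * u)" for u
    unfolding T_circle_exp circle_cos_sin by simp
  have bb: "bounded_borel (\<lambda>u::real. cos (2 * pi * u))" "bounded_borel (\<lambda>u::real. sin (2 * pi * u))"
    by (rule bounded_borelI[where B=1]; simp)+
  note int = unif_integrable[OF bounded_borel_mult[OF bb(1) bb(1)]] unif_integrable[OF bounded_borel_mult[OF bb(1) bb(2)]]
  have "corr (\<lambda>x. cos (2 * pi * x)) k = (LINT u|unif. Re (step_coeff ^ k) * (cos (2 * pi * u) * cos (2 * pi * u))
      - Im (step_coeff ^ k) * (cos (2 * pi * u) * sin (2 * pi * u)))"
    unfolding corr_def T by (simp add: algebra_simps)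
  also have "\<dots> = Re (step_coeff ^ k) * (LINT u|unif. cos (2 * pi * u) * cos (2 * pi * u))
      - Im (step_coeff ^ k) * (LINT u|unif. cos (2 * pi * u) * sin (2 * pi * u))"
    using int by simp
  finally show ?thesis by (simp add: unif_cos_sin)
qed

text \<open>With \<open>z = step_coeff\<close> the variance is half the real part of \<open>(1 + z) / (1 - z)\<close>, and this Moebius map
  sends the unit disc to the right half plane.\<close>

lemma asymp_var_cos_pos: "0 < asymp_var (\<lambda>x. cos (2 * pi * x))"
proof -
  let ?z = step_coeff
  have z1: "?z \<noteq> 1" using step_coeff_less_1 by auto
  have "(\<lambda>k. ?z * ?z ^ k) sums (?z * (1 / (1 - ?z)))"
    by (intro sums_mult geometric_sums step_coeff_less_1)
  then have "(\<lambda>k. Re (?z ^ Suc k)) sums Re (?z / (1 - ?z))"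
    using sums_Re by fastforce
  then have "(\<lambda>k. Re (?z ^ Suc k) / 2) sums (Re (?z / (1 - ?z)) / 2)" by (rule sums_divide)
  then have "asymp_var (\<lambda>x. cos (2 * pi * x)) = 1 / 2 + Re (?z / (1 - ?z))"
    unfolding asymp_var_def corr_cos using sums_unique by fastforce
  moreover have "0 < 1 / 2 + Re (?z / (1 - ?z))"
  proof -
    define D where "D = (1 - Re ?z)\<^sup>2 + (Im ?z)\<^sup>2"
    have D: "0 < D"
      unfolding D_def using z1 by (subst sum_power2_gt_zero_iff) (auto simp: complex_eq_iff)
    have "(Re ?z)\<^sup>2 + (Im ?z)\<^sup>2 < 1"
      using step_coeff_less_1 by (simp add: norm_complex_def)
    then have "0 < D + 2 * (Re ?z * (1 - Re ?z) - Im ?z * Im ?z)"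
      by (simp add: D_def power2_eq_square algebra_simps)
    moreover have "Re (?z / (1 - ?z)) = (Re ?z * (1 - Re ?z) - Im ?z * Im ?z) / D"
      by (simp add: Re_divide D_def)
    ultimately have "1 / 2 + Re (?z / (1 - ?z)) = (D + 2 * (Re ?z * (1 - Re ?z) - Im ?z * Im ?z)) / (2 * D)"
      using D by (simp add: add_divide_distrib del: Re_divide_of_real) (simp add: field_simps)
    with \<open>0 < D + _\<close> D show ?thesis by simp
  qed
  ultimately show ?thesis by simp
qed

end

subsection \<open>The cosine as a combination of centered indicators\<close>

text \<open>The integrand in the representation of the cosine as a combination of centered indicators:
  integration by parts gives \<open>\<integral> 2 * pi * sin (2 * pi * t) * (1[y < t] - t) dt = cos (2 * pi * y)\<close>.\<close>

definition wave :: "real \<Rightarrow> real \<Rightarrow> real" where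
  "wave x t = 2 * pi * sin (2 * pi * t) * (indicator {0..<t} (frac x) - t)"

lemma wave_skorohod: "wave x \<in> skorohod_D"
proof -
  have y: "0 \<le> frac x" by simp
  have "\<exists>l. (wave x \<longlongrightarrow> l) (at_right t)" for t
  proof -
    obtain l where l: "((\<lambda>s. indicator {0..<s} (frac x)) \<longlongrightarrow> (l :: real)) (at_right t)"
      using indicator_jump_limits(1)[OF y] by blast
    have "(wave x \<longlongrightarrow> 2 * pi * sin (2 * pi * t) * (l - t)) (at_right t)"
      unfolding wave_def[abs_def] by (intro tendsto_intros l)
    then show ?thesis by blast
  qed
  moreover have "(wave x \<longlongrightarrow> wave x t) (at_left t)" for t
    unfolding wave_def[abs_def] by (intro tendsto_intros indicator_jump_limits(2) y)
  ultimately show ?thesis unfolding skorohod_D_def continuous_within by blast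
qed

lemma wave_integral: "(LINT t|lebesgue_on {0..1}. wave x t) = cos (2 * pi * x)"
proof -
  define y where "y = frac x"
  have y: "0 \<le> y" "y \<le> 1" using frac_lt_1[of x] by (auto simp: y_def)
  define A where "A t = t * cos (2 * pi * t) - sin (2 * pi * t) / (2 * pi)" for t :: real
  have A: "(A has_real_derivative - (2 * pi * sin (2 * pi * t) * t)) (at t within S)" for t S
    unfolding A_def[abs_def] by (rule derivative_eq_intros refl | simp add: field_simps)+
  have B: "((\<lambda>t. A t - cos (2 * pi * t)) has_real_derivative 2 * pi * sin (2 * pi * t) * (1 - t)) (at t within S)" for t S
    by (rule derivative_eq_intros A refl | simp add: algebra_simps)+
  have 1: "(wave x has_integral (A y - A 0)) {0..y}"
  proof (rule has_integral_eq)
    show "((\<lambda>t. - (2 * pi * sin (2 * pi * t) * t)) has_integral (A y - A 0)) {0..y}"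
      by (rule fundamental_theorem_of_calculus[OF y(1)])
         (rule A[unfolded has_real_derivative_iff_has_vector_derivative])
  qed (auto simp: wave_def y_def)
  have 2: "(wave x has_integral ((A 1 - cos (2 * pi * 1)) - (A y - cos (2 * pi * y)))) {y..1}"
  proof (rule has_integral_spike_finite[of "{y}"])
    show "((\<lambda>t. 2 * pi * sin (2 * pi * t) * (1 - t)) has_integral ((A 1 - cos (2 * pi * 1)) - (A y - cos (2 * pi * y)))) {y..1}"
      by (rule fundamental_theorem_of_calculus[OF y(2)])
         (rule B[unfolded has_real_derivative_iff_has_vector_derivative])
  qed (auto simp: wave_def y_def)
  have "(wave x has_integral ((A y - A 0) + ((A 1 - cos (2 * pi * 1)) - (A y - cos (2 * pi * y))))) {0..1}"
    by (rule has_integral_combine[OF y 1 2])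
  moreover have "(A y - A 0) + ((A 1 - cos (2 * pi * 1)) - (A y - cos (2 * pi * y))) = cos (2 * pi * y)"
    by (simp add: A_def)
  ultimately have "integral {0..1} (wave x) = cos (2 * pi * y)" by (metis integral_unique)
  moreover have "cos (2 * pi * y) = cos (2 * pi * x)"
    using circle_exp_props(3) unfolding y_def circle_cos_sin periodic1_def by simp
  moreover have "integrable (lebesgue_on {0..1}) (wave x)"
    using riemann_sums(1)[OF wave_skorohod, of id x] by (simp add: continuous_on_id')
  ultimately show ?thesis using lebesgue_integral_eq_integral[of "{0..1}" "wave x"] by simp
qed

text \<open>The Riemann sum of \<open>wave\<close> is a combination of finitely many centered indicators, and its
  variance is that of a combination of finitely many values of \<open>K\<close>.\<close>

definition cos_coeff :: "nat \<Rightarrow> nat \<Rightarrow> real" where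
  "cos_coeff n i = 2 * pi * sin (2 * pi * (real i / real (Suc n))) / real (Suc n)"

definition cos_approx :: "nat \<Rightarrow> real \<Rightarrow> real" where
  "cos_approx n x = (\<Sum>i<Suc n. cos_coeff n i * centered_ind {0..<real i / real (Suc n)} x)"

lemma cos_coeff_bound: "\<bar>cos_coeff n i\<bar> \<le> 2 * pi / real (Suc n)"
  unfolding cos_coeff_def by (auto simp: abs_mult intro!: divide_right_mono)

lemma cos_coeff_sum: "(\<Sum>i<Suc n. \<bar>cos_coeff n i\<bar>) \<le> 2 * pi"
proof -
  have "(\<Sum>i<Suc n. \<bar>cos_coeff n i\<bar>) \<le> (\<Sum>i<Suc n. 2 * pi / real (Suc n))"
    by (intro sum_mono cos_coeff_bound)
  also have "\<dots> = 2 * pi" by (simp del: of_nat_Suc sum.lessThan_Suc)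
  finally show ?thesis .
qed

lemma cos_approx_tendsto: "(\<lambda>n. cos_approx n x) \<longlonglongrightarrow> cos (2 * pi * x)"
proof -
  have "cos_approx n x = (\<Sum>i<Suc n. id (wave x (real i / real (Suc n)))) / real (Suc n)" for n
    unfolding cos_approx_def sum_divide_distrib
    by (intro sum.cong refl) (simp add: cos_coeff_def wave_def centered_ind_eq)
  then show ?thesis
    using riemann_sums(2)[OF wave_skorohod, of id x] by (simp add: wave_integral continuous_on_id')
qed

context circle_walk
begin

lemma cos_approx_bv:
  "centered_bv ((\<Sum>i<Suc n. \<bar>cos_coeff n i\<bar>) * 4) (\<Sum>i<Suc n. \<bar>cos_coeff n i\<bar>) (cos_approx n)"
proof -
  have "centered_bv 4 1 (centered_ind {0..<real i / real (Suc n)})" if "i \<in> {..<Suc n}" for i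
    using that by (intro centered_bv_ind) auto
  then show ?thesis
    using centered_bv_sum[of "{..<Suc n}" 4 1 "\<lambda>i. centered_ind {0..<real i / real (Suc n)}" "cos_coeff n"]
    unfolding cos_approx_def[abs_def] sum_distrib_right[symmetric] by (simp del: sum.lessThan_Suc of_nat_Suc)
qed

lemma corr_cos_approx: "(\<lambda>n. corr (cos_approx n) k) \<longlonglongrightarrow> corr (\<lambda>x. cos (2 * pi * x)) k"
proof -
  note bv = centered_bvD[OF cos_approx_bv]
  have B: "\<bar>cos_approx n x\<bar> \<le> 2 * pi" for n x
    using order_trans[OF bv(4) cos_coeff_sum] .
  note [measurable] = bv(1)
  have T: "(\<lambda>n. T k (cos_approx n) u) \<longlonglongrightarrow> T k (\<lambda>x. cos (2 * pi * x)) u" for u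
    unfolding T_def
    by (rule integral_dominated_convergence[where w="\<lambda>_. 2 * pi"])
       (use B cos_approx_tendsto in auto)
  interpret U: prob_space unif by (rule prob_space_unif)
  have bb: "bounded_borel (\<lambda>x::real. cos (2 * pi * x))" by (rule bounded_borelI[where B=1]) auto
  note [measurable] = bounded_borel_measurable[OF bounded_borel_T[OF bb]]
    bounded_borel_measurable[OF bounded_borel_T[OF bv(6)]]
  show ?thesis
    unfolding corr_def
  proof (rule integral_dominated_convergence[where w="\<lambda>_. 2 * pi * (2 * pi)"])
    show "AE x in unif. (\<lambda>n. cos_approx n x * T k (cos_approx n) x) \<longlonglongrightarrow> cos (2 * pi * x) * T k (\<lambda>x. cos (2 * pi * x)) x"
      by (intro AE_I2 tendsto_mult cos_approx_tendsto T)
    have "\<bar>T k (cos_approx n) x\<bar> \<le> 2 * pi" for n x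
      using norm_T_le[of "cos_approx n" "2 * pi"] bv(6) B by auto
    then show "AE x in unif. norm (cos_approx n x * T k (cos_approx n) x) \<le> 2 * pi * (2 * pi)" for n
      unfolding real_norm_def abs_mult by (intro AE_I2 mult_mono B) auto
  qed auto
qed

lemma asymp_var_cos_approx: "(\<lambda>n. asymp_var (cos_approx n)) \<longlonglongrightarrow> asymp_var (\<lambda>x. cos (2 * pi * x))"
proof -
  have bound: "norm (corr (cos_approx n) (Suc k)) \<le> 2 * pi * (3 * (2 * pi * 4) * \<psi> (Suc k))" for n k
  proof -
    have "\<bar>corr (cos_approx n) (Suc k)\<bar> \<le> (\<Sum>i<Suc n. \<bar>cos_coeff n i\<bar>) * (3 * ((\<Sum>i<Suc n. \<bar>cos_coeff n i\<bar>) * 4) * \<psi> (Suc k))"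
      by (rule corr_bound[OF cos_approx_bv])
    also have "\<dots> \<le> 2 * pi * (3 * (2 * pi * 4) * \<psi> (Suc k))"
      by (intro mult_mono mult_left_mono cos_coeff_sum mult_nonneg_nonneg sum_nonneg psi_nonneg) auto
    finally show ?thesis by simp
  qed
  have "(\<lambda>n. \<Sum>k. corr (cos_approx n) (Suc k)) \<longlonglongrightarrow> (\<Sum>k. corr (\<lambda>x. cos (2 * pi * x)) (Suc k))"
    by (rule conjunct2[OF conjunct2[OF tannerys_theorem[where M="\<lambda>k. 2 * pi * (3 * (2 * pi * 4) * \<psi> (Suc k))"]]])
       (intro corr_cos_approx summable_mult summable_psi sequentially_bot always_eventually allI | simp only: split_beta bound)+
  then show ?thesis unfolding asymp_var_def by (intro tendsto_intros corr_cos_approx)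
qed

end

subsection \<open>Anticoncentration and the limit laws\<close>

lemma std_normal_not_compact_support: "measure std_normal_distribution {-c..c} < 1"
proof (rule ccontr)
  interpret N: prob_space std_normal_distribution by (rule prob_space_normal_density) simp
  assume "\<not> ?thesis"
  then have "measure std_normal_distribution {-c..c} = 1" using N.prob_le_1 by (simp add: antisym)
  then have "AE x in std_normal_distribution. x \<in> {-c..c}" by (rule N.AE_prob_1)
  then have "AE x in lborel. x \<in> {-c..c}"
    by (subst (asm) AE_density) (auto simp: normal_density_pos)
  then have "AE x in lborel. x \<notin> {c + 1..c + 2}" by eventually_elim auto
  then have "{c + 1..c + 2} \<in> null_sets lborel" by (subst AE_iff_null_sets) auto
  then have "emeasure lborel {c + 1..c + 2} = 0" by blast
  then show False by simp
qed

lemma gaussian_anticoncentration: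
  assumes P: "prob_space P" and Y[measurable]: "Y \<in> borel_measurable P" and g: "gaussian_distr (distr P borel Y)"
    and mean: "(LINT \<omega>|P. Y \<omega>) = 0" and v: "0 < v" "v \<le> (LINT \<omega>|P. (Y \<omega>)\<^sup>2)" and a: "0 \<le> a"
  shows "measure P {\<omega>\<in>space P. \<bar>Y \<omega>\<bar> \<le> a} \<le> measure std_normal_distribution {- (a / sqrt v)..a / sqrt v}"
proof -
  interpret P: prob_space P by fact
  obtain \<sigma> where \<sigma>: "0 < \<sigma>" and d: "distributed P lborel Y (normal_density 0 \<sigma>)" and m2: "(LINT \<omega>|P. (Y \<omega>)\<^sup>2) = \<sigma>\<^sup>2"
    using gaussian_centered_cases[OF P Y g mean] v by auto
  have "distributed P lborel (\<lambda>\<omega>. (Y \<omega> - 0) / \<sigma>) std_normal_density"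
    using d unfolding P.normal_standard_normal_convert[OF \<sigma>] .
  then have D: "distr P lborel (\<lambda>\<omega>. Y \<omega> / \<sigma>) = std_normal_distribution"
    by (simp add: distributed_def)
  have "sqrt v \<le> sqrt (\<sigma>\<^sup>2)" using v m2 by (intro real_sqrt_le_mono) simp
  then have s: "sqrt v \<le> \<sigma>" using \<sigma> by simp
  have "measure P {\<omega>\<in>space P. \<bar>Y \<omega>\<bar> \<le> a} \<le> measure P ((\<lambda>\<omega>. Y \<omega> / \<sigma>) -` {- (a / sqrt v)..a / sqrt v} \<inter> space P)"
  proof (rule P.finite_measure_mono)
    show "{\<omega>\<in>space P. \<bar>Y \<omega>\<bar> \<le> a} \<subseteq> (\<lambda>\<omega>. Y \<omega> / \<sigma>) -` {- (a / sqrt v)..a / sqrt v} \<inter> space P"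
    proof
      fix \<omega> assume "\<omega> \<in> {\<omega>\<in>space P. \<bar>Y \<omega>\<bar> \<le> a}"
      then have "\<omega> \<in> space P" and le: "\<bar>Y \<omega>\<bar> \<le> a" by auto
      have "\<bar>Y \<omega> / \<sigma>\<bar> \<le> a / sqrt v"
        using \<sigma> s v le a by (auto simp: abs_divide intro!: frac_le)
      then show "\<omega> \<in> (\<lambda>\<omega>. Y \<omega> / \<sigma>) -` {- (a / sqrt v)..a / sqrt v} \<inter> space P"
        using \<open>\<omega> \<in> space P\<close> by (simp only: abs_le_iff) auto
    qed
  qed measurable
  also have "\<dots> = measure (distr P lborel (\<lambda>\<omega>. Y \<omega> / \<sigma>)) {- (a / sqrt v)..a / sqrt v}"
    by (rule measure_distr[symmetric]) auto
  finally show ?thesis unfolding D .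
qed

context skorohod_gaussian_limit
begin

text \<open>If \<open>Z = c\<close> almost surely, the Riemann sums \<open>Q n\<close> of \<open>2 * pi * sin (2 * pi * t) * K t\<close> are eventually
  bounded by \<open>2 * pi * \<bar>c\<bar> + 1\<close>, path by path, hence with probability tending to 1.  They are normal
  with variance bounded away from 0, and so exceed any given bound with a probability bounded away
  from 0.\<close>

lemma nondegenerate_functional:
  assumes Z[measurable]: "Z \<in> borel_measurable P"
    and L1: "AE \<omega> in P. (LINT t|lebesgue_on {0..1}. \<bar>K t \<omega>\<bar>) \<le> Z \<omega>"
  shows "nondegenerate (distr P borel Z)"
  unfolding nondegenerate_def
proof (rule notI, elim exE)
  fix c assume c: "distr P borel Z = return borel c"
  interpret P: prob_space P by (rule prob_space_P)
  have "AE x in return borel c. x = c" by (subst AE_return) auto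
  then have Zc: "AE \<omega> in P. Z \<omega> = c" unfolding c[symmetric] by (subst (asm) AE_distr_iff) auto
  define a where "a = 2 * pi * \<bar>c\<bar> + 1"
  have a: "0 \<le> a" by (simp add: a_def)
  define v where "v = asymp_var (\<lambda>x. cos (2 * pi * x)) / 2"
  have v: "0 < v" using asymp_var_cos_pos by (simp add: v_def)
  define t where "t n i = real i / real (Suc n)" for n i
  define Q where "Q n \<omega> = (\<Sum>i<Suc n. cos_coeff n i * K (t n i) \<omega>)" for n \<omega>
  have t: "inj_on (t n) {..<Suc n}" "\<And>i. i < Suc n \<Longrightarrow> t n i \<in> {0..1}" for n
    by (auto simp: t_def inj_on_def)
  note Q = K_combination[where t="t n" and c="cos_coeff n" and d="Suc n" for n, OF t, folded Q_def]
  note [measurable] = Q(1)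
  have Q2: "(LINT \<omega>|P. (Q n \<omega>)\<^sup>2) = asymp_var (cos_approx n)" for n
    using Q(4)[of n] unfolding cos_approx_def[abs_def] t_def .
  have "\<forall>\<^sub>F n in sequentially. v < asymp_var (cos_approx n)"
    by (rule order_tendstoD[OF asymp_var_cos_approx]) (use v in \<open>simp add: v_def\<close>)
  then have le: "\<forall>\<^sub>F n in sequentially. measure P {\<omega>\<in>space P. \<bar>Q n \<omega>\<bar> \<le> a}
      \<le> measure std_normal_distribution {- (a / sqrt v)..a / sqrt v}"
  proof eventually_elim
    case (elim n)
    then show ?case
      by (intro gaussian_anticoncentration[OF prob_space_P Q(1-3) v _ a] order_trans[OF less_imp_le eq_refl[OF Q2[symmetric]]])
  qed
  have one: "AE \<omega> in P. (\<lambda>n. indicator {\<omega>\<in>space P. \<bar>Q n \<omega>\<bar> \<le> a} \<omega>) \<longlonglongrightarrow> (1::real)"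
    using Zc L1 AE_space
  proof eventually_elim
    case (elim \<omega>)
    have "2 * pi * (LINT t|lebesgue_on {0..1}. \<bar>K t \<omega>\<bar>) \<le> 2 * pi * \<bar>c\<bar>"
      using elim by (intro mult_left_mono) auto
    then have lt: "2 * pi * (LINT t|lebesgue_on {0..1}. \<bar>K t \<omega>\<bar>) < a" unfolding a_def by linarith
    have "(\<lambda>n. 2 * pi * ((\<Sum>i<Suc n. \<bar>K (t n i) \<omega>\<bar>) / real (Suc n))) \<longlonglongrightarrow> 2 * pi * (LINT t|lebesgue_on {0..1}. \<bar>K t \<omega>\<bar>)"
      unfolding t_def using K_skorohod elim(3)
      by (intro tendsto_mult tendsto_const riemann_sums(2)[where f="\<lambda>t. K t \<omega>"] continuous_intros) auto
    from order_tendstoD(2)[OF this lt]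
    have "\<forall>\<^sub>F n in sequentially. indicator {\<omega>\<in>space P. \<bar>Q n \<omega>\<bar> \<le> a} \<omega> = (1::real)"
    proof eventually_elim
      case (elim n)
      have "\<bar>Q n \<omega>\<bar> \<le> (\<Sum>i<Suc n. \<bar>cos_coeff n i * K (t n i) \<omega>\<bar>)" unfolding Q_def by (rule sum_abs)
      also have "\<dots> \<le> (\<Sum>i<Suc n. 2 * pi / real (Suc n) * \<bar>K (t n i) \<omega>\<bar>)"
        unfolding abs_mult by (intro sum_mono mult_right_mono cos_coeff_bound) simp
      also have "\<dots> = 2 * pi * ((\<Sum>i<Suc n. \<bar>K (t n i) \<omega>\<bar>) / real (Suc n))"
        unfolding sum_distrib_left[symmetric] by simp
      finally show ?case using elim \<open>\<omega> \<in> space P\<close> by simp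
    qed
    then show ?case by (rule tendsto_eventually)
  qed
  have "(\<lambda>n. LINT \<omega>|P. indicator {\<omega>\<in>space P. \<bar>Q n \<omega>\<bar> \<le> a} \<omega>) \<longlonglongrightarrow> (LINT \<omega>|P. (1::real))"
    by (rule integral_dominated_convergence[where w="\<lambda>_. 1"]) (use one in \<open>auto split: split_indicator\<close>)
  then have "(\<lambda>n. measure P {\<omega>\<in>space P. \<bar>Q n \<omega>\<bar> \<le> a}) \<longlonglongrightarrow> 1"
    by (simp add: P.prob_space Int_def conj_ac cong: conj_cong)
  from tendsto_upperbound[OF this le] std_normal_not_compact_support[of "a / sqrt v"]
  show False by simp
qed

lemma Lp_norm_nondegenerate:
  assumes p: "1 \<le> p" shows "nondegenerate (distr P borel (\<lambda>\<omega>. Lp_norm p (\<lambda>t. K t \<omega>)))"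
proof (rule nondegenerate_functional[OF Lp_norm_K_measurable[OF p] AE_I2])
  fix \<omega> assume "\<omega> \<in> space P"
  then have "(\<lambda>t. K t \<omega>) \<in> admissible" using K_skorohod skorohod_admissible by blast
  then show "(LINT t|lebesgue_on {0..1}. \<bar>K t \<omega>\<bar>) \<le> Lp_norm p (\<lambda>t. K t \<omega>)" by (rule L1_le_Lp[OF _ p])
qed

text \<open>The centered indicator of the empty interval vanishes, so \<open>K 0\<close> has variance 0.  The largest
  increment, which does not see constants, therefore dominates the path itself.\<close>

lemma K_0: "AE \<omega> in P. K 0 \<omega> = 0"
proof -
  have "Gamma_cov M X 0 0 = 0"
    by (simp add: Gamma_cov_def cov_form_def unif_expectation_def)
  then have "(LINT \<omega>|P. (K 0 \<omega>)\<^sup>2) = 0" using K_prod[of 0 0] by (simp add: power2_eq_square)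
  then have "AE \<omega> in P. (K 0 \<omega>)\<^sup>2 = 0"
    using integral_nonneg_eq_0_iff_AE[OF K_integrable(2)[of 0]] by simp
  then show ?thesis by simp
qed

lemma sup_increment_nondegenerate: "nondegenerate (distr P borel (\<lambda>\<omega>. sup_increment (\<lambda>t. K t \<omega>)))"
proof (rule nondegenerate_functional[OF sup_increment_K_measurable])
  interpret L: prob_space "lebesgue_on {0..1::real}" by (rule prob_space_Icc)
  show "AE \<omega> in P. (LINT t|lebesgue_on {0..1}. \<bar>K t \<omega>\<bar>) \<le> sup_increment (\<lambda>t. K t \<omega>)"
    using K_0 AE_space
  proof eventually_elim
    case (elim \<omega>)
    then have adm: "(\<lambda>t. K t \<omega>) \<in> admissible" using K_skorohod skorohod_admissible by blast
    have "\<bar>K t \<omega>\<bar> \<le> sup_increment (\<lambda>t. K t \<omega>)" if "0 < t" "t \<le> 1" for t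
      using sup_increment_ge[OF adm, of 0 t] that elim by simp
    moreover from this[of 1] have "\<bar>K 0 \<omega>\<bar> \<le> sup_increment (\<lambda>t. K t \<omega>)" using elim by simp
    ultimately have "\<bar>K t \<omega>\<bar> \<le> sup_increment (\<lambda>t. K t \<omega>)" if "0 \<le> t" "t \<le> 1" for t
      using that by (cases "t = 0") auto
    then have "(LINT t|lebesgue_on {0..1}. \<bar>K t \<omega>\<bar>) \<le> (LINT t|lebesgue_on {0..1::real}. sup_increment (\<lambda>t. K t \<omega>))"
      by (intro integral_mono admissible_abs_integrable adm L.integrable_const) (simp add: space_restrict_space)
    then show ?case using L.prob_space by simp
  qed
qed

end

theorem mainTheorem4:
  fixes M :: "'a measure" and X :: "nat \<Rightarrow> 'a \<Rightarrow> real"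
    and P :: "'b measure" and K :: "real \<Rightarrow> 'b \<Rightarrow> real"
    and \<delta> :: real
  assumes "prob_space M"
    and "iid_seq M X"
    and "\<delta> > 0"
    and "bdd_above ((\<lambda>k. real k powr (1 + \<delta>) * psi M X k) ` {1..})"
    and "gaussian_process P {0..1} K"
    and "\<forall>t\<in>{0..1}. (LINT \<omega>|P. K t \<omega>) = 0"
    and "\<forall>s\<in>{0..1}. \<forall>t\<in>{0..1}. covariance P (K s) (K t) = Gamma_cov M X s t"
    and "\<forall>\<omega>\<in>space P. (\<lambda>t. K t \<omega>) \<in> skorohod_D"
  shows "conv_in_distr M (\<lambda>N \<omega>. sqrt (real N) * discrepancy X N \<omega>)
           P (\<lambda>\<omega>. sup_increment (\<lambda>t. K t \<omega>))
       \<and> nondegenerate (distr P borel (\<lambda>\<omega>. sup_increment (\<lambda>t. K t \<omega>)))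
       \<and> (\<forall>p::ennreal. 1 \<le> p \<longrightarrow>
            conv_in_distr M (\<lambda>N \<omega>. sqrt (real N) * Lp_discrepancy p X N \<omega>)
              P (\<lambda>\<omega>. Lp_norm p (\<lambda>t. K t \<omega>))
          \<and> nondegenerate (distr P borel (\<lambda>\<omega>. Lp_norm p (\<lambda>t. K t \<omega>))))"
proof -
  interpret M: prob_space M by fact
  interpret skorohod_gaussian_limit M X \<delta> P K
    by unfold_locales (fact assms)+
  show ?thesis
    using discrepancy_converges sup_increment_nondegenerate Lp_discrepancy_converges Lp_norm_nondegenerate
    by blast
qed

end
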